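(* Let $d<\infty$ and let $V,W\subset\mathbb{B}_d$ be analytic discs attached to the unit sphere with embedding maps $f$ and $g$ respectively, and suppose the extension of $f$ to $\overline{\mathbb{D}}$ is injective. Then $\mathcal{M}_f$ and $\mathcal{M}_g$ are isomorphic as algebras if and only if the extension of $g$ to $\overline{\mathbb{D}}$ is injective.
   Context: $\mathbb{D}$ is the open unit disc, $\mathbb{B}_d$ the open Euclidean unit ball of $\mathbb{C}^d$. The Drury–Arveson space $H^2_d$ is the reproducing kernel Hilbert space on $\mathbb{B}_d$ with kernel $1/(1-\langle z,w\rangle)$, and $\mathcal{M}_d$ denotes its multiplier algebra. A variety is a subset of $\mathbb{B}_d$ which is the common zero set of some family of functions from $\mathcal{M}_d$. An analytic disc attached to the unit sphere is a variety $V\subset\mathbb{B}_d$ ($d<\infty$) for which there is an injective analytic map $f:\mathbb{D}\to\mathbb{B}_d$ with $f'(z)\neq0$ for all $z\in\mathbb{D}$, $V=f(\mathbb{D})$, $f$ extends to a $C^2$ map on $\overline{\mathbb{D}}$, and for $x\in\overline{\mathbb{D}}$, $\|f(x)\|=1$ iff $|x|=1$; such $f$ is called an embedding map of $V$. $\mathcal{H}_f$ is the reproducing kernel Hilbert space on $\mathbb{D}$ with kernel $k^f(z,w)=1/(1-\langle f(z),f(w)\rangle)$, and $\mathcal{M}_f$ is its multiplier algebra; equivalently $\mathcal{M}_f=\{\varphi\circ f:\varphi\in\mathcal{M}_d\}$. *)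

theory Defs
  imports "HOL-Analysis.Analysis"
begin

definition cinner :: "complex^'n::finite \<Rightarrow> complex^'n \<Rightarrow> complex" where
  "cinner z w = (\<Sum>i\<in>UNIV. z$i * cnj (w$i))"

definition pos_kernel :: "'a set \<Rightarrow> ('a \<Rightarrow> 'a \<Rightarrow> complex) \<Rightarrow> bool" where
  "pos_kernel X K \<longleftrightarrow> (\<forall>(n::nat) (x::nat \<Rightarrow> 'a) (a::nat \<Rightarrow> complex).
     (\<forall>i<n. x i \<in> X) \<longrightarrow>
       (let s = (\<Sum>i<n. \<Sum>j<n. cnj (a i) * a j * K (x i) (x j)) in Im s = 0 \<and> Re s \<ge> 0))"

text \<open>The reproducing kernel Hilbert space with kernel K on X, as a space of functions
  (functions are normalised to vanish off X). Membership is Aronszajn's criterion: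
  h lies in H(K) iff c^2 K(z,w) - h(z) conj(h(w)) is a positive kernel for some c.\<close>
definition rkhs :: "'a set \<Rightarrow> ('a \<Rightarrow> 'a \<Rightarrow> complex) \<Rightarrow> ('a \<Rightarrow> complex) set" where
  "rkhs X K = {h. (\<forall>z. z \<notin> X \<longrightarrow> h z = 0) \<and>
     (\<exists>c::real. pos_kernel X (\<lambda>z w. complex_of_real (c\<^sup>2) * K z w - h z * cnj (h w)))}"

definition multipliers :: "'a set \<Rightarrow> ('a \<Rightarrow> 'a \<Rightarrow> complex) \<Rightarrow> ('a \<Rightarrow> complex) set" where
  "multipliers X K = {\<phi>. (\<forall>z. z \<notin> X \<longrightarrow> \<phi> z = 0) \<and>
     (\<forall>h\<in>rkhs X K. (\<lambda>z. \<phi> z * h z) \<in> rkhs X K)}"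

definition DA_kernel :: "complex^'n::finite \<Rightarrow> complex^'n \<Rightarrow> complex" where
  "DA_kernel z w = 1 / (1 - cinner z w)"

definition Mult_d :: "(complex^'n::finite \<Rightarrow> complex) set" where
  "Mult_d = multipliers (ball 0 1) DA_kernel"

definition variety :: "(complex^'n::finite) set \<Rightarrow> bool" where
  "variety V \<longleftrightarrow> (\<exists>S \<subseteq> Mult_d. V = {z \<in> ball 0 1. \<forall>\<phi>\<in>S. \<phi> z = 0})"

definition C2_on_closed_disc :: "(complex \<Rightarrow> 'b::real_normed_vector) \<Rightarrow> bool" where
  "C2_on_closed_disc f \<longleftrightarrow>
     (\<exists>(Df :: complex \<Rightarrow> (complex \<Rightarrow>\<^sub>L 'b)) (D2f :: complex \<Rightarrow> (complex \<Rightarrow>\<^sub>L (complex \<Rightarrow>\<^sub>L 'b))).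
        (\<forall>x\<in>cball 0 1. (f has_derivative blinfun_apply (Df x)) (at x within cball 0 1)) \<and>
        (\<forall>x\<in>cball 0 1. (Df has_derivative blinfun_apply (D2f x)) (at x within cball 0 1)) \<and>
        continuous_on (cball 0 1) D2f)"

text \<open>f is an embedding map of V (V an analytic disc attached to the sphere).
  f is defined on all of C; its values on the closed disc are the (C^2) extension.\<close>
definition embedding_map :: "(complex \<Rightarrow> complex^'n::finite) \<Rightarrow> (complex^'n) set \<Rightarrow> bool" where
  "embedding_map f V \<longleftrightarrow>
     variety V \<and>
     f ` ball 0 1 \<subseteq> ball 0 1 \<and>
     (\<forall>i. (\<lambda>z. f z $ i) holomorphic_on ball 0 1) \<and>
     inj_on f (ball 0 1) \<and>
     (\<forall>z\<in>ball 0 1. \<exists>i. deriv (\<lambda>w. f w $ i) z \<noteq> 0) \<and>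
     V = f ` ball 0 1 \<and>
     C2_on_closed_disc f \<and>
     (\<forall>x\<in>cball 0 1. norm (f x) = 1 \<longleftrightarrow> norm x = 1)"

definition analytic_disc_attached :: "(complex^'n::finite) set \<Rightarrow> bool" where
  "analytic_disc_attached V \<longleftrightarrow> (\<exists>f. embedding_map f V)"

definition kernel_f :: "(complex \<Rightarrow> complex^'n::finite) \<Rightarrow> complex \<Rightarrow> complex \<Rightarrow> complex" where
  "kernel_f f z w = 1 / (1 - cinner (f z) (f w))"

definition Mult_f :: "(complex \<Rightarrow> complex^'n::finite) \<Rightarrow> (complex \<Rightarrow> complex) set" where
  "Mult_f f = multipliers (ball 0 1) (kernel_f f)"

definition alg_isomorphic :: "('a \<Rightarrow> complex) set \<Rightarrow> ('b \<Rightarrow> complex) set \<Rightarrow> bool" where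
  "alg_isomorphic A B \<longleftrightarrow> (\<exists>\<Phi>. bij_betw \<Phi> A B \<and>
     (\<forall>a\<in>A. \<forall>b\<in>A. \<Phi> (\<lambda>z. a z + b z) = (\<lambda>z. \<Phi> a z + \<Phi> b z)) \<and>
     (\<forall>a\<in>A. \<forall>b\<in>A. \<Phi> (\<lambda>z. a z * b z) = (\<lambda>z. \<Phi> a z * \<Phi> b z)) \<and>
     (\<forall>c. \<forall>a\<in>A. \<Phi> (\<lambda>z. c * a z) = (\<lambda>z. c * \<Phi> a z)))"

end

(* For injective f the spaces H_f and the Hardy space coincide. Near the diagonal of the circle,
   1 - <f z, f w> is l(w) (1 - z cnj w) up to a quadratic error, with the normal derivative l > 0
   (Hopf lemma), and injectivity keeps it away from 0 off the diagonal. Hence the quadratic form of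
   k^f on the Hardy space, the sum of |<u, f_i1 ... f_in>|^2 over all words, is bounded above, and it
   is bounded below up to finitely many Taylor coefficients. It has no kernel: if a functional
   annihilates all words, extracting eigenfunctionals of the components of f and of z from it produces
   a point evaluation or point derivation, against f being injective and immersive. So the form is
   equivalent to the Hardy norm, all M_f with f injective up to the boundary are equal to M_szego, and
   one direction follows.

   Conversely an isomorphism from M_szego onto M_g is composition with a map h of the disc. The
   preimages of the components of g form a map psi with psi o h = g; it takes values in the variety W,
   so k = g^-1 o psi is holomorphic with k o h = id, and the coordinate function is a multiplier of
   H_g. If g identifies two boundary points, then functions in H_g have bounded differences along
   suitable sequences tending to these points; an unbounded logarithm and its product with the
   coordinate cannot both have this property. *)
theory Submission
  imports Defs "HOL-Complex_Analysis.Conformal_Mappings" "HOL-Library.Complex_Order"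
    "HOL-Computational_Algebra.Fundamental_Theorem_Algebra"
begin

section \<open>Positive kernels and multipliers\<close>

text \<open>Both forms are singular on the diagonal of the torus. A quadratic error over two linear
  denominators makes the difference of the reciprocals bounded there, but not small, so it cannot be
  treated as a perturbation and only the upper bound is immediate. The kernels are therefore
  regularised to \<open>1 / (\<tau> + (1 - \<tau>) P)\<close>, an Abel sum of the powers
  \<open>cinner (f \<zeta>) (f \<eta>) ^ n\<close>; the regularised model built from
  \<open>l\<close> is evaluated exactly by Cauchy's formula and tends to a norm with weight
  \<open>1 / l\<close>. The remaining defect sees finitely many coefficients, so the absence of a
  kernel becomes a finite-dimensional eigenvalue problem. No Hilbert space is completed: norms in
  \<open>rkhs\<close> are finite quadratic inequalities, the Hardy norm is \<open>N2\<close> on the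
  disc algebra, and limit vectors occur as functionals bounded for \<open>N2\<close>. In the
  converse the isomorphism is only algebraic; continuity is replaced by invertibility and by
  division by \<open>z - w\<close> inside the multiplier algebra.\<close>

lemma complex_nonneg_iff: "0 \<le> (s::complex) \<longleftrightarrow> Im s = 0 \<and> Re s \<ge> 0"
  by (auto simp: less_eq_complex_def)

lemma mult_cnj_nonneg: "0 \<le> z * cnj z"
  by (simp add: complex_nonneg_iff complex_mult_cnj)

lemma pos_kernel_iff:
  "pos_kernel X K \<longleftrightarrow> (\<forall>(n::nat) x a. (\<forall>i<n. x i \<in> X) \<longrightarrow>
     0 \<le> (\<Sum>i<n. \<Sum>j<n. cnj (a i) * a j * K (x i) (x j)))"
  unfolding pos_kernel_def Let_def complex_nonneg_iff ..

lemma pos_kernelI: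
  assumes "\<And>(n::nat) x a. (\<And>i. i < n \<Longrightarrow> x i \<in> X) \<Longrightarrow>
     0 \<le> (\<Sum>i<n. \<Sum>j<n. cnj (a i) * a j * K (x i) (x j))"
  shows "pos_kernel X K"
  unfolding pos_kernel_iff using assms by auto

lemma pos_kernelD:
  assumes "pos_kernel X K" "\<And>i. i < (n::nat) \<Longrightarrow> x i \<in> X"
  shows "0 \<le> (\<Sum>i<n. \<Sum>j<n. cnj (a i) * a j * K (x i) (x j))"
  by (rule assms(1)[unfolded pos_kernel_iff, rule_format]) (rule assms(2))

lemma pos_kernel_cong:
  assumes "\<And>z w. z \<in> X \<Longrightarrow> w \<in> X \<Longrightarrow> K z w = L z w"
  shows "pos_kernel X K \<longleftrightarrow> pos_kernel X L"
proof -
  have "(\<Sum>i<n. \<Sum>j<n. cnj (a i) * a j * K (x i) (x j)) =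
        (\<Sum>i<n. \<Sum>j<n. cnj (a i) * a j * L (x i) (x j))" if "\<forall>i<n. x i \<in> X" for n :: nat and x a
    using that assms by (intro sum.cong) auto
  then have "0 \<le> (\<Sum>i<n. \<Sum>j<n. cnj (a i) * a j * K (x i) (x j)) \<longleftrightarrow>
        0 \<le> (\<Sum>i<n. \<Sum>j<n. cnj (a i) * a j * L (x i) (x j))" if "\<forall>i<n. x i \<in> X" for n :: nat and x a
    using that by simp
  then show ?thesis unfolding pos_kernel_iff by blast
qed

lemma pos_kernel_subset: "pos_kernel X K \<Longrightarrow> Y \<subseteq> X \<Longrightarrow> pos_kernel Y K"
  unfolding pos_kernel_iff by (meson subsetD)

lemma pos_kernel_compose:
  assumes "pos_kernel Y K" "\<And>z. z \<in> X \<Longrightarrow> g z \<in> Y"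
  shows "pos_kernel X (\<lambda>z w. K (g z) (g w))"
proof (rule pos_kernelI)
  fix n :: nat and x a assume "\<And>i. i < n \<Longrightarrow> x i \<in> X"
  then show "0 \<le> (\<Sum>i<n. \<Sum>j<n. cnj (a i) * a j * K (g (x i)) (g (x j)))"
    using pos_kernelD[OF assms(1), of n "\<lambda>i. g (x i)" a] assms(2) by auto
qed

lemma pos_kernel_add:
  assumes "pos_kernel X K" "pos_kernel X L"
  shows "pos_kernel X (\<lambda>z w. K z w + L z w)"
proof (rule pos_kernelI)
  fix n :: nat and x a assume "\<And>i. i < n \<Longrightarrow> x i \<in> X"
  then have "0 \<le> (\<Sum>i<n. \<Sum>j<n. cnj (a i) * a j * K (x i) (x j)) +
                 (\<Sum>i<n. \<Sum>j<n. cnj (a i) * a j * L (x i) (x j))"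
    using pos_kernelD[OF assms(1), of n x a] pos_kernelD[OF assms(2), of n x a] by (intro add_nonneg_nonneg) auto
  then show "0 \<le> (\<Sum>i<n. \<Sum>j<n. cnj (a i) * a j * (K (x i) (x j) + L (x i) (x j)))"
    by (simp add: ring_distribs sum.distrib)
qed

lemma pos_kernel_scale:
  assumes "pos_kernel X K" "0 \<le> c"
  shows "pos_kernel X (\<lambda>z w. c * K z w)"
proof (rule pos_kernelI)
  fix n :: nat and x a assume "\<And>i. i < n \<Longrightarrow> x i \<in> X"
  then have "0 \<le> c * (\<Sum>i<n. \<Sum>j<n. cnj (a i) * a j * K (x i) (x j))"
    using pos_kernelD[OF assms(1), of n x a] assms(2) by (intro mult_nonneg_nonneg) auto
  then show "0 \<le> (\<Sum>i<n. \<Sum>j<n. cnj (a i) * a j * (c * K (x i) (x j)))"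
    by (simp add: sum_distrib_left mult_ac)
qed

lemma pos_kernel_zero: "pos_kernel X (\<lambda>z w. 0)"
  by (rule pos_kernelI) simp

lemma pos_kernel_sum:
  assumes "\<And>i. i \<in> I \<Longrightarrow> pos_kernel X (K i)"
  shows "pos_kernel X (\<lambda>z w. \<Sum>i\<in>I. K i z w)"
  using assms by (induction I rule: infinite_finite_induct) (auto intro: pos_kernel_zero pos_kernel_add)

lemma pos_kernel_rank_one_mult:
  assumes "pos_kernel X K"
  shows "pos_kernel X (\<lambda>z w. \<phi> z * cnj (\<phi> w) * K z w)"
proof (rule pos_kernelI)
  fix n :: nat and x a assume "\<And>i. i < n \<Longrightarrow> x i \<in> X"
  then show "0 \<le> (\<Sum>i<n. \<Sum>j<n. cnj (a i) * a j * (\<phi> (x i) * cnj (\<phi> (x j)) * K (x i) (x j)))"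
    using pos_kernelD[OF assms(1), of n x "\<lambda>i. a i * cnj (\<phi> (x i))"] by (simp add: mult_ac)
qed

lemma rank_one_quadratic_form:
  "(\<Sum>i<(n::nat). \<Sum>j<n. cnj (a i) * a j * (h (x i) * cnj (h (x j)))) =
     of_real ((cmod (\<Sum>i<n. cnj (a i) * h (x i)))\<^sup>2)"
    unfolding complex_norm_square
  by (simp add: sum_product mult_ac) (subst sum.swap, rule refl)

lemma pos_kernel_rank_one: "pos_kernel X (\<lambda>z w. \<phi> z * cnj (\<phi> w))"
  by (rule pos_kernelI) (subst rank_one_quadratic_form, simp add: complex_nonneg_iff)

lemma pos_kernel_limit:
  assumes "\<And>k::nat. pos_kernel X (K k)"
    and "\<And>z w. z \<in> X \<Longrightarrow> w \<in> X \<Longrightarrow> (\<lambda>k. K k z w) \<longlonglongrightarrow> L z w"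
  shows "pos_kernel X L"
proof (rule pos_kernelI)
  fix n :: nat and x a assume x: "\<And>i. i < n \<Longrightarrow> x i \<in> X"
  have lim: "(\<lambda>k. \<Sum>i<n. \<Sum>j<n. cnj (a i) * a j * K k (x i) (x j)) \<longlonglongrightarrow>
      (\<Sum>i<n. \<Sum>j<n. cnj (a i) * a j * L (x i) (x j))" (is "?s \<longlonglongrightarrow> ?l")
    using x by (intro tendsto_sum tendsto_mult tendsto_const assms(2)) auto
  have nn: "0 \<le> ?s k" for k using pos_kernelD[OF assms(1), of n x a] x by auto
  have "(\<lambda>k. Re (?s k)) \<longlonglongrightarrow> Re ?l" "(\<lambda>k. Im (?s k)) \<longlonglongrightarrow> Im ?l"
    by (rule tendsto_Re[OF lim], rule tendsto_Im[OF lim])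
  moreover have "Im (?s k) = 0" "Re (?s k) \<ge> 0" for k using nn[of k] unfolding complex_nonneg_iff by auto
  ultimately have "Im ?l = 0" "Re ?l \<ge> 0"
    by (auto simp: LIMSEQ_const_iff intro: LIMSEQ_le_const)
  then show "0 \<le> ?l" by (simp only: complex_nonneg_iff simp_thms)
qed

text \<open>Aronszajn's criterion in dual form: \<open>h\<close> acts on finite combinations of
  kernel vectors as a functional of norm at most \<open>c\<close>. Estimates on members of the space
  are obtained from it by choosing points and coefficients.\<close>

lemma rkhs_bound:
  assumes "pos_kernel X (\<lambda>z w. complex_of_real (c\<^sup>2) * K z w - h z * cnj (h w))"
    and "\<And>i. i < n \<Longrightarrow> x i \<in> X"
  shows "(cmod (\<Sum>i<n. cnj (a i) * h (x i)))\<^sup>2 \<le>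
    c\<^sup>2 * Re (\<Sum>i<(n::nat). \<Sum>j<n. cnj (a i) * a j * K (x i) (x j))"
proof -
  have "0 \<le> (\<Sum>i<n. \<Sum>j<n. cnj (a i) * a j * (complex_of_real (c\<^sup>2) * K (x i) (x j) - h (x i) * cnj (h (x j))))"
    by (rule pos_kernelD[OF assms(1)]) (use assms(2) in auto)
  also have "\<dots> = of_real (c\<^sup>2) * (\<Sum>i<n. \<Sum>j<n. cnj (a i) * a j * K (x i) (x j)) -
     (\<Sum>i<n. \<Sum>j<n. cnj (a i) * a j * (h (x i) * cnj (h (x j))))"
    by (simp add: sum_subtractf sum_distrib_left right_diff_distrib mult_ac)
  finally show ?thesis
    unfolding rank_one_quadratic_form by (simp add: complex_nonneg_iff)
qed

lemma pos_kernel_of_bound: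
  assumes "pos_kernel X K" and
    "\<And>n x a. (\<And>i. i < n \<Longrightarrow> x i \<in> X) \<Longrightarrow> (cmod (\<Sum>i<n. cnj (a i) * h (x i)))\<^sup>2 \<le>
      c * Re (\<Sum>i<(n::nat). \<Sum>j<n. cnj (a i) * a j * K (x i) (x j))"
  shows "pos_kernel X (\<lambda>z w. complex_of_real c * K z w - h z * cnj (h w))"
proof (rule pos_kernelI)
  fix n :: nat and x a assume x: "\<And>i. i < n \<Longrightarrow> x i \<in> X"
  define s where "s = (\<Sum>i<n. \<Sum>j<n. cnj (a i) * a j * K (x i) (x j))"
  have "(\<Sum>i<n. \<Sum>j<n. cnj (a i) * a j * (complex_of_real c * K (x i) (x j) - h (x i) * cnj (h (x j)))) =
    of_real c * s - (\<Sum>i<n. \<Sum>j<n. cnj (a i) * a j * (h (x i) * cnj (h (x j))))"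
    unfolding s_def by (simp add: sum_subtractf sum_distrib_left right_diff_distrib mult_ac)
  moreover have "0 \<le> s" unfolding s_def by (rule pos_kernelD[OF assms(1)]) (use x in auto)
  ultimately show "0 \<le> (\<Sum>i<n. \<Sum>j<n. cnj (a i) * a j *
      (complex_of_real c * K (x i) (x j) - h (x i) * cnj (h (x j))))"
    using assms(2)[of n x a, OF x] unfolding rank_one_quadratic_form
    by (simp add: complex_nonneg_iff s_def[symmetric])
qed

lemma rkhs_mono:
  assumes "pos_kernel X (\<lambda>z w. complex_of_real C * L z w - K z w)" "0 \<le> C"
  shows "rkhs X K \<subseteq> rkhs X L"
proof
  fix h assume "h \<in> rkhs X K"
  then obtain c where h: "\<forall>z. z \<notin> X \<longrightarrow> h z = 0"
    "pos_kernel X (\<lambda>z w. complex_of_real (c\<^sup>2) * K z w - h z * cnj (h w))"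
    unfolding rkhs_def by blast
  have "pos_kernel X (\<lambda>z w. complex_of_real (c\<^sup>2) * (complex_of_real C * L z w - K z w) +
      (complex_of_real (c\<^sup>2) * K z w - h z * cnj (h w)))"
    by (intro pos_kernel_add pos_kernel_scale h assms) (simp add: complex_nonneg_iff del: of_real_power)
  also have "(\<lambda>z w. complex_of_real (c\<^sup>2) * (complex_of_real C * L z w - K z w) +
      (complex_of_real (c\<^sup>2) * K z w - h z * cnj (h w))) =
     (\<lambda>z w. complex_of_real ((c * sqrt C)\<^sup>2) * L z w - h z * cnj (h w))"
    using assms(2) by (simp add: power_mult_distrib algebra_simps flip: of_real_power)
  finally show "h \<in> rkhs X L" using h(1) unfolding rkhs_def by blast
qed

text \<open>The hypothesis says that multiplication by \<open>\<phi>\<close> has norm at most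
  \<open>sqrt C\<close>, tested through its adjoint, which scales the kernel vector at
  \<open>w\<close> by \<open>cnj (\<phi> w)\<close>.\<close>

lemma rkhs_mult_closed:
  assumes "pos_kernel X (\<lambda>z w. (complex_of_real C - \<phi> z * cnj (\<phi> w)) * K z w)" "0 \<le> C" "h \<in> rkhs X K"
  shows "(\<lambda>z. \<phi> z * h z) \<in> rkhs X K"
proof -
  obtain c where h: "\<forall>z. z \<notin> X \<longrightarrow> h z = 0"
    "pos_kernel X (\<lambda>z w. complex_of_real (c\<^sup>2) * K z w - h z * cnj (h w))"
    using assms(3) unfolding rkhs_def by blast
  have "pos_kernel X (\<lambda>z w. complex_of_real (c\<^sup>2) * ((complex_of_real C - \<phi> z * cnj (\<phi> w)) * K z w) +
     \<phi> z * cnj (\<phi> w) * (complex_of_real (c\<^sup>2) * K z w - h z * cnj (h w)))"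
    by (intro pos_kernel_add pos_kernel_scale pos_kernel_rank_one_mult h assms)
      (simp add: complex_nonneg_iff del: of_real_power)
  also have "(\<lambda>z w. complex_of_real (c\<^sup>2) * ((complex_of_real C - \<phi> z * cnj (\<phi> w)) * K z w) +
     \<phi> z * cnj (\<phi> w) * (complex_of_real (c\<^sup>2) * K z w - h z * cnj (h w))) =
     (\<lambda>z w. complex_of_real ((c * sqrt C)\<^sup>2) * K z w - \<phi> z * h z * cnj (\<phi> w * h w))"
    using assms(2) by (simp add: power_mult_distrib algebra_simps flip: of_real_power)
  finally have "pos_kernel X (\<lambda>z w. complex_of_real ((c * sqrt C)\<^sup>2) * K z w - \<phi> z * h z * cnj (\<phi> w * h w))" .
  moreover have "\<forall>z. z \<notin> X \<longrightarrow> \<phi> z * h z = 0" using h(1) by simp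
  ultimately show ?thesis unfolding rkhs_def by blast
qed

lemma multipliersI:
  assumes "pos_kernel X (\<lambda>z w. (complex_of_real C - \<phi> z * cnj (\<phi> w)) * K z w)" "0 \<le> C"
    "\<And>z. z \<notin> X \<Longrightarrow> \<phi> z = 0"
  shows "\<phi> \<in> multipliers X K"
  using rkhs_mult_closed[OF assms(1,2)] assms(3) unfolding multipliers_def by blast

lemma multipliers_rkhs_cong: "rkhs X K = rkhs X L \<Longrightarrow> multipliers X K = multipliers X L"
  unfolding multipliers_def by simp

lemma multipliers_subset_rkhs:
  assumes "indicator X \<in> rkhs X K" shows "multipliers X K \<subseteq> rkhs X K"
proof
  fix \<phi> assume p: "\<phi> \<in> multipliers X K"
  then have "(\<lambda>z. \<phi> z * indicator X z) \<in> rkhs X K" using assms unfolding multipliers_def by blast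
  also have "(\<lambda>z. \<phi> z * indicator X z) = \<phi>"
    using p unfolding multipliers_def by (intro ext) (auto simp: indicator_def)
  finally show "\<phi> \<in> rkhs X K" .
qed

lemma multipliers_mult:
  "\<phi> \<in> multipliers X K \<Longrightarrow> \<psi> \<in> multipliers X K \<Longrightarrow> (\<lambda>z. \<phi> z * \<psi> z) \<in> multipliers X K"
  unfolding multipliers_def by (auto simp: mult.assoc)

section \<open>Kernels of Drury--Arveson type\<close>

lemma cinner_diff_left: "cinner (x - y) w = cinner x w - cinner y w"
  and cinner_add_left: "cinner (x + y) w = cinner x w + cinner y w"
  and cinner_diff_right: "cinner w (x - y) = cinner w x - cinner w y"
  and cinner_add_right: "cinner w (x + y) = cinner w x + cinner w y"
  and cinner_smult_left: "cinner (c *s x) w = c * cinner x w"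
  and cinner_smult_right: "cinner w (c *s x) = cnj c * cinner w x"
  by (simp_all add: cinner_def sum_subtractf sum.distrib algebra_simps sum_distrib_left)

lemma cnj_cinner: "cnj (cinner x y) = cinner y x"
  by (simp add: cinner_def mult.commute)

lemma Re_cinner: "Re (cinner x y) = x \<bullet> y"
  by (simp add: cinner_def inner_vec_def inner_complex_def)

lemma cinner_self: "cinner x x = of_real ((norm x)\<^sup>2)"
  by (rule complex_eqI) (use cnj_cinner[of x x] in \<open>simp_all add: Re_cinner power2_norm_eq_inner complex_eq_iff\<close>)

lemma norm_vec_smult: "norm (c *s (x::complex^'n)) = cmod c * norm x"
proof -
  have "(norm (c *s x))\<^sup>2 = (cmod c * norm x)\<^sup>2"
  proof -
    have "complex_of_real ((norm (c *s x))\<^sup>2) = c * cnj c * cinner x x"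
      by (simp only: cinner_self[symmetric] cinner_smult_left cinner_smult_right mult_ac)
    also have "\<dots> = of_real ((cmod c)\<^sup>2 * (norm x)\<^sup>2)"
      by (simp only: of_real_mult complex_norm_square cinner_self)
    finally show ?thesis unfolding of_real_eq_iff by (simp only: power_mult_distrib)
  qed
  then show ?thesis by simp
qed

lemma norm_cinner_le: "cmod (cinner x y) \<le> norm x * norm y"
proof (cases "cinner x y = 0")
  case False
  define u where "u = cnj (cinner x y) / of_real (cmod (cinner x y))"
  have u: "cmod u = 1" using False by (simp add: u_def norm_divide)
  have "u * cinner x y = of_real (cmod (cinner x y))"
    using False complex_norm_square[of "cinner x y"] unfolding u_def
    by (simp add: power2_eq_square mult.commute[of "cnj _"] nonzero_divide_eq_eq)
  then have "cmod (cinner x y) = (u *s x) \<bullet> y"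
    by (metis Re_cinner Re_complex_of_real cinner_smult_left)
  also have "\<dots> \<le> norm (u *s x) * norm y" by (rule norm_cauchy_schwarz)
  finally show ?thesis by (simp add: norm_vec_smult u)
qed simp

lemma bounded_bilinear_cinner: "bounded_bilinear (cinner :: complex^'n \<Rightarrow> _)"
  by (standard; (intro exI[of _ 1])?)
     (simp_all add: cinner_add_left cinner_add_right norm_cinner_le,
      simp_all add: cinner_def scaleR_sum_right)

lemmas tendsto_cinner[tendsto_intros] = bounded_bilinear.tendsto[OF bounded_bilinear_cinner]
lemmas continuous_on_cinner[continuous_intros] = bounded_bilinear.continuous_on[OF bounded_bilinear_cinner]

lemma cinner_axis: "cinner x (axis i 1) = x $ i"
  by (simp add: cinner_def axis_def if_distrib cong: if_cong)

lemma holomorphic_on_cinner: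
  assumes "\<forall>i. (\<lambda>z. f z $ i) holomorphic_on S"
  shows "(\<lambda>z. cinner (f z) w) holomorphic_on S"
  unfolding cinner_def using assms by (intro holomorphic_intros) auto

lemma pos_kernel_cinner_mult:
  assumes "pos_kernel X P"
  shows "pos_kernel X (\<lambda>z w. cinner (\<psi> z) (\<psi> w) * P z w)"
  unfolding cinner_def sum_distrib_right
  by (intro pos_kernel_sum) (rule pos_kernel_rank_one_mult[OF assms])

lemma pos_kernel_one: "pos_kernel X (\<lambda>z w. 1)"
  using pos_kernel_rank_one[of X "\<lambda>z. 1"] by simp

lemma pos_kernel_cinner_power: "pos_kernel X (\<lambda>z w. cinner (\<psi> z) (\<psi> w) ^ n)"
  by (induction n) (simp_all add: pos_kernel_one pos_kernel_cinner_mult)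

lemma norm_cinner_less_1:
  assumes "norm x < 1" "norm y \<le> 1"
  shows "cmod (cinner x y) < 1"
  using norm_cinner_le[of x y] assms mult_left_le[of "norm y" "norm x"] by force

lemma kernel_f_denominator:
  assumes "norm (\<psi> z) < 1" "norm (\<psi> w) < 1"
  shows "1 - cinner (\<psi> z) (\<psi> w) \<noteq> 0"
  using norm_cinner_less_1[of "\<psi> z" "\<psi> w"] assms by auto

lemma geometric_LIMSEQ: "cmod c < 1 \<Longrightarrow> (\<lambda>n. \<Sum>k<n. c ^ k) \<longlonglongrightarrow> 1 / (1 - c)"
  using geometric_sums[of c] by (simp add: sums_def)

lemma pos_kernel_DA_kernel: "pos_kernel (ball 0 1) (DA_kernel :: complex^'n \<Rightarrow> _)"
proof (rule pos_kernel_limit[where K="\<lambda>n z w. \<Sum>k<n. cinner z w ^ k"])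
  show "pos_kernel (ball 0 1) (\<lambda>z w :: complex^'n. \<Sum>k<n. cinner z w ^ k)" for n
    by (intro pos_kernel_sum pos_kernel_cinner_power)
  show "(\<lambda>n. \<Sum>k<n. cinner z w ^ k) \<longlonglongrightarrow> DA_kernel z w" if "z \<in> ball 0 1" "w \<in> ball 0 1" for z w :: "complex^'n"
    unfolding DA_kernel_def using that by (intro geometric_LIMSEQ norm_cinner_less_1) auto
qed

text \<open>\<open>K - 1 = cinner z w * K\<close> for \<open>K = 1 / (1 - cinner z w)\<close>, and
  the right side is positive, so the constant function has norm at most one.\<close>

lemma indicator_in_rkhs_DA_kernel: "indicator (ball 0 1) \<in> rkhs (ball 0 1) (DA_kernel :: complex^'n \<Rightarrow> _)"
proof -
  have "pos_kernel (ball 0 1) (\<lambda>z w :: complex^'n. cinner z w * DA_kernel z w)"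
    by (intro pos_kernel_cinner_mult pos_kernel_DA_kernel)
  also have "?this \<longleftrightarrow> pos_kernel (ball 0 1) (\<lambda>z w :: complex^'n. complex_of_real (1\<^sup>2) * DA_kernel z w -
      indicator (ball 0 1) z * cnj (indicator (ball 0 1) w))"
  proof (rule pos_kernel_cong)
    fix z w :: "complex^'n" assume zw: "z \<in> ball 0 1" "w \<in> ball 0 1"
    then have "cinner z w \<noteq> 1" using norm_cinner_less_1[of z w] by auto
    then show "cinner z w * DA_kernel z w = complex_of_real (1\<^sup>2) * DA_kernel z w -
        indicator (ball 0 1) z * cnj (indicator (ball 0 1) w)"
      using zw by (simp add: DA_kernel_def field_simps)
  qed
  finally show ?thesis unfolding rkhs_def by (intro CollectI conjI allI impI exI[of _ 1]) auto
qed

lemma kernel_f_eq_DA_kernel: "kernel_f \<psi> = (\<lambda>z w. DA_kernel (\<psi> z) (\<psi> w))"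
  by (intro ext) (simp add: kernel_f_def DA_kernel_def)

lemma pos_kernel_kernel_f:
  assumes "\<And>z. z \<in> X \<Longrightarrow> norm (\<psi> z) < 1"
  shows "pos_kernel X (kernel_f \<psi>)"
  unfolding kernel_f_eq_DA_kernel by (rule pos_kernel_compose[OF pos_kernel_DA_kernel]) (use assms in auto)

lemma rkhs_DA_kernel_compose:
  assumes "h \<in> rkhs (ball 0 1) DA_kernel" "\<And>z. z \<in> X \<Longrightarrow> norm (\<psi> z) < 1"
  shows "(\<lambda>z. indicator X z * h (\<psi> z)) \<in> rkhs X (kernel_f \<psi>)"
proof -
  obtain c where "pos_kernel (ball 0 1) (\<lambda>z w. complex_of_real (c\<^sup>2) * DA_kernel z w - h z * cnj (h w))"
    using assms(1) unfolding rkhs_def by blast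
  then have "pos_kernel X (\<lambda>z w. complex_of_real (c\<^sup>2) * DA_kernel (\<psi> z) (\<psi> w) - h (\<psi> z) * cnj (h (\<psi> w)))"
    by (rule pos_kernel_compose) (use assms(2) in auto)
  also have "?this \<longleftrightarrow> pos_kernel X (\<lambda>z w. complex_of_real (c\<^sup>2) * kernel_f \<psi> z w -
      indicator X z * h (\<psi> z) * cnj (indicator X w * h (\<psi> w)))"
    by (intro pos_kernel_cong) (simp add: kernel_f_eq_DA_kernel)
  finally show ?thesis unfolding rkhs_def by auto
qed

lemma indicator_in_rkhs_kernel_f:
  assumes "\<And>z. z \<in> X \<Longrightarrow> norm (\<psi> z) < 1"
  shows "indicator X \<in> rkhs X (kernel_f \<psi>)"
proof -
  have "(\<lambda>z. indicator X z * indicator (ball 0 1) (\<psi> z)) \<in> rkhs X (kernel_f \<psi>)"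
    by (intro rkhs_DA_kernel_compose indicator_in_rkhs_DA_kernel assms)
  also have "(\<lambda>z. indicator X z * indicator (ball 0 1) (\<psi> z)) = (indicator X :: _ \<Rightarrow> complex)"
    using assms by (intro ext) (auto simp: indicator_def)
  finally show ?thesis .
qed

text \<open>Lagrange's identity. It exhibits the Cauchy-Schwarz defect as a sum of rank-one kernels,
  which is what positivity of a kernel asks for; \<open>1/2\<close> compensates that each pair of
  indices occurs twice.\<close>

lemma cinner_Lagrange:
  "of_real ((norm p)\<^sup>2) * cinner x y - cinner x p * cnj (cinner y p) =
   (\<Sum>i\<in>UNIV. \<Sum>j\<in>UNIV. 1/2 * ((x$i * p$j - x$j * p$i) * cnj (y$i * p$j - y$j * p$i)))"
proof -
  have "(\<Sum>i\<in>UNIV. \<Sum>j\<in>UNIV. (x$i * p$j - x$j * p$i) * cnj (y$i * p$j - y$j * p$i)) =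
     (\<Sum>i\<in>UNIV. \<Sum>j\<in>UNIV. (x$i * cnj (y$i)) * (p$j * cnj (p$j))) +
     (\<Sum>i\<in>UNIV. \<Sum>j\<in>UNIV. (p$i * cnj (p$i)) * (x$j * cnj (y$j)))
     - (\<Sum>i\<in>UNIV. \<Sum>j\<in>UNIV. (x$i * cnj (p$i)) * (p$j * cnj (y$j)))
     - (\<Sum>i\<in>UNIV. \<Sum>j\<in>UNIV. (p$i * cnj (y$i)) * (x$j * cnj (p$j)))"
    by (simp only: sum.distrib[symmetric] sum_subtractf[symmetric]) (simp add: algebra_simps)
  also have "\<dots> = 2 * (cinner p p * cinner x y - cinner x p * cinner p y)"
    unfolding sum_product[symmetric] cinner_def by (simp add: algebra_simps)
  finally show ?thesis
    by (simp only: sum_distrib_left[symmetric]) (simp add: cinner_self cnj_cinner)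
qed

lemma pos_kernel_cinner_Cauchy_Schwarz:
  assumes "pos_kernel X P"
  shows "pos_kernel X (\<lambda>z w. (of_real ((norm p)\<^sup>2) * cinner (\<psi> z) (\<psi> w) -
     cinner (\<psi> z) p * cnj (cinner (\<psi> w) p)) * P z w)"
  unfolding cinner_Lagrange sum_distrib_right mult.assoc[of "1/2"]
  by (intro pos_kernel_sum pos_kernel_scale pos_kernel_rank_one_mult[OF assms])
    (simp add: complex_nonneg_iff)

text \<open>With \<open>c = cinner (\<psi> z) (\<psi> w)\<close> the kernel satisfies
  \<open>k = 1 + c k\<close>. The defect therefore splits into the constant \<open>r^2\<close>, the
  multiple \<open>r^2 - (norm p)^2\<close> of \<open>c k\<close>, and the Cauchy-Schwarz defect
  times \<open>k\<close>.\<close>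

lemma pos_kernel_contraction:
  assumes "\<And>z. z \<in> X \<Longrightarrow> norm (\<psi> z) < 1" "norm p \<le> r"
  shows "pos_kernel X (\<lambda>z w. (of_real (r\<^sup>2) - cinner (\<psi> z) p * cnj (cinner (\<psi> w) p)) * kernel_f \<psi> z w)"
proof -
  have "(norm p)\<^sup>2 \<le> r\<^sup>2" using assms(2) by (simp add: power_mono)
  then have "pos_kernel X (\<lambda>z w. (of_real (r\<^sup>2) * 1 + of_real (r\<^sup>2 - (norm p)\<^sup>2) * (cinner (\<psi> z) (\<psi> w) * kernel_f \<psi> z w)) +
     (of_real ((norm p)\<^sup>2) * cinner (\<psi> z) (\<psi> w) - cinner (\<psi> z) p * cnj (cinner (\<psi> w) p)) * kernel_f \<psi> z w)"
    by (intro pos_kernel_add pos_kernel_scale pos_kernel_cinner_Cauchy_Schwarz pos_kernel_cinner_mult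
        pos_kernel_kernel_f pos_kernel_one assms)
      (simp_all add: complex_nonneg_iff del: of_real_power of_real_diff)
  also have "?this \<longleftrightarrow> ?thesis"
  proof (rule pos_kernel_cong, goal_cases)
    case (1 z w)
    define c a where "c = cinner (\<psi> z) (\<psi> w)" "a = cinner (\<psi> z) p * cnj (cinner (\<psi> w) p)"
    have "1 - c \<noteq> 0" unfolding c_a_def using 1 by (intro kernel_f_denominator assms)
    then have "R + (R - N) * (c * (1/(1-c))) + (N * c - a) * (1/(1-c)) = (R - a) * (1/(1-c))" for R N
      by (simp add: divide_simps) (simp add: algebra_simps)
    then show ?case by (simp only: kernel_f_def c_a_def[symmetric] of_real_diff mult_1_right)
  qed
  finally show ?thesis .
qed

lemma component_in_multipliers:
  assumes "\<And>z. z \<in> X \<Longrightarrow> norm (\<psi> z) < 1"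
  shows "(\<lambda>z. indicator X z * \<psi> z $ i) \<in> multipliers X (kernel_f \<psi>)"
proof (rule multipliersI[where C="1\<^sup>2"])
  have "pos_kernel X (\<lambda>z w. (of_real (1\<^sup>2) - cinner (\<psi> z) (axis i 1) * cnj (cinner (\<psi> w) (axis i 1))) * kernel_f \<psi> z w)"
    by (rule pos_kernel_contraction[OF assms]) (auto simp: norm_axis_1)
  also have "?this \<longleftrightarrow> pos_kernel X (\<lambda>z w. (complex_of_real (1\<^sup>2) -
      indicator X z * \<psi> z $ i * cnj (indicator X w * \<psi> w $ i)) * kernel_f \<psi> z w)"
    by (intro pos_kernel_cong) (simp add: cinner_axis)
  finally show "pos_kernel X (\<lambda>z w. (complex_of_real (1\<^sup>2) -
      indicator X z * \<psi> z $ i * cnj (indicator X w * \<psi> w $ i)) * kernel_f \<psi> z w)" .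
qed auto

text \<open>With \<open>r \<ge> norm p\<close> and \<open>v z = cinner (\<psi> z) p\<close>, multiplication by \<open>v\<close> has norm at most
  \<open>r\<close>, hence multiplication by \<open>1 - v\<close> is bounded below by \<open>1 - r\<close>.\<close>
lemma resolvent_in_multipliers:
  assumes "\<And>z. z \<in> X \<Longrightarrow> norm (\<psi> z) < 1" "norm p < 1"
  shows "(\<lambda>z. indicator X z / (1 - cinner (\<psi> z) p)) \<in> multipliers X (kernel_f \<psi>)"
proof -
  \<comment> \<open>The bound \<open>1/2\<close> keeps \<open>r\<close> positive when
    \<open>p = 0\<close>; the certificate below divides by \<open>r\<close>.\<close>
  define r where "r = max (norm p) (1/2)"
  have r: "norm p \<le> r" "0 < r" "r < 1" using assms(2) by (auto simp: r_def)
  define v where "v z = cinner (\<psi> z) p" for z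
  have v: "1 - v z \<noteq> 0" if "z \<in> X" for z
    using norm_cinner_less_1[of "\<psi> z" p] assms that unfolding v_def by fastforce
  \<comment> \<open>The certificate is \<open>(1 - a)(1 - b) - (1 - r)^2 = (r - a)(r - b) / r + (1 -
    r)(r^2 - a b) / r\<close>, with \<open>a\<close> for \<open>v z\<close> and \<open>b\<close> for
    \<open>cnj (v w)\<close>: a rank-one term and the contraction defect, both with positive
    weights.\<close>
  have "pos_kernel X (\<lambda>z w. (1 / (1 - v z)) * cnj (1 / (1 - v w)) * (of_real (1/(1-r)\<^sup>2) *
     (of_real (1/r) * ((of_real r - v z) * cnj (of_real r - v w) * kernel_f \<psi> z w) +
      of_real ((1-r)/r) * ((of_real (r\<^sup>2) - v z * cnj (v w)) * kernel_f \<psi> z w))))"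
    unfolding v_def using r
    by (intro pos_kernel_add pos_kernel_scale pos_kernel_rank_one_mult pos_kernel_contraction
        pos_kernel_kernel_f assms) (auto simp: complex_nonneg_iff simp del: of_real_power of_real_diff of_real_divide)
  also have "?this \<longleftrightarrow> pos_kernel X (\<lambda>z w. (complex_of_real (1/(1-r)\<^sup>2) -
     (indicator X z / (1 - v z)) * cnj (indicator X w / (1 - v w))) * kernel_f \<psi> z w)"
  proof (intro pos_kernel_cong, goal_cases)
    case (1 z w)
    define a b R k where "a = v z" "b = cnj (v w)" "R = complex_of_real r" "k = kernel_f \<psi> z w"
    have "1 - b = cnj (1 - v w)" by (simp add: a_b_R_k_def)
    then have nz: "1 - a \<noteq> 0" "1 - b \<noteq> 0" "1 - R \<noteq> 0" "R \<noteq> 0"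
      using v[OF 1(1)] v[OF 1(2)] r unfolding a_b_R_k_def complex_cnj_zero_iff by auto
    have L: "1/R * ((R - a) * (R - b) * k) + (1-R)/R * ((R\<^sup>2 - a*b) * k) =
        ((1-a)*(1-b) - (1-R)\<^sup>2) * k" (is "?L = _")
      using nz(4) by (simp add: field_simps power2_eq_square)
    have M: "1/A * (1/B) * (1/C\<^sup>2 * ((A*B - C\<^sup>2) * k)) = (1/C\<^sup>2 - 1/A * (1/B)) * k"
      if "A \<noteq> 0" "B \<noteq> 0" "C \<noteq> 0" for A B C :: complex
      using that by (simp add: field_simps)
    have "1/(1-a) * (1/(1-b)) * (1/(1-R)\<^sup>2 * ?L) = (1/(1-R)\<^sup>2 - 1/(1-a) * (1/(1-b))) * k"
      unfolding L by (rule M[OF nz(1-3)])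
    then show ?case using 1 by (simp add: a_b_R_k_def)
  qed
  finally show ?thesis
    using r by (intro multipliersI[where C="1/(1-r)\<^sup>2"]) (auto simp: v_def)
qed

section \<open>The Szego kernel\<close>

definition szego :: "complex \<Rightarrow> complex \<Rightarrow> complex" where
  "szego z w = 1 / (1 - z * cnj w)"

lemma cinner_vec1: "cinner ((\<chi> i. z)::complex^1) (\<chi> i. w) = z * cnj w"
  by (simp add: cinner_def)

text \<open>The Hardy space is the Drury-Arveson space of dimension one, so all results on
  \<open>kernel_f\<close> apply to it through \<open>complex^1\<close>.\<close>

lemma szego_eq_kernel_f: "szego = kernel_f (\<lambda>z. (\<chi> i. z)::complex^1)"
  by (intro ext) (simp add: szego_def kernel_f_def cinner_vec1)

lemma norm_vec1: "norm ((\<chi> i. z)::complex^1) = cmod z"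
  by (simp add: norm_vec_def)

lemma pos_kernel_szego: "pos_kernel (ball 0 1) szego"
  unfolding szego_eq_kernel_f by (rule pos_kernel_kernel_f) (simp add: norm_vec1)

text \<open>With \<open>q z = cinner (\<psi> z) p\<close> the difference is
  \<open>(cinner (\<psi> z) (\<psi> w) - q z * cnj (q w)) * k * s\<close>, where \<open>k\<close> is
  \<open>kernel_f\<close> and \<open>s\<close> the pulled back Szego kernel. The first two factors
  form a positive kernel by Cauchy-Schwarz, and \<open>s\<close> is a geometric series of rank-one
  factors. Hence Hardy functions of \<open>q\<close> belong to the space of
  \<open>kernel_f\<close>.\<close>

lemma szego_le_kernel_f:
  assumes "\<And>z. z \<in> X \<Longrightarrow> norm (\<psi> z) < 1" "norm p = 1"
  shows "pos_kernel X (\<lambda>z w. kernel_f \<psi> z w - szego (cinner (\<psi> z) p) (cinner (\<psi> w) p))"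
proof (rule pos_kernel_limit)
  define q where "q z = cinner (\<psi> z) p" for z
  have q: "cmod (q z) < 1" if "z \<in> X" for z
    unfolding q_def using assms that by (intro norm_cinner_less_1) auto
  define P where "P z w = (of_real ((norm p)\<^sup>2) * cinner (\<psi> z) (\<psi> w) - q z * cnj (q w)) * kernel_f \<psi> z w" for z w
  have P: "pos_kernel X P" unfolding P_def q_def
    by (intro pos_kernel_cinner_Cauchy_Schwarz pos_kernel_kernel_f assms)
  show "pos_kernel X (\<lambda>z w. \<Sum>k<n. q z ^ k * cnj (q w ^ k) * P z w)" for n
    by (intro pos_kernel_sum pos_kernel_rank_one_mult P)
  show "(\<lambda>n. \<Sum>k<n. q z ^ k * cnj (q w ^ k) * P z w) \<longlonglongrightarrow>
       kernel_f \<psi> z w - szego (cinner (\<psi> z) p) (cinner (\<psi> w) p)" if "z \<in> X" "w \<in> X" for z w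
  proof -
    have c: "cmod (q z * cnj (q w)) < 1"
      using mult_strict_mono'[OF q[OF that(1)] q[OF that(2)]] by (simp add: norm_mult)
    then have "1 - q z * cnj (q w) \<noteq> 0" by auto
    moreover have "1 - cinner (\<psi> z) (\<psi> w) \<noteq> 0" by (intro kernel_f_denominator assms that)
    ultimately have e: "1 / (1 - q z * cnj (q w)) * P z w = kernel_f \<psi> z w - szego (cinner (\<psi> z) p) (cinner (\<psi> w) p)"
      unfolding P_def kernel_f_def szego_def q_def[symmetric] using assms(2) by (simp add: field_simps)
    have "(\<lambda>n. (\<Sum>k<n. (q z * cnj (q w)) ^ k) * P z w) \<longlonglongrightarrow> 1 / (1 - q z * cnj (q w)) * P z w"
      by (intro tendsto_mult tendsto_const geometric_LIMSEQ c)
    then show ?thesis unfolding e by (simp add: sum_distrib_right power_mult_distrib)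
  qed
qed

section \<open>Holomorphy of the functions in the space\<close>

lemma kernel_difference:
  fixes x x' y :: "complex^'n"
  assumes "cinner x y \<noteq> 1" "cinner x' y \<noteq> 1"
  shows "1 / (1 - cinner x' y) - 1 / (1 - cinner x y) =
         1 / (1 - cinner x' y) * (1 / (1 - cinner x y)) * cinner (x' - x) y"
  using assms by (simp add: cinner_diff_left divide_simps)

text \<open>The quotient by \<open>h * cnj k\<close> is rewritten as a polynomial in kernel values
  and inner products with the difference quotients \<open>p\<close> and \<open>q\<close>, so that
  its joint limit at zero can be read off.\<close>

lemma kernel_mixed_difference:
  fixes x x' y y' :: "complex^'n"
  assumes "cinner x y \<noteq> 1" "cinner x' y \<noteq> 1" "cinner x y' \<noteq> 1" "cinner x' y' \<noteq> 1"
    and "h \<noteq> 0" "k \<noteq> 0" "x' - x = h *s p" "y' - y = k *s q"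
    and "K = (\<lambda>x y. 1 / (1 - cinner x y))"
  shows "(K x' y' - K x y' - K x' y + K x y) / (h * cnj k) =
     K x' y' * K x y' * cinner p q + K x' y' * K x' y * cinner x' q * K x y' * cinner p y
     + K x' y * K x y' * K x y * cinner x q * cinner p y"
proof -
  have K: "K u v * (1 - cinner u v) = 1" if "cinner u v \<noteq> 1" for u v :: "complex^'n"
    using that unfolding assms(9) by simp
  have x': "x' = x + h *s p" and y': "y' = y + k *s q"
    using assms(7,8) by (simp_all add: algebra_simps)
  have e1: "K x' y' - K x y' = K x' y' * K x y' * (h * cinner p y')"
    and e2: "K x' y - K x y = K x' y * K x y * (h * cinner p y)"
    using kernel_difference[of x y' x'] kernel_difference[of x y x'] assms
    by (simp_all add: cinner_smult_left)
  have e3: "K x' y' - K x' y = K x' y' * K x' y * (cnj k * cinner x' q)"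
    and e4: "K x y' - K x y = K x y' * K x y * (cnj k * cinner x q)"
    using K[OF assms(1)] K[OF assms(2)] K[OF assms(3)] K[OF assms(4)]
    unfolding y' cinner_add_right cinner_smult_right by algebra+
  have "K x' y' - K x y' - K x' y + K x y = (K x' y' - K x y') - (K x' y - K x y)" by simp
  also have "\<dots> = h * (K x' y' * K x y' * (cinner p y + cnj k * cinner p q) - K x' y * K x y * cinner p y)"
    unfolding e1 e2 unfolding y' cinner_add_right cinner_smult_right by algebra
  also have "\<dots> = h * (K x' y' * K x y' * (cnj k * cinner p q) +
     (K x' y' - K x' y) * K x y' * cinner p y + K x' y * (K x y' - K x y) * cinner p y)"
    by algebra
  also have "\<dots> = (h * cnj k) * (K x' y' * K x y' * cinner p q + K x' y' * K x' y * cinner x' q * K x y' * cinner p y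
     + K x' y * K x y' * K x y * cinner x q * cinner p y)"
    unfolding e3 e4 by algebra
  finally show ?thesis using assms(5,6) by simp
qed

lemma difference_quotient_converges:
  fixes q :: "complex \<Rightarrow> complex"
  assumes "\<And>e. 0 < e \<Longrightarrow> \<exists>P. eventually P (at 0) \<and> (\<forall>h k. P h \<longrightarrow> P k \<longrightarrow> dist (q h) (q k) < e)"
  shows "\<exists>L. (q \<longlongrightarrow> L) (at 0)"
proof -
  define s where "s n = q (1 / of_nat (Suc n))" for n
  have lim0: "filterlim (\<lambda>n. 1 / of_nat (Suc n) :: complex) (at 0) sequentially"
    unfolding filterlim_at using LIMSEQ_Suc[OF lim_1_over_n[where 'a=complex]] by (auto simp del: of_nat_Suc)
  have ev: "\<exists>N. \<forall>n\<ge>N. P (1 / of_nat (Suc n))" if "eventually P (at (0::complex))" for P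
    using lim0 that unfolding filterlim_iff eventually_sequentially by blast
  have "Cauchy s"
  proof (rule metric_CauchyI)
    fix e :: real assume "0 < e"
    then obtain P where "eventually P (at 0)" "\<forall>h k. P h \<longrightarrow> P k \<longrightarrow> dist (q h) (q k) < e" using assms by blast
    then show "\<exists>M. \<forall>m\<ge>M. \<forall>n\<ge>M. dist (s m) (s n) < e" using ev[of P] unfolding s_def by blast
  qed
  then obtain L where L: "s \<longlonglongrightarrow> L" using Cauchy_convergent convergentD by blast
  have "(q \<longlongrightarrow> L) (at 0)"
  proof (rule tendstoI)
    fix e :: real assume "0 < e"
    then obtain P where P: "eventually P (at 0)" "\<forall>h k. P h \<longrightarrow> P k \<longrightarrow> dist (q h) (q k) < e/2"
      using assms[of "e/2"] by auto
    obtain N where N: "\<forall>n\<ge>N. P (1 / of_nat (Suc n))" using ev[OF P(1)] by blast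
    obtain M where M: "\<forall>n\<ge>M. dist (s n) L < e/2"
      using L \<open>0 < e\<close> unfolding lim_sequentially by (meson half_gt_zero)
    have "dist (q h) L < e" if "P h" for h
    proof -
      have "dist (q h) (s (max M N)) < e/2" unfolding s_def using P(2) that N by auto
      moreover have "dist (s (max M N)) L < e/2" using M by simp
      ultimately show ?thesis using dist_triangle[of "q h" L "s (max M N)"] by linarith
    qed
    then show "\<forall>\<^sub>F h in at 0. dist (q h) L < e" using P(1) by (auto elim: eventually_mono)
  qed
  then show ?thesis ..
qed

text \<open>A function dominated by a kernel is as regular as the kernel: the squared distance between two
  of its difference quotients is bounded by a second mixed difference of the kernel.\<close>
lemma rkhs_kernel_f_holomorphic:
  fixes \<psi> :: "complex \<Rightarrow> complex^'n"
  assumes hol: "\<forall>i. (\<lambda>z. \<psi> z $ i) holomorphic_on ball 0 1"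
    and lt: "\<And>z. z \<in> ball 0 1 \<Longrightarrow> norm (\<psi> z) < 1"
    and u: "u \<in> rkhs (ball 0 1) (kernel_f \<psi>)"
  shows "u holomorphic_on ball 0 1"
proof -
  obtain c where c: "pos_kernel (ball 0 1) (\<lambda>z w. complex_of_real (c\<^sup>2) * kernel_f \<psi> z w - u z * cnj (u w))"
    using u unfolding rkhs_def by blast
  have "u field_differentiable at z" if z: "z \<in> ball 0 1" for z
  proof -
    define K where "K = (\<lambda>x y :: complex^'n. 1 / (1 - cinner x y))"
    define Q where "Q h = (1/h) *s (\<psi> (z + h) - \<psi> z)" for h
    define d where "d = (\<chi> i. deriv (\<lambda>w. \<psi> w $ i) z)"
    define G where "G h k = (K (\<psi> (z+h)) (\<psi> (z+k)) - K (\<psi> z) (\<psi> (z+k)) - K (\<psi> (z+h)) (\<psi> z) +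
        K (\<psi> z) (\<psi> z)) / (h * cnj k)" for h k
    define E where "E x' y' p q = K x' y' * K (\<psi> z) y' * cinner p q +
        K x' y' * K x' (\<psi> z) * cinner x' q * K (\<psi> z) y' * cinner p (\<psi> z)
     + K x' (\<psi> z) * K (\<psi> z) y' * K (\<psi> z) (\<psi> z) * cinner (\<psi> z) q * cinner p (\<psi> z)" for x' y' p q
    define A where "A = E (\<psi> z) (\<psi> z) d d"
    have der: "((\<lambda>w. \<psi> w $ i) has_field_derivative deriv (\<lambda>w. \<psi> w $ i) z) (at z)" for i
      using hol z by (intro holomorphic_derivI[of _ "ball 0 1"]) auto
    have Q: "(Q \<longlongrightarrow> d) (at 0)"
    proof (rule vec_tendstoI)
      fix i
      have "((\<lambda>h. (\<psi> (z+h) $ i - \<psi> z $ i) / h) \<longlongrightarrow> deriv (\<lambda>w. \<psi> w $ i) z) (at 0)"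
        using der[of i] unfolding DERIV_def .
      then show "((\<lambda>h. Q h $ i) \<longlongrightarrow> d $ i) (at 0)" by (simp add: Q_def d_def diff_divide_distrib)
    qed
    have cont: "((\<lambda>h. \<psi> (z+h)) \<longlongrightarrow> \<psi> z) (at 0)"
      using DERIV_isCont[OF der] by (intro vec_tendstoI) (simp add: isCont_iff)
    have K1: "1 - cinner (\<psi> z) (\<psi> z) \<noteq> 0" using lt[OF z] by (intro kernel_f_denominator)
    have evb: "\<forall>\<^sub>F h in at 0. z + h \<in> ball 0 1 \<and> h \<noteq> 0"
    proof -
      have "((\<lambda>h. z + h) \<longlongrightarrow> z + 0) (at 0)" by (intro tendsto_intros)
      then have "\<forall>\<^sub>F h in at 0. z + h \<in> ball 0 1" using z by (intro topological_tendstoD[of _ z]) auto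
      then show ?thesis by (auto simp: eventually_conj_iff eventually_at_filter)
    qed
    have F: "((\<lambda>p. E (\<psi> (z + fst p)) (\<psi> (z + snd p)) (Q (fst p)) (Q (snd p))) \<longlongrightarrow> A) (at 0 \<times>\<^sub>F at 0)"
      unfolding A_def E_def K_def
      by (intro tendsto_intros K1 filterlim_compose[OF cont] filterlim_compose[OF Q] filterlim_fst filterlim_snd)
    have GE: "G h k = E (\<psi> (z + h)) (\<psi> (z + k)) (Q h) (Q k)" if "z + h \<in> ball 0 1" "z + k \<in> ball 0 1" "h \<noteq> 0" "k \<noteq> 0" for h k
    proof -
      have "cinner (\<psi> a) (\<psi> b) \<noteq> 1" if "a \<in> ball 0 1" "b \<in> ball 0 1" for a b
        using kernel_f_denominator[of \<psi> a b] lt that by simp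
      then show ?thesis unfolding G_def E_def using that z
        by (intro kernel_mixed_difference) (auto simp: Q_def K_def)
    qed
    have "\<exists>L. ((\<lambda>h. (u (z + h) - u z) / h) \<longlongrightarrow> L) (at 0)"
    proof (rule difference_quotient_converges)
      fix e :: real assume e: "0 < e"
      \<comment> \<open>Four terms, each within \<open>e'\<close> of \<open>A\<close>, contribute at
        most \<open>4 * e'\<close>; the constant makes \<open>c^2 * (4 * e') < e^2\<close>, also
        when \<open>c = 0\<close>.\<close>
      define e' where "e' = e\<^sup>2 / (4 * (c\<^sup>2 + 1))"
      have c1: "0 < c\<^sup>2 + 1" by (simp add: add_nonneg_pos)
      have "c\<^sup>2 * (4 * e') = e\<^sup>2 * (c\<^sup>2 / (c\<^sup>2 + 1))" using c1 by (simp add: e'_def field_simps)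
      also have "\<dots> < e\<^sup>2 * 1" using c1 e by (intro mult_strict_left_mono) auto
      finally have e': "e' > 0" "c\<^sup>2 * (4 * e') < e\<^sup>2" using c1 e unfolding e'_def by auto
      have "\<forall>\<^sub>F p in at 0 \<times>\<^sub>F at 0. dist (E (\<psi> (z + fst p)) (\<psi> (z + snd p)) (Q (fst p)) (Q (snd p))) A < e'"
        using F e'(1) by (rule tendstoD)
      then obtain P where P: "eventually P (at 0)"
        "\<And>h k. P h \<Longrightarrow> P k \<Longrightarrow> dist (E (\<psi> (z + h)) (\<psi> (z + k)) (Q h) (Q k)) A < e'"
        unfolding eventually_prod_same by (metis fst_conv snd_conv)
      define P' where "P' h \<longleftrightarrow> P h \<and> z + h \<in> ball 0 1 \<and> h \<noteq> 0" for h
      have "dist ((u (z + h) - u z) / h) ((u (z + k) - u z) / k) < e" if "P' h" "P' k" for h k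
      proof -
        \<comment> \<open>These coefficients turn the combination of values of \<open>u\<close> into
          the difference of the two difference quotients. The quadratic form becomes an alternating
          sum of four mixed differences with the common limit \<open>A\<close>, which
          cancels.\<close>
        define x a where "x = (\<lambda>i::nat. if i = 0 then z + h else if i = 1 then z + k else z)"
          and "a = (\<lambda>i::nat. if i = 0 then cnj (1/h) else if i = 1 then - cnj (1/k) else cnj (1/k - 1/h))"
        have s3: "(\<Sum>i<3. F i) = F 0 + F 1 + F 2" for F :: "nat \<Rightarrow> complex"
          by (simp add: numeral_3_eq_3 numeral_2_eq_2)
        have "(\<Sum>i<3. cnj (a i) * u (x i)) = (u (z + h) - u z) / h - (u (z + k) - u z) / k"
          unfolding s3 x_def a_def by (simp add: algebra_simps diff_divide_distrib)
        moreover have "(\<Sum>i<3. \<Sum>j<3. cnj (a i) * a j * kernel_f \<psi> (x i) (x j)) = G h h - G h k - G k h + G k k"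
        proof -
          define p q where "p = 1/h" and "q = 1/k"
          have a: "a 0 = cnj p" "a 1 = - cnj q" "a 2 = cnj q - cnj p" and x: "x 0 = z + h" "x 1 = z + k" "x 2 = z"
            by (simp_all add: a_def x_def p_def q_def)
          have K: "kernel_f \<psi> s t = K (\<psi> s) (\<psi> t)" for s t by (simp add: kernel_f_def K_def)
          have G: "G h' k' = (K (\<psi> (z+h')) (\<psi> (z+k')) - K (\<psi> z) (\<psi> (z+k')) - K (\<psi> (z+h')) (\<psi> z)
              + K (\<psi> z) (\<psi> z)) * ((1/h') * cnj (1/k'))" for h' k' by (simp add: G_def)
          show ?thesis
            unfolding s3 a x K G p_def[symmetric] q_def[symmetric] complex_cnj_cnj complex_cnj_diff complex_cnj_minus
            by algebra
        qed
        moreover have "(cmod (\<Sum>i<3. cnj (a i) * u (x i)))\<^sup>2 \<le>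
            c\<^sup>2 * Re (\<Sum>i<3. \<Sum>j<3. cnj (a i) * a j * kernel_f \<psi> (x i) (x j))"
          by (rule rkhs_bound[OF c]) (use that z in \<open>auto simp: x_def P'_def\<close>)
        ultimately have *: "(dist ((u (z + h) - u z) / h) ((u (z + k) - u z) / k))\<^sup>2 \<le> c\<^sup>2 * Re (G h h -
            G h k - G k h + G k k)"
          by (simp add: dist_norm)
        have g: "cmod (G h' k' - A) < e'" if "h' \<in> {h,k}" "k' \<in> {h,k}" for h' k'
          using P(2)[of h' k'] GE[of h' k'] that \<open>P' h\<close> \<open>P' k\<close> unfolding P'_def by (auto simp: dist_norm)
        have "Re (G h h - G h k - G k h + G k k) = Re ((G h h - A) - (G h k - A) - (G k h - A) + (G k k - A))"
          by simp
        also have "\<dots> \<le> cmod (G h h - A) + cmod (G h k - A) + cmod (G k h - A) + cmod (G k k - A)"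
          using abs_Re_le_cmod[of "G h h - A"] abs_Re_le_cmod[of "G h k - A"] abs_Re_le_cmod[of "G k h -
              A"] abs_Re_le_cmod[of "G k k - A"]
          unfolding plus_complex.sel minus_complex.sel by linarith
        also have "\<dots> \<le> 4 * e'" using g[of h h] g[of h k] g[of k h] g[of k k] by simp
        finally have "c\<^sup>2 * Re (G h h - G h k - G k h + G k k) \<le> c\<^sup>2 * (4 * e')" by (intro mult_left_mono) auto
        then have "(dist ((u (z + h) - u z) / h) ((u (z + k) - u z) / k))\<^sup>2 < e\<^sup>2" using * e'(2) by linarith
        then show ?thesis using e by (simp add: power2_less_imp_less)
      qed
      moreover have "eventually P' (at 0)" unfolding P'_def using P(1) evb by eventually_elim auto
      ultimately show "\<exists>P. eventually P (at 0) \<and> (\<forall>h k. P h \<longrightarrow> P k \<longrightarrow>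
          dist ((u (z + h) - u z) / h) ((u (z + k) - u z) / k) < e)" by blast
    qed
    then show ?thesis unfolding field_differentiable_def DERIV_def .
  qed
  then show ?thesis by (simp add: holomorphic_on_def field_differentiable_at_within)
qed

section \<open>The logarithm and division by a zero in the Hardy space\<close>

lemma szego_denominator: "cmod z < 1 \<Longrightarrow> cmod w < 1 \<Longrightarrow> 1 - z * cnj w \<noteq> 0"
  using kernel_f_denominator[of "\<lambda>z. (\<chi> i. z)::complex^1" z w] by (simp add: norm_vec1 cinner_vec1)

text \<open>The Taylor coefficients \<open>1/n\<close> of \<open>- Ln (1 - z)\<close> are square
  summable. Cauchy-Schwarz bounds each partial sum against the partial sum of the Szego kernel with
  one constant, and positivity survives the limit.\<close>

lemma Ln_dominated_by_szego:
  obtains C where "0 \<le> C"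
    "pos_kernel (ball 0 1) (\<lambda>z w. complex_of_real C * szego z w - Ln (1 - z) * cnj (Ln (1 - w)))"
proof -
  \<comment> \<open>The terms with \<open>n = 0\<close> vanish here and in \<open>l\<close>, since
    \<open>1 / real 0 = 0\<close>.\<close>
  define C where "C = (\<Sum>n. (1 / real n)\<^sup>2)"
  define l where "l M z = (\<Sum>n<M. of_real (1 / real n) * z ^ n)" for M and z :: complex
  have sm: "summable (\<lambda>n. (1 / real n)\<^sup>2)"
    using inverse_power_summable[of 2, where 'a=real] by (simp add: power_divide inverse_eq_divide)
  have C: "0 \<le> C" "(\<Sum>n<M. (1 / real n)\<^sup>2) \<le> C" for M
    unfolding C_def by (auto intro!: suminf_nonneg sum_le_suminf sm)
  have "pos_kernel (ball 0 1) (\<lambda>z w. complex_of_real C * szego z w - Ln (1 - z) * cnj (Ln (1 - w)))"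
  proof (rule pos_kernel_limit)
    fix M :: nat
    define S where "S z w = (\<Sum>n<M. z ^ n * cnj (w ^ n))" for z w :: complex
    show "pos_kernel (ball 0 1) (\<lambda>z w. complex_of_real C * S z w - l M z * cnj (l M w))"
    proof (rule pos_kernel_of_bound)
      show "pos_kernel (ball 0 1) S" unfolding S_def by (intro pos_kernel_sum pos_kernel_rank_one)
      fix n :: nat and x a :: "nat \<Rightarrow> complex"
      define s where "s k = (\<Sum>i<n. cnj (a i) * x i ^ k)" for k
      have "complex_of_real (\<Sum>k<M. (cmod (s k))\<^sup>2) =
          (\<Sum>k<M. \<Sum>i<n. \<Sum>j<n. cnj (a i) * a j * (x i ^ k * cnj (x j ^ k)))"
        unfolding of_real_sum s_def
        by (rule sum.cong[OF refl]) (rule rank_one_quadratic_form[where h="\<lambda>z. z ^ _", symmetric])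
      also have "\<dots> = (\<Sum>i<n. \<Sum>j<n. cnj (a i) * a j * S (x i) (x j))"
        unfolding S_def sum_distrib_left by (subst sum.swap) (rule sum.cong[OF refl], rule sum.swap)
      finally have "Re (complex_of_real (\<Sum>k<M. (cmod (s k))\<^sup>2)) = Re (\<Sum>i<n. \<Sum>j<n. cnj (a i) * a j * S (x i) (x j))"
        by (simp only:)
      then have s2: "(\<Sum>k<M. (cmod (s k))\<^sup>2) = Re (\<Sum>i<n. \<Sum>j<n. cnj (a i) * a j * S (x i) (x j))"
        unfolding Re_complex_of_real .
      have "(\<Sum>i<n. cnj (a i) * l M (x i)) = (\<Sum>k<M. of_real (1 / real k) * s k)"
        unfolding l_def s_def sum_distrib_left by (subst sum.swap) (simp add: mult_ac)
      then have "cmod (\<Sum>i<n. cnj (a i) * l M (x i)) \<le> (\<Sum>k<M. (1 / real k) * cmod (s k))"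
        by (simp only:) (rule order_trans[OF norm_sum], simp add: norm_mult norm_divide)
      then have "(cmod (\<Sum>i<n. cnj (a i) * l M (x i)))\<^sup>2 \<le> (\<Sum>k<M. (1 / real k) * cmod (s k))\<^sup>2"
        by (intro power_mono) auto
      also have "\<dots> \<le> (\<Sum>k<M. (1 / real k)\<^sup>2) * (\<Sum>k<M. (cmod (s k))\<^sup>2)" by (rule Cauchy_Schwarz_ineq_sum)
      also have "\<dots> \<le> C * (\<Sum>k<M. (cmod (s k))\<^sup>2)" using C by (intro mult_right_mono sum_nonneg) auto
      also note s2
      finally show "(cmod (\<Sum>i<n. cnj (a i) * l M (x i)))\<^sup>2 \<le>
         C * Re (\<Sum>i<n. \<Sum>j<n. cnj (a i) * a j * S (x i) (x j))" .
    qed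
  next
    fix z w :: complex assume zw: "z \<in> ball 0 1" "w \<in> ball 0 1"
    have l: "(\<lambda>M. l M z) \<longlonglongrightarrow> - Ln (1 - z)" if "z \<in> ball 0 1" for z
    proof -
      have "(\<lambda>n. (-1) ^ Suc n / of_nat n * (-z) ^ n) sums ln (1 + (-z))"
        using that by (intro Ln_series) simp
      then have "(\<lambda>n. - ((-1) ^ Suc n / of_nat n * (-z) ^ n)) sums - Ln (1 - z)"
        by (intro sums_minus) simp
      also have "(\<lambda>n. - ((-1) ^ Suc n / of_nat n * (-z) ^ n)) = (\<lambda>n. of_real (1 / real n) * z ^ n)"
        by (intro ext) (simp add: power_minus[of z] mult_ac)
      finally show ?thesis unfolding sums_def l_def .
    qed
    have "cmod (z * cnj w) < 1"
      using mult_strict_mono'[of "cmod z" 1 "cmod w" 1] zw by (simp add: norm_mult)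
    then have "(\<lambda>M. \<Sum>n<M. z ^ n * cnj (w ^ n)) \<longlonglongrightarrow> szego z w"
      using geometric_LIMSEQ[of "z * cnj w"] by (simp add: szego_def power_mult_distrib)
    then have "(\<lambda>M. complex_of_real C * (\<Sum>n<M. z ^ n * cnj (w ^ n)) - l M z * cnj (l M w)) \<longlonglongrightarrow>
       complex_of_real C * szego z w - (- Ln (1 - z)) * cnj (- Ln (1 - w))"
      by (intro tendsto_intros l zw)
    then show "(\<lambda>M. complex_of_real C * (\<Sum>n<M. z ^ n * cnj (w ^ n)) - l M z * cnj (l M w)) \<longlonglongrightarrow>
       complex_of_real C * szego z w - Ln (1 - z) * cnj (Ln (1 - w))" by simp
  qed
  then show ?thesis using C(1) that by blast
qed

text \<open>The test function for boundary identifications: it has finite norm, yet is singular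
  where \<open>\<psi>\<close> approaches \<open>p\<close>.\<close>

lemma Ln_in_rkhs:
  assumes "\<And>z. z \<in> X \<Longrightarrow> norm (\<psi> z) < 1" "norm p = 1"
  shows "(\<lambda>z. indicator X z * Ln (1 - cinner (\<psi> z) p)) \<in> rkhs X (kernel_f \<psi>)"
proof -
  obtain C where C: "0 \<le> C"
    "pos_kernel (ball 0 1) (\<lambda>z w. complex_of_real C * szego z w - Ln (1 - z) * cnj (Ln (1 - w)))"
    using Ln_dominated_by_szego .
  have "cinner (\<psi> z) p \<in> ball 0 1" if "z \<in> X" for z
    using norm_cinner_less_1[of "\<psi> z" p] assms that by simp
  then have "pos_kernel X (\<lambda>z w. (complex_of_real C * szego (cinner (\<psi> z) p) (cinner (\<psi> w) p)
      - Ln (1 - cinner (\<psi> z) p) * cnj (Ln (1 - cinner (\<psi> w) p)))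
     + complex_of_real C * (kernel_f \<psi> z w - szego (cinner (\<psi> z) p) (cinner (\<psi> w) p)))"
    using C(1) by (intro pos_kernel_add pos_kernel_compose[OF C(2)] pos_kernel_scale szego_le_kernel_f assms)
      (auto simp: complex_nonneg_iff)
  also have "?this \<longleftrightarrow> pos_kernel X (\<lambda>z w. complex_of_real ((sqrt C)\<^sup>2) * kernel_f \<psi> z w -
     indicator X z * Ln (1 - cinner (\<psi> z) p) * cnj (indicator X w * Ln (1 - cinner (\<psi> w) p)))"
    using C(1) by (intro pos_kernel_cong) (simp add: algebra_simps)
  finally show ?thesis unfolding rkhs_def by (intro CollectI conjI exI) auto
qed

text \<open>The kernel vector at \<open>l\<close> is projected out by adjoining \<open>l\<close> to the given points with the
  optimal coefficient; this is free of charge because the function vanishes at \<open>l\<close>.\<close>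
lemma rkhs_vanishing_point:
  assumes "pos_kernel X (\<lambda>z w. complex_of_real (c\<^sup>2) * K z w - u z * cnj (u w))" "l \<in> X" "u l = 0"
    and herm: "\<And>z. z \<in> X \<Longrightarrow> K l z = cnj (K z l)" and pos: "K l l = of_real k" "0 < k"
    and pk: "pos_kernel X (\<lambda>z w. K z w - K z l * K l w / K l l)"
  shows "pos_kernel X (\<lambda>z w. complex_of_real (c\<^sup>2) * (K z w - K z l * K l w / K l l) - u z * cnj (u w))"
proof (rule pos_kernel_of_bound[OF pk])
  fix n :: nat and x a assume x: "\<And>i. i < n \<Longrightarrow> x i \<in> X"
  define s where "s = (\<Sum>j<n. a j * K l (x j))"
  define t where "t = - s / K l l"
  define x' a' where "x' = x(n := l)" and "a' = a(n := t)"
  define B where "B = (\<Sum>i<n. \<Sum>j<n. cnj (a i) * a j * K (x i) (x j))"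
  have cs: "cnj s = (\<Sum>i<n. cnj (a i) * K (x i) l)"
    unfolding s_def cnj_sum complex_cnj_mult using x herm by (intro sum.cong) auto
  have "(\<Sum>i<n. cnj (a i) * u (x i)) = (\<Sum>i<Suc n. cnj (a' i) * u (x' i))"
    using assms(3) by (simp add: x'_def a'_def)
  also have "(cmod \<dots>)\<^sup>2 \<le> c\<^sup>2 * Re (\<Sum>i<Suc n. \<Sum>j<Suc n. cnj (a' i) * a' j * K (x' i) (x' j))"
    by (rule rkhs_bound[OF assms(1)]) (use x assms(2) in \<open>auto simp: x'_def less_Suc_eq\<close>)
  also have "(\<Sum>i<Suc n. \<Sum>j<Suc n. cnj (a' i) * a' j * K (x' i) (x' j)) =
     (\<Sum>i<n. (\<Sum>j<n. cnj (a i) * a j * K (x i) (x j)) + cnj (a i) * t * K (x i) l) +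
     ((\<Sum>j<n. cnj t * a j * K l (x j)) + cnj t * t * K l l)"
    by (simp add: x'_def a'_def)
  also have "\<dots> = B + t * cnj s + cnj t * s + cnj t * t * K l l"
    unfolding cs unfolding s_def B_def by (simp add: sum.distrib sum_distrib_left mult_ac)
  also have "\<dots> = B - s * cnj s / K l l"
    using pos unfolding t_def by simp
  also have "s * cnj s / K l l = (\<Sum>i<n. \<Sum>j<n. cnj (a i) * a j * (K (x i) l * K l (x j) / K l l))"
    unfolding mult.commute[of s] unfolding cs unfolding s_def sum_product sum_divide_distrib by (simp add: mult_ac)
  also have "B - \<dots> = (\<Sum>i<n. \<Sum>j<n. cnj (a i) * a j * (K (x i) (x j) - K (x i) l * K l (x j) / K l l))"
    unfolding B_def by (simp add: sum_subtractf[symmetric] right_diff_distrib)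
  finally show "(cmod (\<Sum>i<n. cnj (a i) * u (x i)))\<^sup>2 \<le> c\<^sup>2 *
    Re (\<Sum>i<n. \<Sum>j<n. cnj (a i) * a j * (K (x i) (x j) - K (x i) l * K l (x j) / K l l))" .
qed

text \<open>Both sides are the kernel of the subspace of functions vanishing at \<open>l\<close>:
  the left one by projecting out the kernel vector at \<open>l\<close>, the right one because
  multiplication by the Blaschke factor is isometric onto that subspace.\<close>

lemma szego_Blaschke:
  assumes "cmod l < 1" "cmod z < 1" "cmod w < 1"
  shows "szego z w - szego z l * szego l w / szego l l =
    (z - l) / (1 - cnj l * z) * cnj ((w - l) / (1 - cnj l * w)) * szego z w"
proof -
  have "1 - l * cnj l \<noteq> 0" "1 - z * cnj l \<noteq> 0" "1 - l * cnj w \<noteq> 0" "1 - z * cnj w \<noteq> 0"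
    using assms by (intro szego_denominator; simp)+
  then show ?thesis unfolding szego_def
    by (simp add: divide_simps mult.commute) (simp add: algebra_simps)
qed

text \<open>Division by the Blaschke factor at \<open>l\<close> preserves the norm bound
  \<open>c\<close>, which handles \<open>y = u / b\<close>; the factor
  \<open>1 / (1 - cnj l * z)\<close> between \<open>y\<close> and \<open>v\<close> is a resolvent
  multiplier.\<close>

lemma rkhs_szego_divide:
  assumes u: "u \<in> rkhs (ball 0 1) szego" and l: "l \<in> ball 0 1"
    and v: "\<And>z. z \<in> ball 0 1 \<Longrightarrow> u z = (z - l) * v z" and cont: "isCont v l"
    and v0: "\<And>z. z \<notin> ball 0 1 \<Longrightarrow> v z = 0"
  shows "v \<in> rkhs (ball 0 1) szego"
proof -
  have l1: "cmod l < 1" using l by simp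
  obtain c where c: "pos_kernel (ball 0 1) (\<lambda>z w. complex_of_real (c\<^sup>2) * szego z w - u z * cnj (u w))"
    using u unfolding rkhs_def by blast
  define b where "b z = (z - l) / (1 - cnj l * z)" for z
  define y where "y z = (1 - cnj l * z) * v z" for z
  have nz: "1 - cnj l * z \<noteq> 0" if "z \<in> ball 0 1" for z
    using szego_denominator[of z l] that l1 by (simp add: mult.commute)
  have uby: "u z = b z * y z" if "z \<in> ball 0 1" for z
    using v[OF that] nz[OF that] unfolding b_def y_def by simp
  have eq: "szego z w - szego z l * szego l w / szego l l = b z * cnj (b w) * szego z w"
    if "z \<in> ball 0 1" "w \<in> ball 0 1" for z w
    using szego_Blaschke[OF l1, of z w] that unfolding b_def by simp
  have ll: "szego l l = of_real (1 / (1 - (cmod l)\<^sup>2))" unfolding szego_def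
    by (simp only: complex_norm_square[symmetric]) simp
  have "(cmod l)\<^sup>2 < 1" using l1 by (simp add: power_less_one_iff)
  have "pos_kernel (ball 0 1) (\<lambda>z w. b z * cnj (b w) * szego z w)"
    by (intro pos_kernel_rank_one_mult pos_kernel_szego)
  then have pk: "pos_kernel (ball 0 1) (\<lambda>z w. szego z w - szego z l * szego l w / szego l l)"
    using pos_kernel_cong[of "ball 0 1" "\<lambda>z w. szego z w - szego z l * szego l w / szego l l"
       "\<lambda>z w. b z * cnj (b w) * szego z w"] eq by blast
  have "pos_kernel (ball 0 1) (\<lambda>z w. complex_of_real (c\<^sup>2) *
      (szego z w - szego z l * szego l w / szego l l) - u z * cnj (u w))"
    by (rule rkhs_vanishing_point[OF c l _ _ ll _ pk])
       (use l v[OF l] \<open>(cmod l)\<^sup>2 < 1\<close> in \<open>auto simp: szego_def mult.commute\<close>)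
  also have "?this \<longleftrightarrow> pos_kernel (ball 0 1) (\<lambda>z w. b z * cnj (b w) *
      (complex_of_real (c\<^sup>2) * szego z w - y z * cnj (y w)))"
  proof (rule pos_kernel_cong, goal_cases)
    case (1 z w)
    show ?case unfolding eq[OF 1] uby[OF 1(1)] uby[OF 1(2)] by (simp add: algebra_simps)
  qed
  finally have "pos_kernel (ball 0 1 - {l}) (\<lambda>z w. 1 / b z * cnj (1 / b w) * (b z * cnj (b w) *
      (complex_of_real (c\<^sup>2) * szego z w - y z * cnj (y w))))"
    by (rule pos_kernel_rank_one_mult[OF pos_kernel_subset]) auto
  also have "?this \<longleftrightarrow> pos_kernel (ball 0 1 - {l}) (\<lambda>z w. complex_of_real (c\<^sup>2) * szego z w - y z * cnj (y w))"
  proof (rule pos_kernel_cong, goal_cases)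
    case (1 z w)
    then have "b z \<noteq> 0" "cnj (b w) \<noteq> 0" unfolding complex_cnj_zero_iff using nz by (auto simp: b_def)
    then have "1 / b z * (1 / cnj (b w)) * (b z * cnj (b w) * X) = X" for X by simp
    then show ?case unfolding complex_cnj_divide complex_cnj_one .
  qed
  finally have P: "pos_kernel (ball 0 1 - {l}) (\<lambda>z w. complex_of_real (c\<^sup>2) * szego z w - y z * cnj (y w))" .
  have "l islimpt (ball 0 1)" using l by (simp add: open_imp_islimpt)
  then obtain s where s: "\<And>n. s n \<in> ball 0 1 - {l}" "s \<longlonglongrightarrow> l"
    unfolding islimpt_sequential by blast
  \<comment> \<open>Cancelling \<open>b\<close> has lost the point \<open>l\<close>. Moving it to
    points \<open>s n\<close> that tend to \<open>l\<close> and passing to the limit restores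
    positivity on the whole disc.\<close>
  define r where "r n z = (if z = l then s n else z)" for n z
  have rlim: "(\<lambda>n. r n z) \<longlonglongrightarrow> z" for z
    using s(2) by (cases "z = l") (auto simp: r_def)
  have ycont: "(\<lambda>n. y (r n z)) \<longlonglongrightarrow> y z" for z
  proof (cases "z = l")
    case True
    have "isCont y l" unfolding y_def by (intro continuous_intros cont)
    then show ?thesis using True rlim[of z] isCont_tendsto_compose by blast
  qed (simp add: r_def)
  have "pos_kernel (ball 0 1) (\<lambda>z w. complex_of_real (c\<^sup>2) * szego z w - y z * cnj (y w))"
  proof (rule pos_kernel_limit)
    show "pos_kernel (ball 0 1) (\<lambda>z w. complex_of_real (c\<^sup>2) * szego (r n z) (r n w) - y (r n z) * cnj (y (r n w)))" for n
      by (rule pos_kernel_compose[OF P]) (use s in \<open>auto simp: r_def\<close>)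
    show "(\<lambda>n. complex_of_real (c\<^sup>2) * szego (r n z) (r n w) - y (r n z) * cnj (y (r n w))) \<longlonglongrightarrow>
      complex_of_real (c\<^sup>2) * szego z w - y z * cnj (y w)" if "z \<in> ball 0 1" "w \<in> ball 0 1" for z w
      unfolding szego_def using that by (intro tendsto_intros rlim ycont szego_denominator) auto
  qed
  then have yr: "y \<in> rkhs (ball 0 1) szego" unfolding rkhs_def y_def using v0 by auto
  have "(\<lambda>z. indicator (ball 0 1) z / (1 - cinner ((\<chi> i. z)::complex^1) (\<chi> i. l))) \<in> multipliers (ball 0 1) szego"
    unfolding szego_eq_kernel_f using l by (intro resolvent_in_multipliers) (auto simp: norm_vec1)
  then have "(\<lambda>z. indicator (ball 0 1) z / (1 - z * cnj l) * y z) \<in> rkhs (ball 0 1) szego"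
    using yr unfolding multipliers_def cinner_vec1 by blast
  also have "(\<lambda>z. indicator (ball 0 1) z / (1 - z * cnj l) * y z) = v"
    using nz v0 by (intro ext) (auto simp: y_def indicator_def mult.commute)
  finally show ?thesis .
qed

section \<open>Means over the circle and the disc algebra\<close>

definition circ :: "real \<Rightarrow> complex" where "circ t = cis (2 * pi * t)"

definition cmean :: "(complex \<Rightarrow> 'b::banach) \<Rightarrow> 'b" where
  "cmean F = integral {0..1} (\<lambda>t. F (circ t))"

definition disc_algebra :: "(complex \<Rightarrow> complex) set" where
  "disc_algebra = {F. continuous_on (cball 0 1) F \<and> F holomorphic_on ball 0 1}"

definition ip :: "(complex \<Rightarrow> complex) \<Rightarrow> (complex \<Rightarrow> complex) \<Rightarrow> complex" where
  "ip F u = cmean (\<lambda>\<zeta>. F \<zeta> * cnj (u \<zeta>))"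

definition N2 :: "(complex \<Rightarrow> complex) \<Rightarrow> real" where
  "N2 u = cmean (\<lambda>\<zeta>. (cmod (u \<zeta>))\<^sup>2)"

abbreviation circle :: "complex set" where "circle \<equiv> sphere 0 1"

lemma circ_in_circle: "circ t \<in> circle"
  by (simp add: circ_def)

lemma cmod_circ [simp]: "cmod (circ t) = 1"
  by (simp add: circ_def)

lemma continuous_on_circ [continuous_intros]: "continuous_on S circ"
  unfolding circ_def by (intro continuous_intros)

lemma continuous_on_circ_compose: "continuous_on circle F \<Longrightarrow> continuous_on S (\<lambda>t. F (circ t))"
  by (rule continuous_on_compose2[OF _ continuous_on_circ]) (auto simp: circ_in_circle)

lemma integrable_circ: "continuous_on circle (F :: complex \<Rightarrow> 'b::banach) \<Longrightarrow> (\<lambda>t. F (circ t)) integrable_on {0..1}"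
  by (intro integrable_continuous_real continuous_on_circ_compose)

lemma cmean_add: "continuous_on circle F \<Longrightarrow> continuous_on circle G \<Longrightarrow> cmean (\<lambda>\<zeta>. F \<zeta> + G \<zeta>) = cmean F + cmean G"
  unfolding cmean_def by (intro integral_add integrable_circ)

lemma cmean_diff: "continuous_on circle F \<Longrightarrow> continuous_on circle G \<Longrightarrow> cmean (\<lambda>\<zeta>. F \<zeta> - G \<zeta>) = cmean F - cmean G"
  unfolding cmean_def by (intro integral_diff integrable_circ)

lemma cmean_mult_left: "cmean (\<lambda>\<zeta>. c * F \<zeta>) = (c::'a::{real_normed_field,banach}) * cmean F"
  unfolding cmean_def by (rule integral_mult_right)

lemma cmean_mult_right: "cmean (\<lambda>\<zeta>. F \<zeta> * c) = cmean F * (c::'a::{real_normed_field,banach})"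
  unfolding cmean_def by (rule integral_mult_left)

lemma cmean_const: "cmean (\<lambda>\<zeta>. c) = c"
  unfolding cmean_def by simp

lemma cmean_sum:
  "(\<And>i. i \<in> I \<Longrightarrow> continuous_on circle (F i)) \<Longrightarrow> cmean (\<lambda>\<zeta>. \<Sum>i\<in>I. F i \<zeta>) = (\<Sum>i\<in>I. cmean (F i))"
  unfolding cmean_def by (cases "finite I") (auto intro!: integral_sum integrable_circ)

lemma cmean_cong: "(\<And>\<zeta>. \<zeta> \<in> circle \<Longrightarrow> F \<zeta> = G \<zeta>) \<Longrightarrow> cmean F = cmean G"
  unfolding cmean_def by (intro integral_cong) (simp add: circ_in_circle)

lemma cmean_mono:
  fixes F G :: "complex \<Rightarrow> real"
  assumes "continuous_on circle F" "continuous_on circle G" "\<And>\<zeta>. \<zeta> \<in> circle \<Longrightarrow> F \<zeta> \<le> G \<zeta>"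
  shows "cmean F \<le> cmean G"
  unfolding cmean_def using assms by (intro integral_le integrable_circ) (auto simp: circ_in_circle)

lemma cmean_nonneg:
  fixes F :: "complex \<Rightarrow> real"
  assumes "continuous_on circle F" "\<And>\<zeta>. \<zeta> \<in> circle \<Longrightarrow> 0 \<le> F \<zeta>"
  shows "0 \<le> cmean F"
  using cmean_mono[of "\<lambda>_. 0" F] assms by (simp add: cmean_const)

lemma norm_cmean_le:
  fixes F :: "complex \<Rightarrow> complex"
  assumes "continuous_on circle F" shows "cmod (cmean F) \<le> cmean (\<lambda>\<zeta>. cmod (F \<zeta>))"
  unfolding cmean_def
  by (rule integral_norm_bound_integral) (use assms in \<open>auto intro!: integrable_circ continuous_intros\<close>)

lemma cmean_of_real: "continuous_on circle F \<Longrightarrow> cmean (\<lambda>\<zeta>. complex_of_real (F \<zeta>)) = of_real (cmean F)"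
  unfolding cmean_def using integral_linear[OF integrable_circ bounded_linear_of_real, of F] by (simp add: o_def)

lemma cmean_cnj: "continuous_on circle F \<Longrightarrow> cmean (\<lambda>\<zeta>. cnj (F \<zeta>)) = cnj (cmean F)"
  unfolding cmean_def using integral_linear[OF integrable_circ bounded_linear_cnj, of F] by (simp add: o_def)

lemma disc_algebra_continuous: "F \<in> disc_algebra \<Longrightarrow> continuous_on circle F"
  unfolding disc_algebra_def by (auto elim: continuous_on_subset)

lemma disc_algebra_intros:
  "(\<lambda>z. c) \<in> disc_algebra" "(\<lambda>z. z) \<in> disc_algebra"
  "F \<in> disc_algebra \<Longrightarrow> G \<in> disc_algebra \<Longrightarrow> (\<lambda>z. F z + G z) \<in> disc_algebra"
  "F \<in> disc_algebra \<Longrightarrow> G \<in> disc_algebra \<Longrightarrow> (\<lambda>z. F z - G z) \<in> disc_algebra"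
  "F \<in> disc_algebra \<Longrightarrow> G \<in> disc_algebra \<Longrightarrow> (\<lambda>z. F z * G z) \<in> disc_algebra"
  "F \<in> disc_algebra \<Longrightarrow> (\<lambda>z. F z ^ n) \<in> disc_algebra"
  unfolding disc_algebra_def by (auto intro!: continuous_intros holomorphic_intros)

lemma disc_algebra_sum: "(\<And>i. i \<in> I \<Longrightarrow> F i \<in> disc_algebra) \<Longrightarrow> (\<lambda>z. \<Sum>i\<in>I. F i z) \<in> disc_algebra"
  by (induction I rule: infinite_finite_induct) (auto intro: disc_algebra_intros)

text \<open>On the circle \<open>\<zeta> / (\<zeta> - w) = 1 / (1 - w * cnj \<zeta>)\<close>, so
  Cauchy's formula is the reproducing property of the Szego kernel. Continuity up to the boundary
  permits integration over the unit circle itself.\<close>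

lemma cmean_Cauchy:
  assumes "F \<in> disc_algebra" "cmod w < 1"
  shows "cmean (\<lambda>\<zeta>. F \<zeta> / (1 - w * cnj \<zeta>)) = F w"
proof -
  have "((\<lambda>u. F u / (u - w)) has_contour_integral (2 * of_real pi * \<i> * F w)) (circlepath 0 1)"
    by (rule Cauchy_integral_circlepath) (use assms in \<open>auto simp: disc_algebra_def\<close>)
  then have "((\<lambda>t. F (circlepath 0 1 t) / (circlepath 0 1 t - w) * vector_derivative (circlepath 0 1) (at t))
     has_integral (2 * of_real pi * \<i> * F w)) {0..1}"
    unfolding has_contour_integral .
  also have "(\<lambda>t. F (circlepath 0 1 t) / (circlepath 0 1 t - w) * vector_derivative (circlepath 0 1) (at t)) =
     (\<lambda>t. (2 * of_real pi * \<i>) * (F (circ t) / (1 - w * cnj (circ t))))"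
  proof
    fix t
    have c: "circlepath 0 1 t = circ t" by (simp add: circlepath circ_def cis_conv_exp mult_ac)
    have n: "circ t * cnj (circ t) = 1" using complex_norm_square[of "circ t"] by simp
    have "circ t - w = circ t * (1 - w * cnj (circ t))" using n by (simp add: algebra_simps)
    moreover have "circ t \<noteq> 0" using n by auto
    moreover have "vector_derivative (circlepath 0 1) (at t) = 2 * of_real pi * \<i> * circ t"
      by (simp add: vector_derivative_circlepath circ_def cis_conv_exp mult_ac)
    ultimately show "F (circlepath 0 1 t) / (circlepath 0 1 t - w) * vector_derivative (circlepath 0 1) (at t) =
       (2 * of_real pi * \<i>) * (F (circ t) / (1 - w * cnj (circ t)))"
      unfolding c by simp
  qed
  finally have "((\<lambda>t. 1 / (2 * of_real pi * \<i>) * ((2 * of_real pi * \<i>) * (F (circ t) / (1 - w * cnj (circ t)))))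
      has_integral 1 / (2 * of_real pi * \<i>) * (2 * of_real pi * \<i> * F w)) {0..1}"
    by (rule has_integral_mult_right)
  then have "((\<lambda>t. F (circ t) / (1 - w * cnj (circ t))) has_integral F w) {0..1}" by simp
  then show ?thesis unfolding cmean_def by (rule integral_unique)
qed

section \<open>The mean-square pairing\<close>

lemma ip_self: "continuous_on circle u \<Longrightarrow> ip u u = of_real (N2 u)"
  unfolding ip_def N2_def complex_norm_square[symmetric]
  by (intro cmean_of_real continuous_intros)

lemma N2_nonneg: "continuous_on circle u \<Longrightarrow> 0 \<le> N2 u"
  unfolding N2_def by (intro cmean_nonneg continuous_intros) auto

lemma cmean_Cauchy_Schwarz:
  fixes a b :: "complex \<Rightarrow> real"
  assumes a: "continuous_on circle a" and b: "continuous_on circle b"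
  shows "(cmean (\<lambda>\<zeta>. a \<zeta> * b \<zeta>))\<^sup>2 \<le> cmean (\<lambda>\<zeta>. (a \<zeta>)\<^sup>2) * cmean (\<lambda>\<zeta>. (b \<zeta>)\<^sup>2)"
proof -
  define A B M where "A = cmean (\<lambda>\<zeta>. (a \<zeta>)\<^sup>2)" "B = cmean (\<lambda>\<zeta>. (b \<zeta>)\<^sup>2)" "M = cmean (\<lambda>\<zeta>. a \<zeta> * b \<zeta>)"
  have q: "0 \<le> s\<^sup>2 * A - 2 * s * M + B" for s
  proof -
    have "0 \<le> cmean (\<lambda>\<zeta>. (s * a \<zeta> - b \<zeta>)\<^sup>2)" by (intro cmean_nonneg continuous_intros a b) auto
    also have "(\<lambda>\<zeta>. (s * a \<zeta> - b \<zeta>)\<^sup>2) = (\<lambda>\<zeta>. s\<^sup>2 * (a \<zeta>)\<^sup>2 - 2 * s * (a \<zeta> * b \<zeta>) + (b \<zeta>)\<^sup>2)"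
      by (simp add: power2_eq_square algebra_simps)
    also have "cmean \<dots> = s\<^sup>2 * A - 2 * s * M + B"
      unfolding A_B_M_def
      by (subst cmean_add cmean_diff cmean_mult_left; (intro continuous_intros a b)?)+ simp
    finally show ?thesis .
  qed
  have A: "0 \<le> A" unfolding A_B_M_def by (intro cmean_nonneg continuous_intros a) auto
  show ?thesis
  proof (cases "A = 0")
    case True
    have "M = 0"
    proof (rule ccontr)
      assume "M \<noteq> 0"
      \<comment> \<open>At this argument the form takes the value \<open>-1\<close>.\<close>
      then show False using q[of "(B + 1) / (2 * M)"] True by simp
    qed
    then show ?thesis using True A_B_M_def by simp
  next
    case False
    then have "A > 0" using A by simp
    have "0 \<le> ((M/A)\<^sup>2 * A - 2 * (M/A) * M + B) * A" using q[of "M/A"] A by simp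
    also have "\<dots> = A * B - M\<^sup>2" using \<open>A > 0\<close> by (simp add: field_simps power2_eq_square)
    finally show ?thesis unfolding A_B_M_def by simp
  qed
qed

lemma cmean_abs_mult_le:
  assumes "continuous_on circle F" "continuous_on circle u"
  shows "cmean (\<lambda>\<zeta>. cmod (F \<zeta>) * cmod (u \<zeta>)) \<le> sqrt (N2 F) * sqrt (N2 u)"
proof -
  have "(cmean (\<lambda>\<zeta>. cmod (F \<zeta>) * cmod (u \<zeta>)))\<^sup>2 \<le> N2 F * N2 u"
    unfolding N2_def by (intro cmean_Cauchy_Schwarz continuous_intros assms)
  then show ?thesis unfolding real_sqrt_mult[symmetric] by (rule real_le_rsqrt)
qed

lemma norm_ip_le:
  assumes "continuous_on circle F" "continuous_on circle u"
  shows "cmod (ip F u) \<le> sqrt (N2 F) * sqrt (N2 u)"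
proof -
  have "cmod (ip F u) \<le> cmean (\<lambda>\<zeta>. cmod (F \<zeta> * cnj (u \<zeta>)))"
    unfolding ip_def by (intro norm_cmean_le continuous_intros assms)
  then show ?thesis using cmean_abs_mult_le[OF assms] by (simp add: norm_mult)
qed

lemma cmean_norm_le:
  assumes "continuous_on circle u" shows "cmean (\<lambda>\<zeta>. cmod (u \<zeta>)) \<le> sqrt (N2 u)"
  using cmean_abs_mult_le[OF continuous_on_const[of _ 1] assms] by (simp add: N2_def cmean_const)

lemma N2_mult_le:
  assumes "continuous_on circle \<phi>" "continuous_on circle u" "\<And>\<zeta>. \<zeta> \<in> circle \<Longrightarrow> cmod (\<phi> \<zeta>) \<le> M"
  shows "N2 (\<lambda>z. \<phi> z * u z) \<le> M\<^sup>2 * N2 u"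
  unfolding N2_def cmean_mult_left[symmetric]
  by (intro cmean_mono continuous_intros assms) (use assms(3) in \<open>auto simp: norm_mult power_mult_distrib
      intro!: mult_right_mono power_mono\<close>)

lemma N2_scale: "N2 (\<lambda>z. c * u z) = (cmod c)\<^sup>2 * N2 u"
  unfolding N2_def cmean_mult_left[symmetric] by (simp add: norm_mult power_mult_distrib)

lemma ip_add_left: "continuous_on circle F \<Longrightarrow> continuous_on circle G \<Longrightarrow> continuous_on circle u \<Longrightarrow>
    ip (\<lambda>z. F z + G z) u = ip F u + ip G u"
  unfolding ip_def by (subst cmean_add[symmetric]) (auto intro!: continuous_intros simp: ring_distribs)

lemma ip_diff_left: "continuous_on circle F \<Longrightarrow> continuous_on circle G \<Longrightarrow> continuous_on circle u \<Longrightarrow>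
    ip (\<lambda>z. F z - G z) u = ip F u - ip G u"
  unfolding ip_def by (subst cmean_diff[symmetric]) (auto intro!: continuous_intros simp: ring_distribs)

lemma ip_diff_right: "continuous_on circle F \<Longrightarrow> continuous_on circle u \<Longrightarrow> continuous_on circle v \<Longrightarrow>
    ip F (\<lambda>z. u z - v z) = ip F u - ip F v"
  unfolding ip_def by (subst cmean_diff[symmetric]) (auto intro!: continuous_intros simp: ring_distribs)

lemma ip_scale_left: "ip (\<lambda>z. c * F z) u = c * ip F u"
  unfolding ip_def cmean_mult_left[symmetric] by (simp add: mult.assoc)

lemma ip_scale_right: "ip F (\<lambda>z. c * u z) = cnj c * ip F u"
  unfolding ip_def cmean_mult_left[symmetric] by (simp add: mult_ac)

lemma ip_sum_right:
  assumes "continuous_on circle F" "\<And>i. i \<in> I \<Longrightarrow> continuous_on circle (u i)"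
  shows "ip F (\<lambda>z. \<Sum>i\<in>I. u i z) = (\<Sum>i\<in>I. ip F (u i))"
  unfolding ip_def cnj_sum sum_distrib_left by (intro cmean_sum continuous_intros assms)

lemma ip_sum_left:
  assumes "continuous_on circle v" "\<And>i. i \<in> I \<Longrightarrow> continuous_on circle (u i)"
  shows "ip (\<lambda>z. \<Sum>i\<in>I. u i z) v = (\<Sum>i\<in>I. ip (u i) v)"
  unfolding ip_def sum_distrib_right by (intro cmean_sum continuous_intros assms)

lemma ip_commute: "continuous_on circle F \<Longrightarrow> continuous_on circle u \<Longrightarrow> ip u F = cnj (ip F u)"
  unfolding ip_def by (subst cmean_cnj[symmetric]) (auto intro!: continuous_intros simp: mult.commute)

text \<open>Combinations of Szego kernel vectors. Pairing with one evaluates at the points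
  \<open>x j\<close>, and its \<open>N2\<close> is the quadratic form of \<open>szego\<close>;
  through it, positivity of kernels becomes an inequality between forms on the disc algebra.\<close>

definition szego_comb :: "nat \<Rightarrow> (nat \<Rightarrow> complex) \<Rightarrow> (nat \<Rightarrow> complex) \<Rightarrow> complex \<Rightarrow> complex" where
  "szego_comb n x a z = (\<Sum>j<n. a j * (1 / (1 - z * cnj (x j))))"

lemma szego_comb_disc_algebra:
  assumes "\<And>i. i < n \<Longrightarrow> x i \<in> ball 0 1"
  shows "szego_comb n x a \<in> disc_algebra"
proof -
  have "1 - z * cnj (x j) \<noteq> 0" if "cmod z \<le> 1" "j < n" for z j
  proof
    assume "1 - z * cnj (x j) = 0"
    then have "cmod z * cmod (x j) = 1" by (metis complex_mod_cnj eq_iff_diff_eq_0 norm_mult norm_one)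
    moreover have "cmod z * cmod (x j) \<le> 1 * cmod (x j)" using that by (intro mult_right_mono) auto
    ultimately show False using assms[OF that(2)] by simp
  qed
  then have "(\<lambda>z. a j * (1 / (1 - z * cnj (x j)))) \<in> disc_algebra" if "j < n" for j
    unfolding disc_algebra_def using that by (auto intro!: continuous_intros holomorphic_intros)
  then show ?thesis unfolding szego_comb_def[abs_def] by (intro disc_algebra_sum) auto
qed

lemma ip_szego_comb:
  assumes "F \<in> disc_algebra" "\<And>i. i < n \<Longrightarrow> x i \<in> ball 0 1"
  shows "ip F (szego_comb n x a) = (\<Sum>i<n. cnj (a i) * F (x i))"
proof -
  have c: "szego_comb 1 (\<lambda>_. x j) (\<lambda>_. a j) \<in> disc_algebra" if "j < n" for j
    using assms(2) that by (intro szego_comb_disc_algebra) auto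
  have "ip F (szego_comb n x a) = (\<Sum>j<n. ip F (\<lambda>z. a j * (1 / (1 - z * cnj (x j)))))"
    unfolding szego_comb_def[abs_def]
    using c disc_algebra_continuous by (intro ip_sum_right disc_algebra_continuous assms) (fastforce simp:
        szego_comb_def[abs_def])
  also have "\<dots> = (\<Sum>j<n. cnj (a j) * F (x j))"
  proof (intro sum.cong refl)
    fix j assume "j \<in> {..<n}"
    then have "cmod (x j) < 1" using assms(2)[of j] by simp
    then show "ip F (\<lambda>z. a j * (1 / (1 - z * cnj (x j)))) = cnj (a j) * F (x j)"
      unfolding ip_scale_right using cmean_Cauchy[OF assms(1), of "x j"]
      by (simp add: ip_def mult.commute[of "cnj _"])
  qed
  finally show ?thesis .
qed

lemma N2_szego_comb:
  assumes "\<And>i. i < n \<Longrightarrow> x i \<in> ball 0 1"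
  shows "of_real (N2 (szego_comb n x a)) = (\<Sum>i<n. \<Sum>j<n. cnj (a i) * a j * szego (x i) (x j))"
  using ip_self[of "szego_comb n x a"] ip_szego_comb[of "szego_comb n x a" n x a]
    szego_comb_disc_algebra[of n x a] assms disc_algebra_continuous[of "szego_comb n x a"]
  by (simp add: szego_comb_def szego_def sum_distrib_left mult.assoc)

text \<open>\<open>v\<close> is the adjoint of multiplication by \<open>\<phi>\<close> applied to
  \<open>u\<close>. The reproducing property shows that \<open>N2 v\<close> is the pairing of
  \<open>\<phi> v\<close> with \<open>u\<close>, and Cauchy-Schwarz together with the bound on the
  circle gives \<open>N2 v \<le> N2 u\<close>, which is the claim.\<close>

lemma Pick_disc_algebra:
  assumes phi: "\<phi> \<in> disc_algebra" and le: "\<And>z. z \<in> circle \<Longrightarrow> cmod (\<phi> z) \<le> 1"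
  shows "pos_kernel (ball 0 1) (\<lambda>z w. (1 - \<phi> z * cnj (\<phi> w)) * szego z w)"
proof (rule pos_kernelI)
  fix n :: nat and x a assume x: "\<And>i. i < n \<Longrightarrow> x i \<in> ball (0::complex) 1"
  define u where "u = szego_comb n x a"
  define v where "v = szego_comb n x (\<lambda>j. a j * cnj (\<phi> (x j)))"
  have uA: "u \<in> disc_algebra" and vA: "v \<in> disc_algebra"
    unfolding u_def v_def using x by (auto intro: szego_comb_disc_algebra)
  note cont = disc_algebra_continuous[OF uA] disc_algebra_continuous[OF vA] disc_algebra_continuous[OF phi]
  have "complex_of_real (N2 v) = ip v v" using ip_self cont by simp
  also have "\<dots> = (\<Sum>i<n. cnj (a i) * (\<phi> (x i) * v (x i)))"
    unfolding v_def by (subst ip_szego_comb) (use x szego_comb_disc_algebra in \<open>auto simp: mult_ac\<close>)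
  also have "\<dots> = ip (\<lambda>z. \<phi> z * v z) u"
    unfolding u_def by (subst ip_szego_comb) (use x in \<open>auto intro!: disc_algebra_intros phi vA\<close>)
  finally have "N2 v = cmod (ip (\<lambda>z. \<phi> z * v z) u)"
    using N2_nonneg[OF cont(2)] by (metis abs_of_nonneg norm_of_real)
  also have "\<dots> \<le> sqrt (N2 (\<lambda>z. \<phi> z * v z)) * sqrt (N2 u)"
    by (intro norm_ip_le continuous_intros cont)
  also have "\<dots> \<le> sqrt (N2 v) * sqrt (N2 u)"
    using N2_mult_le[OF cont(3) cont(2) le] N2_nonneg cont by (intro mult_right_mono) auto
  finally have "N2 v \<le> sqrt (N2 v) * sqrt (N2 u)" .
  then have *: "sqrt (N2 v) * sqrt (N2 v) \<le> sqrt (N2 v) * sqrt (N2 u)"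
    using N2_nonneg[OF cont(2)] by simp
  have "N2 v \<le> N2 u"
  proof (cases "N2 v = 0")
    case True then show ?thesis using N2_nonneg[OF cont(1)] by simp
  next
    case False
    then have "0 < sqrt (N2 v)" using N2_nonneg[OF cont(2)] by simp
    then show ?thesis using mult_left_le_imp_le[OF *] by simp
  qed
  then have "0 \<le> complex_of_real (N2 u) - complex_of_real (N2 v)" by (simp add: complex_nonneg_iff)
  also have "\<dots> = (\<Sum>i<n. \<Sum>j<n. cnj (a i) * a j * ((1 - \<phi> (x i) * cnj (\<phi> (x j))) * szego (x i) (x j)))"
    unfolding u_def v_def
    by (subst (1 2) N2_szego_comb) (use x in \<open>auto simp: sum_subtractf[symmetric] algebra_simps\<close>)
  finally show "0 \<le> (\<Sum>i<n. \<Sum>j<n. cnj (a i) * a j * ((1 - \<phi> (x i) * cnj (\<phi> (x j))) * szego (x i) (x j)))" .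
qed

lemma disc_algebra_dilate:
  assumes "\<phi> holomorphic_on ball 0 1" "0 \<le> r" "r < 1"
  shows "(\<lambda>z. \<phi> (of_real r * z)) \<in> disc_algebra"
proof -
  have *: "(\<lambda>z. complex_of_real r * z) ` cball 0 1 \<subseteq> ball 0 1"
  proof safe
    fix z :: complex assume "z \<in> cball 0 1"
    then have "r * cmod z \<le> r * 1" using assms(2) by (intro mult_left_mono) auto
    then show "of_real r * z \<in> ball 0 1" using assms(2,3) by (simp add: norm_mult)
  qed
  have "continuous_on (cball 0 1) (\<lambda>z. \<phi> (of_real r * z))"
    by (rule continuous_on_compose2[OF holomorphic_on_imp_continuous_on[OF assms(1)] _ *]) (intro continuous_intros)
  moreover have "(\<lambda>z. \<phi> (of_real r * z)) holomorphic_on ball 0 1"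
  proof (rule holomorphic_on_compose_gen[of "\<lambda>z. of_real r * z" "ball 0 1" \<phi> "ball 0 1", unfolded o_def])
    show "(*) (complex_of_real r) ` ball 0 1 \<subseteq> ball 0 1" using * by (auto simp: image_subset_iff)
  qed (intro holomorphic_intros assms(1))+
  ultimately show ?thesis unfolding disc_algebra_def by blast
qed

lemma Pick_ball:
  assumes phi: "\<phi> holomorphic_on ball 0 1" and le: "\<And>z. z \<in> ball 0 1 \<Longrightarrow> cmod (\<phi> z) \<le> 1"
  shows "pos_kernel (ball 0 1) (\<lambda>z w. (1 - \<phi> z * cnj (\<phi> w)) * szego z w)"
proof (rule pos_kernel_limit)
  define r where "r n = 1 - 1 / real (Suc n)" for n
  have r: "0 \<le> r n" "r n < 1" for n by (auto simp: r_def)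
  have "r \<longlonglongrightarrow> 1 - 0" unfolding r_def by (intro tendsto_intros LIMSEQ_Suc[OF lim_1_over_n])
  then have rl: "(\<lambda>n. complex_of_real (r n) * z) \<longlonglongrightarrow> z" for z
    using tendsto_mult[OF tendsto_of_real tendsto_const[of z], of r 1 sequentially] by simp
  show "pos_kernel (ball 0 1) (\<lambda>z w. (1 - \<phi> (of_real (r n) * z) * cnj (\<phi> (of_real (r n) * w))) * szego z w)" for n
    by (rule Pick_disc_algebra[OF disc_algebra_dilate[OF phi r]], rule le) (use r[of n] in \<open>simp add: norm_mult\<close>)
  have pl: "(\<lambda>n. \<phi> (of_real (r n) * z)) \<longlonglongrightarrow> \<phi> z" if "z \<in> ball 0 1" for z
  proof -
    have "isCont \<phi> z" using phi that holomorphic_on_imp_continuous_on continuous_on_eq_continuous_at[OF open_ball] by blast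
    then show ?thesis using rl isCont_tendsto_compose by blast
  qed
  show "(\<lambda>n. (1 - \<phi> (of_real (r n) * z) * cnj (\<phi> (of_real (r n) * w))) * szego z w) \<longlonglongrightarrow> (1 - \<phi> z * cnj (\<phi> w)) * szego z w"
    if "z \<in> ball 0 1" "w \<in> ball 0 1" for z w
    by (intro tendsto_intros pl that)
qed

section \<open>Boundary behaviour of an embedding map\<close>

lemma embedding_mapD:
  assumes "embedding_map f V"
  shows "\<And>z. z \<in> ball 0 1 \<Longrightarrow> norm (f z) < 1" "\<forall>i. (\<lambda>z. f z $ i) holomorphic_on ball 0 1"
    "inj_on f (ball 0 1)" "\<And>z. z \<in> ball 0 1 \<Longrightarrow> \<exists>i. deriv (\<lambda>w. f w $ i) z \<noteq> 0"
    "V = f ` ball 0 1" "variety V" "C2_on_closed_disc f"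
    "\<And>z. z \<in> cball 0 1 \<Longrightarrow> norm (f z) = 1 \<longleftrightarrow> norm z = 1"
    "continuous_on (cball 0 1) f" "\<And>z. z \<in> cball 0 1 \<Longrightarrow> norm (f z) \<le> 1"
proof -
  show lt: "norm (f z) < 1" if "z \<in> ball 0 1" for z using assms that unfolding embedding_map_def image_subset_iff by auto
  show "C2_on_closed_disc f" using assms unfolding embedding_map_def by auto
  then show "continuous_on (cball 0 1) f"
    unfolding C2_on_closed_disc_def continuous_on_eq_continuous_within
    by (meson has_derivative_continuous)
  show eq: "norm (f z) = 1 \<longleftrightarrow> norm z = 1" if "z \<in> cball 0 1" for z
    using assms that unfolding embedding_map_def by auto
  show "norm (f z) \<le> 1" if "z \<in> cball 0 1" for z
    using eq[OF that] lt[of z] that by (cases "norm z = 1") auto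
qed (use assms in \<open>auto simp: embedding_map_def\<close>)

text \<open>The mean value inequality is applied to \<open>f - Df \<eta>\<close>, whose derivative
  along the segment is at most \<open>B * cmod (\<zeta> - \<eta>)\<close>. Complex linearity of
  \<open>Df\<close> comes from holomorphy inside the disc and from continuity on the circle; it
  makes the linear term a complex multiple of one vector \<open>d \<eta>\<close>.\<close>

lemma embedding_map_Taylor:
  fixes f :: "complex \<Rightarrow> complex^'n"
  assumes "embedding_map f V"
  obtains d B where "0 \<le> B" "continuous_on (cball 0 1) d"
    "\<And>\<zeta> \<eta>. \<zeta> \<in> cball 0 1 \<Longrightarrow> \<eta> \<in> cball 0 1 \<Longrightarrow>
       norm (f \<zeta> - f \<eta> - (\<zeta> - \<eta>) *s d \<eta>) \<le> B * (cmod (\<zeta> - \<eta>))\<^sup>2"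
proof -
  obtain Df :: "complex \<Rightarrow> (complex \<Rightarrow>\<^sub>L (complex^'n))" and D2f where
    Df: "\<And>x. x \<in> cball 0 1 \<Longrightarrow> (f has_derivative blinfun_apply (Df x)) (at x within cball 0 1)"
    and D2f: "\<And>x. x \<in> cball 0 1 \<Longrightarrow> (Df has_derivative blinfun_apply (D2f x)) (at x within cball 0 1)"
    and cont: "continuous_on (cball 0 1) D2f"
    using embedding_mapD(7)[OF assms] unfolding C2_on_closed_disc_def by blast
  have "bounded (D2f ` cball 0 1)" using cont by (intro compact_imp_bounded compact_continuous_image) auto
  then obtain B where B: "\<And>x. x \<in> cball 0 1 \<Longrightarrow> norm (D2f x) \<le> B" "0 < B"
    unfolding bounded_pos by blast
  have lip: "norm (Df x - Df y) \<le> B * norm (x - y)" if "x \<in> cball 0 1" "y \<in> cball 0 1" for x y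
    using B(1) that by (intro differentiable_bound[OF convex_cball D2f]) (auto simp: norm_blinfun.rep_eq)
  have Dc: "continuous_on (cball 0 1) Df"
    unfolding continuous_on_eq_continuous_within using D2f has_derivative_continuous by blast
  have expand: "norm (f \<zeta> - f \<eta> - blinfun_apply (Df \<eta>) (\<zeta> - \<eta>)) \<le> B * (cmod (\<zeta> - \<eta>))\<^sup>2"
    if z: "\<zeta> \<in> cball 0 1" and e: "\<eta> \<in> cball 0 1" for \<zeta> \<eta>
  proof -
    define g where "g x = f x - blinfun_apply (Df \<eta>) x" for x
    have sub: "closed_segment \<eta> \<zeta> \<subseteq> cball 0 1" using z e by (intro closed_segment_subset convex_cball) auto
    have "norm (g \<zeta> - g \<eta>) \<le> (B * norm (\<zeta> - \<eta>)) * norm (\<zeta> - \<eta>)"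
    proof (rule differentiable_bound[OF convex_closed_segment])
      fix x assume x: "x \<in> closed_segment \<eta> \<zeta>"
      have "(f has_derivative blinfun_apply (Df x)) (at x within closed_segment \<eta> \<zeta>)"
        using Df sub x by (meson has_derivative_subset subsetD)
      then show "(g has_derivative blinfun_apply (Df x - Df \<eta>)) (at x within closed_segment \<eta> \<zeta>)"
        unfolding g_def by (auto intro!: derivative_eq_intros simp: blinfun.diff_left)
      have "norm (Df x - Df \<eta>) \<le> B * norm (x - \<eta>)" using lip x sub e by blast
      also have "\<dots> \<le> B * norm (\<zeta> - \<eta>)"
        using B(2) segment_bound(1)[OF x] by (intro mult_left_mono) (auto simp: norm_minus_commute)
      finally show "onorm (blinfun_apply (Df x - Df \<eta>)) \<le> B * norm (\<zeta> - \<eta>)"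
        unfolding norm_blinfun.rep_eq .
    qed auto
    then show ?thesis by (simp add: g_def blinfun.diff_right power2_eq_square algebra_simps)
  qed
  define d where "d \<eta> = blinfun_apply (Df \<eta>) 1" for \<eta>
  have dc: "continuous_on (cball 0 1) d" unfolding d_def by (intro continuous_intros Dc)
  have lin: "blinfun_apply (Df \<eta>) v = v *s d \<eta>" if "\<eta> \<in> cball 0 1" for \<eta> v
  proof -
    have 0: "blinfun_apply (Df \<eta>) v - v *s d \<eta> = 0" if "\<eta> \<in> ball 0 1" for \<eta>
    proof -
      have "(f has_derivative blinfun_apply (Df \<eta>)) (at \<eta>)"
        using Df[of \<eta>] that at_within_interior[of \<eta> "cball 0 1"] by (simp add: interior_cball)
      have "blinfun_apply (Df \<eta>) v $ i = v * d \<eta> $ i" for i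
      proof -
        have 1: "((\<lambda>z. f z $ i) has_derivative (\<lambda>v. blinfun_apply (Df \<eta>) v $ i)) (at \<eta>)"
          by (rule bounded_linear.has_derivative[OF bounded_linear_vec_nth]) fact
        define D where "D = deriv (\<lambda>z. f z $ i) \<eta>"
        have "((\<lambda>z. f z $ i) has_field_derivative D) (at \<eta>)"
          unfolding D_def using embedding_mapD(2)[OF assms] that
          by (intro holomorphic_derivI[of _ "ball 0 1"]) auto
        then have "((\<lambda>z. f z $ i) has_derivative (\<lambda>v. D * v)) (at \<eta>)"
          by (simp add: has_field_derivative_def)
        then have "(\<lambda>v. blinfun_apply (Df \<eta>) v $ i) = (\<lambda>v. D * v)"
          using 1 has_derivative_unique by blast
        then show ?thesis unfolding d_def by (metis mult.commute mult.right_neutral)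
      qed
      then show ?thesis by (simp add: vec_eq_iff)
    qed
    have "continuous_on (closure (ball 0 1)) (\<lambda>\<eta>. blinfun_apply (Df \<eta>) v - v *s d \<eta>)"
      using Dc dc unfolding vector_scalar_mult_def
      by (auto intro!: continuous_intros)
    then have "blinfun_apply (Df \<eta>) v - v *s d \<eta> = 0"
      by (rule continuous_constant_on_closure) (use 0 that in auto)
    then show ?thesis by simp
  qed
  show ?thesis
    using that[of B d] B(2) dc expand lin by (metis less_imp_le)
qed

text \<open>The normal derivative \<open>l\<close> of \<open>f\<close> is the value at \<open>\<eta>\<close> of the quotient of \<open>1 - \<langle>f \<zeta>, f \<eta>\<rangle>\<close> by
  \<open>1 - \<zeta> cnj \<eta>\<close>. It is real because \<open>Re (1 - \<langle>f \<zeta>, f \<eta>\<rangle>) \<ge> 0\<close> along the circle on both sides of \<open>\<eta>\<close>.\<close>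
lemma real_of_tangential_bound:
  assumes "\<And>\<zeta>. cmod \<zeta> = 1 \<Longrightarrow> 0 \<le> Re ((1 - \<zeta>) * l) + M * (cmod (\<zeta> - 1))\<^sup>2"
  shows "Im l = 0"
proof -
  define C where "C = Re l + 2 * M"
  have main: "0 \<le> s * (s * C + Im l)" for s :: real
  proof -
    \<comment> \<open>The rational parametrisation
      \<open>\<zeta> = (1 + \<i> s)^2 / (1 + s^2)\<close> makes the hypothesis an inequality
      polynomial in \<open>s\<close>.\<close>
    define \<zeta> where "\<zeta> = Complex ((1 - s\<^sup>2) / (1 + s\<^sup>2)) (2 * s / (1 + s\<^sup>2))"
    have p: "0 < 1 + s\<^sup>2" by (simp add: add_pos_nonneg)
    have "(1 - s\<^sup>2)\<^sup>2 + (2 * s)\<^sup>2 = (1 + s\<^sup>2)\<^sup>2" by (simp add: power2_eq_square algebra_simps)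
    then have "((1 - s\<^sup>2) / (1 + s\<^sup>2))\<^sup>2 + (2 * s / (1 + s\<^sup>2))\<^sup>2 = 1"
      using p by (simp add: power_divide add_divide_distrib[symmetric])
    then have n: "cmod \<zeta> = 1" by (simp add: \<zeta>_def cmod_def)
    have re: "1 - Re \<zeta> = 2 * s\<^sup>2 / (1 + s\<^sup>2)" using p by (simp add: \<zeta>_def divide_simps)
    have "(cmod (\<zeta> - 1))\<^sup>2 = (cmod \<zeta>)\<^sup>2 + 1 - 2 * Re \<zeta>"
      unfolding cmod_power2 by (simp add: power2_eq_square algebra_simps)
    then have m: "(cmod (\<zeta> - 1))\<^sup>2 = 4 * s\<^sup>2 / (1 + s\<^sup>2)" using re n by simp
    have "Re ((1 - \<zeta>) * l) = (1 - Re \<zeta>) * Re l + Im \<zeta> * Im l" by simp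
    also have "\<dots> = (2 * s\<^sup>2 * Re l + 2 * s * Im l) / (1 + s\<^sup>2)" unfolding re by (simp add: \<zeta>_def add_divide_distrib)
    finally have "0 \<le> (2 * s\<^sup>2 * Re l + 2 * s * Im l) / (1 + s\<^sup>2) + M * (4 * s\<^sup>2 / (1 + s\<^sup>2))"
      using assms[OF n] m by simp
    also have "\<dots> = 2 * (s * (s * C + Im l)) / (1 + s\<^sup>2)"
      by (simp add: C_def add_divide_distrib[symmetric] power2_eq_square algebra_simps)
    finally show ?thesis using p by (simp add: zero_le_divide_iff)
  qed
  show ?thesis
  proof (rule ccontr)
    assume "Im l \<noteq> 0"
    \<comment> \<open>\<open>s\<close> has the sign opposite to \<open>Im l\<close> and is so small
      that \<open>s * C + Im l\<close> keeps the sign of \<open>Im l\<close>; the product is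
      negative.\<close>
    define s where "s = - Im l / (2 * (\<bar>C\<bar> + 1))"
    define D where "D = 2 * (\<bar>C\<bar> + 1)"
    have sD: "s * D = - Im l" unfolding s_def D_def by simp
    have "D * D * (s * (s * C + Im l)) = (s * D) * ((s * D) * C + D * Im l)" by (simp add: algebra_simps)
    also have "\<dots> = - (Im l)\<^sup>2 * (D - C)" unfolding sD by (simp add: power2_eq_square algebra_simps)
    finally have "D * D * (s * (s * C + Im l)) = - (Im l)\<^sup>2 * (D - C)" .
    moreover have "0 \<le> D * D * (s * (s * C + Im l))" using main[of s] by (intro mult_nonneg_nonneg[OF _ main]) simp
    moreover have "0 < (Im l)\<^sup>2 * (D - C)" using \<open>Im l \<noteq> 0\<close> unfolding D_def by (intro mult_pos_pos) auto
    ultimately show False by simp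
  qed
qed

text \<open>A quantitative Hopf lemma, read off from the Pick matrix at the points \<open>0\<close>
  and \<open>z\<close>. The constant loses one factor two to \<open>1 + cmod (q 0) \<le> 2\<close>
  and another to \<open>1 + cmod (q z) \<le> 2\<close>.\<close>

lemma Schwarz_Pick_origin:
  assumes "q holomorphic_on ball 0 1" "\<And>z. z \<in> ball 0 1 \<Longrightarrow> cmod (q z) \<le> 1"
    and "cmod (q 0) \<le> m" "m < 1" "cmod z < 1"
  shows "(1 - m) / 4 * (1 - cmod z) \<le> 1 - cmod (q z)"
proof -
  define k where "k z w = (1 - q z * cnj (q w)) * szego z w" for z w
  define x where "x i = (if i = (0::nat) then 0 else z)" for i
  have k00: "k 0 0 = of_real (1 - (cmod (q 0))\<^sup>2)"
    unfolding k_def szego_def complex_norm_square[symmetric] by simp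
  have p0: "0 < 1 - (cmod (q 0))\<^sup>2" using assms(3,4) by (simp add: power_less_one_iff)
  \<comment> \<open>This coefficient minimises the form and leaves the Schur complement of the entry
    at \<open>0\<close>.\<close>
  define a where "a i = (if i = (0::nat) then - k 0 z / k 0 0 else 1)" for i
  have k10: "k z 0 = cnj (k 0 z)" by (simp add: k_def szego_def mult.commute)
  have "0 \<le> (\<Sum>i<2. \<Sum>j<2. cnj (a i) * a j * k (x i) (x j))"
    unfolding k_def by (rule pos_kernelD[OF Pick_ball[OF assms(1,2)]]) (use assms(5) in \<open>auto simp: x_def\<close>)
  also have "\<dots> = k z z - k 0 z * cnj (k 0 z) / k 0 0"
  proof -
    have "cnj (k 0 0) = k 0 0" unfolding k00 by simp
    moreover have "k 0 0 \<noteq> 0" unfolding k00 of_real_eq_0_iff using p0 by simp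
    ultimately show ?thesis unfolding numeral_2_eq_2 by (simp add: a_def x_def k10 divide_simps)
  qed
  also have "\<dots> = of_real ((1 - (cmod (q z))\<^sup>2) / (1 - (cmod z)\<^sup>2) - (cmod (1 - q 0 * cnj (q z)))\<^sup>2 / (1 - (cmod (q 0))\<^sup>2))"
  proof -
    have "k z z = of_real ((1 - (cmod (q z))\<^sup>2) / (1 - (cmod z)\<^sup>2))"
      unfolding k_def szego_def complex_norm_square[symmetric] by simp
    moreover have "k 0 z = 1 - q 0 * cnj (q z)" by (simp add: k_def szego_def)
    ultimately show ?thesis unfolding k00 complex_norm_square[symmetric] by simp
  qed
  finally have A: "(cmod (1 - q 0 * cnj (q z)))\<^sup>2 / (1 - (cmod (q 0))\<^sup>2) \<le> (1 - (cmod (q z))\<^sup>2) / (1 - (cmod z)\<^sup>2)"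
    by (simp add: complex_nonneg_iff del: of_real_diff of_real_divide)
  have qz: "cmod (q z) \<le> 1" using assms(2,5) by simp
  have "cmod (q 0) * cmod (q z) \<le> cmod (q 0) * 1" by (intro mult_left_mono qz) simp
  then have "1 - cmod (q 0) \<le> cmod (1 - q 0 * cnj (q z))"
    using norm_triangle_ineq2[of 1 "q 0 * cnj (q z)"] by (simp add: norm_mult)
  then have "(1 - cmod (q 0))\<^sup>2 \<le> (cmod (1 - q 0 * cnj (q z)))\<^sup>2" using assms(3,4) by (intro power_mono) auto
  then have "(1 - cmod (q 0))\<^sup>2 / (1 - (cmod (q 0))\<^sup>2) \<le> (1 - (cmod (q z))\<^sup>2) / (1 - (cmod z)\<^sup>2)"
    using A p0 by (meson divide_right_mono less_imp_le order_trans)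
  also have "(1 - cmod (q 0))\<^sup>2 / (1 - (cmod (q 0))\<^sup>2) = (1 - cmod (q 0)) / (1 + cmod (q 0))"
  proof -
    have "1 - (cmod (q 0))\<^sup>2 = (1 - cmod (q 0)) * (1 + cmod (q 0))" by (simp add: power2_eq_square algebra_simps)
    then show ?thesis using assms(3,4) by (simp add: power2_eq_square)
  qed
  also have "(1 - m) / 2 \<le> (1 - cmod (q 0)) / (1 + cmod (q 0))"
    using assms(3,4) by (intro frac_le) (auto simp: add_pos_nonneg)
  finally have B: "(1 - m) / 2 \<le> (1 - (cmod (q z))\<^sup>2) / (1 - (cmod z)\<^sup>2)" by simp
  have z2: "0 < 1 - (cmod z)\<^sup>2" using assms(5) by (simp add: power_less_one_iff)
  have "(1 - m) / 2 * (1 - (cmod z)\<^sup>2) \<le> 1 - (cmod (q z))\<^sup>2" using B z2 by (simp add: pos_le_divide_eq)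
  moreover have "1 - (cmod (q z))\<^sup>2 \<le> 2 * (1 - cmod (q z))"
  proof -
    have "(1 - cmod (q z)) * (1 + cmod (q z)) \<le> (1 - cmod (q z)) * 2" using qz by (intro mult_left_mono) auto
    then show ?thesis by (simp add: power2_eq_square algebra_simps)
  qed
  moreover have "(1 - m) / 2 * (1 - cmod z) \<le> (1 - m) / 2 * (1 - (cmod z)\<^sup>2)"
    using assms(4,5) by (intro mult_left_mono) (auto simp: power2_eq_square mult_left_le)
  ultimately show ?thesis by simp
qed

text \<open>Up to the factor \<open>\<eta>\<close>, \<open>L \<eta>\<close> is the derivative of
  \<open>cinner (f \<zeta>) (f \<eta>)\<close> at \<open>\<zeta> = \<eta>\<close>. Its lower bound
  is uniform because \<open>cinner (f z) (f \<eta>)\<close> maps the disc into itself and has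
  modulus at most \<open>norm (f 0) < 1\<close> at the origin, so Schwarz-Pick applies along every
  radius with the same constant.\<close>

lemma boundary_expansion:
  fixes f :: "complex \<Rightarrow> complex^'n"
  assumes emb: "embedding_map f V"
  obtains l :: "complex \<Rightarrow> real" and c0 C0 M where "0 < c0" "0 \<le> M" "continuous_on circle l"
    "\<And>\<eta>. \<eta> \<in> circle \<Longrightarrow> c0 \<le> l \<eta>" "\<And>\<eta>. \<eta> \<in> circle \<Longrightarrow> l \<eta> \<le> C0"
    "\<And>\<zeta> \<eta>. \<zeta> \<in> cball 0 1 \<Longrightarrow> \<eta> \<in> circle \<Longrightarrow>
       cmod (1 - cinner (f \<zeta>) (f \<eta>) - of_real (l \<eta>) * (1 - \<zeta> * cnj \<eta>)) \<le> M * (cmod (\<zeta> - \<eta>))\<^sup>2"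
    "\<And>\<zeta> \<eta>. \<zeta> \<in> cball 0 1 \<Longrightarrow> \<eta> \<in> circle \<Longrightarrow> norm (f \<zeta> - f \<eta>) \<le> M * cmod (\<zeta> - \<eta>)"
proof -
  note E = embedding_mapD[OF emb]
  obtain B d where B: "0 \<le> B" and dc: "continuous_on (cball 0 1) d" and T:
    "\<And>\<zeta> \<eta>. \<zeta> \<in> cball 0 1 \<Longrightarrow> \<eta> \<in> cball 0 1 \<Longrightarrow>
       norm (f \<zeta> - f \<eta> - (\<zeta> - \<eta>) *s d \<eta>) \<le> B * (cmod (\<zeta> - \<eta>))\<^sup>2"
    using embedding_map_Taylor[OF emb] by metis
  define L where "L \<eta> = \<eta> * cinner (d \<eta>) (f \<eta>)" for \<eta>
  have Lc: "continuous_on circle L" unfolding L_def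
    by (intro continuous_intros continuous_on_subset[OF dc] continuous_on_subset[OF E(9)]) auto
  have fn: "norm (f \<eta>) = 1" if "\<eta> \<in> circle" for \<eta> using E(8)[of \<eta>] that by simp
  have fe: "cinner (f \<eta>) (f \<eta>) = 1" if "\<eta> \<in> circle" for \<eta> using fn[OF that] by (simp add: cinner_self)
  have nn: "\<eta> * cnj \<eta> = 1" if "\<eta> \<in> circle" for \<eta>
    using complex_norm_square[of \<eta>] that by simp
  have exp: "cmod (1 - cinner (f \<zeta>) (f \<eta>) - L \<eta> * (1 - \<zeta> * cnj \<eta>)) \<le> B * (cmod (\<zeta> - \<eta>))\<^sup>2"
    if z: "\<zeta> \<in> cball 0 1" and e: "\<eta> \<in> circle" for \<zeta> \<eta>
  proof -
    have "L \<eta> * (1 - \<zeta> * cnj \<eta>) = (\<eta> - \<zeta> * (\<eta> * cnj \<eta>)) * cinner (d \<eta>) (f \<eta>)"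
      by (simp add: L_def algebra_simps)
    then have LE: "L \<eta> * (1 - \<zeta> * cnj \<eta>) = (\<eta> - \<zeta>) * cinner (d \<eta>) (f \<eta>)" unfolding nn[OF e] by simp
    have "1 - cinner (f \<zeta>) (f \<eta>) - L \<eta> * (1 - \<zeta> * cnj \<eta>) = - cinner (f \<zeta> - f \<eta> - (\<zeta> - \<eta>) *s d \<eta>) (f \<eta>)"
      unfolding LE cinner_diff_left cinner_smult_left fe[OF e] by (simp add: left_diff_distrib)
    then have "cmod (1 - cinner (f \<zeta>) (f \<eta>) - L \<eta> * (1 - \<zeta> * cnj \<eta>)) \<le> norm (f \<zeta> - f \<eta> - (\<zeta> - \<eta>) *s d \<eta>) * norm (f \<eta>)"
      using norm_cinner_le by (metis norm_minus_cancel)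
    then show ?thesis using T[OF z, of \<eta>] fn[OF e] e by simp
  qed
  have im: "Im (L \<eta>) = 0" if e: "\<eta> \<in> circle" for \<eta>
  proof (rule real_of_tangential_bound[where M=B])
    fix \<zeta> :: complex assume z: "cmod \<zeta> = 1"
    have ze: "\<zeta> * \<eta> \<in> cball 0 1" using z e by (simp add: norm_mult)
    have "cmod (cinner (f (\<zeta> * \<eta>)) (f \<eta>)) \<le> 1 * 1"
      using norm_cinner_le[of "f (\<zeta> * \<eta>)" "f \<eta>"] E(10)[OF ze] fn[OF e] by simp
    then have "0 \<le> Re (1 - cinner (f (\<zeta> * \<eta>)) (f \<eta>))" using complex_Re_le_cmod[of "cinner (f (\<zeta> * \<eta>)) (f \<eta>)"] by simp
    moreover have "Re (1 - cinner (f (\<zeta> * \<eta>)) (f \<eta>)) \<le> Re (L \<eta> * (1 - \<zeta> * \<eta> * cnj \<eta>)) + B * (cmod (\<zeta> * \<eta> - \<eta>))\<^sup>2"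
      using exp[OF ze e] complex_Re_le_cmod[of "1 - cinner (f (\<zeta> * \<eta>)) (f \<eta>) - L \<eta> * (1 - \<zeta> * \<eta> * cnj \<eta>)"]
      unfolding minus_complex.sel by linarith
    moreover have e1: "\<zeta> * \<eta> * cnj \<eta> = \<zeta>" using nn[OF e] by (simp add: mult.assoc)
    have e2: "cmod (\<zeta> * \<eta> - \<eta>) = cmod (\<zeta> - 1)"
      using e norm_mult[of "\<zeta> - 1" \<eta>] by (simp add: algebra_simps)
    ultimately show "0 \<le> Re ((1 - \<zeta>) * L \<eta>) + B * (cmod (\<zeta> - 1))\<^sup>2"
      unfolding e1 e2 mult.commute[of "L \<eta>"] by linarith
  qed
  define m where "m = norm (f 0)"
  have m: "m < 1" using E(1)[of 0] by (simp add: m_def)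
  have lower: "(1 - m) / 4 \<le> Re (L \<eta>)" if e: "\<eta> \<in> circle" for \<eta>
  proof (rule field_le_epsilon)
    fix ep :: real assume ep: "0 < ep"
    define t where "t = min (1/2) (ep / (B + 1))"
    have t: "0 < t" "t < 1" "B * t \<le> ep"
    proof -
      show "0 < t" "t < 1" using ep B by (auto simp: t_def)
      have "B * t \<le> B * (ep / (B + 1))" unfolding t_def using B by (intro mult_left_mono) auto
      also have "\<dots> \<le> ep" using B ep by (simp add: divide_simps)
      finally show "B * t \<le> ep" .
    qed
    define \<zeta> where "\<zeta> = of_real (1 - t) * \<eta>"
    have cz: "cmod \<zeta> = 1 - t" using t e by (simp add: \<zeta>_def norm_mult del: of_real_diff)
    define q where "q z = cinner (f z) (f \<eta>)" for z
    have "(1 - m) / 4 * (1 - cmod \<zeta>) \<le> 1 - cmod (q \<zeta>)"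
    proof (rule Schwarz_Pick_origin)
      show "q holomorphic_on ball 0 1" unfolding q_def by (intro holomorphic_on_cinner E(2))
      show "cmod (q z) \<le> 1" if "z \<in> ball 0 1" for z
        unfolding q_def using norm_cinner_le[of "f z" "f \<eta>"] E(1)[OF that] fn[OF e] by simp
      show "cmod (q 0) \<le> m" unfolding q_def m_def using norm_cinner_le[of "f 0" "f \<eta>"] fn[OF e] by simp
    qed (use m cz t in auto)
    then have "(1 - m) / 4 * t \<le> Re (1 - q \<zeta>)"
      using complex_Re_le_cmod[of "q \<zeta>"] cz by simp
    also have "\<dots> \<le> Re (L \<eta> * (1 - \<zeta> * cnj \<eta>)) + B * (cmod (\<zeta> - \<eta>))\<^sup>2"
      using exp[OF _ e, of \<zeta>] complex_Re_le_cmod[of "1 - q \<zeta> - L \<eta> * (1 - \<zeta> * cnj \<eta>)"] cz t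
      unfolding minus_complex.sel q_def by simp
    also have "1 - \<zeta> * cnj \<eta> = of_real t"
      unfolding \<zeta>_def using nn[OF e] by (simp add: mult.assoc)
    also have "\<zeta> - \<eta> = of_real (- t) * \<eta>" by (simp add: \<zeta>_def algebra_simps)
    then have "cmod (\<zeta> - \<eta>) = t" using t e by (simp add: norm_mult del: of_real_minus)
    finally have "(1 - m) / 4 * t \<le> (Re (L \<eta>) + B * t) * t" by (simp add: power2_eq_square algebra_simps)
    then have "(1 - m) / 4 \<le> Re (L \<eta>) + B * t" using t by simp
    then show "(1 - m) / 4 \<le> Re (L \<eta>) + ep" using t by simp
  qed
  have bd: "bounded (L ` circle)" "bounded (d ` cball 0 1)"
    using Lc dc by (auto intro!: compact_imp_bounded compact_continuous_image)
  obtain C where C: "\<And>\<eta>. \<eta> \<in> circle \<Longrightarrow> cmod (L \<eta>) \<le> C"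
    using bd(1)[unfolded bounded_iff] by (metis imageI)
  obtain D where D: "\<And>\<eta>. \<eta> \<in> cball 0 1 \<Longrightarrow> norm (d \<eta>) \<le> D"
    using bd(2)[unfolded bounded_iff] by (metis imageI)
  have lip: "norm (f \<zeta> - f \<eta>) \<le> (D + 2 * B) * cmod (\<zeta> - \<eta>)" if z: "\<zeta> \<in> cball 0 1" and e: "\<eta> \<in> circle" for \<zeta> \<eta>
  proof -
    have "norm (f \<zeta> - f \<eta>) \<le> norm ((\<zeta> - \<eta>) *s d \<eta>) + norm (f \<zeta> - f \<eta> - (\<zeta> - \<eta>) *s d \<eta>)"
      by (metis add.commute diff_add_cancel norm_triangle_ineq)
    also have "\<dots> \<le> cmod (\<zeta> - \<eta>) * D + B * (cmod (\<zeta> - \<eta>))\<^sup>2"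
      unfolding norm_vec_smult using D[of \<eta>] e T[OF z, of \<eta>] by (intro add_mono mult_left_mono) auto
    also have "\<dots> = (D + B * cmod (\<zeta> - \<eta>)) * cmod (\<zeta> - \<eta>)" by (simp add: power2_eq_square algebra_simps)
    also have "\<dots> \<le> (D + B * 2) * cmod (\<zeta> - \<eta>)"
      using norm_triangle_ineq4[of \<zeta> \<eta>] z e B by (intro mult_right_mono add_left_mono mult_left_mono) auto
    finally show ?thesis by (simp add: mult.commute)
  qed
  define M where "M = max B (D + 2 * B)"
  have M: "B \<le> M" "D + 2 * B \<le> M" by (auto simp: M_def)
  show ?thesis
  proof (rule that[of "(1 - m) / 4" M "\<lambda>\<eta>. Re (L \<eta>)" C])
    show "Re (L \<eta>) \<le> C" if "\<eta> \<in> circle" for \<eta> using C[OF that] complex_Re_le_cmod[of "L \<eta>"] by simp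
    show "norm (f \<zeta> - f \<eta>) \<le> M * cmod (\<zeta> - \<eta>)" if "\<zeta> \<in> cball 0 1" "\<eta> \<in> circle" for \<zeta> \<eta>
      using lip[OF that] M(2) by (meson mult_right_mono norm_ge_zero order_trans)
    fix \<zeta> \<eta> :: complex assume z: "\<zeta> \<in> cball 0 1" and e: "\<eta> \<in> circle"
    have "of_real (Re (L \<eta>)) = L \<eta>" using im[OF e] by (simp add: complex_eq_iff)
    then show "cmod (1 - cinner (f \<zeta>) (f \<eta>) - of_real (Re (L \<eta>)) * (1 - \<zeta> * cnj \<eta>)) \<le> M * (cmod (\<zeta> - \<eta>))\<^sup>2"
      using exp[OF z e] M(1) by (simp only:) (meson mult_right_mono zero_le_power2 order_trans)
  qed (use m M B lower Lc in \<open>auto intro!: continuous_intros\<close>)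
qed

lemma cinner_eq_1_imp_eq:
  assumes "norm x = 1" "norm y = 1" "cinner x y = 1" shows "x = y"
proof -
  have "x \<bullet> y = 1" using assms(3) Re_cinner[of x y] by simp
  moreover have "(x - y) \<bullet> (x - y) = x \<bullet> x - 2 * (x \<bullet> y) + y \<bullet> y"
    by (simp add: inner_diff_left inner_diff_right inner_commute)
  ultimately have "(x - y) \<bullet> (x - y) = 0" using assms(1,2) by (simp add: dot_square_norm)
  then show ?thesis by simp
qed

text \<open>Near the diagonal the first-order term dominates the quadratic error. Away from it
  compactness gives a positive minimum, because equality in Cauchy-Schwarz would force
  \<open>f \<zeta> = f \<eta>\<close>. Injectivity up to the boundary enters the form estimates
  through this constant.\<close>

lemma boundary_separation:
  fixes f :: "complex \<Rightarrow> complex^'n"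
  assumes emb: "embedding_map f V" and inj: "inj_on f (cball 0 1)"
  obtains c where "0 < c" "\<And>\<zeta> \<eta>. \<zeta> \<in> circle \<Longrightarrow> \<eta> \<in> circle \<Longrightarrow> c * cmod (\<zeta> - \<eta>) \<le> cmod (1 - cinner (f \<zeta>) (f \<eta>))"
proof -
  note E = embedding_mapD[OF emb]
  obtain c0 M l C0 where c0: "0 < c0" and M: "0 \<le> M" and l: "continuous_on circle l"
    "\<And>\<eta>. \<eta> \<in> circle \<Longrightarrow> c0 \<le> l \<eta>" "\<And>\<eta>. \<eta> \<in> circle \<Longrightarrow> l \<eta> \<le> C0"
    and ex: "\<And>\<zeta> \<eta>. \<zeta> \<in> cball 0 1 \<Longrightarrow> \<eta> \<in> circle \<Longrightarrow>
       cmod (1 - cinner (f \<zeta>) (f \<eta>) - of_real (l \<eta>) * (1 - \<zeta> * cnj \<eta>)) \<le> M * (cmod (\<zeta> - \<eta>))\<^sup>2"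
    "\<And>\<zeta> \<eta>. \<zeta> \<in> cball 0 1 \<Longrightarrow> \<eta> \<in> circle \<Longrightarrow> norm (f \<zeta> - f \<eta>) \<le> M * cmod (\<zeta> - \<eta>)"
    using boundary_expansion[OF emb] by metis
  define \<delta> where "\<delta> = c0 / (2 * (M + 1))"
  have \<delta>: "0 < \<delta>" "M * \<delta> \<le> c0 / 2" using c0 M by (auto simp: \<delta>_def field_simps)
  have near: "c0 / 2 * cmod (\<zeta> - \<eta>) \<le> cmod (1 - cinner (f \<zeta>) (f \<eta>))"
    if z: "\<zeta> \<in> circle" and e: "\<eta> \<in> circle" and d: "cmod (\<zeta> - \<eta>) \<le> \<delta>" for \<zeta> \<eta>
  proof -
    have "1 - \<zeta> * cnj \<eta> = (\<eta> - \<zeta>) * cnj \<eta>"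
      using complex_norm_square[of \<eta>] e by (simp add: algebra_simps)
    then have "cmod (1 - \<zeta> * cnj \<eta>) = cmod (\<zeta> - \<eta>)" using e by (simp add: norm_mult norm_minus_commute)
    then have "c0 * cmod (\<zeta> - \<eta>) \<le> cmod (of_real (l \<eta>) * (1 - \<zeta> * cnj \<eta>))"
      using l(2)[OF e] c0 by (simp add: norm_mult mult_right_mono)
    also have "\<dots> \<le> cmod (1 - cinner (f \<zeta>) (f \<eta>)) + M * (cmod (\<zeta> - \<eta>))\<^sup>2"
      using ex[OF _ e, of \<zeta>] z norm_triangle_ineq2[of "of_real (l \<eta>) * (1 - \<zeta> * cnj \<eta>)" "1 - cinner (f \<zeta>) (f \<eta>)"]
      by (simp add: norm_minus_commute)
    also have "M * (cmod (\<zeta> - \<eta>))\<^sup>2 \<le> c0 / 2 * cmod (\<zeta> - \<eta>)"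
    proof -
      have "M * cmod (\<zeta> - \<eta>) \<le> c0 / 2" using mult_left_mono[OF d M] \<delta>(2) by simp
      then show ?thesis unfolding power2_eq_square mult.assoc[symmetric] by (intro mult_right_mono) auto
    qed
    finally show ?thesis by simp
  qed
  define S where "S = {p \<in> circle \<times> circle. \<delta> \<le> cmod (fst p - snd p)}"
  have "closed {p :: complex \<times> complex. \<delta> \<le> cmod (fst p - snd p)}"
    by (intro closed_Collect_le continuous_intros)
  moreover have "S = (circle \<times> circle) \<inter> {p. \<delta> \<le> cmod (fst p - snd p)}" unfolding S_def by auto
  ultimately have S: "compact S" by (auto intro!: compact_Int_closed compact_Times)
  have fc: "continuous_on circle f" using E(9) by (rule continuous_on_subset) auto
  have Fc: "continuous_on S (\<lambda>p. cmod (1 - cinner (f (fst p)) (f (snd p))))"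
    by (intro continuous_intros continuous_on_compose2[OF fc]) (auto simp: S_def)
  obtain e where e: "0 < e" "\<And>p. p \<in> S \<Longrightarrow> e \<le> cmod (1 - cinner (f (fst p)) (f (snd p)))"
  proof (cases "S = {}")
    case True then show ?thesis using that[of 1] by simp
  next
    case False
    then obtain p where p: "p \<in> S" "\<forall>q\<in>S. cmod (1 - cinner (f (fst p)) (f (snd p))) \<le> cmod (1 -
        cinner (f (fst q)) (f (snd q)))"
      using continuous_attains_inf[OF S False Fc] by blast
    have "1 - cinner (f (fst p)) (f (snd p)) \<noteq> 0"
    proof
      assume "1 - cinner (f (fst p)) (f (snd p)) = 0"
      then have "f (fst p) = f (snd p)"
        using p(1) E(8)[of "fst p"] E(8)[of "snd p"] by (intro cinner_eq_1_imp_eq) (auto simp: S_def)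
      then have "fst p = snd p" using inj p(1) unfolding S_def inj_on_def by auto
      then show False using p(1) \<delta>(1) by (simp add: S_def)
    qed
    then show ?thesis using that[of "cmod (1 - cinner (f (fst p)) (f (snd p)))"] p(2) by auto
  qed
  \<comment> \<open>Points of the circle are at distance at most 2, hence the bound
    \<open>e/2\<close>.\<close>
  define c where "c = min (c0/2) (e/2)"
  have "c * cmod (\<zeta> - \<eta>) \<le> cmod (1 - cinner (f \<zeta>) (f \<eta>))" if z: "\<zeta> \<in> circle" and h: "\<eta> \<in> circle" for \<zeta> \<eta>
  proof (cases "cmod (\<zeta> - \<eta>) \<le> \<delta>")
    case True
    have "c * cmod (\<zeta> - \<eta>) \<le> c0/2 * cmod (\<zeta> - \<eta>)" by (intro mult_right_mono) (auto simp: c_def)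
    then show ?thesis using near[OF z h True] by simp
  next
    case False
    have "cmod (\<zeta> - \<eta>) \<le> 2" using norm_triangle_ineq4[of \<zeta> \<eta>] z h by simp
    then have "c * cmod (\<zeta> - \<eta>) \<le> e/2 * 2" using e(1) c0 by (intro mult_mono) (auto simp: c_def)
    then show ?thesis using e(2)[of "(\<zeta>, \<eta>)"] False z h by (simp add: S_def)
  qed
  then show ?thesis using that[of c] c0 e(1) by (simp add: c_def)
qed

text \<open>If \<open>g \<zeta> = g \<eta>\<close> at two boundary points, radial sequences towards \<open>\<zeta>\<close> and \<open>\<eta>\<close>, run at speeds
  inversely proportional to the normal derivatives, are so close in the ball that every function in the
  space has bounded differences along them. Applied to the unbounded function
  \<open>Ln (1 - \<langle>g z, g \<zeta>\<rangle>)\<close> and to its product with \<open>z\<close>, this is absurd.\<close>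
lemma inj_on_of_identity_multiplier:
  fixes g :: "complex \<Rightarrow> complex^'n"
  assumes emb: "embedding_map g W" and id: "(\<lambda>z. indicator (ball 0 1) z * z) \<in> Mult_f g"
  shows "inj_on g (cball 0 1)"
proof (rule inj_onI)
  fix \<zeta> \<eta> assume ze: "\<zeta> \<in> cball 0 1" "\<eta> \<in> cball 0 1" and geq: "g \<zeta> = g \<eta>"
  note E = embedding_mapD[OF emb]
  show "\<zeta> = \<eta>"
  proof (cases "norm \<zeta> = 1 \<and> norm \<eta> = 1")
    case False
    then have "\<zeta> \<in> ball 0 1" "\<eta> \<in> ball 0 1" using E(8)[OF ze(1)] E(8)[OF ze(2)] geq ze by auto
    then show ?thesis using E(3) geq by (auto dest: inj_onD)
  next
    case True
    then have circle: "\<zeta> \<in> circle" "\<eta> \<in> circle" by auto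
    define p where "p = g \<zeta>"
    have p: "norm p = 1" using E(8)[OF ze(1)] True by (simp add: p_def)
    have pp: "cinner p p = 1" using p by (simp add: cinner_self)
    obtain c0 M l C0 where c0: "0 < c0" and M: "0 \<le> M" and l: "continuous_on circle l"
      "\<And>\<eta>. \<eta> \<in> circle \<Longrightarrow> c0 \<le> l \<eta>" "\<And>\<eta>. \<eta> \<in> circle \<Longrightarrow> l \<eta> \<le> C0"
      and ex: "\<And>\<zeta> \<eta>. \<zeta> \<in> cball 0 1 \<Longrightarrow> \<eta> \<in> circle \<Longrightarrow>
         cmod (1 - cinner (g \<zeta>) (g \<eta>) - of_real (l \<eta>) * (1 - \<zeta> * cnj \<eta>)) \<le> M * (cmod (\<zeta> - \<eta>))\<^sup>2"
      and lip: "\<And>\<zeta> \<eta>. \<zeta> \<in> cball 0 1 \<Longrightarrow> \<eta> \<in> circle \<Longrightarrow> norm (g \<zeta> - g \<eta>) \<le> M * cmod (\<zeta> - \<eta>)"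
      using boundary_expansion[OF emb] by metis
    \<comment> \<open>Dividing by \<open>l a\<close> makes the approach to the sphere independent of
      \<open>a\<close>: \<open>1 - cinner (g (pt a t)) p\<close> is \<open>t\<close> up to order
      \<open>t^2\<close> at both boundary points.\<close>
    define pt where "pt a t = of_real (1 - t / l a) * a" for a :: complex and t :: real
    \<comment> \<open>\<open>k * t^2\<close> bounds the second-order terms of
      \<open>1 - cinner x y\<close> for two such points: twice the error at one point plus the
      product of the distances to \<open>p\<close>. The choice of \<open>t0\<close> then makes it at
      most \<open>t\<close>.\<close>
    define k where "k = 2 * (M / c0\<^sup>2) + M\<^sup>2 / c0\<^sup>2"
    have k: "0 \<le> k" using M by (simp add: k_def)
    define t0 where "t0 = min (c0/2) (1 / (k + 1))"
    have t0: "0 < t0" "t0 < c0" "k * t0 \<le> 1"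
    proof -
      have "k * t0 \<le> k * (1 / (k + 1))" unfolding t0_def using k by (intro mult_left_mono) auto
      also have "\<dots> \<le> 1" using k by (simp add: divide_simps)
      finally show "k * t0 \<le> 1" .
    qed (use c0 k in \<open>auto simp: t0_def\<close>)
    have P: "pt a t \<in> ball 0 1" "cmod (pt a t - a) \<le> t / c0"
        "cmod (1 - cinner (g (pt a t)) p - of_real t) \<le> M / c0\<^sup>2 * t\<^sup>2" "norm (g (pt a t) - p) \<le> M / c0 * t"
      if a: "a \<in> {\<zeta>, \<eta>}" and t: "0 < t" "t < t0" for a t
    proof -
      have ac: "a \<in> circle" and ga: "g a = p" using a circle geq by (auto simp: p_def)
      have la: "0 < l a" "t / l a \<le> t / c0" "0 < t / l a" using l(2)[OF ac] c0 t by (auto intro!: divide_left_mono)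
      have "t / c0 < 1" using t t0 c0 by simp
      then have "t / l a < 1" using la(2) by (rule le_less_trans[rotated])
      then have "cmod (pt a t) = 1 - t / l a" using ac by (simp add: pt_def norm_mult del: of_real_diff of_real_divide)
      then show b: "pt a t \<in> ball 0 1" using la by simp
      have "pt a t - a = of_real (- (t / l a)) * a" by (simp add: pt_def algebra_simps)
      then show d: "cmod (pt a t - a) \<le> t / c0"
        using ac la by (simp add: norm_mult del: of_real_minus of_real_divide)
      have "a * cnj a = 1" using complex_norm_square[of a] ac by simp
      then have "1 - pt a t * cnj a = of_real (t / l a)" by (simp add: pt_def mult.assoc)
      then have "complex_of_real (l a) * (1 - pt a t * cnj a) = of_real t" using la by simp
      then have "cmod (1 - cinner (g (pt a t)) p - of_real t) \<le> M * (cmod (pt a t - a))\<^sup>2"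
        using ex[of "pt a t" a] b ac ga by (simp add: less_imp_le)
      also have "\<dots> \<le> M * (t / c0)\<^sup>2" using d M by (intro mult_left_mono power_mono) auto
      finally show "cmod (1 - cinner (g (pt a t)) p - of_real t) \<le> M / c0\<^sup>2 * t\<^sup>2" by (simp add: power_divide)
      have "norm (g (pt a t) - p) \<le> M * cmod (pt a t - a)" using lip[of "pt a t" a] b ac ga by (simp add: less_imp_le)
      also have "\<dots> \<le> M * (t / c0)" using d M by (intro mult_left_mono) auto
      finally show "norm (g (pt a t) - p) \<le> M / c0 * t" by simp
    qed
    \<comment> \<open>All four kernel values are \<open>1 / (2 * t)\<close> up to a bounded error.
      The coefficients of the difference functional sum to zero, so its norm stays bounded although
      the kernel blows up.\<close>
    have K: "cmod (kernel_f g (pt a t) (pt b t) - of_real (1 / (2 * t))) \<le> k / 2"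
      if a: "a \<in> {\<zeta>, \<eta>}" and b: "b \<in> {\<zeta>, \<eta>}" and t: "0 < t" "t < t0" for a b t
    proof -
      define x y where "x = g (pt a t)" and "y = g (pt b t)"
      define X where "X = 1 - cinner x y"
      have "X - 2 * of_real t = (1 - cinner x p - of_real t) + cnj (1 - cinner y p - of_real t) - cinner (x - p) (y - p)"
        unfolding X_def by (simp add: cinner_diff_left cinner_diff_right pp cnj_cinner)
      also have "cmod \<dots> \<le> cmod (1 - cinner x p - of_real t) + cmod (1 - cinner y p - of_real t) +
          cmod (cinner (x - p) (y - p))"
        by (rule order_trans[OF norm_triangle_ineq4 add_right_mono[OF order_trans[OF norm_triangle_ineq]]])
           (simp only: complex_mod_cnj order_refl)
      also have "\<dots> \<le> M / c0\<^sup>2 * t\<^sup>2 + M / c0\<^sup>2 * t\<^sup>2 + (M / c0 * t) * (M / c0 * t)"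
        unfolding x_def y_def using P(3)[OF a t] P(3)[OF b t] P(4)[OF a t] P(4)[OF b t] M c0 t
        by (intro add_mono order_trans[OF norm_cinner_le mult_mono]) auto
      also have "\<dots> = k * t\<^sup>2" by (simp add: k_def power2_eq_square algebra_simps)
      finally have X2: "cmod (X - 2 * of_real t) \<le> k * t\<^sup>2" .
      have "k * t\<^sup>2 \<le> t"
      proof -
        have "k * t \<le> 1" using mult_left_mono[of t t0 k] t t0 k by simp
        then have "(k * t) * t \<le> 1 * t" using t by (intro mult_right_mono) auto
        then show ?thesis by (simp add: power2_eq_square)
      qed
      moreover have "2 * t - cmod X \<le> cmod (X - 2 * of_real t)"
        using norm_triangle_ineq2[of "2 * of_real t" X] t by (simp add: norm_mult norm_minus_commute)
      ultimately have Xt: "t \<le> cmod X" using X2 by linarith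
      then have "X \<noteq> 0" using t by auto
      then have "kernel_f g (pt a t) (pt b t) - of_real (1 / (2 * t)) = (2 * of_real t - X) / (of_real (2 * t) * X)"
        using t unfolding kernel_f_def x_def[symmetric] y_def[symmetric] X_def[symmetric] by (simp add: field_simps)
      then have "cmod (kernel_f g (pt a t) (pt b t) - of_real (1 / (2 * t))) = cmod (X - 2 * of_real t) / (2 * t * cmod X)"
        using t by (simp add: norm_divide norm_mult norm_minus_commute)
      also have "\<dots> \<le> (k * t\<^sup>2) / (2 * t * t)"
        using X2 Xt t k by (intro frac_le mult_left_mono) auto
      also have "\<dots> = k / 2" using t by (simp add: power2_eq_square)
      finally show ?thesis .
    qed
    have bdd: "\<exists>B. \<forall>t. 0 < t \<longrightarrow> t < t0 \<longrightarrow> cmod (u (pt \<zeta> t) - u (pt \<eta> t)) \<le> B" if u: "u \<in> rkhs (ball 0 1) (kernel_f g)" for u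
    proof -
      obtain c where c: "pos_kernel (ball 0 1) (\<lambda>z w. complex_of_real (c\<^sup>2) * kernel_f g z w - u z * cnj (u w))"
        using u unfolding rkhs_def by blast
      have "cmod (u (pt \<zeta> t) - u (pt \<eta> t)) \<le> sqrt (c\<^sup>2 * (2 * k))" if t: "0 < t" "t < t0" for t
      proof -
        define x a where "x i = (if i = 0 then pt \<zeta> t else pt \<eta> t)"
            and "a i = (if i = 0 then 1 else - 1 :: complex)" for i :: nat
        define D where "D z w = kernel_f g z w - of_real (1 / (2 * t))" for z w
        have "u (pt \<zeta> t) - u (pt \<eta> t) = (\<Sum>i<2. cnj (a i) * u (x i))"
          by (simp add: numeral_2_eq_2 a_def x_def)
        then have "(cmod (u (pt \<zeta> t) - u (pt \<eta> t)))\<^sup>2 \<le> c\<^sup>2 * Re (\<Sum>i<2. \<Sum>j<2. cnj (a i) * a j * kernel_f g (x i) (x j))"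
          by (simp only:) (rule rkhs_bound[OF c], use P(1) t in \<open>auto simp: x_def\<close>)
        also have "(\<Sum>i<2. \<Sum>j<2. cnj (a i) * a j * kernel_f g (x i) (x j)) =
           D (pt \<zeta> t) (pt \<zeta> t) - D (pt \<zeta> t) (pt \<eta> t) - D (pt \<eta> t) (pt \<zeta> t) + D (pt \<eta> t) (pt \<eta> t)"
          by (simp add: numeral_2_eq_2 a_def x_def D_def)
        also have "Re \<dots> \<le> k/2 + k/2 + k/2 + k/2"
          using K[of \<zeta> \<zeta> t] K[of \<zeta> \<eta> t] K[of \<eta> \<zeta> t] K[of \<eta> \<eta> t] t
            abs_Re_le_cmod[of "D (pt \<zeta> t) (pt \<zeta> t)"] abs_Re_le_cmod[of "D (pt \<zeta> t) (pt \<eta> t)"]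
            abs_Re_le_cmod[of "D (pt \<eta> t) (pt \<zeta> t)"] abs_Re_le_cmod[of "D (pt \<eta> t) (pt \<eta> t)"]
          unfolding D_def[symmetric] plus_complex.sel minus_complex.sel by simp
        finally have "(cmod (u (pt \<zeta> t) - u (pt \<eta> t)))\<^sup>2 \<le> c\<^sup>2 * (2 * k)" by (simp add: mult_left_mono)
        then show ?thesis by (rule real_le_rsqrt)
      qed
      then show ?thesis by blast
    qed
    define h where "h z = indicator (ball 0 1) z * Ln (1 - cinner (g z) p)" for z
    have h: "h \<in> rkhs (ball 0 1) (kernel_f g)" unfolding h_def by (rule Ln_in_rkhs[OF E(1) p])
    obtain B where B: "\<And>t. 0 < t \<Longrightarrow> t < t0 \<Longrightarrow> cmod (h (pt \<zeta> t) - h (pt \<eta> t)) \<le> B" using bdd[OF h] by blast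
    have "(\<lambda>z. indicator (ball 0 1) z * z * h z) \<in> rkhs (ball 0 1) (kernel_f g)"
      using id h unfolding Mult_f_def multipliers_def by blast
    then obtain B' where B': "\<And>t. 0 < t \<Longrightarrow> t < t0 \<Longrightarrow> cmod (pt \<zeta> t * h (pt \<zeta> t) - pt \<eta> t * h (pt \<eta> t)) \<le> B'"
      using bdd[of "\<lambda>z. indicator (ball 0 1) z * z * h z"] P(1) by auto
    show "\<zeta> = \<eta>"
    proof (rule ccontr)
      assume "\<zeta> \<noteq> \<eta>"
      define \<delta> where "\<delta> = cmod (\<zeta> - \<eta>)"
      have \<delta>: "0 < \<delta>" using \<open>\<zeta> \<noteq> \<eta>\<close> by (simp add: \<delta>_def)
      \<comment> \<open>\<open>cmod (h z) \<ge> N\<close> is incompatible with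
        \<open>\<delta> / 2 * cmod (h z) \<le> B + B'\<close>. The choice of \<open>t\<close> keeps
        the two points at least \<open>\<delta> / 2\<close> apart and makes the logarithm at least
        \<open>N\<close> in modulus.\<close>
      define N where "N = 2 * (B + B' + 1) / \<delta>"
      define t where "t = min (t0/2) (min (\<delta> * c0 / 4) (exp (- N) / 2))"
      have t: "0 < t" "t < t0" "t / c0 \<le> \<delta> / 4" "2 * t \<le> exp (- N)"
        using t0 \<delta> c0 by (auto simp: t_def min_def field_simps)
      define z w where "z = pt \<zeta> t" and "w = pt \<eta> t"
      have "\<delta> \<le> cmod (\<zeta> - z) + cmod (z - w) + cmod (w - \<eta>)"
        unfolding \<delta>_def using norm_triangle_ineq[of "\<zeta> - z" "z - w"] norm_triangle_ineq[of "\<zeta> - w" "w - \<eta>"] by simp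
      then have zw: "\<delta> / 2 \<le> cmod (z - w)"
        using P(2)[OF insertI1 t(1,2)] P(2)[OF insertI2[OF singletonI] t(1,2)] t(3)
        unfolding z_def w_def norm_minus_commute[of \<zeta>] by linarith
      have "(z - w) * h z = (z * h z - w * h w) - w * (h z - h w)" by (simp add: algebra_simps)
      then have "cmod (z - w) * cmod (h z) \<le> cmod (z * h z - w * h w) + cmod w * cmod (h z - h w)"
        by (metis norm_mult norm_triangle_ineq4)
      also have "\<dots> \<le> B' + 1 * B"
        using B[OF t(1,2)] B'[OF t(1,2)] P(1)[of \<eta> t] t unfolding z_def w_def
        by (intro add_mono mult_mono) auto
      finally have "cmod (z - w) * cmod (h z) \<le> B + B'" by simp
      then have up: "\<delta> / 2 * cmod (h z) \<le> B + B'" using mult_right_mono[OF zw norm_ge_zero[of "h z"]] by linarith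
      have zb: "z \<in> ball 0 1" using P(1)[of \<zeta> t] t by (simp add: z_def)
      define X where "X = 1 - cinner (g z) p"
      have "X \<noteq> 0" using norm_cinner_less_1[of "g z" p] E(1)[OF zb] p unfolding X_def by auto
      have "cmod (X - of_real t) \<le> M / c0\<^sup>2 * t\<^sup>2" using P(3)[of \<zeta> t] t by (simp add: X_def z_def)
      also have "\<dots> \<le> t"
      proof -
        have "0 \<le> M / c0\<^sup>2" "0 \<le> M\<^sup>2 / c0\<^sup>2" using M by auto
        then have "M / c0\<^sup>2 \<le> k" unfolding k_def by linarith
        then have "M / c0\<^sup>2 * t \<le> k * t0" using t k by (intro mult_mono) auto
        then have "M / c0\<^sup>2 * t \<le> 1" using t0(3) by (rule order_trans)
        then have "(M / c0\<^sup>2 * t) * t \<le> 1 * t" using t by (intro mult_right_mono) auto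
        then show ?thesis by (simp add: power2_eq_square)
      qed
      finally have "cmod X \<le> 2 * t" using norm_triangle_ineq2[of X "of_real t"] t by simp
      then have "cmod X \<le> exp (- N)" using t by simp
      then have "ln (cmod X) \<le> - N" using \<open>X \<noteq> 0\<close> by (metis ln_exp ln_mono zero_less_norm_iff)
      then have "N \<le> cmod (Ln X)"
        using abs_Re_le_cmod[of "Ln X"] Re_Ln[OF \<open>X \<noteq> 0\<close>] by linarith
      then have "\<delta> / 2 * N \<le> \<delta> / 2 * cmod (h z)"
        using zb \<delta> by (intro mult_left_mono) (auto simp: h_def X_def)
      then show False using up \<delta> by (simp add: N_def)
    qed
  qed
qed

section \<open>Quadratic forms on the torus\<close>

lemma cmean_continuous_param:
  fixes F :: "'a::topological_space \<Rightarrow> complex \<Rightarrow> 'b::banach"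
  assumes "continuous_on (U \<times> circle) (\<lambda>(x, \<zeta>). F x \<zeta>)"
  shows "continuous_on U (\<lambda>x. cmean (F x))"
proof -
  have "continuous_on (U \<times> cbox 0 1) (\<lambda>p. (\<lambda>(x, \<zeta>). F x \<zeta>) (fst p, circ (snd p)))"
    by (rule continuous_on_compose2[OF assms])
       (auto intro!: continuous_intros continuous_on_circ_compose[of id, unfolded id_def]
           continuous_on_compose2[OF continuous_on_circ])
  then have "continuous_on (U \<times> cbox 0 1) (\<lambda>(x, t). F x (circ t))" by (simp add: case_prod_beta)
  from integral_continuous_on_param[OF this] show ?thesis by (simp add: cmean_def)
qed

lemma cmean_swap:
  fixes F :: "complex \<Rightarrow> complex \<Rightarrow> 'b::banach"
  assumes "continuous_on (circle \<times> circle) (\<lambda>(x, y). F x y)"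
  shows "cmean (\<lambda>x. cmean (\<lambda>y. F x y)) = cmean (\<lambda>y. cmean (\<lambda>x. F x y))"
proof -
  have "continuous_on (cbox (0,0) (1,1)) (\<lambda>p. (\<lambda>(x, y). F x y) (circ (fst p), circ (snd p)))"
    by (rule continuous_on_compose2[OF assms])
       (auto intro!: continuous_intros continuous_on_compose2[OF continuous_on_circ])
  then have "continuous_on (cbox (0,0) (1,1)) (\<lambda>(s, t). F (circ s) (circ t))" by (simp add: case_prod_beta)
  from integral_swap_continuous[OF this] show ?thesis by (simp add: cmean_def)
qed

lemma circle_slice_continuous:
  assumes "continuous_on (circle \<times> circle) (\<lambda>(x, y). F x y)" "y \<in> circle"
  shows "continuous_on circle (\<lambda>x. F x y)" "continuous_on circle (\<lambda>x. F y x)"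
proof -
  have "continuous_on circle (\<lambda>x. (\<lambda>(x, y). F x y) (x, y))"
    by (rule continuous_on_compose2[OF assms(1)]) (use assms(2) in \<open>auto intro!: continuous_intros\<close>)
  then show "continuous_on circle (\<lambda>x. F x y)" by simp
  have "continuous_on circle (\<lambda>x. (\<lambda>(x, y). F x y) (y, x))"
    by (rule continuous_on_compose2[OF assms(1)]) (use assms(2) in \<open>auto intro!: continuous_intros\<close>)
  then show "continuous_on circle (\<lambda>x. F y x)" by simp
qed

lemma continuous_on_circle_swap:
  assumes "continuous_on (circle \<times> circle) (\<lambda>(x, y). F x y)"
  shows "continuous_on (circle \<times> circle) (\<lambda>(x, y). F y x)"
proof -
  have "continuous_on (circle \<times> circle) (\<lambda>p. (\<lambda>(x, y). F x y) (snd p, fst p))"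
    by (rule continuous_on_compose2[OF assms]) (auto intro!: continuous_intros)
  then show ?thesis by (simp add: case_prod_beta)
qed

lemma continuous_on_circle_square:
  assumes "continuous_on circle u"
  shows "continuous_on (circle \<times> circle) (\<lambda>p. u (fst p))" "continuous_on (circle \<times> circle) (\<lambda>p. u (snd p))"
  by (auto intro!: continuous_intros continuous_on_compose2[OF assms])

text \<open>The inner mean runs over \<open>\<zeta>\<close> against \<open>cnj (u \<zeta>)\<close>,
  so that for kernels of Cauchy type it is evaluated by \<open>cmean_Cauchy\<close>.\<close>

definition dform :: "(complex \<Rightarrow> complex \<Rightarrow> complex) \<Rightarrow> (complex \<Rightarrow> complex) \<Rightarrow> complex" where
  "dform G u = cmean (\<lambda>\<eta>. u \<eta> * cmean (\<lambda>\<zeta>. G \<zeta> \<eta> * cnj (u \<zeta>)))"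

lemma dform_inner_continuous:
  assumes "continuous_on (circle \<times> circle) (\<lambda>(\<zeta>, \<eta>). G \<zeta> \<eta>)" "continuous_on circle u"
  shows "continuous_on circle (\<lambda>\<eta>. cmean (\<lambda>\<zeta>. G \<zeta> \<eta> * cnj (u \<zeta>)))"
proof (rule cmean_continuous_param)
  have "continuous_on (circle \<times> circle) (\<lambda>p. (\<lambda>(\<zeta>, \<eta>). G \<zeta> \<eta>) (snd p, fst p))"
    by (rule continuous_on_compose2[OF assms(1)]) (auto intro!: continuous_intros)
  then show "continuous_on (circle \<times> circle) (\<lambda>(x, \<zeta>). G \<zeta> x * cnj (u \<zeta>))"
    unfolding case_prod_beta by (auto intro!: continuous_intros continuous_on_circle_square assms(2))
qed

lemma dform_diff:
  assumes "continuous_on (circle \<times> circle) (\<lambda>(\<zeta>, \<eta>). G \<zeta> \<eta>)" "continuous_on (circle \<times> circle) (\<lambda>(\<zeta>, \<eta>). H \<zeta> \<eta>)"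
    "continuous_on circle u"
  shows "dform (\<lambda>\<zeta> \<eta>. G \<zeta> \<eta> - H \<zeta> \<eta>) u = dform G u - dform H u"
proof -
  have "dform (\<lambda>\<zeta> \<eta>. G \<zeta> \<eta> - H \<zeta> \<eta>) u = cmean (\<lambda>\<eta>. u \<eta> * cmean (\<lambda>\<zeta>. G \<zeta> \<eta> * cnj (u \<zeta>)) -
      u \<eta> * cmean (\<lambda>\<zeta>. H \<zeta> \<eta> * cnj (u \<zeta>)))"
    unfolding dform_def left_diff_distrib right_diff_distrib[symmetric]
    by (intro cmean_cong arg_cong2[where f="(*)"] refl cmean_diff continuous_intros circle_slice_continuous assms)
  also have "\<dots> = dform G u - dform H u" unfolding dform_def
    by (intro cmean_diff continuous_intros dform_inner_continuous assms)
  finally show ?thesis .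
qed

lemma dform_scale: "dform (\<lambda>\<zeta> \<eta>. c * G \<zeta> \<eta>) u = c * dform G u"
  unfolding dform_def cmean_mult_left[symmetric] by (simp add: mult_ac flip: cmean_mult_left)

lemma dform_sum:
  assumes "finite I" "\<And>i. i \<in> I \<Longrightarrow> continuous_on (circle \<times> circle) (\<lambda>(\<zeta>, \<eta>). G i \<zeta> \<eta>)" "continuous_on circle u"
  shows "dform (\<lambda>\<zeta> \<eta>. \<Sum>i\<in>I. G i \<zeta> \<eta>) u = (\<Sum>i\<in>I. dform (G i) u)"
proof -
  have "dform (\<lambda>\<zeta> \<eta>. \<Sum>i\<in>I. G i \<zeta> \<eta>) u = cmean (\<lambda>\<eta>. \<Sum>i\<in>I. u \<eta> * cmean (\<lambda>\<zeta>. G i \<zeta> \<eta> * cnj (u \<zeta>)))"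
    unfolding dform_def sum_distrib_right sum_distrib_left[symmetric]
    by (intro cmean_cong arg_cong2[where f="(*)"] refl cmean_sum continuous_intros circle_slice_continuous assms)
  also have "\<dots> = (\<Sum>i\<in>I. dform (G i) u)" unfolding dform_def
    by (intro cmean_sum continuous_intros dform_inner_continuous assms)
  finally show ?thesis .
qed

lemma dform_rank_one:
  assumes "continuous_on circle F" "continuous_on circle u"
  shows "dform (\<lambda>\<zeta> \<eta>. F \<zeta> * cnj (F \<eta>)) u = of_real ((cmod (ip F u))\<^sup>2)"
proof -
  have "dform (\<lambda>\<zeta> \<eta>. F \<zeta> * cnj (F \<eta>)) u = cmean (\<lambda>\<eta>. (u \<eta> * cnj (F \<eta>)) * ip F u)"
    unfolding dform_def ip_def cmean_mult_left[symmetric] by (simp add: mult_ac)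
  also have "\<dots> = ip u F * ip F u" unfolding ip_def[of u F] by (rule cmean_mult_right)
  also have "\<dots> = ip F u * cnj (ip F u)" using ip_commute[OF assms] by (simp add: mult.commute)
  finally show ?thesis by (simp only: complex_norm_square)
qed

lemma one_minus_mult_cnj_nonzero:
  assumes "0 \<le> b" "b < 1" "\<zeta> \<in> circle" "\<eta> \<in> circle" shows "1 - of_real b * \<zeta> * cnj \<eta> \<noteq> 0"
proof
  assume "1 - of_real b * \<zeta> * cnj \<eta> = 0"
  then have "cmod (of_real b * \<zeta> * cnj \<eta>) = 1" by simp
  then show False using assms by (simp add: norm_mult)
qed

text \<open>The mean of the modulus is at most the mean-square norm of the Szego kernel vector at
  \<open>b * \<eta>\<close>, which the reproducing property evaluates.\<close>

lemma cmean_inverse_abs: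
  assumes b: "0 \<le> b" "b < 1" and e: "\<eta> \<in> circle"
  shows "cmean (\<lambda>\<zeta>. 1 / cmod (1 - of_real b * \<zeta> * cnj \<eta>)) \<le> 1 / sqrt (1 - b\<^sup>2)"
    and "cmean (\<lambda>\<zeta>. 1 / cmod (1 - of_real b * \<eta> * cnj \<zeta>)) \<le> 1 / sqrt (1 - b\<^sup>2)"
proof -
  define u where "u = szego_comb 1 (\<lambda>_. of_real b * \<eta>) (\<lambda>_. 1)"
  have be: "of_real b * \<eta> \<in> ball 0 1" using b e by (simp add: norm_mult)
  have uA: "u \<in> disc_algebra" unfolding u_def by (rule szego_comb_disc_algebra) (use be in auto)
  have u: "u \<zeta> = 1 / (1 - of_real b * \<zeta> * cnj \<eta>)" for \<zeta> by (simp add: u_def szego_comb_def mult_ac)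
  have "complex_of_real (N2 u) = szego (of_real b * \<eta>) (of_real b * \<eta>)"
    unfolding u_def by (subst N2_szego_comb) (use be in auto)
  also have "\<dots> = of_real (1 / (1 - b\<^sup>2))"
    unfolding szego_def complex_norm_square[symmetric] using e b by (simp add: norm_mult)
  finally have "N2 u = 1 / (1 - b\<^sup>2)" by (simp only: of_real_eq_iff)
  then have "cmean (\<lambda>\<zeta>. cmod (u \<zeta>)) \<le> 1 / sqrt (1 - b\<^sup>2)"
    using cmean_norm_le[OF disc_algebra_continuous[OF uA]] by (simp add: real_sqrt_divide)
  then show 1: "cmean (\<lambda>\<zeta>. 1 / cmod (1 - of_real b * \<zeta> * cnj \<eta>)) \<le> 1 / sqrt (1 - b\<^sup>2)"
    unfolding u by (simp add: norm_divide)
  have "cmod (1 - of_real b * \<eta> * cnj \<zeta>) = cmod (1 - of_real b * \<zeta> * cnj \<eta>)" for \<zeta>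
    using complex_mod_cnj[of "1 - of_real b * \<zeta> * cnj \<eta>"] by (simp add: mult_ac)
  then show "cmean (\<lambda>\<zeta>. 1 / cmod (1 - of_real b * \<eta> * cnj \<zeta>)) \<le> 1 / sqrt (1 - b\<^sup>2)" using 1 by simp
qed

text \<open>Schur's test: the bound of \<open>2 * cmod (u \<eta>) * cmod (u \<zeta>)\<close> by the
  sum of the squares splits the form in two, and in each half one variable is integrated out against
  a majorant whose row and column means are at most \<open>h\<close>.\<close>

lemma dform_Schur:
  assumes G: "continuous_on (circle \<times> circle) (\<lambda>(\<zeta>, \<eta>). G \<zeta> \<eta>)" and u: "continuous_on circle u"
    and b: "0 \<le> b" "b < 1" and AB: "0 \<le> A" "0 \<le> B"
    and le: "\<And>\<zeta> \<eta>. \<zeta> \<in> circle \<Longrightarrow> \<eta> \<in> circle \<Longrightarrow> cmod (G \<zeta> \<eta>) \<le> A + B / cmod (1 - of_real b * \<zeta> * cnj \<eta>)"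
  shows "cmod (dform G u) \<le> (A + B / sqrt (1 - b\<^sup>2)) * N2 u"
proof -
  define H where "H \<zeta> \<eta> = A + B * (1 / cmod (1 - of_real b * \<zeta> * cnj \<eta>))" for \<zeta> \<eta>
  define h where "h = A + B / sqrt (1 - b\<^sup>2)"
  have Hc: "continuous_on (circle \<times> circle) (\<lambda>(\<zeta>, \<eta>). H \<zeta> \<eta>)"
    unfolding H_def case_prod_beta using one_minus_mult_cnj_nonzero[OF b]
    by (intro continuous_intros) auto
  have H0: "0 \<le> H \<zeta> \<eta>" for \<zeta> \<eta> using AB by (simp add: H_def)
  have ic: "continuous_on circle (\<lambda>\<zeta>. 1 / cmod (1 - of_real b * \<zeta> * cnj \<eta>))"
    "continuous_on circle (\<lambda>\<zeta>. 1 / cmod (1 - of_real b * \<eta> * cnj \<zeta>))" if "\<eta> \<in> circle" for \<eta>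
    using one_minus_mult_cnj_nonzero[OF b _ that] one_minus_mult_cnj_nonzero[OF b that] by (auto intro!: continuous_intros)
  have Hm: "cmean (\<lambda>\<zeta>. H \<zeta> \<eta>) \<le> h" "cmean (\<lambda>\<zeta>. H \<eta> \<zeta>) \<le> h" if e: "\<eta> \<in> circle" for \<eta>
  proof -
    have "cmean (\<lambda>\<zeta>. H \<zeta> \<eta>) = A + B * cmean (\<lambda>\<zeta>. 1 / cmod (1 - of_real b * \<zeta> * cnj \<eta>))"
      unfolding H_def by (subst cmean_add) (auto intro!: continuous_intros ic e simp only: cmean_const cmean_mult_left)
    then show "cmean (\<lambda>\<zeta>. H \<zeta> \<eta>) \<le> h" using mult_left_mono[OF cmean_inverse_abs(1)[OF b e] AB(2)] by (simp add: h_def)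
    have "cmean (\<lambda>\<zeta>. H \<eta> \<zeta>) = A + B * cmean (\<lambda>\<zeta>. 1 / cmod (1 - of_real b * \<eta> * cnj \<zeta>))"
      unfolding H_def by (subst cmean_add) (auto intro!: continuous_intros ic e simp only: cmean_const cmean_mult_left)
    then show "cmean (\<lambda>\<zeta>. H \<eta> \<zeta>) \<le> h" using mult_left_mono[OF cmean_inverse_abs(2)[OF b e] AB(2)] by (simp add: h_def)
  qed
  define a where "a \<zeta> = (cmod (u \<zeta>))\<^sup>2" for \<zeta>
  have ac: "continuous_on circle a" unfolding a_def by (intro continuous_intros u)
  have a0: "0 \<le> a \<zeta>" for \<zeta> by (simp add: a_def)
  have c1: "continuous_on (circle \<times> circle) (\<lambda>(\<zeta>, \<eta>). H \<zeta> \<eta> * a \<eta>)" "continuous_on (circle \<times> circle) (\<lambda>(\<zeta>, \<eta>). H \<zeta> \<eta> * a \<zeta>)"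
    using Hc unfolding case_prod_beta by (auto intro!: continuous_intros continuous_on_circle_square ac)
  have c2: "continuous_on circle (\<lambda>\<eta>. cmean (\<lambda>\<zeta>. H \<zeta> \<eta> * a \<eta>))" "continuous_on circle (\<lambda>\<eta>. cmean (\<lambda>\<zeta>. H \<zeta> \<eta> * a \<zeta>))"
    by (rule cmean_continuous_param[OF continuous_on_circle_swap[OF c1(1)]],
        rule cmean_continuous_param[OF continuous_on_circle_swap[OF c1(2)]])
  have "cmod (dform G u) \<le> cmean (\<lambda>\<eta>. cmod (u \<eta> * cmean (\<lambda>\<zeta>. G \<zeta> \<eta> * cnj (u \<zeta>))))"
    unfolding dform_def by (intro norm_cmean_le continuous_intros u dform_inner_continuous G)
  also have "\<dots> \<le> cmean (\<lambda>\<eta>. 1/2 * cmean (\<lambda>\<zeta>. H \<zeta> \<eta> * a \<eta>) + 1/2 * cmean (\<lambda>\<zeta>. H \<zeta> \<eta> * a \<zeta>))"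
  proof (intro cmean_mono)
    show "continuous_on circle (\<lambda>\<eta>. cmod (u \<eta> * cmean (\<lambda>\<zeta>. G \<zeta> \<eta> * cnj (u \<zeta>))))"
      by (intro continuous_intros u dform_inner_continuous G)
    show "continuous_on circle (\<lambda>\<eta>. 1/2 * cmean (\<lambda>\<zeta>. H \<zeta> \<eta> * a \<eta>) + 1/2 * cmean (\<lambda>\<zeta>. H \<zeta> \<eta> * a \<zeta>))"
      by (intro continuous_intros c2)
    fix \<eta> :: complex assume e: "\<eta> \<in> circle"
    note sl = circle_slice_continuous(1)[OF G e] circle_slice_continuous(1)[OF Hc e]
    have "cmod (u \<eta> * cmean (\<lambda>\<zeta>. G \<zeta> \<eta> * cnj (u \<zeta>))) = cmod (cmean (\<lambda>\<zeta>. u \<eta> * (G \<zeta> \<eta> * cnj (u \<zeta>))))"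
      by (simp only: cmean_mult_left)
    also have "\<dots> \<le> cmean (\<lambda>\<zeta>. cmod (u \<eta> * (G \<zeta> \<eta> * cnj (u \<zeta>))))"
      by (intro norm_cmean_le continuous_intros sl u)
    also have "\<dots> \<le> cmean (\<lambda>\<zeta>. 1/2 * (H \<zeta> \<eta> * a \<eta>) + 1/2 * (H \<zeta> \<eta> * a \<zeta>))"
    proof (intro cmean_mono continuous_intros sl u ac)
      fix \<zeta> :: complex assume z: "\<zeta> \<in> circle"
      have "cmod (u \<eta> * (G \<zeta> \<eta> * cnj (u \<zeta>))) = cmod (G \<zeta> \<eta>) * (cmod (u \<eta>) * cmod (u \<zeta>))" by (simp add: norm_mult mult_ac)
      also have "\<dots> \<le> H \<zeta> \<eta> * (1/2 * a \<eta> + 1/2 * a \<zeta>)"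
        using le[OF z e] sum_squares_bound[of "cmod (u \<eta>)" "cmod (u \<zeta>)"] H0[of \<zeta> \<eta>]
        by (intro mult_mono) (auto simp: H_def a_def)
      finally show "cmod (u \<eta> * (G \<zeta> \<eta> * cnj (u \<zeta>))) \<le> 1/2 * (H \<zeta> \<eta> * a \<eta>) + 1/2 * (H \<zeta> \<eta> * a \<zeta>)"
        by (simp add: algebra_simps)
    qed
    also have "\<dots> = 1/2 * cmean (\<lambda>\<zeta>. H \<zeta> \<eta> * a \<eta>) + 1/2 * cmean (\<lambda>\<zeta>. H \<zeta> \<eta> * a \<zeta>)"
      unfolding cmean_mult_left[symmetric]
      by (intro cmean_add continuous_intros sl ac)
    finally show "cmod (u \<eta> * cmean (\<lambda>\<zeta>. G \<zeta> \<eta> * cnj (u \<zeta>))) \<le> 1/2 * cmean (\<lambda>\<zeta>. H \<zeta> \<eta> * a \<eta>) +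
        1/2 * cmean (\<lambda>\<zeta>. H \<zeta> \<eta> * a \<zeta>)" .
  qed
  also have "\<dots> = 1/2 * cmean (\<lambda>\<eta>. cmean (\<lambda>\<zeta>. H \<zeta> \<eta> * a \<eta>)) + 1/2 * cmean (\<lambda>\<eta>. cmean (\<lambda>\<zeta>. H \<zeta> \<eta> * a \<zeta>))"
    unfolding cmean_mult_left[symmetric] by (subst cmean_add) (auto intro!: continuous_intros c2 simp only: cmean_mult_left)
  finally have main: "cmod (dform G u) \<le> 1/2 * cmean (\<lambda>\<eta>. cmean (\<lambda>\<zeta>. H \<zeta> \<eta> * a \<eta>)) +
      1/2 * cmean (\<lambda>\<eta>. cmean (\<lambda>\<zeta>. H \<zeta> \<eta> * a \<zeta>))" .
  have "cmean (\<lambda>\<eta>. cmean (\<lambda>\<zeta>. H \<zeta> \<eta> * a \<zeta>)) = cmean (\<lambda>\<zeta>. cmean (\<lambda>\<eta>. H \<zeta> \<eta> * a \<zeta>))"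
    by (rule cmean_swap[symmetric]) (rule c1)
  also have "\<dots> \<le> cmean (\<lambda>\<zeta>. h * a \<zeta>)"
    unfolding cmean_mult_right
  proof (intro cmean_mono continuous_intros ac mult_right_mono a0 Hm)
    show "continuous_on circle (\<lambda>\<zeta>. cmean (H \<zeta>))" using Hc by (rule cmean_continuous_param)
  qed
  finally have "cmean (\<lambda>\<eta>. cmean (\<lambda>\<zeta>. H \<zeta> \<eta> * a \<zeta>)) \<le> h * cmean a" unfolding cmean_mult_left .
  moreover have "cmean (\<lambda>\<eta>. cmean (\<lambda>\<zeta>. H \<zeta> \<eta> * a \<eta>)) \<le> cmean (\<lambda>\<zeta>. h * a \<zeta>)"
    unfolding cmean_mult_right
  proof (intro cmean_mono continuous_intros ac mult_right_mono a0 Hm)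
    show "continuous_on circle (\<lambda>\<eta>. cmean (\<lambda>\<zeta>. H \<zeta> \<eta>))"
      by (rule cmean_continuous_param[OF continuous_on_circle_swap[OF Hc]])
  qed
  ultimately have "cmod (dform G u) \<le> h * cmean a" using main unfolding cmean_mult_left by linarith
  then show ?thesis by (simp add: h_def N2_def a_def[abs_def])
qed

definition coef :: "(complex \<Rightarrow> complex) \<Rightarrow> nat \<Rightarrow> complex" where
  "coef u k = ip u (\<lambda>z. z ^ k)"

section \<open>Values inside the disc and comparison of regularised reciprocals\<close>

lemma geometric_remainder: "x \<noteq> 1 \<Longrightarrow> 1 / (1 - x) = (\<Sum>k<N. x ^ k) + x ^ N / (1 - (x::complex))"
  by (simp add: sum_gp_strict add_divide_distrib[symmetric])

text \<open>The geometric remainder of the Cauchy kernel is uniformly small on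
  \<open>cmod z \<le> \<beta>\<close>. Hence on a smaller disc the values of \<open>u\<close> are
  given by finitely many coefficients up to a small multiple of the norm.\<close>

lemma disc_algebra_Taylor:
  assumes u: "u \<in> disc_algebra" and z: "cmod z \<le> \<beta>" "\<beta> < 1"
  shows "cmod (u z - (\<Sum>k<N. z ^ k * coef u k)) \<le> \<beta> ^ N / (1 - \<beta>) * sqrt (N2 u)"
proof -
  note uc = disc_algebra_continuous[OF u]
  have nz: "1 - z * cnj \<zeta> \<noteq> 0" if "\<zeta> \<in> circle" for \<zeta>
  proof
    assume "1 - z * cnj \<zeta> = 0"
    then have "cmod (z * cnj \<zeta>) = 1" by simp
    then show False using z that by (simp add: norm_mult)
  qed
  have b0: "0 \<le> \<beta>" using z norm_ge_zero[of z] by linarith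
  have "u z = cmean (\<lambda>\<zeta>. u \<zeta> / (1 - z * cnj \<zeta>))" using cmean_Cauchy[OF u, of z] z by simp
  moreover have "(\<Sum>k<N. z ^ k * coef u k) = cmean (\<lambda>\<zeta>. \<Sum>k<N. z ^ k * (u \<zeta> * cnj (\<zeta> ^ k)))"
    unfolding coef_def ip_def cmean_mult_left[symmetric] by (intro cmean_sum[symmetric] continuous_intros uc)
  ultimately have "u z - (\<Sum>k<N. z ^ k * coef u k) =
     cmean (\<lambda>\<zeta>. u \<zeta> / (1 - z * cnj \<zeta>) - (\<Sum>k<N. z ^ k * (u \<zeta> * cnj (\<zeta> ^ k))))"
    using nz by (simp only:) (intro cmean_diff[symmetric] continuous_intros uc, auto)
  also have "\<dots> = cmean (\<lambda>\<zeta>. u \<zeta> * ((z * cnj \<zeta>) ^ N / (1 - z * cnj \<zeta>)))"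
  proof (rule cmean_cong)
    fix \<zeta> :: complex assume "\<zeta> \<in> circle"
    then have "z * cnj \<zeta> \<noteq> 1" using nz by fastforce
    have "(\<Sum>k<N. z ^ k * (u \<zeta> * cnj (\<zeta> ^ k))) = u \<zeta> * (\<Sum>k<N. (z * cnj \<zeta>) ^ k)"
      by (simp add: sum_distrib_left power_mult_distrib mult_ac)
    then show "u \<zeta> / (1 - z * cnj \<zeta>) - (\<Sum>k<N. z ^ k * (u \<zeta> * cnj (\<zeta> ^ k))) = u \<zeta> * ((z * cnj \<zeta>) ^ N / (1 - z * cnj \<zeta>))"
      using geometric_remainder[OF \<open>z * cnj \<zeta> \<noteq> 1\<close>, of N]
      by (simp add: divide_inverse algebra_simps) (metis distrib_left mult.left_commute)
  qed
  also have "cmod \<dots> \<le> cmean (\<lambda>\<zeta>. cmod (u \<zeta> * ((z * cnj \<zeta>) ^ N / (1 - z * cnj \<zeta>))))"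
    using nz by (intro norm_cmean_le continuous_intros uc) auto
  also have "\<dots> \<le> cmean (\<lambda>\<zeta>. \<beta> ^ N / (1 - \<beta>) * cmod (u \<zeta>))"
  proof (intro cmean_mono)
    fix \<zeta> :: complex assume c: "\<zeta> \<in> circle"
    have "1 - \<beta> \<le> cmod (1 - z * cnj \<zeta>)"
      using norm_triangle_ineq2[of 1 "z * cnj \<zeta>"] z c by (simp add: norm_mult)
    then have "cmod ((z * cnj \<zeta>) ^ N / (1 - z * cnj \<zeta>)) \<le> \<beta> ^ N / (1 - \<beta>)"
      unfolding norm_divide norm_power using z c b0 by (intro frac_le power_mono) (auto simp: norm_mult)
    then have "cmod (u \<zeta>) * cmod ((z * cnj \<zeta>) ^ N / (1 - z * cnj \<zeta>)) \<le> cmod (u \<zeta>) * (\<beta> ^ N / (1 - \<beta>))"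
      by (intro mult_left_mono) auto
    then show "cmod (u \<zeta> * ((z * cnj \<zeta>) ^ N / (1 - z * cnj \<zeta>))) \<le> \<beta> ^ N / (1 - \<beta>) * cmod (u \<zeta>)"
      unfolding norm_mult[of "u \<zeta>"] mult.commute[of _ "cmod (u \<zeta>)"] .
  qed (use nz z in \<open>auto intro!: continuous_intros uc\<close>)
  also have "\<dots> \<le> \<beta> ^ N / (1 - \<beta>) * sqrt (N2 u)"
    unfolding cmean_mult_left using z b0 by (intro mult_left_mono cmean_norm_le uc) auto
  finally show ?thesis .
qed

text \<open>As \<open>Re P \<ge> 0\<close>, nothing cancels between \<open>\<tau>\<close> and
  \<open>P\<close>; and \<open>\<tau> \<le> 1/2\<close> keeps at least half of
  \<open>P\<close>.\<close>

lemma resolvent_lower_bound: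
  assumes "0 \<le> Re P" "0 < \<tau>" "\<tau> \<le> 1/2"
  shows "\<tau> \<le> cmod (of_real \<tau> + of_real (1 - \<tau>) * P)" "cmod P / 2 \<le> cmod (of_real \<tau> + of_real (1 - \<tau>) * P)"
proof -
  have re: "Re (of_real \<tau> + of_real (1 - \<tau>) * P) = \<tau> + (1 - \<tau>) * Re P"
    and im: "Im (of_real \<tau> + of_real (1 - \<tau>) * P) = (1 - \<tau>) * Im P" by simp_all
  have p: "0 \<le> (1 - \<tau>) * Re P" using assms by simp
  then show "\<tau> \<le> cmod (of_real \<tau> + of_real (1 - \<tau>) * P)" using complex_Re_le_cmod re
      by (metis add_increasing2 order_trans order_refl)
  have "cmod (of_real (1 - \<tau>) * P) \<le> cmod (of_real \<tau> + of_real (1 - \<tau>) * P)"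
    using p assms(2) unfolding cmod_def re im
    by (intro real_sqrt_le_mono add_right_mono power_mono) auto
  moreover have "1/2 * cmod P \<le> (1 - \<tau>) * cmod P" using assms by (intro mult_right_mono) auto
  ultimately show "cmod P / 2 \<le> cmod (of_real \<tau> + of_real (1 - \<tau>) * P)"
    using assms by (simp add: norm_mult del: of_real_diff)
qed

text \<open>In the first bound the numerator is of order \<open>D^2\<close> and the two denominators
  are at least \<open>c * D\<close> each. In the second the four reciprocals are telescoped so that
  every term contains \<open>R - P\<close> with two denominators absorbing \<open>D^2\<close>, the
  factor \<open>\<sigma> - \<tau>\<close>, and at most one further reciprocal, taken at
  \<open>\<sigma>\<close>. The singularity at the smaller parameter disappears.\<close>

lemma resolvent_comparison:
  fixes P R :: complex
  assumes re: "0 \<le> Re P" "0 \<le> Re R" and d: "cmod (P - R) \<le> M * D\<^sup>2"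
    and low: "2 * c * D \<le> cmod P" "2 * c * D \<le> cmod R" and c: "0 < c" and D: "0 \<le> D" and M: "0 \<le> M"
    and R0: "cmod R \<le> R0" and t: "0 < \<tau>" "\<tau> \<le> \<sigma>" "\<sigma> \<le> 1/2"
  defines "X \<equiv> \<lambda>t. of_real t + of_real (1 - t) * P" and "Y \<equiv> \<lambda>t. of_real t + of_real (1 - t) * R"
  shows "cmod (1 / X \<tau> - 1 / Y \<tau>) \<le> M / c\<^sup>2"
    and "cmod ((1 / X \<tau> - 1 / Y \<tau>) - (1 / X \<sigma> - 1 / Y \<sigma>)) \<le>
      \<sigma> * (M / c\<^sup>2 + (1 + R0) * (M / c\<^sup>2) * (1 / cmod (X \<sigma>) + 1 / cmod (Y \<sigma>)))"
proof -
  define C where "C = M / c\<^sup>2"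
  have C: "0 \<le> C" using M by (simp add: C_def)
  have lo: "t \<le> cmod (X t)" "c * D \<le> cmod (X t)" "t \<le> cmod (Y t)" "c * D \<le> cmod (Y t)" if "0 < t" "t \<le> 1/2" for t
    using resolvent_lower_bound[OF re(1) that] resolvent_lower_bound[OF re(2) that] low unfolding X_def Y_def by auto
  have s: "0 < \<sigma>" "\<tau> \<le> 1/2" using t by auto
  have nz: "X \<tau> \<noteq> 0" "Y \<tau> \<noteq> 0" "X \<sigma> \<noteq> 0" "Y \<sigma> \<noteq> 0"
    using lo[OF t(1) s(2)] lo[OF s(1) t(3)] t(1) s(1) by auto
  define \<alpha> \<alpha>' \<beta> \<beta>' where "\<alpha> = 1 / X \<tau>" and "\<alpha>' = 1 / X \<sigma>" and "\<beta> = 1 / Y \<tau>" and "\<beta>' = 1 / Y \<sigma>"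
  have q: "cmod ((R - P) * (1/u) * (1/v)) \<le> C" if "c * D \<le> cmod u" "c * D \<le> cmod v" "u \<noteq> 0" "v \<noteq> 0" for u v
  proof -
    have "(c * D) * (c * D) \<le> cmod u * cmod v" using that c D by (intro mult_mono) auto
    then have "C * ((c * D) * (c * D)) \<le> C * (cmod u * cmod v)" using C by (rule mult_left_mono)
    also have "C * ((c * D) * (c * D)) = M * D\<^sup>2" using c by (simp add: C_def power2_eq_square)
    finally have "cmod (R - P) \<le> C * (cmod u * cmod v)" using d by (simp add: norm_minus_commute)
    then show ?thesis using that(3,4) by (simp add: norm_mult norm_divide divide_le_eq mult.assoc)
  qed
  have dX: "1 / a - 1 / b = (b - a) * (1/a) * (1/b)" if "a \<noteq> 0" "b \<noteq> 0" for a b :: complex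
    using that by (simp add: field_simps)
  have n1: "Y t - X t = of_real (1 - t) * (R - P)" for t unfolding X_def Y_def by (simp add: algebra_simps)
  have n2: "X \<sigma> - X \<tau> = of_real (\<sigma> - \<tau>) * (1 - P)" "Y \<sigma> - Y \<tau> = of_real (\<sigma> - \<tau>) * (1 - R)"
    unfolding X_def Y_def by (simp_all add: algebra_simps)
  have ab: "\<alpha> - \<beta> = of_real (1 - \<tau>) * ((R - P) * \<alpha> * \<beta>)" "\<alpha>' - \<beta>' = of_real (1 - \<sigma>) * ((R - P) * \<alpha>' * \<beta>')"
    unfolding \<alpha>_def \<alpha>'_def \<beta>_def \<beta>'_def dX[OF nz(1,2)] dX[OF nz(3,4)] n1
    by (simp_all only: mult.assoc)
  have aa: "\<alpha> - \<alpha>' = of_real (\<sigma> - \<tau>) * ((1 - P) * \<alpha> * \<alpha>')" "\<beta> - \<beta>' = of_real (\<sigma> - \<tau>) * ((1 - R) * \<beta> * \<beta>')"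
    unfolding \<alpha>_def \<alpha>'_def \<beta>_def \<beta>'_def dX[OF nz(1,3)] dX[OF nz(2,4)] n2
    by (simp_all only: mult.assoc)
  have k: "cmod ((R - P) * \<alpha> * \<beta>) \<le> C" "cmod ((R - P) * \<alpha> * \<alpha>') \<le> C" "cmod ((R - P) * \<alpha> * \<beta>') \<le> C"
    unfolding \<alpha>_def \<alpha>'_def \<beta>_def \<beta>'_def
    by (rule q[OF lo(2)[OF t(1) s(2)] lo(4)[OF t(1) s(2)] nz(1,2)], rule q[OF lo(2)[OF t(1) s(2)] lo(2)[OF
        s(1) t(3)] nz(1,3)],
        rule q[OF lo(2)[OF t(1) s(2)] lo(4)[OF s(1) t(3)] nz(1,4)])
  have n: "cmod (of_real x * z) \<le> cmod z" if "0 \<le> x" "x \<le> 1" for x z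
    using that by (simp add: norm_mult mult_left_le_one_le)
  have "cmod (\<alpha> - \<beta>) \<le> cmod ((R - P) * \<alpha> * \<beta>)" unfolding ab(1) using t s by (intro n) auto
  then show "cmod (1 / X \<tau> - 1 / Y \<tau>) \<le> M / c\<^sup>2" using k(1) by (simp add: \<alpha>_def \<beta>_def C_def)
  \<comment> \<open>Regrouping by parameter produces the small factor
    \<open>\<sigma> - \<tau>\<close>; the differences between \<open>P\<close> and \<open>R\<close>
    are then recovered inside.\<close>
  have "(\<alpha> - \<beta>) - (\<alpha>' - \<beta>') = (\<alpha> - \<alpha>') - (\<beta> - \<beta>')" by simp
  also have "\<dots> = of_real (\<sigma> - \<tau>) * ((R - P) * \<alpha> * \<alpha>' + (1 - R) * (\<alpha> * (\<alpha>' - \<beta>') + (\<alpha> - \<beta>) * \<beta>'))"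
    unfolding aa by (simp add: algebra_simps)
  also have "\<alpha> * (\<alpha>' - \<beta>') = of_real (1 - \<sigma>) * (((R - P) * \<alpha> * \<beta>') * \<alpha>')" unfolding ab by (simp add: mult_ac)
  also have "(\<alpha> - \<beta>) * \<beta>' = of_real (1 - \<tau>) * (((R - P) * \<alpha> * \<beta>) * \<beta>')" unfolding ab by (simp add: mult_ac)
  also have "cmod (of_real (\<sigma> - \<tau>) * ((R - P) * \<alpha> * \<alpha>' + (1 - R) * (of_real (1 - \<sigma>) * (((R - P) * \<alpha> * \<beta>') * \<alpha>') +
       of_real (1 - \<tau>) * (((R - P) * \<alpha> * \<beta>) * \<beta>')))) \<le> \<sigma> * (C + (1 + R0) * (C * cmod \<alpha>' + C * cmod \<beta>'))"
    (is "cmod (_ * (_ + _ * (?A + ?B))) \<le> _")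
  proof -
    have A: "cmod ?A \<le> C * cmod \<alpha>'"
    proof -
      have "cmod ?A \<le> cmod (((R - P) * \<alpha> * \<beta>') * \<alpha>')" using t s by (intro n) auto
      also have "\<dots> \<le> C * cmod \<alpha>'" unfolding norm_mult[of _ \<alpha>'] by (intro mult_right_mono k) auto
      finally show ?thesis .
    qed
    have B: "cmod ?B \<le> C * cmod \<beta>'"
    proof -
      have "cmod ?B \<le> cmod (((R - P) * \<alpha> * \<beta>) * \<beta>')" using t s by (intro n) auto
      also have "\<dots> \<le> C * cmod \<beta>'" unfolding norm_mult[of _ \<beta>'] by (intro mult_right_mono k) auto
      finally show ?thesis .
    qed
    have R: "cmod (1 - R) \<le> 1 + R0" using norm_triangle_ineq4[of 1 R] R0 by simp
    have "cmod ((1 - R) * (?A + ?B)) \<le> (1 + R0) * (C * cmod \<alpha>' + C * cmod \<beta>')"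
      unfolding norm_mult[of "1 - R"] using norm_triangle_ineq[of ?A ?B] A B R
      by (intro mult_mono) (auto intro: order_trans[OF norm_ge_zero R])
    then have "cmod ((R - P) * \<alpha> * \<alpha>' + (1 - R) * (?A + ?B)) \<le> C + (1 + R0) * (C * cmod \<alpha>' + C * cmod \<beta>')"
      using norm_triangle_ineq[of "(R - P) * \<alpha> * \<alpha>'" "(1 - R) * (?A + ?B)"] k(2) by linarith
    moreover have "cmod (of_real (\<sigma> - \<tau>)) \<le> \<sigma>" using t unfolding norm_of_real by simp
    ultimately show ?thesis unfolding norm_mult[of "of_real (\<sigma> - \<tau>)"] using s by (intro mult_mono) auto
  qed
  finally show "cmod ((1 / X \<tau> - 1 / Y \<tau>) - (1 / X \<sigma> - 1 / Y \<sigma>)) \<le>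
      \<sigma> * (M / c\<^sup>2 + (1 + R0) * (M / c\<^sup>2) * (1 / cmod (X \<sigma>) + 1 / cmod (Y \<sigma>)))"
    by (simp add: \<alpha>_def \<alpha>'_def \<beta>_def \<beta>'_def C_def norm_divide distrib_left mult.assoc)
qed

section \<open>The quadratic form of an embedded disc\<close>

text \<open>Lists instead of multi-indices: repeated monomials supply the multinomial coefficients,
  so the n-th power of \<open>cinner (f z) (f w)\<close> is an unweighted sum of rank-one
  kernels.\<close>

definition word :: "(complex \<Rightarrow> complex^'n) \<Rightarrow> 'n list \<Rightarrow> complex \<Rightarrow> complex" where
  "word f xs z = (\<Prod>i\<leftarrow>xs. f z $ i)"

definition Qn :: "(complex \<Rightarrow> complex^'n) \<Rightarrow> nat \<Rightarrow> (complex \<Rightarrow> complex) \<Rightarrow> real" where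
  "Qn f n u = (\<Sum>xs | length xs = n. (cmod (ip (word f xs) u))\<^sup>2)"

lemma finite_words: "finite {xs :: 'n::finite list. length xs = n}"
  using finite_lists_length_eq[of "UNIV :: 'n set" n] by simp

lemma cinner_power_words:
  "cinner (f z) (f w) ^ n = (\<Sum>xs | length xs = n. word f xs z * cnj (word f xs w))"
proof (induction n)
  case (Suc n)
  have "bij_betw (\<lambda>p. fst p # snd p) (UNIV \<times> {xs. length xs = n}) {xs. length xs = Suc n}"
    by (rule bij_betwI[where g="\<lambda>xs. (hd xs, tl xs)"]) (auto simp: length_Suc_conv)
  then have "(\<Sum>xs | length xs = Suc n. word f xs z * cnj (word f xs w)) =
     (\<Sum>(i, xs)\<in>UNIV \<times> {xs. length xs = n}. word f (i # xs) z * cnj (word f (i # xs) w))"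
    by (subst sum.reindex_bij_betw[symmetric]) (simp_all add: case_prod_beta)
  also have "\<dots> = (\<Sum>i\<in>UNIV. \<Sum>xs | length xs = n. (f z $ i * cnj (f w $ i)) * (word f xs z * cnj (word f xs w)))"
    by (subst sum.cartesian_product[symmetric]) (simp add: word_def mult_ac)
  also have "\<dots> = cinner (f z) (f w) * cinner (f z) (f w) ^ n"
    unfolding Suc.IH by (simp add: cinner_def sum_product)
  finally show ?case by simp
qed (simp add: word_def)

lemma Qn_nonneg: "0 \<le> Qn f n u"
  unfolding Qn_def by (intro sum_nonneg) auto

lemma word_disc_algebra:
  assumes "\<And>i. (\<lambda>z. f z $ i) \<in> disc_algebra" shows "word f xs \<in> disc_algebra"
  unfolding word_def by (induction xs) (auto intro!: disc_algebra_intros assms)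

text \<open>The boundary data on which the form estimates rest; injectivity and immersion in the
  open disc are added in \<open>embedded_disc\<close>.\<close>

locale separated_disc =
  fixes f :: "complex \<Rightarrow> complex^'n" and l :: "complex \<Rightarrow> real" and c0 C0 M c :: real
  assumes comp: "\<And>i. (\<lambda>z. f z $ i) \<in> disc_algebra"
    and norm_circle: "\<And>\<eta>. \<eta> \<in> circle \<Longrightarrow> norm (f \<eta>) = 1"
    and c0: "0 < c0" and M: "0 \<le> M" and c: "0 < c" and lc: "continuous_on circle l"
    and l_ge: "\<And>\<eta>. \<eta> \<in> circle \<Longrightarrow> c0 \<le> l \<eta>" and l_le: "\<And>\<eta>. \<eta> \<in> circle \<Longrightarrow> l \<eta> \<le> C0"
    and expand: "\<And>\<zeta> \<eta>. \<zeta> \<in> circle \<Longrightarrow> \<eta> \<in> circle \<Longrightarrow>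
       cmod (1 - cinner (f \<zeta>) (f \<eta>) - of_real (l \<eta>) * (1 - \<zeta> * cnj \<eta>)) \<le> M * (cmod (\<zeta> - \<eta>))\<^sup>2"
    and sep: "\<And>\<zeta> \<eta>. \<zeta> \<in> circle \<Longrightarrow> \<eta> \<in> circle \<Longrightarrow> c * cmod (\<zeta> - \<eta>) \<le> cmod (1 - cinner (f \<zeta>) (f \<eta>))"
begin

definition "P \<zeta> \<eta> = 1 - cinner (f \<zeta>) (f \<eta>)"
definition "R \<zeta> \<eta> = of_real (l \<eta>) * (1 - \<zeta> * cnj \<eta>)"
text \<open>\<open>K \<tau>\<close> is the geometric series of
  \<open>(1 - \<tau>) * cinner (f \<zeta>) (f \<eta>)\<close>, an Abel mean of the powers;
  \<open>Y \<tau>\<close> is its model with \<open>P\<close> replaced by the first-order part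
  \<open>R\<close>.\<close>

definition "K \<tau> \<zeta> \<eta> = 1 / (of_real \<tau> + of_real (1 - \<tau>) * P \<zeta> \<eta>)"
definition "Y \<tau> \<zeta> \<eta> = 1 / (of_real \<tau> + of_real (1 - \<tau>) * R \<zeta> \<eta>)"
text \<open>The halving matches the hypotheses \<open>2 * c * D\<close> of
  \<open>resolvent_comparison\<close>, where passing to the regularised denominators costs a factor
  two.\<close>

definition "c2 = min c0 c / 2"
definition "C4 = M / c2\<^sup>2"
definition "C5 = 1 + 1 / c2"

lemma c2: "0 < c2" using c0 c by (simp add: c2_def)
lemma C4: "0 \<le> C4" using M by (simp add: C4_def)
lemma C5: "0 < C5" using c2 by (simp add: C5_def add_pos_pos)
lemma C0: "c0 \<le> C0" using l_ge[of 1] l_le[of 1] by simp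

lemma f_continuous: "continuous_on circle f"
proof -
  have "continuous_on circle (\<lambda>z. \<chi> i. f z $ i)"
    by (intro continuous_on_vec_lambda disc_algebra_continuous comp)
  then show ?thesis by simp
qed

lemma circle_distance: "\<eta> \<in> circle \<Longrightarrow> cmod (1 - \<zeta> * cnj \<eta>) = cmod (\<zeta> - \<eta>)"
proof -
  assume e: "\<eta> \<in> circle"
  then have "1 - \<zeta> * cnj \<eta> = (\<eta> - \<zeta>) * cnj \<eta>"
    using complex_norm_square[of \<eta>] by (simp add: algebra_simps)
  then show ?thesis using e by (simp add: norm_mult norm_minus_commute)
qed

lemma Re_P: "\<zeta> \<in> circle \<Longrightarrow> \<eta> \<in> circle \<Longrightarrow> 0 \<le> Re (P \<zeta> \<eta>)"
  using norm_cinner_le[of "f \<zeta>" "f \<eta>"] norm_circle[of \<zeta>] norm_circle[of \<eta>] complex_Re_le_cmod[of "cinner (f \<zeta>) (f \<eta>)"]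
  unfolding P_def by simp

lemma Re_R: "\<zeta> \<in> circle \<Longrightarrow> \<eta> \<in> circle \<Longrightarrow> 0 \<le> Re (R \<zeta> \<eta>)"
proof -
  assume a: "\<zeta> \<in> circle" "\<eta> \<in> circle"
  have "Re (\<zeta> * cnj \<eta>) \<le> 1" using complex_Re_le_cmod[of "\<zeta> * cnj \<eta>"] a by (simp add: norm_mult)
  moreover have "Re (R \<zeta> \<eta>) = l \<eta> * (1 - Re (\<zeta> * cnj \<eta>))" by (simp add: R_def)
  moreover have "0 \<le> l \<eta>" using l_ge[OF a(2)] c0 by simp
  ultimately show ?thesis by simp
qed

lemma denominators:
  assumes "\<zeta> \<in> circle" "\<eta> \<in> circle" "0 < \<tau>" "\<tau> \<le> 1/2"
  shows "of_real \<tau> + of_real (1 - \<tau>) * P \<zeta> \<eta> \<noteq> 0" "of_real \<tau> + of_real (1 - \<tau>) * R \<zeta> \<eta> \<noteq> 0"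
  using resolvent_lower_bound(1)[OF Re_P[OF assms(1,2)] assms(3,4)] resolvent_lower_bound(1)[OF Re_R[OF
      assms(1,2)] assms(3,4)]
    assms(3) by auto

lemma K_continuous:
  assumes "0 < \<tau>" "\<tau> \<le> 1/2"
  shows "continuous_on (circle \<times> circle) (\<lambda>(\<zeta>, \<eta>). K \<tau> \<zeta> \<eta>)" "continuous_on (circle \<times> circle) (\<lambda>(\<zeta>, \<eta>). Y \<tau> \<zeta> \<eta>)"
proof -
  have "continuous_on (circle \<times> circle) (\<lambda>p. P (fst p) (snd p))" unfolding P_def
    by (intro continuous_intros continuous_on_compose2[OF f_continuous]) auto
  then show "continuous_on (circle \<times> circle) (\<lambda>(\<zeta>, \<eta>). K \<tau> \<zeta> \<eta>)"
    unfolding K_def case_prod_beta using denominators(1)[OF _ _ assms] by (intro continuous_intros) auto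
  have "continuous_on (circle \<times> circle) (\<lambda>p. R (fst p) (snd p))" unfolding R_def
    by (intro continuous_intros continuous_on_compose2[OF lc]) auto
  then show "continuous_on (circle \<times> circle) (\<lambda>(\<zeta>, \<eta>). Y \<tau> \<zeta> \<eta>)"
    unfolding Y_def case_prod_beta using denominators(2)[OF _ _ assms] by (intro continuous_intros) auto
qed

lemma bounds_PR:
  assumes "\<zeta> \<in> circle" "\<eta> \<in> circle"
  defines "D \<equiv> cmod (\<zeta> - \<eta>)"
  shows "cmod (P \<zeta> \<eta> - R \<zeta> \<eta>) \<le> M * D\<^sup>2" "2 * c2 * D \<le> cmod (P \<zeta> \<eta>)" "2 * c2 * D \<le> cmod (R \<zeta> \<eta>)"
    "cmod (R \<zeta> \<eta>) \<le> 2 * C0"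
proof -
  have D: "0 \<le> D" "D \<le> 2" using norm_triangle_ineq4[of \<zeta> \<eta>] assms by (auto simp: D_def)
  show "cmod (P \<zeta> \<eta> - R \<zeta> \<eta>) \<le> M * D\<^sup>2" using expand[OF assms(1,2)] unfolding P_def R_def D_def .
  have "2 * c2 * D \<le> c * D" using D by (intro mult_right_mono) (auto simp: c2_def)
  then show "2 * c2 * D \<le> cmod (P \<zeta> \<eta>)" using sep[OF assms(1,2)] unfolding P_def D_def by linarith
  have R: "cmod (R \<zeta> \<eta>) = l \<eta> * D" unfolding R_def D_def circle_distance[OF assms(2), symmetric]
    using l_ge[OF assms(2)] c0 by (simp add: norm_mult)
  have "2 * c2 * D \<le> l \<eta> * D" using D l_ge[OF assms(2)] by (intro mult_right_mono) (auto simp: c2_def)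
  then show "2 * c2 * D \<le> cmod (R \<zeta> \<eta>)" unfolding R .
  have "l \<eta> * D \<le> C0 * 2" using D l_le[OF assms(2)] C0 c0 by (intro mult_mono) auto
  then show "cmod (R \<zeta> \<eta>) \<le> 2 * C0" unfolding R by simp
qed

lemma E_bound:
  assumes "\<zeta> \<in> circle" "\<eta> \<in> circle" "0 < \<tau>" "\<tau> \<le> 1/2"
  shows "cmod (K \<tau> \<zeta> \<eta> - Y \<tau> \<zeta> \<eta>) \<le> C4"
  unfolding K_def Y_def C4_def
  by (rule resolvent_comparison(1)[OF Re_P Re_R bounds_PR(1-3) c2 norm_ge_zero M bounds_PR(4)]) (use assms in auto)

text \<open>The denominators at \<open>\<sigma>\<close> dominate both \<open>\<sigma>\<close> and
  \<open>c2 * cmod (\<zeta> - \<eta>)\<close>, and the sum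
  \<open>\<sigma> + cmod (\<zeta> - \<eta>)\<close> controls \<open>V\<close>. This gives the bound
  the shape that \<open>dform_Schur\<close> asks for, with \<open>b = 1 - \<sigma>\<close>.\<close>

lemma E_difference_bound:
  assumes z: "\<zeta> \<in> circle" "\<eta> \<in> circle" and t: "0 < \<tau>" "\<tau> \<le> \<sigma>" "\<sigma> \<le> 1/2"
  shows "cmod ((K \<tau> \<zeta> \<eta> - Y \<tau> \<zeta> \<eta>) - (K \<sigma> \<zeta> \<eta> - Y \<sigma> \<zeta> \<eta>)) \<le>
    \<sigma> * C4 + \<sigma> * ((1 + 2 * C0) * C4 * (2 * C5)) / cmod (1 - of_real (1 - \<sigma>) * \<zeta> * cnj \<eta>)"
proof -
  define V where "V = cmod (1 - of_real (1 - \<sigma>) * \<zeta> * cnj \<eta>)"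
  have s: "0 < \<sigma>" using t by simp
  have "V \<noteq> 0" unfolding V_def norm_eq_zero using t z by (intro one_minus_mult_cnj_nonzero) auto
  then have Vp: "0 < V" by (simp add: V_def)
  have "1 - of_real (1 - \<sigma>) * \<zeta> * cnj \<eta> = (1 - \<zeta> * cnj \<eta>) + of_real \<sigma> * (\<zeta> * cnj \<eta>)" by (simp add: algebra_simps)
  then have "V \<le> cmod (1 - \<zeta> * cnj \<eta>) + cmod (of_real \<sigma> * (\<zeta> * cnj \<eta>))" unfolding V_def by (metis norm_triangle_ineq)
  then have V: "V \<le> cmod (\<zeta> - \<eta>) + \<sigma>" unfolding circle_distance[OF z(2)] using z s by (simp add: norm_mult)
  have inv: "1 / cmod x \<le> C5 / V" if "\<sigma> \<le> cmod x" "c2 * cmod (\<zeta> - \<eta>) \<le> cmod x" for x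
  proof -
    have "cmod (\<zeta> - \<eta>) \<le> cmod x / c2" using that(2) c2 by (simp add: field_simps)
    then have "V \<le> C5 * cmod x" using V that(1) by (simp add: C5_def distrib_right)
    moreover have "0 < cmod x" using that(1) s by linarith
    ultimately show ?thesis using Vp by (simp add: divide_simps mult.commute)
  qed
  define X' Y' where "X' = of_real \<sigma> + of_real (1 - \<sigma>) * P \<zeta> \<eta>" and "Y' = of_real \<sigma> + of_real (1 - \<sigma>) * R \<zeta> \<eta>"
  have "cmod ((K \<tau> \<zeta> \<eta> - Y \<tau> \<zeta> \<eta>) - (K \<sigma> \<zeta> \<eta> - Y \<sigma> \<zeta> \<eta>)) \<le>
     \<sigma> * (C4 + (1 + 2 * C0) * C4 * (1 / cmod X' + 1 / cmod Y'))"
    unfolding K_def Y_def C4_def X'_def Y'_def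
    by (rule resolvent_comparison(2)[OF Re_P Re_R bounds_PR(1-3) c2 norm_ge_zero M bounds_PR(4)]) (use z t in auto)
  also have "\<dots> \<le> \<sigma> * (C4 + (1 + 2 * C0) * C4 * (C5 / V + C5 / V))"
  proof (intro mult_left_mono add_left_mono add_mono inv)
    show "\<sigma> \<le> cmod X'" "\<sigma> \<le> cmod Y'" unfolding X'_def Y'_def
      by (rule resolvent_lower_bound(1); use Re_P Re_R z t s in auto)+
    show "c2 * cmod (\<zeta> - \<eta>) \<le> cmod X'" unfolding X'_def
      using resolvent_lower_bound(2)[OF Re_P[OF z] s t(3)] bounds_PR(2)[OF z] by linarith
    show "c2 * cmod (\<zeta> - \<eta>) \<le> cmod Y'" unfolding Y'_def
      using resolvent_lower_bound(2)[OF Re_R[OF z] s t(3)] bounds_PR(3)[OF z] by linarith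
  qed (use C0 c0 C4 s in auto)
  also have "\<dots> = \<sigma> * C4 + \<sigma> * ((1 + 2 * C0) * C4 * (2 * C5)) / V" by (simp add: algebra_simps add_divide_distrib)
  finally show ?thesis unfolding V_def .
qed

text \<open>Expanding \<open>K \<tau>\<close> in powers and each power in words gives the sums of
  squares \<open>Qn\<close>. The remainder kernel is at most
  \<open>(1 - \<tau>) ^ A / \<tau>\<close> in modulus, so Schur's test with \<open>B = 0\<close>
  removes it in the limit.\<close>

lemma dform_K_sums:
  assumes u: "continuous_on circle u" and t: "0 < \<tau>" "\<tau> \<le> 1/2"
  shows "(\<lambda>n. (1 - \<tau>) ^ n * Qn f n u) sums Re (dform (K \<tau>) u)"
proof -
  define G where "G n \<zeta> \<eta> = of_real ((1 - \<tau>) ^ n) * cinner (f \<zeta>) (f \<eta>) ^ n" for n and \<zeta> \<eta> :: complex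
  have cc: "continuous_on (circle \<times> circle) (\<lambda>(\<zeta>, \<eta>). cinner (f \<zeta>) (f \<eta>) ^ n)" for n
    unfolding case_prod_beta by (intro continuous_intros continuous_on_compose2[OF f_continuous]) auto
  have Gc: "continuous_on (circle \<times> circle) (\<lambda>(\<zeta>, \<eta>). G n \<zeta> \<eta>)" for n
    unfolding G_def case_prod_beta by (intro continuous_on_mult continuous_on_const cc[unfolded case_prod_beta])
  have wc: "continuous_on circle (word f xs)" for xs
    by (intro disc_algebra_continuous word_disc_algebra comp)
  have dG: "dform (G n) u = of_real ((1 - \<tau>) ^ n * Qn f n u)" for n
  proof -
    have "dform (G n) u = of_real ((1 - \<tau>) ^ n) * dform (\<lambda>\<zeta> \<eta>. \<Sum>xs | length xs = n. word f xs \<zeta> * cnj (word f xs \<eta>)) u"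
      unfolding G_def dform_scale cinner_power_words ..
    also have "dform (\<lambda>\<zeta> \<eta>. \<Sum>xs | length xs = n. word f xs \<zeta> * cnj (word f xs \<eta>)) u =
       (\<Sum>xs | length xs = n. dform (\<lambda>\<zeta> \<eta>. word f xs \<zeta> * cnj (word f xs \<eta>)) u)"
      unfolding case_prod_beta by (rule dform_sum[OF finite_words _ u])
        (auto simp: case_prod_beta intro!: continuous_intros continuous_on_circle_square wc)
    also have "\<dots> = of_real (Qn f n u)" unfolding Qn_def of_real_sum by (intro sum.cong refl dform_rank_one wc u)
    finally show ?thesis by simp
  qed
  have bd: "\<bar>(\<Sum>n<A. (1 - \<tau>) ^ n * Qn f n u) - Re (dform (K \<tau>) u)\<bar> \<le> (1 - \<tau>) ^ A / \<tau> * N2 u" for A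
  proof -
    have rem: "cmod (K \<tau> \<zeta> \<eta> - (\<Sum>n<A. G n \<zeta> \<eta>)) \<le> (1 - \<tau>) ^ A / \<tau> + 0 / cmod (1 - of_real 0 * \<zeta> * cnj \<eta>)"
        if z: "\<zeta> \<in> circle" "\<eta> \<in> circle" for \<zeta> \<eta>
    proof -
      define x where "x = of_real (1 - \<tau>) * cinner (f \<zeta>) (f \<eta>)"
      have d: "1 - x = of_real \<tau> + of_real (1 - \<tau>) * P \<zeta> \<eta>" by (simp add: x_def P_def algebra_simps)
      have "x \<noteq> 1" using denominators(1)[OF z t] unfolding d[symmetric] by auto
      have "(\<Sum>n<A. G n \<zeta> \<eta>) = (\<Sum>n<A. x ^ n)" by (simp add: G_def x_def power_mult_distrib)
      then have "K \<tau> \<zeta> \<eta> - (\<Sum>n<A. G n \<zeta> \<eta>) = x ^ A / (1 - x)"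
        unfolding K_def d[symmetric] using geometric_remainder[OF \<open>x \<noteq> 1\<close>, of A] by simp
      moreover have "cmod x \<le> (1 - \<tau>) * 1"
      proof -
        have "cmod (cinner (f \<zeta>) (f \<eta>)) \<le> 1" using norm_cinner_le[of "f \<zeta>" "f \<eta>"] norm_circle z by simp
        then have "(1 - \<tau>) * cmod (cinner (f \<zeta>) (f \<eta>)) \<le> (1 - \<tau>) * 1" using t by (intro mult_left_mono) auto
        then show ?thesis using t by (simp add: x_def norm_mult del: of_real_diff)
      qed
      moreover have "\<tau> \<le> cmod (1 - x)" unfolding d using resolvent_lower_bound(1)[OF Re_P[OF z] t] .
      ultimately show ?thesis unfolding norm_divide norm_power using t
        by (auto simp: norm_divide norm_power intro!: frac_le power_mono)
    qed
    have Sc: "continuous_on (circle \<times> circle) (\<lambda>(\<zeta>, \<eta>). \<Sum>n<A. G n \<zeta> \<eta>)"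
      using Gc unfolding case_prod_beta by (intro continuous_intros) auto
    have "cmod (dform (\<lambda>\<zeta> \<eta>. K \<tau> \<zeta> \<eta> - (\<Sum>n<A. G n \<zeta> \<eta>)) u) \<le> ((1 - \<tau>) ^ A / \<tau> + 0 / sqrt (1 - 0\<^sup>2)) * N2 u"
    proof (rule dform_Schur[OF _ u _ _ _ _ rem])
      show "continuous_on (circle \<times> circle) (\<lambda>(\<zeta>, \<eta>). K \<tau> \<zeta> \<eta> - (\<Sum>n<A. G n \<zeta> \<eta>))"
        unfolding case_prod_beta
        by (rule continuous_on_diff[OF K_continuous(1)[OF t, unfolded case_prod_beta] Sc[unfolded case_prod_beta]])
    qed (use t in auto)
    also have "dform (\<lambda>\<zeta> \<eta>. K \<tau> \<zeta> \<eta> - (\<Sum>n<A. G n \<zeta> \<eta>)) u = dform (K \<tau>) u - (\<Sum>n<A. dform (G n) u)"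
      by (subst dform_diff[OF K_continuous(1)[OF t] Sc u], subst dform_sum) (auto intro!: Gc u)
    also have "\<dots> = dform (K \<tau>) u - of_real (\<Sum>n<A. (1 - \<tau>) ^ n * Qn f n u)" unfolding dG by simp
    finally show ?thesis
      using abs_Re_le_cmod[of "dform (K \<tau>) u - of_real (\<Sum>n<A. (1 - \<tau>) ^ n * Qn f n u)"] by simp
  qed
  have "(\<lambda>A. (1 - \<tau>) ^ A / \<tau> * N2 u) \<longlonglongrightarrow> 0 / \<tau> * N2 u"
    using t by (intro tendsto_intros LIMSEQ_power_zero) auto
  then have l0: "(\<lambda>A. (1 - \<tau>) ^ A / \<tau> * N2 u) \<longlonglongrightarrow> 0" by (simp only: div_0 mult_zero_left)
  have "(\<lambda>A. (\<Sum>n<A. (1 - \<tau>) ^ n * Qn f n u) - Re (dform (K \<tau>) u)) \<longlonglongrightarrow> 0"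
    by (rule Lim_null_comparison[OF always_eventually l0], rule allI, unfold real_norm_def, rule bd)
  then show ?thesis unfolding sums_def by (rule LIM_zero_cancel)
qed

end

context separated_disc
begin

text \<open>\<open>a\<close> and \<open>b\<close> solve \<open>\<tau> + (1 - \<tau>) * R \<zeta>
  \<eta> = a * (1 - b * \<zeta> * cnj \<eta>)\<close>, so that Cauchy's formula collapses the form
  of \<open>Y \<tau>\<close> to the single mean \<open>Dm\<close>. In contrast to the kernel,
  \<open>Dm\<close> is continuous up to \<open>\<tau> = 0\<close>, where \<open>b = 1\<close> and
  \<open>a = l\<close>.\<close>

definition "a \<tau> \<eta> = \<tau> + (1 - \<tau>) * l \<eta>"
definition "b \<tau> \<eta> = (1 - \<tau>) * l \<eta> / a \<tau> \<eta>"
definition "Dm \<tau> u = cmean (\<lambda>\<eta>. u \<eta> / of_real (a \<tau> \<eta>) * cnj (u (of_real (b \<tau> \<eta>) * \<eta>)))"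
definition "Q u = (\<Sum>n. Qn f n u)"

section \<open>Upper and lower bounds for the form\<close>

lemma a_b_bounds:
  assumes "\<eta> \<in> circle" "0 \<le> \<tau>" "\<tau> \<le> 1/2"
  shows "c0 / 2 \<le> a \<tau> \<eta>" "0 < a \<tau> \<eta>" "0 \<le> b \<tau> \<eta>" "b \<tau> \<eta> = 1 - \<tau> / a \<tau> \<eta>" "b \<tau> \<eta> \<le> 1 - \<tau> / (1 + C0)"
    "0 < \<tau> \<Longrightarrow> b \<tau> \<eta> < 1"
proof -
  note l = l_ge[OF assms(1)] l_le[OF assms(1)]
  have "1/2 * c0 \<le> (1 - \<tau>) * l \<eta>" using l assms c0 by (intro mult_mono) auto
  then show 1: "c0 / 2 \<le> a \<tau> \<eta>" using assms by (simp add: a_def)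
  then show 2: "0 < a \<tau> \<eta>" using c0 by linarith
  show "0 \<le> b \<tau> \<eta>" using 2 l c0 assms by (simp add: b_def)
  show 3: "b \<tau> \<eta> = 1 - \<tau> / a \<tau> \<eta>" using 2 by (simp add: b_def divide_simps) (simp add: a_def)
  have "(1 - \<tau>) * l \<eta> \<le> 1 * C0" using l assms c0 by (intro mult_mono) auto
  then have "a \<tau> \<eta> \<le> 1 + C0" using assms by (simp add: a_def)
  then have "\<tau> / (1 + C0) \<le> \<tau> / a \<tau> \<eta>" using 2 assms by (intro divide_left_mono) auto
  then show "b \<tau> \<eta> \<le> 1 - \<tau> / (1 + C0)" using 3 by simp
  show "0 < \<tau> \<Longrightarrow> b \<tau> \<eta> < 1" using 3 2 by simp
qed

lemma b_le_1:
  assumes "\<eta> \<in> circle" "0 \<le> \<tau>" "\<tau> \<le> 1/2" shows "b \<tau> \<eta> \<le> 1"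
  using a_b_bounds(4)[OF assms] a_b_bounds(2)[OF assms] assms(2) by simp

lemma Dm_continuous:
  assumes u: "u \<in> disc_algebra"
  shows "continuous_on {0..1/2} (\<lambda>\<tau>. Dm \<tau> u)"
  unfolding Dm_def
proof (rule cmean_continuous_param)
  have lc': "continuous_on ({0..1/2} \<times> circle) (\<lambda>p. l (snd p))"
    by (rule continuous_on_compose2[OF lc]) (auto intro!: continuous_intros)
  have ac: "continuous_on ({0..1/2} \<times> circle) (\<lambda>p. a (fst p) (snd p))"
    unfolding a_def by (intro continuous_intros lc')
  have an: "a \<tau> \<eta> \<noteq> 0" if "\<tau> \<in> {0..1/2}" "\<eta> \<in> circle" for \<tau> \<eta>
    using a_b_bounds(2)[of \<eta> \<tau>] that by auto
  have bc: "continuous_on ({0..1/2} \<times> circle) (\<lambda>p. b (fst p) (snd p))"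
    unfolding b_def using an by (intro continuous_intros lc' ac) auto
  have u1: "continuous_on ({0..1/2} \<times> circle) (\<lambda>p. u (snd p))"
    by (rule continuous_on_compose2[OF disc_algebra_continuous[OF u]]) (auto intro!: continuous_intros)
  have uc: "continuous_on (cball 0 1) u" using u by (simp add: disc_algebra_def)
  have u2: "continuous_on ({0..1/2} \<times> circle) (\<lambda>p. u (of_real (b (fst p) (snd p)) * snd p))"
  proof (rule continuous_on_compose2[OF uc])
    show "(\<lambda>p. of_real (b (fst p) (snd p)) * snd p) ` ({0..1/2} \<times> circle) \<subseteq> cball 0 1"
      using a_b_bounds(3) b_le_1 by (auto simp: norm_mult)
  qed (intro continuous_intros bc)
  show "continuous_on ({0..1/2} \<times> circle) (\<lambda>(\<tau>, \<eta>). u \<eta> / of_real (a \<tau> \<eta>) * cnj (u (of_real (b \<tau> \<eta>) * \<eta>)))"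
    unfolding case_prod_beta using an by (intro continuous_intros u1 u2 ac) auto
qed

lemma dform_Y:
  assumes u: "u \<in> disc_algebra" and t: "0 < \<tau>" "\<tau> \<le> 1/2"
  shows "dform (Y \<tau>) u = Dm \<tau> u"
  unfolding dform_def Dm_def
proof (rule cmean_cong)
  fix \<eta> :: complex assume e: "\<eta> \<in> circle"
  have t0: "0 \<le> \<tau>" using t by simp
  note ab = a_b_bounds[OF e t0 t(2)]
  define w where "w = of_real (b \<tau> \<eta>) * \<eta>"
  have w: "cmod w < 1" using ab(3) ab(6)[OF t(1)] e by (simp add: w_def norm_mult)
  have Yeq: "Y \<tau> \<zeta> \<eta> * cnj (u \<zeta>) = of_real (1 / a \<tau> \<eta>) * cnj (u \<zeta> / (1 - w * cnj \<zeta>))" for \<zeta>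
  proof -
    have den: "of_real \<tau> + of_real (1 - \<tau>) * R \<zeta> \<eta> = of_real (a \<tau> \<eta>) * (1 - of_real (b \<tau> \<eta>) * (\<zeta> * cnj \<eta>))"
    proof -
      have "of_real (a \<tau> \<eta>) * (1 - of_real (b \<tau> \<eta>) * (\<zeta> * cnj \<eta>)) = of_real (a \<tau> \<eta>) - of_real (a \<tau> \<eta> * b \<tau> \<eta>) * (\<zeta> * cnj \<eta>)"
        by (simp add: algebra_simps)
      also have "a \<tau> \<eta> * b \<tau> \<eta> = (1 - \<tau>) * l \<eta>" using ab(2) by (simp add: b_def)
      finally show ?thesis by (simp add: a_def R_def algebra_simps)
    qed
    have "cnj (u \<zeta> / (1 - w * cnj \<zeta>)) = cnj (u \<zeta>) / (1 - of_real (b \<tau> \<eta>) * (\<zeta> * cnj \<eta>))" by (simp add: w_def mult_ac)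
    then show ?thesis unfolding Y_def den by (simp only:) (simp add: field_simps)
  qed
  have "1 - w * cnj \<zeta> \<noteq> 0" if "\<zeta> \<in> circle" for \<zeta>
    using one_minus_mult_cnj_nonzero[OF ab(3) ab(6)[OF t(1)] e that] by (simp add: w_def)
  then have "continuous_on circle (\<lambda>\<zeta>. u \<zeta> / (1 - w * cnj \<zeta>))"
    by (intro continuous_intros disc_algebra_continuous u) auto
  then have "cmean (\<lambda>\<zeta>. Y \<tau> \<zeta> \<eta> * cnj (u \<zeta>)) = of_real (1 / a \<tau> \<eta>) * cnj (u w)"
    unfolding Yeq cmean_mult_left by (simp only: cmean_cnj cmean_Cauchy[OF u w])
  then show "u \<eta> * cmean (\<lambda>\<zeta>. Y \<tau> \<zeta> \<eta> * cnj (u \<zeta>)) = u \<eta> / of_real (a \<tau> \<eta>) * cnj (u (of_real (b \<tau> \<eta>) * \<eta>))"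
    by (simp add: w_def)
qed

lemma Dm_0:
  assumes u: "u \<in> disc_algebra"
  shows "N2 u / C0 \<le> Re (Dm 0 u)" "Re (Dm 0 u) \<le> N2 u / c0"
proof -
  note uc = disc_algebra_continuous[OF u]
  have lp: "0 < l \<eta>" if "\<eta> \<in> circle" for \<eta> using l_ge[OF that] c0 by simp
  have "Dm 0 u = cmean (\<lambda>\<eta>. of_real ((cmod (u \<eta>))\<^sup>2 / l \<eta>))"
    unfolding Dm_def
  proof (rule cmean_cong)
    fix \<eta> :: complex assume "\<eta> \<in> circle"
    then have "b 0 \<eta> = 1" "a 0 \<eta> = l \<eta>" using lp[of \<eta>] by (auto simp: b_def a_def)
    then show "u \<eta> / of_real (a 0 \<eta>) * cnj (u (of_real (b 0 \<eta>) * \<eta>)) = of_real ((cmod (u \<eta>))\<^sup>2 / l \<eta>)"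
      unfolding of_real_divide complex_norm_square by simp
  qed
  also have "\<dots> = of_real (cmean (\<lambda>\<eta>. (cmod (u \<eta>))\<^sup>2 / l \<eta>))"
    using lp by (intro cmean_of_real continuous_intros uc lc) force
  finally have R: "Re (Dm 0 u) = cmean (\<lambda>\<eta>. (cmod (u \<eta>))\<^sup>2 / l \<eta>)" by simp
  have c: "continuous_on circle (\<lambda>\<eta>. (cmod (u \<eta>))\<^sup>2 / l \<eta>)" using lp by (intro continuous_intros uc lc) force
  have cc: "continuous_on circle (\<lambda>\<eta>. 1 / x * (cmod (u \<eta>))\<^sup>2)" for x by (intro continuous_intros uc)
  have "cmean (\<lambda>\<eta>. 1 / C0 * (cmod (u \<eta>))\<^sup>2) \<le> Re (Dm 0 u)"
    unfolding R
  proof (rule cmean_mono[OF cc c])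
    fix \<eta> :: complex assume e: "\<eta> \<in> circle"
    show "1 / C0 * (cmod (u \<eta>))\<^sup>2 \<le> (cmod (u \<eta>))\<^sup>2 / l \<eta>"
      using divide_left_mono[OF l_le[OF e], of "(cmod (u \<eta>))\<^sup>2"] lp[OF e] l_le[OF e] by simp
  qed
  then show "N2 u / C0 \<le> Re (Dm 0 u)" unfolding cmean_mult_left by (simp add: N2_def)
  have "Re (Dm 0 u) \<le> cmean (\<lambda>\<eta>. 1 / c0 * (cmod (u \<eta>))\<^sup>2)"
    unfolding R
  proof (rule cmean_mono[OF c cc])
    fix \<eta> :: complex assume e: "\<eta> \<in> circle"
    show "(cmod (u \<eta>))\<^sup>2 / l \<eta> \<le> 1 / c0 * (cmod (u \<eta>))\<^sup>2"
      using divide_left_mono[OF l_ge[OF e], of "(cmod (u \<eta>))\<^sup>2"] lp[OF e] c0 by simp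
  qed
  then show "Re (Dm 0 u) \<le> N2 u / c0" unfolding cmean_mult_left by (simp add: N2_def)
qed

lemma le_at_zero:
  fixes F :: "real \<Rightarrow> real"
  assumes "continuous_on {0..s} F" "0 < s" "\<And>\<tau>. 0 < \<tau> \<Longrightarrow> \<tau> \<le> s \<Longrightarrow> F \<tau> \<le> x"
  shows "F 0 \<le> x"
  using continuous_le_on_closure[of "{0<..s}" F 0 x] assms by auto

lemma E_continuous:
  assumes "0 < \<tau>" "\<tau> \<le> 1/2"
  shows "continuous_on (circle \<times> circle) (\<lambda>(\<zeta>, \<eta>). K \<tau> \<zeta> \<eta> - Y \<tau> \<zeta> \<eta>)"
  unfolding case_prod_beta
  by (rule continuous_on_diff[OF K_continuous[OF assms, unfolded case_prod_beta]])

lemma dform_E: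
  assumes u: "u \<in> disc_algebra" and t: "0 < \<tau>" "\<tau> \<le> 1/2"
  shows "dform (\<lambda>\<zeta> \<eta>. K \<tau> \<zeta> \<eta> - Y \<tau> \<zeta> \<eta>) u = dform (K \<tau>) u - Dm \<tau> u"
  unfolding dform_diff[OF K_continuous[OF t] disc_algebra_continuous[OF u]] dform_Y[OF u t] ..

text \<open>For fixed \<open>A\<close> the damped partial sum is below the form of
  \<open>K \<tau>\<close>, which differs from \<open>Dm \<tau>\<close> by at most
  \<open>C4 * N2 u\<close>. Since the partial sum is finite and \<open>Dm\<close> is continuous, the
  damping can be removed at \<open>\<tau> = 0\<close>.\<close>

lemma Qn_partial_sum_le:
  assumes u: "u \<in> disc_algebra"
  shows "(\<Sum>n<A. Qn f n u) \<le> (1 / c0 + C4) * N2 u"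
proof -
  note uc = disc_algebra_continuous[OF u]
  define F where "F \<tau> = (\<Sum>n<A. (1 - \<tau>) ^ n * Qn f n u) - Re (Dm \<tau> u)" for \<tau>
  have "F 0 \<le> C4 * N2 u"
  proof (rule le_at_zero[where s="1/2"])
    show "continuous_on {0..1/2} F" unfolding F_def by (intro continuous_intros Dm_continuous u)
    fix \<tau> :: real assume t: "0 < \<tau>" "\<tau> \<le> 1/2"
    have "cmod (dform (\<lambda>\<zeta> \<eta>. K \<tau> \<zeta> \<eta> - Y \<tau> \<zeta> \<eta>) u) \<le> (C4 + 0 / sqrt (1 - 0\<^sup>2)) * N2 u"
      by (rule dform_Schur[OF E_continuous[OF t] uc]) (use C4 E_bound t in auto)
    then have "Re (dform (K \<tau>) u) - Re (Dm \<tau> u) \<le> C4 * N2 u"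
      unfolding dform_E[OF u t] using complex_Re_le_cmod[of "dform (K \<tau>) u - Dm \<tau> u"] by simp
    moreover have "(\<Sum>n<A. (1 - \<tau>) ^ n * Qn f n u) \<le> Re (dform (K \<tau>) u)"
      using sum_le_suminf[OF sums_summable[OF dform_K_sums[OF uc t]], of "{..<A}"] t Qn_nonneg[of f]
        sums_unique[OF dform_K_sums[OF uc t]] by auto
    ultimately show "F \<tau> \<le> C4 * N2 u" unfolding F_def by linarith
  qed simp
  then show ?thesis using Dm_0(2)[OF u] by (simp add: F_def distrib_right)
qed

lemma Qn_summable: "u \<in> disc_algebra \<Longrightarrow> summable (\<lambda>n. Qn f n u)"
  by (rule summableI_nonneg_bounded[OF Qn_nonneg Qn_partial_sum_le])

lemma Q_le: "u \<in> disc_algebra \<Longrightarrow> Q u \<le> (1 / c0 + C4) * N2 u"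
  unfolding Q_def by (rule suminf_le_const[OF Qn_summable Qn_partial_sum_le])

lemma dform_K_bounds:
  assumes u: "u \<in> disc_algebra" and t: "0 < \<tau>" "\<tau> \<le> 1/2"
  shows "0 \<le> Re (dform (K \<tau>) u)" "Re (dform (K \<tau>) u) \<le> Q u"
proof -
  note s = dform_K_sums[OF disc_algebra_continuous[OF u] t]
  have nn: "0 \<le> (1 - \<tau>) ^ n * Qn f n u" for n using t Qn_nonneg[of f n u] by simp
  show "0 \<le> Re (dform (K \<tau>) u)" using suminf_nonneg[OF sums_summable[OF s] nn] sums_unique[OF s] by simp
  have "(1 - \<tau>) ^ n * Qn f n u \<le> Qn f n u" for n
    using mult_right_mono[OF power_le_one[of "1 - \<tau>" n] Qn_nonneg[of f n u]] t by simp
  then show "Re (dform (K \<tau>) u) \<le> Q u"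
    unfolding Q_def using sums_le[OF _ s summable_sums[OF Qn_summable[OF u]]] by simp
qed

text \<open>Comparing two values of the regularisation parameter cancels the singular remainder: the
  difference of the error kernels is small in the Schur norm, and the error at the larger parameter
  only sees the values of \<open>u\<close> on a smaller disc, that is, finitely many coefficients.\<close>
lemma N2_le_Q_plus_coefficients:
  obtains N C where "0 < N" "0 \<le> C"
    "\<And>u. u \<in> disc_algebra \<Longrightarrow> N2 u / (4 * C0) \<le> Q u + C * (\<Sum>k<N. cmod (coef u k))\<^sup>2"
proof -
  define K' where "K' = (1 + 2 * C0) * C4 * (2 * C5)"
  have C0p: "0 < C0" using C0 c0 by simp
  have K': "0 \<le> K'" using C0p C4 C5 by (simp add: K'_def)
  \<comment> \<open>With this size the difference of the error forms costs at most
    \<open>N2 u / (2 * C0)\<close>, half of the main term.\<close>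
  define \<kappa> where "\<kappa> = 1 / (2 * C0 * (C4 + K' + 1))"
  have \<kappa>: "0 < \<kappa>" using C0p C4 K' by (simp add: \<kappa>_def)
  define \<sigma> where "\<sigma> = min (1/2) (\<kappa>\<^sup>2)"
  have s: "0 < \<sigma>" "\<sigma> \<le> 1/2" using \<kappa> by (auto simp: \<sigma>_def)
  have "\<sigma> \<le> \<kappa>\<^sup>2" by (simp add: \<sigma>_def)
  then have "sqrt \<sigma> \<le> sqrt (\<kappa>\<^sup>2)" by (rule real_sqrt_le_mono)
  then have sk: "sqrt \<sigma> \<le> \<kappa>" using \<kappa> by simp
  have "(sqrt \<sigma>)\<^sup>2 \<le> sqrt \<sigma> * 1" unfolding power2_eq_square using s by (intro mult_left_mono) auto
  then have ss: "\<sigma> \<le> sqrt \<sigma>" using s by simp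
  \<comment> \<open>The points \<open>b \<sigma> \<eta> * \<eta>\<close> at which
    \<open>Dm \<sigma>\<close> evaluates \<open>u\<close> all lie in the disc of radius
    \<open>\<beta>\<close>.\<close>
  define \<beta> where "\<beta> = 1 - \<sigma> / (1 + C0)"
  have \<beta>: "0 \<le> \<beta>" "\<beta> < 1" using s C0p by (auto simp: \<beta>_def field_simps)
  \<comment> \<open>Makes the Taylor remainder contribute exactly \<open>N2 u / (8 * C0)\<close> to
    the bound for \<open>Dm \<sigma>\<close>.\<close>
  define \<delta> where "\<delta> = c0 / (16 * C0)"
  have \<delta>: "0 < \<delta>" using c0 C0p by (simp add: \<delta>_def)
  obtain N0 where N0: "\<beta> ^ N0 < \<delta> * (1 - \<beta>)"
    using real_arch_pow_inv[of "\<delta> * (1 - \<beta>)" \<beta>] \<delta> \<beta> by auto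
  \<comment> \<open>\<open>Suc\<close> ensures \<open>0 < N\<close>, so that the constant
    coefficient is among the controlled ones.\<close>
  define N where "N = Suc N0"
  have N: "\<beta> ^ N / (1 - \<beta>) \<le> \<delta>"
  proof -
    have "\<beta> ^ N \<le> \<beta> ^ N0" using \<beta> by (simp add: N_def mult_left_le_one_le)
    then show ?thesis using N0 \<beta> by (simp add: pos_divide_le_eq)
  qed
  \<comment> \<open>The coefficient of the squared sum that results from completing the square in
    \<open>am\<close>.\<close>
  define C where "C = 8 * C0 / c0\<^sup>2"
  have "N2 u / (4 * C0) \<le> Q u + C * (\<Sum>k<N. cmod (coef u k))\<^sup>2" if u: "u \<in> disc_algebra" for u
  proof -
    note uc = disc_algebra_continuous[OF u]
    define L where "L = (\<Sum>k<N. cmod (coef u k))"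
    define n where "n = sqrt (N2 u)"
    have n: "0 \<le> n" "n\<^sup>2 = N2 u" using N2_nonneg[OF uc] by (auto simp: n_def)
    have L: "0 \<le> L" by (auto simp: L_def intro: sum_nonneg)
    have e: "cmod (dform (\<lambda>\<zeta> \<eta>. (K \<tau> \<zeta> \<eta> - Y \<tau> \<zeta> \<eta>) - (K \<sigma> \<zeta> \<eta> - Y \<sigma> \<zeta> \<eta>)) u) \<le> n\<^sup>2 / (2 * C0)"
      if t: "0 < \<tau>" "\<tau> \<le> \<sigma>" for \<tau>
    proof -
      have "cmod (dform (\<lambda>\<zeta> \<eta>. (K \<tau> \<zeta> \<eta> - Y \<tau> \<zeta> \<eta>) - (K \<sigma> \<zeta> \<eta> - Y \<sigma> \<zeta> \<eta>)) u) \<le>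
        (\<sigma> * C4 + \<sigma> * K' / sqrt (1 - (1 - \<sigma>)\<^sup>2)) * N2 u"
      proof (rule dform_Schur[OF _ uc])
        show "continuous_on (circle \<times> circle) (\<lambda>(\<zeta>, \<eta>). (K \<tau> \<zeta> \<eta> - Y \<tau> \<zeta> \<eta>) - (K \<sigma> \<zeta> \<eta> - Y \<sigma> \<zeta> \<eta>))"
          unfolding case_prod_beta using t s
          by (intro continuous_on_diff[OF E_continuous[unfolded case_prod_beta] E_continuous[unfolded case_prod_beta]]) auto
      qed (use E_difference_bound t s C4 K' in \<open>auto simp: K'_def\<close>)
      also have "\<dots> \<le> (1 / (2 * C0)) * N2 u"
      proof (intro mult_right_mono N2_nonneg uc)
        \<comment> \<open>Schur's test loses only \<open>1 / sqrt \<sigma>\<close> against the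
          factor \<open>\<sigma>\<close>, so the bound still tends to zero with
          \<open>\<sigma>\<close>.\<close>
        have "\<sigma> \<le> 1 - (1 - \<sigma>)\<^sup>2" using s mult_left_le[of \<sigma> \<sigma>] by (simp add: power2_eq_square algebra_simps)
        then have "\<sigma> * K' / sqrt (1 - (1 - \<sigma>)\<^sup>2) \<le> \<sigma> * K' / sqrt \<sigma>" using s K' by (intro divide_left_mono) auto
        also have "\<dots> = sqrt \<sigma> * K'" using s by (simp add: field_simps)
        finally have "\<sigma> * C4 + \<sigma> * K' / sqrt (1 - (1 - \<sigma>)\<^sup>2) \<le> sqrt \<sigma> * C4 + sqrt \<sigma> * K'"
          using mult_right_mono[OF ss C4] by linarith
        also have "\<dots> \<le> \<kappa> * (C4 + K' + 1)" unfolding distrib_left[symmetric] using sk \<kappa> C4 K' s by (intro mult_mono) auto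
        also have "\<dots> = 1 / (2 * C0)" using C0p C4 K' by (simp add: \<kappa>_def)
        finally show "\<sigma> * C4 + \<sigma> * K' / sqrt (1 - (1 - \<sigma>)\<^sup>2) \<le> 1 / (2 * C0)" .
      qed
      finally show ?thesis using n by simp
    qed
    have small: "cmod (u (of_real (b \<sigma> \<eta>) * \<eta>)) \<le> L + \<delta> * n" if h: "\<eta> \<in> circle" for \<eta>
    proof -
      define z where "z = of_real (b \<sigma> \<eta>) * \<eta>"
      have s0: "0 \<le> \<sigma>" using s by simp
      have z: "cmod z \<le> \<beta>" using a_b_bounds(3,5)[OF h s0 s(2)] h by (simp add: z_def norm_mult \<beta>_def)
      have "cmod (\<Sum>k<N. z ^ k * coef u k) \<le> L"
        unfolding L_def
      proof (rule sum_norm_le)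
        fix k
        have "cmod z ^ k \<le> 1" using z \<beta> by (intro power_le_one) auto
        then show "cmod (z ^ k * coef u k) \<le> cmod (coef u k)" by (simp add: norm_mult norm_power mult_left_le_one_le)
      qed
      moreover have "cmod (u z - (\<Sum>k<N. z ^ k * coef u k)) \<le> \<delta> * n"
        using disc_algebra_Taylor[OF u z \<beta>(2), of N] mult_right_mono[OF N n(1)] by (simp add: n_def)
      ultimately show ?thesis
        using norm_triangle_sub[of "u z" "\<Sum>k<N. z ^ k * coef u k"] by (simp add: z_def)
    qed
    have Ds: "cmod (Dm \<sigma> u) \<le> 2 / c0 * (L + \<delta> * n) * n"
    proof -
      have s0: "0 \<le> \<sigma>" using s by simp
      have cc: "continuous_on circle (\<lambda>\<eta>. u \<eta> / of_real (a \<sigma> \<eta>) * cnj (u (of_real (b \<sigma> \<eta>) * \<eta>)))"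
      proof -
        have ac: "continuous_on circle (a \<sigma>)" unfolding a_def by (intro continuous_intros lc)
        have an: "\<forall>\<eta>\<in>circle. a \<sigma> \<eta> \<noteq> 0" using a_b_bounds(2) s0 s by (metis less_irrefl)
        have bc: "continuous_on circle (b \<sigma>)" unfolding b_def by (intro continuous_intros lc ac an)
        have "continuous_on circle (\<lambda>\<eta>. u (of_real (b \<sigma> \<eta>) * \<eta>))"
        proof (rule continuous_on_compose2[of "cball 0 1" u])
          show "continuous_on (cball 0 1) u" using u by (simp add: disc_algebra_def)
          show "(\<lambda>\<eta>. of_real (b \<sigma> \<eta>) * \<eta>) ` circle \<subseteq> cball 0 1"
            using a_b_bounds(3) b_le_1 s s0 by (auto simp: norm_mult)
        qed (intro continuous_intros bc)
        then show ?thesis using an by (intro continuous_intros uc ac) auto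
      qed
      have "cmod (Dm \<sigma> u) \<le> cmean (\<lambda>\<eta>. cmod (u \<eta> / of_real (a \<sigma> \<eta>) * cnj (u (of_real (b \<sigma> \<eta>) * \<eta>))))"
        unfolding Dm_def by (rule norm_cmean_le[OF cc])
      also have "\<dots> \<le> cmean (\<lambda>\<eta>. 2 / c0 * (L + \<delta> * n) * cmod (u \<eta>))"
      proof (rule cmean_mono)
        fix \<eta> :: complex assume h: "\<eta> \<in> circle"
        have a: "c0 / 2 \<le> a \<sigma> \<eta>" "0 < a \<sigma> \<eta>" using a_b_bounds(1,2)[OF h s0 s(2)] .
        have "1 / a \<sigma> \<eta> \<le> 1 / (c0 / 2)" using a c0 by (intro divide_left_mono) auto
        then have "1 / a \<sigma> \<eta> \<le> 2 / c0" by simp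
        then have "(1 / a \<sigma> \<eta> * cmod (u (of_real (b \<sigma> \<eta>) * \<eta>))) * cmod (u \<eta>) \<le> (2 / c0 * (L + \<delta> * n)) * cmod (u \<eta>)"
          using small[OF h] a c0 by (intro mult_right_mono mult_mono) auto
        then show "cmod (u \<eta> / of_real (a \<sigma> \<eta>) * cnj (u (of_real (b \<sigma> \<eta>) * \<eta>))) \<le> 2 / c0 * (L + \<delta> * n) * cmod (u \<eta>)"
          using a by (simp add: norm_mult norm_divide mult_ac)
      qed (use cc c0 in \<open>auto intro!: continuous_intros uc\<close>)
      also have "\<dots> \<le> 2 / c0 * (L + \<delta> * n) * n"
        unfolding cmean_mult_left n_def using L \<delta> n c0 cmean_norm_le[OF uc]
        by (intro mult_left_mono) (auto simp: n_def)
      finally show ?thesis .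
    qed
    \<comment> \<open>The form of \<open>K \<tau>\<close> is at most \<open>Q u\<close>, that of
      \<open>K \<sigma>\<close> is nonnegative, and the two error forms are close;
      \<open>\<tau>\<close> tends to zero while \<open>\<sigma>\<close> stays fixed.\<close>
    have "Re (Dm 0 u) \<le> Q u + cmod (Dm \<sigma> u) + n\<^sup>2 / (2 * C0)"
    proof (rule le_at_zero[OF _ s(1)])
      show "continuous_on {0..\<sigma>} (\<lambda>\<tau>. Re (Dm \<tau> u))"
        by (rule continuous_on_Re[OF continuous_on_subset[OF Dm_continuous[OF u]]]) (use s in auto)
      fix \<tau> assume t: "0 < \<tau>" "\<tau> \<le> \<sigma>"
      have t2: "\<tau> \<le> 1/2" using t s by simp
      have "dform (\<lambda>\<zeta> \<eta>. (K \<tau> \<zeta> \<eta> - Y \<tau> \<zeta> \<eta>) - (K \<sigma> \<zeta> \<eta> - Y \<sigma> \<zeta> \<eta>)) u =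
        (dform (K \<tau>) u - Dm \<tau> u) - (dform (K \<sigma>) u - Dm \<sigma> u)"
        unfolding dform_diff[OF E_continuous[OF t(1) t2] E_continuous[OF s] uc] dform_E[OF u t(1) t2] dform_E[OF u s] ..
      then have "- (n\<^sup>2 / (2 * C0)) \<le> Re ((dform (K \<tau>) u - Dm \<tau> u) - (dform (K \<sigma>) u - Dm \<sigma> u))"
        using e[OF t] abs_Re_le_cmod[of "(dform (K \<tau>) u - Dm \<tau> u) - (dform (K \<sigma>) u - Dm \<sigma> u)"] by simp
      then show "Re (Dm \<tau> u) \<le> Q u + cmod (Dm \<sigma> u) + n\<^sup>2 / (2 * C0)"
        using dform_K_bounds(2)[OF u t(1) t2] dform_K_bounds(1)[OF u s] abs_Re_le_cmod[of "Dm \<sigma> u"] by simp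
    qed
    then have main: "n\<^sup>2 / C0 \<le> Q u + 2 / c0 * (L + \<delta> * n) * n + n\<^sup>2 / (2 * C0)"
      using Dm_0(1)[OF u] Ds n(2) by simp
    have am: "2 / c0 * L * n \<le> n\<^sup>2 / (8 * C0) + C * L\<^sup>2"
    proof -
      have "0 \<le> (n - 8 * C0 / c0 * L)\<^sup>2 / (8 * C0)" using C0p by simp
      also have "\<dots> = n\<^sup>2 / (8 * C0) + C * L\<^sup>2 - 2 / c0 * L * n"
        using C0p c0 by (simp add: C_def field_simps power2_eq_square)
      finally show ?thesis by simp
    qed
    have "2 / c0 * (\<delta> * n) * n = n\<^sup>2 / (8 * C0)" using C0p c0 by (simp add: \<delta>_def field_simps power2_eq_square)
    then have "2 / c0 * (L + \<delta> * n) * n \<le> n\<^sup>2 / (8 * C0) + C * L\<^sup>2 + n\<^sup>2 / (8 * C0)"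
      using am by (simp add: distrib_left distrib_right)
    \<comment> \<open>Of the main term \<open>n^2 / C0\<close> one half and two eighths are spent; a
      quarter remains.\<close>
    then have "n\<^sup>2 / C0 - n\<^sup>2 / (2 * C0) - n\<^sup>2 / (8 * C0) - n\<^sup>2 / (8 * C0) \<le> Q u + C * L\<^sup>2" using main by linarith
    moreover have "n\<^sup>2 / C0 - n\<^sup>2 / (2 * C0) - n\<^sup>2 / (8 * C0) - n\<^sup>2 / (8 * C0) = n\<^sup>2 / (4 * C0)"
      using C0p by (simp add: field_simps)
    ultimately show ?thesis using n by (simp add: L_def)
  qed
  then show ?thesis using that[of N C] C0p by (simp add: N_def C_def)
qed

end

section \<open>Functionals annihilating an algebra\<close>

lemma disc_algebra_power: "(\<lambda>z. z ^ n) \<in> disc_algebra"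
  by (intro disc_algebra_intros)

lemma disc_algebra_scale: "F \<in> disc_algebra \<Longrightarrow> (\<lambda>z. c * F z) \<in> disc_algebra"
  by (intro disc_algebra_intros)

lemma cmean_disc_algebra: "F \<in> disc_algebra \<Longrightarrow> cmean F = F 0"
  using cmean_Cauchy[of F 0] by simp

lemma coef_power: "coef (\<lambda>z. z ^ j) k = (if j = k then 1 else 0)"
proof -
  have ge: "cmean (\<lambda>\<zeta>. \<zeta> ^ j * cnj (\<zeta> ^ k)) = (if j = k then 1 else 0)" if "k \<le> j" for j k :: nat
  proof -
    have "cmean (\<lambda>\<zeta>. \<zeta> ^ j * cnj (\<zeta> ^ k)) = cmean (\<lambda>\<zeta>. \<zeta> ^ (j - k))"
    proof (rule cmean_cong)
      fix \<zeta> :: complex assume "\<zeta> \<in> circle"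
      then have "\<zeta> * cnj \<zeta> = 1" using complex_norm_square[of \<zeta>] by simp
      then have "\<zeta> ^ k * cnj (\<zeta> ^ k) = 1" by (metis complex_cnj_power power_mult_distrib power_one)
      moreover have "\<zeta> ^ j = \<zeta> ^ (j - k) * \<zeta> ^ k" using that by (simp flip: power_add)
      ultimately show "\<zeta> ^ j * cnj (\<zeta> ^ k) = \<zeta> ^ (j - k)" by (metis mult.assoc mult.right_neutral)
    qed
    also have "\<dots> = 0 ^ (j - k)" by (rule cmean_disc_algebra[OF disc_algebra_power])
    finally show ?thesis using that by (simp add: power_0_left)
  qed
  show ?thesis
  proof (cases "k \<le> j")
    case True then show ?thesis using ge by (simp add: coef_def ip_def)
  next
    case False
    have "coef (\<lambda>z. z ^ j) k = cnj (coef (\<lambda>z. z ^ k) j)" unfolding coef_def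
      by (rule ip_commute) (intro continuous_intros)+
    also have "\<dots> = 0" using ge[of j k] False by (simp add: coef_def ip_def)
    finally show ?thesis using False by auto
  qed
qed

text \<open>A dilation is uniformly close to \<open>F\<close> by uniform continuity, and the Taylor
  polynomials converge uniformly on the smaller circle that it sees.\<close>

lemma disc_algebra_polynomial_approx:
  assumes F: "F \<in> disc_algebra" and e: "0 < e"
  obtains N c where "\<And>z. z \<in> circle \<Longrightarrow> cmod (F z - (\<Sum>k<N. c k * z ^ k)) \<le> e"
proof -
  have "uniformly_continuous_on (cball 0 1) F"
    using F by (intro compact_uniformly_continuous) (auto simp: disc_algebra_def)
  then obtain d where d: "0 < d" "\<And>x y. x \<in> cball 0 1 \<Longrightarrow> y \<in> cball 0 1 \<Longrightarrow> dist y x < d \<Longrightarrow> dist (F y) (F x) < e/2"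
    using e unfolding uniformly_continuous_on_def by (meson half_gt_zero)
  define r where "r = 1 - min (1/2) (d/2)"
  have r: "0 < r" "r < 1" "1 - r < d" using d by (auto simp: r_def min_def)
  have "(\<lambda>N. r ^ N / (1 - r) * sqrt (N2 F)) \<longlonglongrightarrow> 0 / (1 - r) * sqrt (N2 F)"
    using r by (intro tendsto_intros LIMSEQ_power_zero) auto
  then have "\<forall>\<^sub>F N in sequentially. r ^ N / (1 - r) * sqrt (N2 F) < e/2"
    using e by (intro order_tendstoD(2)[where a="e/2"]) auto
  then obtain N where N: "r ^ N / (1 - r) * sqrt (N2 F) < e/2" unfolding eventually_sequentially by blast
  have "cmod (F z - (\<Sum>k<N. (of_real r ^ k * coef F k) * z ^ k)) \<le> e" if z: "z \<in> circle" for z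
  proof -
    have rz: "cmod (of_real r * z) = r" using z r by (simp add: norm_mult)
    have "z - of_real r * z = of_real (1 - r) * z" by (simp add: algebra_simps)
    then have "dist z (of_real r * z) = 1 - r" using z r by (simp add: dist_norm norm_mult del: of_real_diff)
    then have "dist (F z) (F (of_real r * z)) < e/2" using d(2)[of "of_real r * z" z] r rz z by simp
    moreover have "cmod (F (of_real r * z) - (\<Sum>k<N. (of_real r * z) ^ k * coef F k)) < e/2"
      by (rule le_less_trans[OF disc_algebra_Taylor[OF F _ r(2)] N]) (simp only: rz order_refl)
    ultimately have "cmod (F z - (\<Sum>k<N. (of_real r * z) ^ k * coef F k)) \<le> e"
      using norm_triangle_ineq[of "F z - F (of_real r * z)" "F (of_real r * z) - (\<Sum>k<N. (of_real r * z) ^ k * coef F k)"]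
      unfolding dist_norm diff_add_cancel add_diff_eq by linarith
    then show ?thesis by (simp add: power_mult_distrib mult_ac)
  qed
  then show ?thesis by (rule that)
qed

text \<open>By Riesz these are the vectors of the Hardy space up to conjugation; speaking of
  functionals spares completing the disc algebra. Only values on \<open>disc_algebra\<close> are
  constrained.\<close>

definition hardy_functional :: "((complex \<Rightarrow> complex) \<Rightarrow> complex) \<Rightarrow> bool" where
  "hardy_functional \<Lambda> \<longleftrightarrow> (\<forall>F\<in>disc_algebra. \<forall>G\<in>disc_algebra. \<Lambda> (\<lambda>z. F z + G z) = \<Lambda> F + \<Lambda> G) \<and>
     (\<forall>c. \<forall>F\<in>disc_algebra. \<Lambda> (\<lambda>z. c * F z) = c * \<Lambda> F) \<and>
     (\<exists>B\<ge>0. \<forall>F\<in>disc_algebra. cmod (\<Lambda> F) \<le> B * sqrt (N2 F))"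

lemma hardy_functional_add: "hardy_functional \<Lambda> \<Longrightarrow> F \<in> disc_algebra \<Longrightarrow> G \<in> disc_algebra \<Longrightarrow> \<Lambda> (\<lambda>z. F z + G z) = \<Lambda> F + \<Lambda> G"
  and hardy_functional_scale: "hardy_functional \<Lambda> \<Longrightarrow> F \<in> disc_algebra \<Longrightarrow> \<Lambda> (\<lambda>z. c * F z) = c * \<Lambda> F"
  unfolding hardy_functional_def by blast+

lemma hardy_functional_bound:
  assumes "hardy_functional \<Lambda>" obtains B where "0 \<le> B" "\<And>F. F \<in> disc_algebra \<Longrightarrow> cmod (\<Lambda> F) \<le> B * sqrt (N2 F)"
  using assms unfolding hardy_functional_def by blast

lemma hardy_functional_diff:
  "hardy_functional \<Lambda> \<Longrightarrow> F \<in> disc_algebra \<Longrightarrow> G \<in> disc_algebra \<Longrightarrow> \<Lambda> (\<lambda>z. F z - G z) = \<Lambda> F - \<Lambda> G"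
  using hardy_functional_add[of \<Lambda> F "\<lambda>z. (-1) * G z"] hardy_functional_scale[of \<Lambda> G "-1"]
    disc_algebra_scale[of G "-1"] by simp

lemma hardy_functional_zero: "hardy_functional \<Lambda> \<Longrightarrow> \<Lambda> (\<lambda>z. 0) = 0"
  using hardy_functional_scale[of \<Lambda> "\<lambda>z. 0" 0] disc_algebra_intros(1)[of 0] by simp

lemma hardy_functional_sum:
  assumes "hardy_functional \<Lambda>" "\<And>i. i \<in> I \<Longrightarrow> F i \<in> disc_algebra"
  shows "\<Lambda> (\<lambda>z. \<Sum>i\<in>I. F i z) = (\<Sum>i\<in>I. \<Lambda> (F i))"
  using assms(2)
proof (induction I rule: infinite_finite_induct)
  case (insert i I)
  then have "\<Lambda> (\<lambda>z. F i z + (\<Sum>i\<in>I. F i z)) = \<Lambda> (F i) + \<Lambda> (\<lambda>z. \<Sum>i\<in>I. F i z)"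
    by (intro hardy_functional_add assms(1) disc_algebra_sum) auto
  then show ?case using insert by simp
qed (simp_all add: hardy_functional_zero[OF assms(1)])

lemma N2_le_of_bound:
  assumes "continuous_on circle u" "\<And>z. z \<in> circle \<Longrightarrow> cmod (u z) \<le> e"
  shows "N2 u \<le> e\<^sup>2"
proof -
  have "N2 u \<le> cmean (\<lambda>z. e\<^sup>2)" unfolding N2_def
    by (intro cmean_mono continuous_intros assms power_mono) auto
  then show ?thesis by (simp add: cmean_const)
qed

lemma hardy_functional_eq_0:
  assumes L: "hardy_functional \<Lambda>" and 0: "\<And>n. \<Lambda> (\<lambda>z. z ^ n) = 0" and F: "F \<in> disc_algebra"
  shows "\<Lambda> F = 0"
proof -
  obtain B where B: "0 \<le> B" "\<And>F. F \<in> disc_algebra \<Longrightarrow> cmod (\<Lambda> F) \<le> B * sqrt (N2 F)"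
    using hardy_functional_bound[OF L] by blast
  have "cmod (\<Lambda> F) \<le> 0 + e" if e: "0 < e" for e
  proof -
    define e' where "e' = e / (B + 1)"
    have e': "0 < e'" "B * e' \<le> e" using e B by (auto simp: e'_def field_simps)
    obtain N c where N: "\<And>z. z \<in> circle \<Longrightarrow> cmod (F z - (\<Sum>k<N. c k * z ^ k)) \<le> e'"
      using disc_algebra_polynomial_approx[OF F e'(1)] by blast
    define p where "p z = (\<Sum>k<N. c k * z ^ k)" for z
    have p: "p \<in> disc_algebra" unfolding p_def by (intro disc_algebra_sum disc_algebra_scale disc_algebra_power)
    have "\<Lambda> p = 0" unfolding p_def
      by (subst hardy_functional_sum[OF L]) (auto intro!: disc_algebra_scale disc_algebra_power simp:
          hardy_functional_scale[OF L disc_algebra_power] 0)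
    then have "\<Lambda> F = \<Lambda> (\<lambda>z. F z - p z)" using hardy_functional_diff[OF L F p] by simp
    then have "cmod (\<Lambda> F) \<le> B * sqrt (N2 (\<lambda>z. F z - p z))" using B(2)[OF disc_algebra_intros(4)[OF F p]] by simp
    also have "N2 (\<lambda>z. F z - p z) \<le> e'\<^sup>2"
      using N by (intro N2_le_of_bound disc_algebra_continuous disc_algebra_intros F p) (auto simp: p_def)
    then have "B * sqrt (N2 (\<lambda>z. F z - p z)) \<le> B * e'" using B(1) e' by (intro mult_left_mono real_le_lsqrt) auto
    finally show ?thesis using e' by simp
  qed
  then show ?thesis using field_le_epsilon[of "cmod (\<Lambda> F)" 0] by simp
qed

lemma N2_polynomial:
  "N2 (\<lambda>z. \<Sum>n\<in>I. a n * z ^ n) = (\<Sum>n\<in>I. (cmod (a n))\<^sup>2)" if "finite I"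
proof -
  have c: "continuous_on circle (\<lambda>z. \<Sum>n\<in>I. a n * z ^ n)" by (intro continuous_intros)
  have "of_real (N2 (\<lambda>z. \<Sum>n\<in>I. a n * z ^ n)) = ip (\<lambda>z. \<Sum>n\<in>I. a n * z ^ n) (\<lambda>z. \<Sum>n\<in>I. a n * z ^ n)"
    using ip_self[OF c] by simp
  also have "\<dots> = (\<Sum>n\<in>I. cnj (a n) * (\<Sum>m\<in>I. a m * coef (\<lambda>z. z ^ m) n))"
    unfolding coef_def
    by (subst ip_sum_right, (intro continuous_intros)+, subst ip_scale_right, subst ip_sum_left, (intro
        continuous_intros)+, subst ip_scale_left, rule refl)
  also have "\<dots> = (\<Sum>n\<in>I. cnj (a n) * a n)"
    using that by (intro sum.cong refl) (simp add: coef_power if_distrib sum.delta cong: if_cong)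
  also have "\<dots> = of_real (\<Sum>n\<in>I. (cmod (a n))\<^sup>2)" unfolding of_real_sum complex_norm_square by (simp add: mult.commute)
  finally show ?thesis by (simp only: of_real_eq_iff)
qed

text \<open>Truncation of the Riesz representer of \<open>\<Lambda>\<close>, whose Taylor
  coefficients are the conjugates of the values of \<open>\<Lambda>\<close> on the powers.\<close>

definition partial_representer :: "((complex \<Rightarrow> complex) \<Rightarrow> complex) \<Rightarrow> nat \<Rightarrow> complex \<Rightarrow> complex" where
  "partial_representer \<Lambda> m z = (\<Sum>n<m. cnj (\<Lambda> (\<lambda>z. z ^ n)) * z ^ n)"

lemma partial_representer_disc_algebra: "partial_representer \<Lambda> m \<in> disc_algebra"
  unfolding partial_representer_def by (intro disc_algebra_sum disc_algebra_scale disc_algebra_power)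

lemma ip_partial_representer:
  assumes "continuous_on circle F"
  shows "ip F (partial_representer \<Lambda> m) = (\<Sum>n<m. \<Lambda> (\<lambda>z. z ^ n) * coef F n)"
  unfolding partial_representer_def[abs_def] coef_def
  by (subst ip_sum_right, (intro continuous_intros assms)+, subst ip_scale_right, simp)

lemma N2_partial_representer: "N2 (partial_representer \<Lambda> m) = (\<Sum>n<m. (cmod (\<Lambda> (\<lambda>z. z ^ n)))\<^sup>2)"
  unfolding partial_representer_def[abs_def] by (subst N2_polynomial) auto

lemma N2_partial_representer_diff:
  assumes "m \<le> m'"
  shows "N2 (\<lambda>z. partial_representer \<Lambda> m' z - partial_representer \<Lambda> m z) =
     (\<Sum>n<m'. (cmod (\<Lambda> (\<lambda>z. z ^ n)))\<^sup>2) - (\<Sum>n<m. (cmod (\<Lambda> (\<lambda>z. z ^ n)))\<^sup>2)"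
proof -
  have s: "(\<Sum>n<m'. g n) - (\<Sum>n<m. g n) = (\<Sum>n\<in>{m..<m'}. g n)" for g :: "nat \<Rightarrow> 'x::ab_group_add"
    using assms sum_diff[of "{..<m'}" "{..<m}" g] by (simp add: ivl_diff lessThan_atLeast0)
  show ?thesis unfolding partial_representer_def s by (subst N2_polynomial) auto
qed

text \<open>On its own truncated representer \<open>\<Lambda>\<close> takes the value
  \<open>s\<close>, which is also the squared norm of that representer. Boundedness gives
  \<open>s \<le> B * sqrt s\<close>, hence \<open>s \<le> B^2\<close> for every truncation.\<close>

lemma hardy_functional_square_summable:
  assumes L: "hardy_functional \<Lambda>"
  shows "summable (\<lambda>n. (cmod (\<Lambda> (\<lambda>z. z ^ n)))\<^sup>2)"
proof -
  obtain B where B: "0 \<le> B" "\<And>F. F \<in> disc_algebra \<Longrightarrow> cmod (\<Lambda> F) \<le> B * sqrt (N2 F)"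
    using hardy_functional_bound[OF L] by blast
  have "(\<Sum>n<m. (cmod (\<Lambda> (\<lambda>z. z ^ n)))\<^sup>2) \<le> B\<^sup>2" for m
  proof -
    define s where "s = (\<Sum>n<m. (cmod (\<Lambda> (\<lambda>z. z ^ n)))\<^sup>2)"
    have s0: "0 \<le> s" unfolding s_def by (intro sum_nonneg) auto
    have "\<Lambda> (partial_representer \<Lambda> m) = (\<Sum>n<m. cnj (\<Lambda> (\<lambda>z. z ^ n)) * \<Lambda> (\<lambda>z. z ^ n))"
      unfolding partial_representer_def[abs_def]
      by (subst hardy_functional_sum[OF L]) (auto intro!: disc_algebra_scale disc_algebra_power simp:
          hardy_functional_scale[OF L disc_algebra_power])
    also have "\<dots> = of_real s" unfolding s_def of_real_sum complex_norm_square by (simp add: mult.commute)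
    finally have "s \<le> B * sqrt s"
      using B(2)[OF partial_representer_disc_algebra[of \<Lambda> m]] s0 unfolding N2_partial_representer s_def[symmetric] by simp
    then have "sqrt s * sqrt s \<le> B * sqrt s" using s0 by simp
    have "sqrt s \<le> B"
    proof (cases "s = 0")
      case False
      then have "0 < sqrt s" using s0 by simp
      then show ?thesis using \<open>sqrt s * sqrt s \<le> B * sqrt s\<close> by (rule mult_right_le_imp_le[rotated])
    qed (use B(1) in simp)
    then show ?thesis unfolding s_def[symmetric] using s0 B(1) by (simp add: sqrt_le_D)
  qed
  then show ?thesis by (intro summableI_nonneg_bounded) auto
qed

text \<open>On a polynomial the pairing eventually equals \<open>\<Lambda>\<close>; polynomials are
  dense, and the norms of the truncated representers are bounded by \<open>S\<close>.\<close>

lemma ip_partial_representer_tendsto: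
  assumes L: "hardy_functional \<Lambda>" and F: "F \<in> disc_algebra"
  shows "(\<lambda>m. ip F (partial_representer \<Lambda> m)) \<longlonglongrightarrow> \<Lambda> F"
proof (rule LIMSEQ_I)
  fix e :: real assume e: "0 < e"
  obtain B where B: "0 \<le> B" "\<And>F. F \<in> disc_algebra \<Longrightarrow> cmod (\<Lambda> F) \<le> B * sqrt (N2 F)"
    using hardy_functional_bound[OF L] by blast
  define S where "S = sqrt (\<Sum>n. (cmod (\<Lambda> (\<lambda>z. z ^ n)))\<^sup>2)"
  have S: "sqrt (N2 (partial_representer \<Lambda> m)) \<le> S" for m
    unfolding N2_partial_representer S_def
    by (intro real_sqrt_le_mono sum_le_suminf hardy_functional_square_summable L) auto
  have S0: "0 \<le> S" unfolding S_def by (intro real_sqrt_ge_zero suminf_nonneg hardy_functional_square_summable L) auto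
  define e' where "e' = e / (B + S + 1)"
  have e': "0 < e'" "(B + S) * e' < e" using e B S0 by (auto simp: e'_def field_simps)
  obtain N c where N: "\<And>z. z \<in> circle \<Longrightarrow> cmod (F z - (\<Sum>k<N. c k * z ^ k)) \<le> e'"
    using disc_algebra_polynomial_approx[OF F e'(1)] by blast
  define p where "p z = (\<Sum>k<N. c k * z ^ k)" for z
  have p: "p \<in> disc_algebra" unfolding p_def by (intro disc_algebra_sum disc_algebra_scale disc_algebra_power)
  have Fp: "(\<lambda>z. F z - p z) \<in> disc_algebra" by (intro disc_algebra_intros F p)
  have "N2 (\<lambda>z. F z - p z) \<le> e'\<^sup>2"
    using N by (intro N2_le_of_bound disc_algebra_continuous Fp) (auto simp: p_def)
  then have n: "sqrt (N2 (\<lambda>z. F z - p z)) \<le> e'" using e' by (intro real_le_lsqrt) auto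
  have ipp: "ip p (partial_representer \<Lambda> m) = \<Lambda> p" if "N \<le> m" for m
  proof -
    have "coef p n = (\<Sum>k<N. c k * (if k = n then 1 else 0))" for n
      unfolding coef_power[symmetric] coef_def p_def[abs_def]
      by (subst ip_sum_left, (intro continuous_intros)+, subst ip_scale_left, rule refl)
    then have cp: "coef p n = (if n < N then c n else 0)" for n by (simp add: if_distrib sum.delta cong: if_cong)
    have "ip p (partial_representer \<Lambda> m) = (\<Sum>n<m. \<Lambda> (\<lambda>z. z ^ n) * coef p n)"
      by (rule ip_partial_representer[OF disc_algebra_continuous[OF p]])
    also have "\<dots> = (\<Sum>n<N. c n * \<Lambda> (\<lambda>z. z ^ n))"
      using that unfolding cp by (intro sum.mono_neutral_cong_right) auto
    also have "\<dots> = \<Lambda> p" unfolding p_def[abs_def]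
      by (subst hardy_functional_sum[OF L]) (auto intro!: disc_algebra_scale disc_algebra_power simp:
          hardy_functional_scale[OF L disc_algebra_power])
    finally show ?thesis .
  qed
  have "cmod (ip F (partial_representer \<Lambda> m) - \<Lambda> F) < e" if m: "N \<le> m" for m
  proof -
    note uc = disc_algebra_continuous[OF partial_representer_disc_algebra[of \<Lambda> m]]
    have "ip F (partial_representer \<Lambda> m) - \<Lambda> F = ip (\<lambda>z. F z - p z) (partial_representer \<Lambda> m) - \<Lambda> (\<lambda>z. F z - p z)"
      using ipp[OF m] ip_diff_left[OF disc_algebra_continuous[OF F] disc_algebra_continuous[OF p] uc]
        hardy_functional_diff[OF L F p] by simp
    also have "cmod \<dots> \<le> cmod (ip (\<lambda>z. F z - p z) (partial_representer \<Lambda> m)) + cmod (\<Lambda> (\<lambda>z. F z - p z))"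
      by (rule norm_triangle_ineq4)
    also have "\<dots> \<le> e' * S + B * e'"
    proof (rule add_mono)
      have "cmod (ip (\<lambda>z. F z - p z) (partial_representer \<Lambda> m)) \<le> sqrt (N2 (\<lambda>z. F z -
          p z)) * sqrt (N2 (partial_representer \<Lambda> m))"
        by (rule norm_ip_le[OF disc_algebra_continuous[OF Fp] uc])
      also have "\<dots> \<le> e' * S" using n S e' N2_nonneg[OF uc] by (intro mult_mono) auto
      finally show "cmod (ip (\<lambda>z. F z - p z) (partial_representer \<Lambda> m)) \<le> e' * S" .
      show "cmod (\<Lambda> (\<lambda>z. F z - p z)) \<le> B * e'" using B(2)[OF Fp] mult_left_mono[OF n B(1)] by linarith
    qed
    also have "\<dots> < e" using e'(2) by (simp add: algebra_simps)
    finally show ?thesis .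
  qed
  then show "\<exists>no. \<forall>m\<ge>no. norm (ip F (partial_representer \<Lambda> m) - \<Lambda> F) < e" by auto
qed

context separated_disc
begin

lemma Qn_tendsto:
  assumes "\<And>xs. (\<lambda>m. ip (word f xs) (v m)) \<longlonglongrightarrow> w xs"
  shows "(\<lambda>m. Qn f n (v m)) \<longlonglongrightarrow> (\<Sum>xs | length xs = n. (cmod (w xs))\<^sup>2)"
  unfolding Qn_def by (intro tendsto_intros assms)

text \<open>A functional that kills all words is determined by \<open>N\<close> values. Its
  truncated representers \<open>u m\<close> are nearly orthogonal to the words, so that
  \<open>Q (u m)\<close> is bounded by the tail \<open>S - s m\<close>; their low coefficients
  vanish, and the lower bound forces \<open>s m\<close> below a multiple of that tail. In the limit
  \<open>S = 0\<close>.\<close>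

lemma hardy_functional_vanishing:
  assumes L: "hardy_functional \<Lambda>" and words: "\<And>xs. \<Lambda> (word f xs) = 0"
    and N: "\<And>u. u \<in> disc_algebra \<Longrightarrow> N2 u / (4 * C0) \<le> Q u + C * (\<Sum>k<N. cmod (coef u k))\<^sup>2"
    and low: "\<And>k. k < N \<Longrightarrow> \<Lambda> (\<lambda>z. z ^ k) = 0"
  shows "\<Lambda> (\<lambda>z. z ^ n) = 0"
proof -
  define u where "u = partial_representer \<Lambda>"
  define s where "s m = (\<Sum>n<m. (cmod (\<Lambda> (\<lambda>z. z ^ n)))\<^sup>2)" for m
  define S where "S = (\<Sum>n. (cmod (\<Lambda> (\<lambda>z. z ^ n)))\<^sup>2)"
  have sS: "s \<longlonglongrightarrow> S" unfolding s_def S_def by (rule summable_LIMSEQ[OF hardy_functional_square_summable[OF L]])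
  have uA: "u m \<in> disc_algebra" for m unfolding u_def by (rule partial_representer_disc_algebra)
  note uc = disc_algebra_continuous[OF uA]
  have wA: "word f xs \<in> disc_algebra" for xs by (intro word_disc_algebra comp)
  note wc = disc_algebra_continuous[OF wA]
  have lim0: "(\<lambda>m. ip (word f xs) (u m)) \<longlonglongrightarrow> 0" for xs
    using ip_partial_representer_tendsto[OF L wA, of xs] words unfolding u_def by simp
  define C1 where "C1 = 1 / c0 + C4"
  have Qb: "Q (u m) \<le> C1 * (S - s m)" for m
    unfolding Q_def
  proof (rule suminf_le_const[OF Qn_summable[OF uA]])
    fix A
    \<comment> \<open>\<open>ip (word f xs) (u m')\<close> tends to zero, so
      \<open>u m' - u m\<close> has asymptotically the same form as \<open>u m\<close>. The upper
      bound is applied to this difference, whose squared norm is part of the tail.\<close>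
    have "(\<lambda>m'. \<Sum>n<A. Qn f n (\<lambda>z. u m' z - u m z)) \<longlonglongrightarrow> (\<Sum>n<A. \<Sum>xs | length xs = n. (cmod (0 - ip (word f xs) (u m)))\<^sup>2)"
    proof (intro tendsto_sum Qn_tendsto)
      fix xs
      have "(\<lambda>m'. ip (word f xs) (u m') - ip (word f xs) (u m)) \<longlonglongrightarrow> 0 - ip (word f xs) (u m)"
        by (intro tendsto_diff lim0 tendsto_const)
      then show "(\<lambda>m'. ip (word f xs) (\<lambda>z. u m' z - u m z)) \<longlonglongrightarrow> 0 - ip (word f xs) (u m)"
        using ip_diff_right[OF wc uc uc] by simp
    qed
    then have l: "(\<lambda>m'. \<Sum>n<A. Qn f n (\<lambda>z. u m' z - u m z)) \<longlonglongrightarrow> (\<Sum>n<A. Qn f n (u m))"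
      by (simp add: Qn_def)
    have r: "(\<lambda>m'. C1 * (s m' - s m)) \<longlonglongrightarrow> C1 * (S - s m)" by (intro tendsto_intros sS)
    show "(\<Sum>n<A. Qn f n (u m)) \<le> C1 * (S - s m)"
    proof (rule LIMSEQ_le[OF l r], intro exI allI impI)
      fix m' assume "m \<le> m'"
      have "(\<Sum>n<A. Qn f n (\<lambda>z. u m' z - u m z)) \<le> C1 * N2 (\<lambda>z. u m' z - u m z)"
        unfolding C1_def by (intro Qn_partial_sum_le disc_algebra_intros uA)
      then show "(\<Sum>n<A. Qn f n (\<lambda>z. u m' z - u m z)) \<le> C1 * (s m' - s m)"
        unfolding u_def s_def N2_partial_representer_diff[OF \<open>m \<le> m'\<close>] .
    qed
  qed
  have co: "coef (u m) k = 0" if "k < N" for m k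
  proof -
    have "coef (u m) k = cnj (ip (\<lambda>z. z ^ k) (u m))"
      unfolding coef_def by (rule ip_commute) (intro continuous_intros uc)+
    also have "ip (\<lambda>z. z ^ k) (u m) = (\<Sum>n<m. \<Lambda> (\<lambda>z. z ^ n) * coef (\<lambda>z. z ^ k) n)"
      unfolding u_def by (rule ip_partial_representer) (intro continuous_intros)
    also have "\<dots> = 0" using low[OF that] by (intro sum.neutral) (auto simp: coef_power)
    finally show ?thesis by simp
  qed
  have "s m / (4 * C0) \<le> C1 * (S - s m)" for m
  proof -
    have "N2 (u m) / (4 * C0) \<le> Q (u m) + C * (\<Sum>k<N. cmod (coef (u m) k))\<^sup>2" by (rule N[OF uA])
    also have "(\<Sum>k<N. cmod (coef (u m) k)) = 0" using co by simp
    finally show ?thesis using Qb[of m] by (simp add: u_def s_def N2_partial_representer)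
  qed
  moreover have "(\<lambda>m. s m / (4 * C0)) \<longlonglongrightarrow> S / (4 * C0)"
    using C0 c0 by (intro tendsto_intros sS) auto
  moreover have "(\<lambda>m. C1 * (S - s m)) \<longlonglongrightarrow> C1 * (S - S)" by (intro tendsto_intros sS)
  ultimately have "S / (4 * C0) \<le> C1 * (S - S)" by (intro LIMSEQ_le) auto
  then have "S \<le> 0" using C0 c0 by (simp add: divide_le_0_iff)
  moreover have "(cmod (\<Lambda> (\<lambda>z. z ^ n)))\<^sup>2 \<le> S"
    using sum_le_suminf[OF hardy_functional_square_summable[OF L], of "{n}"] by (simp add: S_def)
  ultimately show ?thesis by (metis dual_order.trans norm_eq_zero power2_less_eq_zero_iff)
qed

end

section \<open>Eigenfunctionals\<close>

lemma linear_dependence: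
  fixes v :: "nat \<Rightarrow> nat \<Rightarrow> complex"
  assumes "finite J" "N < card J"
  shows "\<exists>a. (\<exists>j\<in>J. a j \<noteq> 0) \<and> (\<forall>k<N. (\<Sum>j\<in>J. a j * v j k) = 0)"
  using assms
proof (induction N arbitrary: J v)
  case 0
  then have "J \<noteq> {}" by auto
  then show ?case by (intro exI[of _ "\<lambda>_. 1"]) auto
next
  case (Suc N)
  show ?case
  proof (cases "\<forall>j\<in>J. v j N = 0")
    case True
    obtain a where a: "\<exists>j\<in>J. a j \<noteq> 0" "\<forall>k<N. (\<Sum>j\<in>J. a j * v j k) = 0"
      using Suc.IH[of J v] Suc.prems by auto
    then show ?thesis using True by (intro exI[of _ a]) (auto simp: less_Suc_eq)
  next
    case False
    then obtain p where p: "p \<in> J" "v p N \<noteq> 0" by blast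
    define w where "w j k = v j k - v j N / v p N * v p k" for j k
    have "finite (J - {p})" "N < card (J - {p})" using Suc.prems p by auto
    then obtain a where a: "\<exists>j\<in>J - {p}. a j \<noteq> 0" "\<forall>k<N. (\<Sum>j\<in>J - {p}. a j * w j k) = 0"
      using Suc.IH[of "J - {p}" w] by blast
    define b where "b = a(p := - (\<Sum>j\<in>J - {p}. a j * v j N) / v p N)"
    have "(\<Sum>j\<in>J. b j * v j k) = (\<Sum>j\<in>J - {p}. a j * w j k)" for k
    proof -
      have "(\<Sum>j\<in>J. b j * v j k) = b p * v p k + (\<Sum>j\<in>J - {p}. b j * v j k)"
        using Suc.prems p by (simp add: sum.remove)
      also have "(\<Sum>j\<in>J - {p}. b j * v j k) = (\<Sum>j\<in>J - {p}. a j * v j k)"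
        by (intro sum.cong) (auto simp: b_def)
      also have "b p * v p k = - (\<Sum>j\<in>J - {p}. a j * (v j N / v p N * v p k))"
        by (simp add: b_def sum_distrib_left sum_divide_distrib mult_ac)
      finally show ?thesis by (simp add: w_def right_diff_distrib sum_subtractf)
    qed
    moreover have "w j N = 0" for j using p by (simp add: w_def)
    ultimately show ?thesis using a by (intro exI[of _ b]) (auto simp: less_Suc_eq b_def)
  qed
qed

lemma disc_algebra_poly:
  assumes "\<phi> \<in> disc_algebra" shows "(\<lambda>z. poly q (\<phi> z)) \<in> disc_algebra"
  by (induction q) (auto intro!: disc_algebra_intros assms)

lemma hardy_functional_mult:
  assumes L: "hardy_functional \<Lambda>" and psi: "\<psi> \<in> disc_algebra"
  shows "hardy_functional (\<lambda>F. \<Lambda> (\<lambda>z. \<psi> z * F z))"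
proof -
  obtain B where B: "0 \<le> B" "\<And>F. F \<in> disc_algebra \<Longrightarrow> cmod (\<Lambda> F) \<le> B * sqrt (N2 F)"
    using hardy_functional_bound[OF L] by blast
  have pc: "continuous_on circle \<psi>" using psi by (rule disc_algebra_continuous)
  have "bounded (\<psi> ` circle)" using pc by (intro compact_imp_bounded compact_continuous_image) auto
  then obtain D where D: "\<And>z. z \<in> circle \<Longrightarrow> cmod (\<psi> z) \<le> D" unfolding bounded_iff by (metis imageI)
  have D0: "0 \<le> D" using D[of 1] norm_ge_zero[of "\<psi> 1"] by (simp del: norm_ge_zero)
  show ?thesis
    unfolding hardy_functional_def
  proof (intro conjI ballI allI exI[of _ "B * D"])
    fix F assume F: "F \<in> disc_algebra"
    have pF: "(\<lambda>z. \<psi> z * F z) \<in> disc_algebra" by (intro disc_algebra_intros F psi)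
    show "\<Lambda> (\<lambda>z. \<psi> z * (c * F z)) = c * \<Lambda> (\<lambda>z. \<psi> z * F z)" for c
      using hardy_functional_scale[OF L pF, of c] by (simp add: mult.left_commute)
    show "\<Lambda> (\<lambda>z. \<psi> z * (F z + G z)) = \<Lambda> (\<lambda>z. \<psi> z * F z) + \<Lambda> (\<lambda>z. \<psi> z * G z)" if "G \<in> disc_algebra" for G
      using hardy_functional_add[OF L pF disc_algebra_intros(5)[OF psi that]] by (simp add: distrib_left)
    have "cmod (\<Lambda> (\<lambda>z. \<psi> z * F z)) \<le> B * sqrt (N2 (\<lambda>z. \<psi> z * F z))" by (rule B(2)[OF pF])
    also have "\<dots> \<le> B * sqrt (D\<^sup>2 * N2 F)"
      by (intro mult_left_mono real_sqrt_le_mono N2_mult_le pc disc_algebra_continuous F D B(1))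
    also have "\<dots> = B * D * sqrt (N2 F)" using D0 by (simp add: real_sqrt_mult)
    finally show "cmod (\<Lambda> (\<lambda>z. \<psi> z * F z)) \<le> B * D * sqrt (N2 F)" .
  qed (use B(1) D0 in auto)
qed

text \<open>An annihilating polynomial of least degree exists because the values on \<open>z ^ k\<close>, \<open>k < N\<close>,
  determine the functionals of the family; splitting off a root yields an eigenfunctional.\<close>
lemma eigenfunctional:
  assumes V: "\<And>\<Lambda>. V \<Lambda> \<Longrightarrow> hardy_functional \<Lambda>"
    and closed: "\<And>\<Lambda> q. V \<Lambda> \<Longrightarrow> V (\<lambda>F. \<Lambda> (\<lambda>z. poly q (\<phi> z) * F z))"
    and phi: "\<phi> \<in> disc_algebra"
    and fin: "\<And>\<Lambda> n. V \<Lambda> \<Longrightarrow> (\<And>k. k < N \<Longrightarrow> \<Lambda> (\<lambda>z. z ^ k) = 0) \<Longrightarrow> \<Lambda> (\<lambda>z. z ^ n) = 0"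
    and L0: "V \<Lambda>0" "\<Lambda>0 (\<lambda>z. z ^ m0) \<noteq> 0"
  obtains \<mu> \<Lambda> m where "V \<Lambda>" "\<Lambda> (\<lambda>z. z ^ m) \<noteq> 0" "\<And>F. F \<in> disc_algebra \<Longrightarrow> \<Lambda> (\<lambda>z. \<phi> z * F z) = \<mu> * \<Lambda> F"
proof -
  define A where "A p \<longleftrightarrow> p \<noteq> 0 \<and> (\<forall>n. \<Lambda>0 (\<lambda>z. poly p (\<phi> z) * z ^ n) = 0)" for p
  have H0: "hardy_functional \<Lambda>0" using V L0(1) .
  obtain a where a: "\<exists>j\<in>{..N}. a j \<noteq> 0" "\<forall>k<N. (\<Sum>j\<le>N. a j * \<Lambda>0 (\<lambda>z. \<phi> z ^ j * z ^ k)) = 0"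
    using linear_dependence[of "{..N}" N "\<lambda>j k. \<Lambda>0 (\<lambda>z. \<phi> z ^ j * z ^ k)"] by auto
  define p where "p = (\<Sum>j\<le>N. monom (a j) j)"
  have pk: "\<Lambda>0 (\<lambda>z. poly p (\<phi> z) * z ^ k) = (\<Sum>j\<le>N. a j * \<Lambda>0 (\<lambda>z. \<phi> z ^ j * z ^ k))" for k
  proof -
    have fA: "(\<lambda>z. \<phi> z ^ j * z ^ k) \<in> disc_algebra" for j by (intro disc_algebra_intros phi)
    have "(\<lambda>z. poly p (\<phi> z) * z ^ k) = (\<lambda>z. \<Sum>j\<le>N. a j * (\<phi> z ^ j * z ^ k))"
      by (simp add: p_def poly_sum poly_monom sum_distrib_right mult.assoc)
    then have "\<Lambda>0 (\<lambda>z. poly p (\<phi> z) * z ^ k) = (\<Sum>j\<le>N. \<Lambda>0 (\<lambda>z. a j * (\<phi> z ^ j * z ^ k)))"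
      using hardy_functional_sum[OF H0, of "{..N}" "\<lambda>j z. a j * (\<phi> z ^ j * z ^ k)"] disc_algebra_scale[OF fA] by simp
    then show ?thesis using hardy_functional_scale[OF H0 fA] by simp
  qed
  obtain j where j: "j \<le> N" "a j \<noteq> 0" using a(1) by auto
  have "coeff p j = a j" using j by (simp add: p_def coeff_sum sum.delta cong: if_cong)
  then have "p \<noteq> 0" using j by auto
  moreover have "\<Lambda>0 (\<lambda>z. poly p (\<phi> z) * z ^ n) = 0" for n
    using fin[OF closed[OF L0(1), of p], of n] pk a(2) by simp
  ultimately have "A p" by (simp add: A_def)
  then obtain p where p: "A p" "\<And>q. A q \<Longrightarrow> degree p \<le> degree q"
    using ex_has_least_nat[of A p degree] by blast
  have "degree p \<noteq> 0"
  proof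
    assume "degree p = 0"
    then obtain c where c: "p = [:c:]" by (rule degree_eq_zeroE)
    then have "c \<noteq> 0" using p(1) by (auto simp: A_def)
    have "\<Lambda>0 (\<lambda>z. c * z ^ m0) = 0" using p(1) c by (auto simp: A_def)
    then show False using hardy_functional_scale[OF H0 disc_algebra_power, of c m0] \<open>c \<noteq> 0\<close> L0(2) by simp
  qed
  then have "\<not> constant (poly p)" by (simp add: constant_degree)
  then obtain \<mu> where "poly p \<mu> = 0" using fundamental_theorem_of_algebra by blast
  then obtain q where q: "p = [:-\<mu>, 1:] * q" unfolding poly_eq_0_iff_dvd by (elim dvdE)
  have q0: "q \<noteq> 0" using p(1) q by (auto simp: A_def)
  then have "degree p = Suc (degree q)" unfolding q by (subst degree_mult_eq) auto
  then have "\<not> A q" using p(2)[of q] by auto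
  then obtain m where m: "\<Lambda>0 (\<lambda>z. poly q (\<phi> z) * z ^ m) \<noteq> 0" using q0 by (auto simp: A_def)
  show ?thesis
  proof (rule that[of "\<lambda>F. \<Lambda>0 (\<lambda>z. poly q (\<phi> z) * F z)" m \<mu>])
    show "V (\<lambda>F. \<Lambda>0 (\<lambda>z. poly q (\<phi> z) * F z))" by (rule closed[OF L0(1)])
    show "\<Lambda>0 (\<lambda>z. poly q (\<phi> z) * z ^ m) \<noteq> 0" by (rule m)
    fix F assume F: "F \<in> disc_algebra"
    have qA: "(\<lambda>z. poly q (\<phi> z) * F z) \<in> disc_algebra" by (intro disc_algebra_intros disc_algebra_poly phi F)
    have qA': "(\<lambda>z. poly q (\<phi> z) * (\<phi> z * F z)) \<in> disc_algebra" by (intro disc_algebra_intros disc_algebra_poly phi F)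
    have "0 = \<Lambda>0 (\<lambda>z. poly p (\<phi> z) * F z)"
      using hardy_functional_eq_0[OF hardy_functional_mult[OF H0 disc_algebra_poly[OF phi, of p]] _ F] p(1)
          by (simp add: A_def)
    also have "(\<lambda>z. poly p (\<phi> z) * F z) = (\<lambda>z. poly q (\<phi> z) * (\<phi> z * F z) - \<mu> * (poly q (\<phi> z) * F z))"
      unfolding q by (simp add: algebra_simps)
    also have "\<Lambda>0 \<dots> = \<Lambda>0 (\<lambda>z. poly q (\<phi> z) * (\<phi> z * F z)) - \<mu> * \<Lambda>0 (\<lambda>z. poly q (\<phi> z) * F z)"
      using hardy_functional_diff[OF H0 qA' disc_algebra_scale[OF qA]] hardy_functional_scale[OF H0 qA] by simp
    finally show "\<Lambda>0 (\<lambda>z. poly q (\<phi> z) * (\<phi> z * F z)) = \<mu> * \<Lambda>0 (\<lambda>z. poly q (\<phi> z) * F z)" by simp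
  qed
qed

text \<open>The quotient is holomorphic inside because the singularity at \<open>c\<close> is
  removable, and continuous near the circle, which stays away from \<open>c\<close>; an intermediate
  radius \<open>s\<close> joins the two regions.\<close>

lemma disc_algebra_divide:
  assumes F: "F \<in> disc_algebra" and c: "cmod c < 1"
  obtains G where "G \<in> disc_algebra" "\<And>z. F z = F c + (z - c) * G z" "G c = deriv F c"
proof -
  define G where "G z = (if z = c then deriv F c else (F z - F c) / (z - c))" for z
  have hol: "G holomorphic_on ball 0 1" unfolding G_def
    using F by (intro pole_lemma_open) (auto simp: disc_algebra_def)
  obtain s where s: "cmod c < s" "s < 1" using dense[OF c] by blast
  define T where "T = {z. s \<le> cmod z} \<inter> cball (0::complex) 1"
  have "continuous_on (cball 0 s \<union> T) G"
  proof (rule continuous_on_closed_Un)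
    show "closed (cball (0::complex) s)" by simp
    have "closed {z::complex. s \<le> cmod z}" by (intro closed_Collect_le continuous_intros)
    then show "closed T" unfolding T_def by (intro closed_Int) auto
    show "continuous_on (cball 0 s) G"
      by (rule continuous_on_subset[OF holomorphic_on_imp_continuous_on[OF hol]]) (use s in auto)
    have "continuous_on T (\<lambda>z. (F z - F c) / (z - c))"
      using F s by (intro continuous_intros) (auto simp: disc_algebra_def T_def elim: continuous_on_subset)
    moreover have "(F z - F c) / (z - c) = G z" if "z \<in> T" for z using that s by (auto simp: G_def T_def)
    ultimately show "continuous_on T G" by (simp cong: continuous_on_cong)
  qed
  moreover have "cball 0 s \<union> T = cball 0 1" using s by (auto simp: T_def)
  ultimately have "G \<in> disc_algebra" using hol by (simp add: disc_algebra_def)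
  then show ?thesis using that[of G] by (auto simp: G_def)
qed

text \<open>Eigenfunctionals of the shift are multiples of point evaluations: the values
  \<open>c ^ n * \<Lambda> 1\<close> on the powers are square summable only for
  \<open>cmod c < 1\<close>, and then \<open>F - F c\<close> is a multiple of \<open>z - c\<close>,
  on which \<open>\<Lambda>\<close> vanishes.\<close>

lemma shift_eigenfunctional:
  assumes L: "hardy_functional \<Lambda>" and eig: "\<And>F. F \<in> disc_algebra \<Longrightarrow> \<Lambda> (\<lambda>z. z * F z) = c * \<Lambda> F"
    and m: "\<Lambda> (\<lambda>z. z ^ m) \<noteq> 0"
  shows "cmod c < 1" "\<Lambda> (\<lambda>z. 1) \<noteq> 0" "\<And>F. F \<in> disc_algebra \<Longrightarrow> \<Lambda> F = F c * \<Lambda> (\<lambda>z. 1)"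
proof -
  have pw: "\<Lambda> (\<lambda>z. z ^ n) = c ^ n * \<Lambda> (\<lambda>z. 1)" for n
  proof (induction n)
    case (Suc n)
    then show ?case using eig[OF disc_algebra_power[of n]] by simp
  qed simp
  show 1: "\<Lambda> (\<lambda>z. 1) \<noteq> 0" using m pw[of m] by auto
  show c: "cmod c < 1"
  proof (rule ccontr)
    assume "\<not> cmod c < 1"
    have "(\<lambda>n. (cmod (\<Lambda> (\<lambda>z. z ^ n)))\<^sup>2) \<longlonglongrightarrow> 0"
      by (rule summable_LIMSEQ_zero[OF hardy_functional_square_summable[OF L]])
    moreover have "(cmod (\<Lambda> (\<lambda>z. 1)))\<^sup>2 \<le> (cmod (\<Lambda> (\<lambda>z. z ^ n)))\<^sup>2" for n
    proof -
      have "1 \<le> cmod c ^ n" using \<open>\<not> cmod c < 1\<close> by (simp add: one_le_power)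
      then have "1 * cmod (\<Lambda> (\<lambda>z. 1)) \<le> cmod c ^ n * cmod (\<Lambda> (\<lambda>z. 1))" by (intro mult_right_mono) auto
      then show ?thesis unfolding pw by (intro power_mono) (auto simp: norm_mult norm_power)
    qed
    ultimately have "(cmod (\<Lambda> (\<lambda>z. 1)))\<^sup>2 \<le> 0" by (rule LIMSEQ_le_const[OF _ exI, OF _ allI, OF _ impI])
    then show False using 1 by simp
  qed
  show "\<Lambda> F = F c * \<Lambda> (\<lambda>z. 1)" if F: "F \<in> disc_algebra" for F
  proof -
    obtain G where G: "G \<in> disc_algebra" "\<And>z. F z = F c + (z - c) * G z"
      using disc_algebra_divide[OF F c] by metis
    have zG: "(\<lambda>z. z * G z) \<in> disc_algebra" by (intro disc_algebra_intros G)
    have Fe: "F = (\<lambda>z. F c * 1 + (z * G z - c * G z))" using G(2) by (auto simp: algebra_simps)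
    have "\<Lambda> F = \<Lambda> (\<lambda>z. F c * 1) + \<Lambda> (\<lambda>z. z * G z - c * G z)"
      by (subst Fe) (intro hardy_functional_add L disc_algebra_intros G)
    also have "\<Lambda> (\<lambda>z. F c * 1) = F c * \<Lambda> (\<lambda>z. 1)" by (rule hardy_functional_scale[OF L disc_algebra_intros(1)])
    also have "\<Lambda> (\<lambda>z. z * G z - c * G z) = \<Lambda> (\<lambda>z. z * G z) - \<Lambda> (\<lambda>z. c * G z)"
      by (intro hardy_functional_diff L zG disc_algebra_scale G)
    also have "\<dots> = 0" using eig[OF G(1)] hardy_functional_scale[OF L G(1)] by simp
    finally show ?thesis by simp
  qed
qed

locale embedded_disc = separated_disc +
  assumes inj_ball: "inj_on f (ball 0 1)"
    and immersion: "\<And>z. z \<in> ball 0 1 \<Longrightarrow> \<exists>i. deriv (\<lambda>w. f w $ i) z \<noteq> 0"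
begin

text \<open>A functional annihilating the algebra generated by the components of \<open>f\<close> would produce, by
  successive eigenfunctional extraction, a point evaluation on which \<open>f\<close> is not an immersion.\<close>
lemma annihilator_trivial:
  assumes L: "hardy_functional \<Lambda>" and words: "\<And>xs. \<Lambda> (word f xs) = 0"
  shows "\<Lambda> (\<lambda>z. z ^ n) = 0"
proof (rule ccontr)
  assume nz: "\<Lambda> (\<lambda>z. z ^ n) \<noteq> 0"
  obtain N C where N: "0 < N" "\<And>u. u \<in> disc_algebra \<Longrightarrow> N2 u / (4 * C0) \<le> Q u + C * (\<Sum>k<N. cmod (coef u k))\<^sup>2"
    using N2_le_Q_plus_coefficients by metis
  define E where "E \<Lambda> \<nu> i \<longleftrightarrow> (\<forall>F\<in>disc_algebra. \<Lambda> (\<lambda>z. f z $ i * F z) = \<nu> * \<Lambda> F)"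
      for \<Lambda> :: "(complex \<Rightarrow> complex) \<Rightarrow> complex" and \<nu> i
  have E_mult: "E (\<lambda>F. \<Lambda> (\<lambda>z. \<psi> z * F z)) \<nu> i" if "E \<Lambda> \<nu> i" "\<psi> \<in> disc_algebra" for \<Lambda> \<nu> i \<psi>
    unfolding E_def
  proof
    fix F assume "F \<in> disc_algebra"
    then have "\<Lambda> (\<lambda>z. f z $ i * (\<psi> z * F z)) = \<nu> * \<Lambda> (\<lambda>z. \<psi> z * F z)"
      using that disc_algebra_intros(5)[of \<psi> F] by (auto simp: E_def)
    then show "\<Lambda> (\<lambda>z. \<psi> z * (f z $ i * F z)) = \<nu> * \<Lambda> (\<lambda>z. \<psi> z * F z)" by (simp add: mult.left_commute)
  qed
  have wA: "word f xs \<in> disc_algebra" for xs by (intro word_disc_algebra comp)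
  define V0 where "V0 \<Lambda> \<longleftrightarrow> hardy_functional \<Lambda> \<and> (\<forall>xs. \<Lambda> (word f xs) = 0)" for \<Lambda>
  have V0_poly: "V0 (\<lambda>F. \<Lambda> (\<lambda>z. poly q (f z $ i) * F z))" if V: "V0 \<Lambda>" for \<Lambda> q i
  proof -
    have H: "hardy_functional \<Lambda>" using V by (simp add: V0_def)
    have "\<Lambda> (\<lambda>z. poly q (f z $ i) * word f xs z) = 0" for xs
    proof (induction q arbitrary: xs)
      case 0 then show ?case using hardy_functional_zero[OF H] by simp
    next
      case (pCons a q)
      have "(\<lambda>z. poly (pCons a q) (f z $ i) * word f xs z) = (\<lambda>z. a * word f xs z + poly q (f z $ i) * word f (i # xs) z)"
        by (simp add: word_def algebra_simps)
      then show ?case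
        using hardy_functional_add[OF H disc_algebra_scale[OF wA[of xs], of a] disc_algebra_intros(5)[OF
            disc_algebra_poly[OF comp[of i], of q] wA[of "i # xs"]]]
          hardy_functional_scale[OF H wA] V pCons.IH[of "i # xs"] by (simp add: V0_def)
    qed
    then show ?thesis unfolding V0_def using hardy_functional_mult[OF H disc_algebra_poly[OF comp]] by simp
  qed
  \<comment> \<open>The components are treated one at a time. Multiplying the functional by a
    polynomial in a further component preserves the eigenvalue equations already obtained, since
    multiplications commute.\<close>
  have "\<exists>\<nu> \<Lambda> m. V0 \<Lambda> \<and> \<Lambda> (\<lambda>z. z ^ m) \<noteq> 0 \<and> (\<forall>i\<in>I. E \<Lambda> (\<nu> i) i)" if "finite I" for I
    using that
  proof (induction I)
    case empty
    then show ?case using L words nz by (auto simp: V0_def)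
  next
    case (insert j I)
    then obtain \<nu> \<Lambda>1 m1 where 1: "V0 \<Lambda>1" "\<Lambda>1 (\<lambda>z. z ^ m1) \<noteq> 0" "\<forall>i\<in>I. E \<Lambda>1 (\<nu> i) i" by blast
    define V where "V \<Lambda> \<longleftrightarrow> V0 \<Lambda> \<and> (\<forall>i\<in>I. E \<Lambda> (\<nu> i) i)" for \<Lambda>
    obtain \<mu> \<Lambda>2 m2 where 2: "V \<Lambda>2" "\<Lambda>2 (\<lambda>z. z ^ m2) \<noteq> 0" "\<And>F. F \<in> disc_algebra \<Longrightarrow> \<Lambda>2 (\<lambda>z. f z $ j * F z) = \<mu> * \<Lambda>2 F"
    proof (rule eigenfunctional[where V=V and \<phi>="\<lambda>z. f z $ j" and N=N])
      show "V (\<lambda>F. \<Lambda> (\<lambda>z. poly q (f z $ j) * F z))" if "V \<Lambda>" for \<Lambda> q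
        using that V0_poly[of \<Lambda> q j] E_mult[OF _ disc_algebra_poly[OF comp, of q j]] unfolding V_def by blast
      show "\<Lambda> (\<lambda>z. z ^ n) = 0" if "V \<Lambda>" "\<And>k. k < N \<Longrightarrow> \<Lambda> (\<lambda>z. z ^ k) = 0" for \<Lambda> n
        by (rule hardy_functional_vanishing[OF _ _ N(2)]) (use that in \<open>auto simp: V_def V0_def\<close>)
    qed (use 1 comp in \<open>auto simp: V_def V0_def\<close>)
    have "\<forall>i\<in>insert j I. E \<Lambda>2 ((\<nu>(j := \<mu>)) i) i"
      using 2 insert.hyps by (auto simp: V_def E_def)
    then show ?case using 2(1,2) unfolding V_def by blast
  qed
  from this[of UNIV] obtain \<nu> \<Lambda>0 m0 where 0: "V0 \<Lambda>0" "\<Lambda>0 (\<lambda>z. z ^ m0) \<noteq> 0" "\<And>i. E \<Lambda>0 (\<nu> i) i" by auto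
  have H0: "hardy_functional \<Lambda>0" using 0 by (simp add: V0_def)
  \<comment> \<open>Used twice: with all joint eigenfunctionals, to find a point \<open>c\<close>
    with \<open>f c = \<nu>\<close>, and with those that also kill the multiples of every
    \<open>G i\<close>, to find a point where all \<open>G i\<close> vanish.\<close>
  have point: "\<exists>\<Lambda> c. V \<Lambda> \<and> cmod c < 1 \<and> \<Lambda> (\<lambda>z. 1) \<noteq> 0 \<and> (\<forall>F\<in>disc_algebra. \<Lambda> F = F c * \<Lambda> (\<lambda>z. 1)) \<and> (\<forall>i. f c $ i = \<nu> i)"
    if V: "\<And>\<Lambda>. V \<Lambda> \<Longrightarrow> hardy_functional \<Lambda> \<and> (\<forall>i. E \<Lambda> (\<nu> i) i)"
      and closed: "\<And>\<Lambda> \<psi>. V \<Lambda> \<Longrightarrow> \<psi> \<in> disc_algebra \<Longrightarrow> V (\<lambda>F. \<Lambda> (\<lambda>z. \<psi> z * F z))"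
      and start: "V \<Lambda>s" "\<Lambda>s (\<lambda>z. z ^ m) \<noteq> 0" for V \<Lambda>s and m :: nat
  proof -
    obtain c \<Lambda> m where 1: "V \<Lambda>" "\<Lambda> (\<lambda>z. z ^ m) \<noteq> 0" "\<And>F. F \<in> disc_algebra \<Longrightarrow> \<Lambda> (\<lambda>z. z * F z) = c * \<Lambda> F"
    proof (rule eigenfunctional[where V=V and \<phi>="\<lambda>z. z" and N=N])
      show "V (\<lambda>F. \<Lambda> (\<lambda>z. poly q z * F z))" if "V \<Lambda>" for \<Lambda> q
        using closed[OF that disc_algebra_poly[OF disc_algebra_intros(2)]] .
      show "\<Lambda> (\<lambda>z. z ^ n) = 0" if v: "V \<Lambda>" "\<And>k. k < N \<Longrightarrow> \<Lambda> (\<lambda>z. z ^ k) = 0" for \<Lambda> n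
      proof (rule hardy_functional_vanishing[OF _ _ N(2)])
        \<comment> \<open>By the eigenvalue equations the value on a word is a multiple of the value
          on \<open>z ^ 0\<close>, which is zero because \<open>0 < N\<close>.\<close>
        show "\<Lambda> (word f xs) = 0" for xs
        proof (induction xs)
          case Nil
          then show ?case using v(2)[of 0] N(1) by (simp add: word_def[abs_def])
        next
          case (Cons i xs)
          have "word f (i # xs) = (\<lambda>z. f z $ i * word f xs z)" by (simp add: word_def[abs_def])
          then show ?case using V[OF v(1)] wA[of xs] Cons by (simp add: E_def)
        qed
      qed (use V v in auto)
    qed (use V start disc_algebra_intros(2) in auto)
    have H: "hardy_functional \<Lambda>" using V 1(1) by blast
    have S: "cmod c < 1" "\<Lambda> (\<lambda>z. 1) \<noteq> 0" "\<And>F. F \<in> disc_algebra \<Longrightarrow> \<Lambda> F = F c * \<Lambda> (\<lambda>z. 1)"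
      by (rule shift_eigenfunctional(1)[OF H _ 1(2)], erule 1(3),
          rule shift_eigenfunctional(2)[OF H _ 1(2)], erule 1(3),
          rule shift_eigenfunctional(3)[OF H _ 1(2)], erule 1(3))
    have "f c $ i = \<nu> i" for i
    proof -
      have "E \<Lambda> (\<nu> i) i" using V[OF 1(1)] by blast
      then have "\<Lambda> (\<lambda>z. f z $ i * 1) = \<nu> i * \<Lambda> (\<lambda>z. 1)"
        unfolding E_def by (rule bspec[OF _ disc_algebra_intros(1)])
      then show ?thesis using S(3)[OF comp[of i]] S(2) by simp
    qed
    then show ?thesis using 1(1) S by blast
  qed
  obtain c where c: "cmod c < 1" "\<And>i. f c $ i = \<nu> i"
  proof -
    define V1 where "V1 \<Lambda> \<longleftrightarrow> hardy_functional \<Lambda> \<and> (\<forall>i. E \<Lambda> (\<nu> i) i)" for \<Lambda>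
    have "V1 (\<lambda>F. \<Lambda> (\<lambda>z. \<psi> z * F z))" if "V1 \<Lambda>" "\<psi> \<in> disc_algebra" for \<Lambda> \<psi>
      using that E_mult hardy_functional_mult unfolding V1_def by blast
    then show ?thesis using point[of V1 \<Lambda>0 m0] H0 0(2,3) that unfolding V1_def by blast
  qed
  have "\<exists>G. G \<in> disc_algebra \<and> (\<forall>z. f z $ i = f c $ i + (z - c) * G z) \<and> G c = deriv (\<lambda>z. f z $ i) c" for i
    using disc_algebra_divide[OF comp[of i] c(1)] by metis
  then obtain G where G: "\<And>i. G i \<in> disc_algebra" "\<And>i z. f z $ i = f c $ i + (z - c) * G i z"
    "\<And>i. G i c = deriv (\<lambda>z. f z $ i) c" by metis
  \<comment> \<open>\<open>\<Lambda>1\<close> tests \<open>\<Lambda>0\<close> on multiples of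
    \<open>z - c\<close>. It kills the multiples of \<open>G i\<close>, because
    \<open>(z - c) * G i z = f z $ i - \<nu> i\<close>.\<close>
  define \<Lambda>1 where "\<Lambda>1 F = \<Lambda>0 (\<lambda>z. (z - c) * F z)" for F
  have zc: "(\<lambda>z. z - c) \<in> disc_algebra" by (intro disc_algebra_intros)
  have H1: "hardy_functional \<Lambda>1" unfolding \<Lambda>1_def by (rule hardy_functional_mult[OF H0 zc])
  \<comment> \<open>Otherwise \<open>\<Lambda>0\<close> is a nonzero multiple of a point evaluation
    and does not vanish on the empty word, the constant function.\<close>
  have "\<exists>m. \<Lambda>1 (\<lambda>z. z ^ m) \<noteq> 0"
  proof (rule ccontr)
    assume "\<not> ?thesis"
    then have z: "\<Lambda>1 F = 0" if "F \<in> disc_algebra" for F using hardy_functional_eq_0[OF H1 _ that] by blast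
    have "\<Lambda>0 (\<lambda>z. z * F z) = c * \<Lambda>0 F" if F: "F \<in> disc_algebra" for F
    proof -
      have "\<Lambda>0 (\<lambda>z. z * F z - c * F z) = \<Lambda>0 (\<lambda>z. z * F z) - \<Lambda>0 (\<lambda>z. c * F z)"
        by (intro hardy_functional_diff H0 disc_algebra_intros F)
      then show ?thesis using z[OF F] hardy_functional_scale[OF H0 F, of c] by (simp add: \<Lambda>1_def left_diff_distrib)
    qed
    then have "\<Lambda>0 (\<lambda>z. 1) \<noteq> 0" by (rule shift_eigenfunctional(2)[OF H0 _ 0(2)])
    moreover have "\<Lambda>0 (word f []) = 0" using 0(1) by (simp add: V0_def)
    ultimately show False by (simp add: word_def[abs_def])
  qed
  then obtain m1 where m1: "\<Lambda>1 (\<lambda>z. z ^ m1) \<noteq> 0" ..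
  define V2 where "V2 \<Lambda> \<longleftrightarrow> hardy_functional \<Lambda> \<and> (\<forall>i. E \<Lambda> (\<nu> i) i) \<and> (\<forall>i. \<forall>F\<in>disc_algebra. \<Lambda> (\<lambda>z. G i z * F z) = 0)" for \<Lambda>
  have "V2 \<Lambda>1"
    unfolding V2_def
  proof (intro conjI allI ballI)
    show "hardy_functional \<Lambda>1" by (rule H1)
    show "E \<Lambda>1 (\<nu> i) i" for i using E_mult[OF 0(3) zc] unfolding \<Lambda>1_def[abs_def] .
    fix i F assume F: "F \<in> disc_algebra"
    have e: "(z - c) * (G i z * F z) = f z $ i * F z - \<nu> i * F z" for z
      unfolding G(2)[of z i] c(2)[of i] by (simp add: algebra_simps)
    have "\<Lambda>1 (\<lambda>z. G i z * F z) = \<Lambda>0 (\<lambda>z. f z $ i * F z) - \<Lambda>0 (\<lambda>z. \<nu> i * F z)"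
      unfolding \<Lambda>1_def e by (intro hardy_functional_diff H0 disc_algebra_intros F comp)
    then show "\<Lambda>1 (\<lambda>z. G i z * F z) = 0"
      using 0(3)[of i] F hardy_functional_scale[OF H0 F] by (simp add: E_def)
  qed
  have cl2: "V2 (\<lambda>F. \<Lambda> (\<lambda>z. \<psi> z * F z))" if "V2 \<Lambda>" "\<psi> \<in> disc_algebra" for \<Lambda> \<psi>
  proof -
    have "\<Lambda> (\<lambda>z. \<psi> z * (G i z * F z)) = 0" if F: "F \<in> disc_algebra" for i F
    proof -
      have "\<Lambda> (\<lambda>z. G i z * (\<psi> z * F z)) = 0"
        using \<open>V2 \<Lambda>\<close> disc_algebra_intros(5)[OF \<open>\<psi> \<in> disc_algebra\<close> F] by (auto simp: V2_def)
      then show ?thesis by (simp add: mult.left_commute)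
    qed
    then show ?thesis using that E_mult hardy_functional_mult unfolding V2_def by blast
  qed
  have "\<exists>\<Lambda> c. V2 \<Lambda> \<and> cmod c < 1 \<and> \<Lambda> (\<lambda>z. 1) \<noteq> 0 \<and> (\<forall>F\<in>disc_algebra. \<Lambda> F = F c * \<Lambda> (\<lambda>z. 1)) \<and> (\<forall>i. f c $ i = \<nu> i)"
  proof (rule point)
    show "hardy_functional \<Lambda> \<and> (\<forall>i. E \<Lambda> (\<nu> i) i)" if "V2 \<Lambda>" for \<Lambda> using that unfolding V2_def by blast
  qed (fact cl2 \<open>V2 \<Lambda>1\<close> m1)+
  then obtain \<Lambda>2 c' where 2: "V2 \<Lambda>2" "cmod c' < 1" "\<Lambda>2 (\<lambda>z. 1) \<noteq> 0" "\<And>F. F \<in> disc_algebra \<Longrightarrow> \<Lambda>2 F = F c' * \<Lambda>2 (\<lambda>z. 1)"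
    "\<And>i. f c' $ i = \<nu> i"
    by blast
  \<comment> \<open>The eigenvalues determine the point by injectivity. So the \<open>G i\<close>
    vanish at \<open>c\<close> itself, where they are the derivatives of the components.\<close>
  have "f c' = f c" using 2(5) c(2) by (simp add: vec_eq_iff)
  then have cc: "c' = c" using inj_ball 2(2) c(1) by (auto dest: inj_onD)
  have "deriv (\<lambda>z. f z $ i) c = 0" for i
  proof -
    have "\<forall>F\<in>disc_algebra. \<Lambda>2 (\<lambda>z. G i z * F z) = 0" using 2(1) unfolding V2_def by blast
    then have "\<Lambda>2 (\<lambda>z. G i z * 1) = 0" by (rule bspec[OF _ disc_algebra_intros(1)])
    then show ?thesis using 2(4)[OF G(1)[of i]] 2(3) G(3)[of i] cc by simp
  qed
  then show False using immersion[of c] c(1) by simp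
qed

end

section \<open>Comparison with the Hardy space\<close>

lemma bounded_coordinates_subsequence:
  fixes x :: "nat \<Rightarrow> nat \<Rightarrow> complex"
  assumes "\<And>n k. cmod (x n k) \<le> B"
  shows "\<exists>r. strict_mono r \<and> (\<forall>k<N. convergent (\<lambda>n. x (r n) k))"
proof (induction N)
  case 0
  show ?case by (intro exI[of _ id]) (simp add: strict_mono_def)
next
  case (Suc N)
  then obtain r where r: "strict_mono r" "\<forall>k<N. convergent (\<lambda>n. x (r n) k)" by blast
  have "bounded (range (\<lambda>n. x (r n) N))" unfolding bounded_iff using assms by blast
  then obtain l s where s: "strict_mono s" "((\<lambda>n. x (r n) N) \<circ> s) \<longlonglongrightarrow> l"
    using bounded_imp_convergent_subsequence by blast
  have "convergent (\<lambda>n. x ((r \<circ> s) n) k)" if "k < Suc N" for k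
  proof (cases "k = N")
    case True
    then show ?thesis using s(2) by (auto simp: convergent_def o_def)
  next
    case False
    then have "convergent (\<lambda>n. x (r n) k)" using r that by simp
    then obtain l where "(\<lambda>n. x (r n) k) \<longlonglongrightarrow> l" by (auto simp: convergent_def)
    from LIMSEQ_subseq_LIMSEQ[OF this s(1)] show ?thesis by (auto simp: convergent_def o_def)
  qed
  then show ?case using strict_mono_o[OF r(1) s(1)] by blast
qed

context separated_disc
begin

lemma word_continuous: "continuous_on circle (word f xs)"
  by (intro disc_algebra_continuous word_disc_algebra comp)

lemma Q_scale:
  assumes "u \<in> disc_algebra" shows "Q (\<lambda>z. \<gamma> * u z) = (cmod \<gamma>)\<^sup>2 * Q u"
proof -
  have "Qn f n (\<lambda>z. \<gamma> * u z) = (cmod \<gamma>)\<^sup>2 * Qn f n u" for n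
    unfolding Qn_def ip_scale_right sum_distrib_left by (simp add: norm_mult power_mult_distrib)
  then show ?thesis unfolding Q_def using suminf_mult[OF Qn_summable[OF assms]] by simp
qed

lemma Q_diff_le:
  assumes u: "u \<in> disc_algebra" and v: "v \<in> disc_algebra"
  shows "Q (\<lambda>z. u z - v z) \<le> 2 * Q u + 2 * Q v"
proof -
  have "(cmod (a - b))\<^sup>2 \<le> 2 * (cmod a)\<^sup>2 + 2 * (cmod b)\<^sup>2" for a b
  proof -
    have "(cmod (a - b))\<^sup>2 \<le> (cmod a + cmod b)\<^sup>2" by (intro power_mono norm_triangle_ineq4) auto
    also have "\<dots> \<le> 2 * (cmod a)\<^sup>2 + 2 * (cmod b)\<^sup>2"
      using sum_squares_bound[of "cmod a" "cmod b"] by (simp add: power2_sum)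
    finally show ?thesis .
  qed
  then have "Qn f n (\<lambda>z. u z - v z) \<le> 2 * Qn f n u + 2 * Qn f n v" for n
    unfolding Qn_def sum_distrib_left sum.distrib[symmetric]
    by (intro sum_mono) (simp add: ip_diff_right[OF word_continuous disc_algebra_continuous[OF u]
        disc_algebra_continuous[OF v]])
  then have "Q (\<lambda>z. u z - v z) \<le> (\<Sum>n. 2 * Qn f n u + 2 * Qn f n v)"
    unfolding Q_def by (intro suminf_le Qn_summable disc_algebra_intros u v summable_add summable_mult)
  also have "\<dots> = 2 * Q u + 2 * Q v"
    unfolding Q_def using Qn_summable[OF u] Qn_summable[OF v]
    by (simp add: suminf_add[symmetric] suminf_mult summable_mult)
  finally show ?thesis .
qed

lemma Q_nonneg: "u \<in> disc_algebra \<Longrightarrow> 0 \<le> Q u"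
  unfolding Q_def by (intro suminf_nonneg Qn_summable Qn_nonneg)

lemma ip_word_le_Q:
  assumes "u \<in> disc_algebra" shows "(cmod (ip (word f xs) u))\<^sup>2 \<le> Q u"
proof -
  have "(cmod (ip (word f xs) u))\<^sup>2 \<le> Qn f (length xs) u"
    unfolding Qn_def by (rule member_le_sum) (auto simp: finite_words)
  also have "\<dots> \<le> Q u" unfolding Q_def
    using sum_le_suminf[OF Qn_summable[OF assms], of "{length xs}"] Qn_nonneg[of f] by simp
  finally show ?thesis .
qed

end

context embedded_disc
begin

text \<open>A normalised sequence along which \<open>Q\<close> tends to zero is Cauchy once its low coefficients
  converge; its limit functional would annihilate all words.\<close>
lemma N2_le_Q: "\<exists>C\<ge>0. \<forall>u\<in>disc_algebra. N2 u \<le> C * Q u"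
proof (rule ccontr)
  assume neg: "\<not> ?thesis"
  obtain N C where C: "0 \<le> C" and N: "\<And>u. u \<in> disc_algebra \<Longrightarrow> N2 u / (4 * C0) \<le> Q u + C * (\<Sum>k<N. cmod (coef u k))\<^sup>2"
    using N2_le_Q_plus_coefficients by metis
  have C0p: "0 < C0" using C0 c0 by simp
  have "\<exists>v\<in>disc_algebra. N2 v = 1 \<and> Q v \<le> 1 / real (Suc n)" for n
  proof -
    obtain u where u: "u \<in> disc_algebra" "real (Suc n) * Q u < N2 u"
      using neg by (meson not_le of_nat_0_le_iff)
    have "0 \<le> real (Suc n) * Q u" using Q_nonneg[OF u(1)] by (intro mult_nonneg_nonneg) auto
    then have n2: "0 < N2 u" using u(2) by linarith
    define c where "c = complex_of_real (1 / sqrt (N2 u))"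
    have c: "(cmod c)\<^sup>2 = 1 / N2 u" using n2 by (simp add: c_def norm_divide power_divide)
    have "N2 (\<lambda>z. c * u z) = 1" unfolding N2_scale c using n2 by simp
    moreover have "Q (\<lambda>z. c * u z) \<le> 1 / real (Suc n)"
      unfolding Q_scale[OF u(1)] c using u(2) n2 by (simp add: field_simps del: of_nat_Suc)
    ultimately show ?thesis using disc_algebra_scale[OF u(1)] by blast
  qed
  then obtain v0 where v0: "\<And>n. v0 n \<in> disc_algebra" "\<And>n. N2 (v0 n) = 1" "\<And>n. Q (v0 n) \<le> 1 / real (Suc n)" by metis
  have "cmod (coef (v0 n) k) \<le> 1" for n k
  proof -
    have "N2 (\<lambda>z. z ^ k) = 1" using N2_polynomial[of "{k}" "\<lambda>_. 1"] by simp
    then show ?thesis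
      using norm_ip_le[OF disc_algebra_continuous[OF v0(1)[of n]] disc_algebra_continuous[OF disc_algebra_power[of k]]]
      by (simp add: coef_def v0)
  qed
  then obtain r where r: "strict_mono r" "\<forall>k<N. convergent (\<lambda>n. coef (v0 (r n)) k)"
    using bounded_coordinates_subsequence[of "\<lambda>n k. coef (v0 n) k" 1 N] by auto
  define v where "v n = v0 (r n)" for n
  have v: "v n \<in> disc_algebra" "N2 (v n) = 1" for n using v0 by (auto simp: v_def)
  note vc = disc_algebra_continuous[OF v(1)]
  have vQ: "Q (v n) \<le> 1 / real (Suc n)" for n
  proof -
    have "Q (v n) \<le> 1 / real (Suc (r n))" using v0(3) by (simp add: v_def)
    also have "\<dots> \<le> 1 / real (Suc n)" using seq_suble[OF r(1), of n] by (intro divide_left_mono) auto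
    finally show ?thesis .
  qed
  have inv0: "(\<lambda>n. 1 / real (Suc n)) \<longlonglongrightarrow> 0" by (rule LIMSEQ_Suc[OF lim_1_over_n])
  have Qlim: "(\<lambda>n. Q (v n)) \<longlonglongrightarrow> 0"
    by (rule tendsto_sandwich[OF always_eventually always_eventually tendsto_const inv0]) (intro allI Q_nonneg v vQ)+
  obtain a where a: "\<And>k. k < N \<Longrightarrow> (\<lambda>n. coef (v n) k) \<longlonglongrightarrow> a k"
    using r(2) unfolding convergent_def v_def by metis
  \<comment> \<open>Chosen so that the squared distance of \<open>v m\<close> and \<open>v n\<close>
    is at most \<open>g m + g n\<close>; the factors \<open>4\<close> absorb the squares of
    sums.\<close>
  define g where "g n = 4 * C0 * (4 * Q (v n) + C * 4 * (\<Sum>k<N. cmod (coef (v n) k - a k))\<^sup>2)" for n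
  have "g \<longlonglongrightarrow> 4 * C0 * (4 * 0 + C * 4 * (\<Sum>k<N. cmod (a k - a k))\<^sup>2)"
    unfolding g_def by (intro tendsto_intros Qlim a) auto
  then have g0: "g \<longlonglongrightarrow> 0" by simp
  have diff: "N2 (\<lambda>z. v m z - v n z) \<le> g m + g n" for m n
  proof -
    define s where "s n = (\<Sum>k<N. cmod (coef (v n) k - a k))" for n
    have s0: "0 \<le> s n" for n unfolding s_def by (intro sum_nonneg) auto
    have vd: "(\<lambda>z. v m z - v n z) \<in> disc_algebra" by (intro disc_algebra_intros v)
    have "(\<Sum>k<N. cmod (coef (\<lambda>z. v m z - v n z) k)) \<le> s m + s n"
      unfolding s_def sum.distrib[symmetric]
    proof (rule sum_mono)
      fix k
      have "coef (\<lambda>z. v m z - v n z) k = (coef (v m) k - a k) - (coef (v n) k - a k)"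
        unfolding coef_def by (subst ip_diff_left) (auto intro!: vc continuous_intros)
      then show "cmod (coef (\<lambda>z. v m z - v n z) k) \<le> cmod (coef (v m) k - a k) + cmod (coef (v n) k - a k)"
        by (simp only: norm_triangle_ineq4)
    qed
    then have "(\<Sum>k<N. cmod (coef (\<lambda>z. v m z - v n z) k))\<^sup>2 \<le> (s m + s n)\<^sup>2" by (intro power_mono sum_nonneg) auto
    also have "\<dots> \<le> 4 * (s m)\<^sup>2 + 4 * (s n)\<^sup>2"
      using sum_squares_bound[of "s m" "s n"] zero_le_power2[of "s m"] zero_le_power2[of "s n"]
      unfolding power2_sum by linarith
    finally have "C * (\<Sum>k<N. cmod (coef (\<lambda>z. v m z - v n z) k))\<^sup>2 \<le> C * (4 * (s m)\<^sup>2 + 4 * (s n)\<^sup>2)"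
      using C by (rule mult_left_mono)
    moreover have "Q (\<lambda>z. v m z - v n z) \<le> 4 * Q (v m) + 4 * Q (v n)"
      using Q_diff_le[OF v(1) v(1), of m n] Q_nonneg[OF v(1)[of m]] Q_nonneg[OF v(1)[of n]] by linarith
    ultimately have "N2 (\<lambda>z. v m z - v n z) / (4 * C0) \<le> 4 * Q (v m) + 4 * Q (v n) + C * (4 * (s m)\<^sup>2 + 4 * (s n)\<^sup>2)"
      using N[OF vd] by linarith
    then have "N2 (\<lambda>z. v m z - v n z) \<le> 4 * C0 * (4 * Q (v m) + 4 * Q (v n) + C * (4 * (s m)\<^sup>2 + 4 * (s n)\<^sup>2))"
      using C0p by (simp add: pos_divide_le_eq mult.commute)
    then show ?thesis by (simp add: g_def s_def algebra_simps)
  qed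
  have conv: "convergent (\<lambda>n. ip F (v n))" if F: "F \<in> disc_algebra" for F
  proof -
    note Fc = disc_algebra_continuous[OF F]
    define B where "B = sqrt (N2 F) + 1"
    have B: "0 < B" using N2_nonneg[OF Fc] by (simp add: B_def add_nonneg_pos)
    have "Cauchy (\<lambda>n. ip F (v n))"
    proof (rule CauchyI)
      fix e :: real assume e: "0 < e"
      have "0 < (e / B)\<^sup>2 / 2" using e B by simp
      then obtain n0 where n0: "\<And>n. n \<ge> n0 \<Longrightarrow> g n < (e / B)\<^sup>2 / 2"
        using order_tendstoD(2)[OF g0] unfolding eventually_sequentially by blast
      have "cmod (ip F (v m) - ip F (v n)) < e" if "m \<ge> n0" "n \<ge> n0" for m n
      proof -
        have vd: "(\<lambda>z. v m z - v n z) \<in> disc_algebra" by (intro disc_algebra_intros v)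
        have "N2 (\<lambda>z. v m z - v n z) < (e / B)\<^sup>2" using diff[of m n] n0[OF that(1)] n0[OF that(2)] by simp
        then have s: "sqrt (N2 (\<lambda>z. v m z - v n z)) < e / B" using e B by (intro real_less_lsqrt) auto
        have "ip F (v m) - ip F (v n) = ip F (\<lambda>z. v m z - v n z)" by (rule ip_diff_right[OF Fc vc vc, symmetric])
        also have "cmod \<dots> \<le> sqrt (N2 F) * sqrt (N2 (\<lambda>z. v m z - v n z))"
            by (rule norm_ip_le[OF Fc disc_algebra_continuous[OF vd]])
        also have "\<dots> \<le> B * sqrt (N2 (\<lambda>z. v m z - v n z))"
          using N2_nonneg[OF disc_algebra_continuous[OF vd]] by (intro mult_right_mono) (auto simp: B_def)
        also have "\<dots> < B * (e / B)" using s B by (intro mult_strict_left_mono)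
        finally show ?thesis using B by simp
      qed
      then show "\<exists>M. \<forall>m\<ge>M. \<forall>n\<ge>M. norm (ip F (v m) - ip F (v n)) < e" by blast
    qed
    then show ?thesis by (rule Cauchy_convergent)
  qed
  define \<Lambda> where "\<Lambda> F = lim (\<lambda>n. ip F (v n))" for F
  have L: "(\<lambda>n. ip F (v n)) \<longlonglongrightarrow> \<Lambda> F" if "F \<in> disc_algebra" for F
    using conv[OF that] unfolding \<Lambda>_def by (simp add: convergent_LIMSEQ_iff)
  have H: "hardy_functional \<Lambda>"
    unfolding hardy_functional_def
  proof (intro conjI ballI allI exI[of _ 1])
    fix F assume F: "F \<in> disc_algebra"
    note Fc = disc_algebra_continuous[OF F]
    show "\<Lambda> (\<lambda>z. c * F z) = c * \<Lambda> F" for c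
      using LIMSEQ_unique[OF L[OF disc_algebra_scale[OF F, of c]]] tendsto_mult[OF tendsto_const[of c] L[OF F]]
      unfolding ip_scale_left by blast
    show "\<Lambda> (\<lambda>z. F z + G z) = \<Lambda> F + \<Lambda> G" if G: "G \<in> disc_algebra" for G
      using LIMSEQ_unique[OF L[OF disc_algebra_intros(3)[OF F G]]] tendsto_add[OF L[OF F] L[OF G]]
      unfolding ip_add_left[OF Fc disc_algebra_continuous[OF G] vc] by blast
    have "cmod (ip F (v n)) \<le> 1 * sqrt (N2 F)" for n
      using norm_ip_le[OF Fc vc[of n]] v(2)[of n] by simp
    then show "cmod (\<Lambda> F) \<le> 1 * sqrt (N2 F)"
      by (intro LIMSEQ_le_const2[OF tendsto_norm[OF L[OF F]]]) blast
  qed auto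
  have W: "\<Lambda> (word f xs) = 0" for xs
  proof -
    have "(\<lambda>n. (cmod (ip (word f xs) (v n)))\<^sup>2) \<longlonglongrightarrow> 0"
      by (rule tendsto_sandwich[OF always_eventually always_eventually tendsto_const Qlim])
        (intro allI zero_le_power2 ip_word_le_Q v)+
    moreover have "(\<lambda>n. (cmod (ip (word f xs) (v n)))\<^sup>2) \<longlonglongrightarrow> (cmod (\<Lambda> (word f xs)))\<^sup>2"
      by (intro tendsto_intros L word_disc_algebra comp)
    ultimately have "(cmod (\<Lambda> (word f xs)))\<^sup>2 = 0" by (rule LIMSEQ_unique[symmetric])
    then show ?thesis by simp
  qed
  \<comment> \<open>The limits of the low coefficients are conjugate values of the limit functional
    on powers, hence zero. The lower bound would then let vectors of norm one tend to zero.\<close>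
  have "a k = 0" if "k < N" for k
  proof -
    have "(\<lambda>n. ip (\<lambda>z. z ^ k) (v n)) \<longlonglongrightarrow> 0" using L[OF disc_algebra_power[of k]] annihilator_trivial[OF H W] by simp
    then have "(\<lambda>n. cnj (ip (\<lambda>z. z ^ k) (v n))) \<longlonglongrightarrow> cnj 0" by (rule tendsto_cnj)
    moreover have "cnj (ip (\<lambda>z. z ^ k) (v n)) = coef (v n) k" for n
      unfolding coef_def by (rule ip_commute[symmetric]) (auto intro!: vc continuous_intros)
    ultimately show ?thesis using LIMSEQ_unique[OF a[OF that]] by simp
  qed
  then have "(\<lambda>n. Q (v n) + C * (\<Sum>k<N. cmod (coef (v n) k))\<^sup>2) \<longlonglongrightarrow> 0 + C * (\<Sum>k<N. cmod (0::complex))\<^sup>2"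
    using a by (intro tendsto_intros Qlim) fastforce
  moreover have "1 / (4 * C0) \<le> Q (v n) + C * (\<Sum>k<N. cmod (coef (v n) k))\<^sup>2" for n
    using N[OF v(1)[of n]] v(2) by simp
  ultimately have "1 / (4 * C0) \<le> 0" by (intro LIMSEQ_le_const) auto
  then show False using C0p by (simp add: divide_le_0_iff)
qed

text \<open>Pairing with a kernel combination evaluates the words at its points, and the words of
  length \<open>m\<close> add up to the m-th term of the geometric series of
  \<open>kernel_f\<close>. Thus \<open>Q\<close> and \<open>N2\<close>, restricted to kernel
  combinations, are the quadratic forms of the two kernels, and inequalities between them become
  domination of kernels.\<close>

lemma Q_szego_comb:
  assumes lt: "\<And>z. z \<in> ball 0 1 \<Longrightarrow> norm (f z) < 1" and x: "\<And>i. i < n \<Longrightarrow> x i \<in> ball 0 1"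
  shows "of_real (Q (szego_comb n x \<alpha>)) = (\<Sum>i<n. \<Sum>j<n. cnj (\<alpha> i) * \<alpha> j * kernel_f f (x i) (x j))"
proof -
  define u where "u = szego_comb n x \<alpha>"
  have u: "u \<in> disc_algebra" unfolding u_def by (rule szego_comb_disc_algebra[OF x])
  have "complex_of_real (Qn f m u) = (\<Sum>i<n. \<Sum>j<n. cnj (\<alpha> i) * \<alpha> j * cinner (f (x i)) (f (x j)) ^ m)" for m
  proof -
    have "complex_of_real (Qn f m u) = (\<Sum>xs | length xs = m. of_real ((cmod (\<Sum>i<n. cnj (\<alpha> i) * word f xs (x i)))\<^sup>2))"
      unfolding Qn_def u_def of_real_sum using ip_szego_comb[OF word_disc_algebra[OF comp] x] by simp
    also have "\<dots> = (\<Sum>xs | length xs = m. \<Sum>i<n. \<Sum>j<n. cnj (\<alpha> i) * \<alpha> j * (word f xs (x i) * cnj (word f xs (x j))))"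
      by (simp only: rank_one_quadratic_form)
    also have "\<dots> = (\<Sum>i<n. \<Sum>j<n. \<Sum>xs | length xs = m. cnj (\<alpha> i) * \<alpha> j * (word f xs (x i) * cnj (word f xs (x j))))"
      by (subst sum.swap) (rule sum.cong[OF refl], rule sum.swap)
    finally show ?thesis unfolding cinner_power_words sum_distrib_left .
  qed
  moreover have "(\<lambda>m. \<Sum>i<n. \<Sum>j<n. cnj (\<alpha> i) * \<alpha> j * cinner (f (x i)) (f (x j)) ^ m) sums
      (\<Sum>i<n. \<Sum>j<n. cnj (\<alpha> i) * \<alpha> j * kernel_f f (x i) (x j))"
    unfolding kernel_f_def using x lt
    by (intro sums_sum sums_mult geometric_sums norm_cinner_less_1) (auto intro: less_imp_le)
  ultimately have "(\<lambda>m. complex_of_real (Qn f m u)) sums (\<Sum>i<n. \<Sum>j<n. cnj (\<alpha> i) * \<alpha> j * kernel_f f (x i) (x j))" by simp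
  moreover have "(\<lambda>m. complex_of_real (Qn f m u)) sums of_real (Q u)"
    unfolding Q_def by (intro sums_of_real summable_sums Qn_summable u)
  ultimately show ?thesis unfolding u_def[symmetric] by (rule sums_unique2[symmetric])
qed

lemma rkhs_eq_szego:
  assumes lt: "\<And>z. z \<in> ball 0 1 \<Longrightarrow> norm (f z) < 1"
  shows "rkhs (ball 0 1) (kernel_f f) = rkhs (ball 0 1) szego"
proof
  have 0: "0 \<le> 1 / c0 + C4" using c0 C4 by simp
  have "pos_kernel (ball 0 1) (\<lambda>z w. complex_of_real (1 / c0 + C4) * szego z w - kernel_f f z w)"
  proof (rule pos_kernelI)
    fix n :: nat and x a assume x: "\<And>i. i < n \<Longrightarrow> x i \<in> ball (0::complex) 1"
    have "(\<Sum>i<n. \<Sum>j<n. cnj (a i) * a j * (complex_of_real (1 / c0 + C4) * szego (x i) (x j) - kernel_f f (x i) (x j))) =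
      of_real (1 / c0 + C4) * of_real (N2 (szego_comb n x a)) - of_real (Q (szego_comb n x a))"
      using Q_szego_comb[where n=n and x=x and \<alpha>=a, OF lt x] N2_szego_comb[where n=n and x=x and a=a, OF x]
      by (simp only:) (simp add: sum_subtractf sum_distrib_left right_diff_distrib mult_ac)
    then show "0 \<le> (\<Sum>i<n. \<Sum>j<n. cnj (a i) * a j * (complex_of_real (1 / c0 + C4) * szego (x i) (x j) -
        kernel_f f (x i) (x j)))"
      using Q_le[OF szego_comb_disc_algebra[where n=n and x=x and a=a, OF x]]
      by (simp only: complex_nonneg_iff of_real_mult[symmetric] of_real_diff[symmetric] Re_complex_of_real
          Im_complex_of_real) simp
  qed
  then show "rkhs (ball 0 1) (kernel_f f) \<subseteq> rkhs (ball 0 1) szego" by (rule rkhs_mono[OF _ 0])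
  obtain C where C: "0 \<le> C" "\<And>u. u \<in> disc_algebra \<Longrightarrow> N2 u \<le> C * Q u" using N2_le_Q by blast
  have "pos_kernel (ball 0 1) (\<lambda>z w. complex_of_real C * kernel_f f z w - szego z w)"
  proof (rule pos_kernelI)
    fix n :: nat and x a assume x: "\<And>i. i < n \<Longrightarrow> x i \<in> ball (0::complex) 1"
    have "(\<Sum>i<n. \<Sum>j<n. cnj (a i) * a j * (complex_of_real C * kernel_f f (x i) (x j) - szego (x i) (x j))) =
      of_real C * of_real (Q (szego_comb n x a)) - of_real (N2 (szego_comb n x a))"
      using Q_szego_comb[where n=n and x=x and \<alpha>=a, OF lt x] N2_szego_comb[where n=n and x=x and a=a, OF x]
      by (simp only:) (simp add: sum_subtractf sum_distrib_left right_diff_distrib mult_ac)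
    then show "0 \<le> (\<Sum>i<n. \<Sum>j<n. cnj (a i) * a j * (complex_of_real C * kernel_f f (x i) (x j) - szego (x i) (x j)))"
      using C(2)[OF szego_comb_disc_algebra[where n=n and x=x and a=a, OF x]]
      by (simp only: complex_nonneg_iff of_real_mult[symmetric] of_real_diff[symmetric] Re_complex_of_real
          Im_complex_of_real) simp
  qed
  then show "rkhs (ball 0 1) szego \<subseteq> rkhs (ball 0 1) (kernel_f f)" by (rule rkhs_mono[OF _ C(1)])
qed

end

lemma rkhs_embedding_eq_szego:
  assumes emb: "embedding_map f V" and inj: "inj_on f (cball 0 1)"
  shows "rkhs (ball 0 1) (kernel_f f) = rkhs (ball 0 1) szego"
proof -
  note E = embedding_mapD[OF emb]
  obtain c0 M l C0 where B: "0 < c0" "0 \<le> M" "continuous_on circle l"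
    "\<And>\<eta>. \<eta> \<in> circle \<Longrightarrow> c0 \<le> l \<eta>" "\<And>\<eta>. \<eta> \<in> circle \<Longrightarrow> l \<eta> \<le> C0"
    "\<And>\<zeta> \<eta>. \<zeta> \<in> cball 0 1 \<Longrightarrow> \<eta> \<in> circle \<Longrightarrow>
       cmod (1 - cinner (f \<zeta>) (f \<eta>) - of_real (l \<eta>) * (1 - \<zeta> * cnj \<eta>)) \<le> M * (cmod (\<zeta> - \<eta>))\<^sup>2"
    using boundary_expansion[OF emb] by metis
  obtain c where c: "0 < c" "\<And>\<zeta> \<eta>. \<zeta> \<in> circle \<Longrightarrow> \<eta> \<in> circle \<Longrightarrow> c * cmod (\<zeta> - \<eta>) \<le> cmod (1 - cinner (f \<zeta>) (f \<eta>))"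
    using boundary_separation[OF emb inj] by blast
  have "continuous_on (cball 0 1) (\<lambda>z. f z $ i)" for i by (intro continuous_intros E(9))
  then interpret embedded_disc f l c0 C0 M c
    by unfold_locales (use B c E in \<open>auto simp: disc_algebra_def\<close>)
  show ?thesis by (rule rkhs_eq_szego[OF E(1)])
qed

section \<open>Isomorphisms of multiplier algebras\<close>

text \<open>The parallelogram identity: the rank-one kernels of \<open>h1 + h2\<close> and
  \<open>h1 - h2\<close> add up to twice those of \<open>h1\<close> and \<open>h2\<close>.\<close>

lemma rkhs_diff:
  assumes "h1 \<in> rkhs X K" "h2 \<in> rkhs X K"
  shows "(\<lambda>z. h1 z - h2 z) \<in> rkhs X K"
proof -
  obtain a where a: "\<forall>z. z \<notin> X \<longrightarrow> h1 z = 0" "pos_kernel X (\<lambda>z w. complex_of_real (a\<^sup>2) * K z w - h1 z * cnj (h1 w))"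
    using assms(1) unfolding rkhs_def by blast
  obtain b where b: "\<forall>z. z \<notin> X \<longrightarrow> h2 z = 0" "pos_kernel X (\<lambda>z w. complex_of_real (b\<^sup>2) * K z w - h2 z * cnj (h2 w))"
    using assms(2) unfolding rkhs_def by blast
  have "pos_kernel X (\<lambda>z w. 2 * ((complex_of_real (a\<^sup>2) * K z w - h1 z * cnj (h1 w)) +
     (complex_of_real (b\<^sup>2) * K z w - h2 z * cnj (h2 w))) + (h1 z + h2 z) * cnj (h1 w + h2 w))"
    by (intro pos_kernel_add pos_kernel_scale a b pos_kernel_rank_one) (simp add: complex_nonneg_iff)
  also have "(\<lambda>z w. 2 * ((complex_of_real (a\<^sup>2) * K z w - h1 z * cnj (h1 w)) +
     (complex_of_real (b\<^sup>2) * K z w - h2 z * cnj (h2 w))) + (h1 z + h2 z) * cnj (h1 w + h2 w)) =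
     (\<lambda>z w. complex_of_real ((sqrt (2 * (a\<^sup>2 + b\<^sup>2)))\<^sup>2) * K z w - (h1 z - h2 z) * cnj (h1 w - h2 w))"
    by (intro ext) (simp add: algebra_simps)
  finally have "pos_kernel X (\<lambda>z w. complex_of_real ((sqrt (2 * (a\<^sup>2 + b\<^sup>2)))\<^sup>2) * K z w - (h1 z -
      h2 z) * cnj (h1 w - h2 w))" .
  moreover have "\<forall>z. z \<notin> X \<longrightarrow> h1 z - h2 z = 0" using a(1) b(1) by simp
  ultimately show ?thesis unfolding rkhs_def by blast
qed

lemma rkhs_scale:
  assumes "h \<in> rkhs X K" shows "(\<lambda>z. c * h z) \<in> rkhs X K"
proof -
  obtain a where a: "\<forall>z. z \<notin> X \<longrightarrow> h z = 0" "pos_kernel X (\<lambda>z w. complex_of_real (a\<^sup>2) * K z w - h z * cnj (h w))"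
    using assms(1) unfolding rkhs_def by blast
  have "pos_kernel X (\<lambda>z w. c * cnj c * (complex_of_real (a\<^sup>2) * K z w - h z * cnj (h w)))"
    by (intro pos_kernel_scale a mult_cnj_nonneg)
  also have "(\<lambda>z w. c * cnj c * (complex_of_real (a\<^sup>2) * K z w - h z * cnj (h w))) =
     (\<lambda>z w. complex_of_real ((cmod c * a)\<^sup>2) * K z w - (c * h z) * cnj (c * h w))"
  proof -
    have "complex_of_real ((cmod c * a)\<^sup>2) = c * cnj c * complex_of_real (a\<^sup>2)"
      unfolding power_mult_distrib of_real_mult complex_norm_square ..
    then show ?thesis by (intro ext) (simp only:, simp add: algebra_simps)
  qed
  finally have "pos_kernel X (\<lambda>z w. complex_of_real ((cmod c * a)\<^sup>2) * K z w - (c * h z) * cnj (c * h w))" .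
  moreover have "\<forall>z. z \<notin> X \<longrightarrow> c * h z = 0" using a(1) by simp
  ultimately show ?thesis unfolding rkhs_def by blast
qed

lemma indicator_in_multipliers: "indicator X \<in> multipliers X K"
proof -
  have "(\<lambda>z. indicator X z * h z) = h" if "h \<in> rkhs X K" for h
    using that unfolding rkhs_def by (intro ext) (auto simp: indicator_def)
  then show ?thesis unfolding multipliers_def by auto
qed

lemma multipliers_scale:
  assumes "\<phi> \<in> multipliers X K" shows "(\<lambda>z. c * \<phi> z) \<in> multipliers X K"
  using assms rkhs_scale[of _ X K c] unfolding multipliers_def by (auto simp: mult.assoc)

section \<open>Multipliers as holomorphic functions on the disc\<close>

abbreviation disc_ind :: "complex \<Rightarrow> complex" where "disc_ind \<equiv> indicator (ball 0 1)"

lemma multipliers_kernel_f_holomorphic: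
  fixes \<psi> :: "complex \<Rightarrow> complex^'n"
  assumes "\<forall>i. (\<lambda>z. \<psi> z $ i) holomorphic_on ball 0 1" "\<And>z. z \<in> ball 0 1 \<Longrightarrow> norm (\<psi> z) < 1"
    and "\<phi> \<in> multipliers (ball 0 1) (kernel_f \<psi>)"
  shows "\<phi> holomorphic_on ball 0 1"
  using rkhs_kernel_f_holomorphic[OF assms(1,2)] assms(3)
    multipliers_subset_rkhs[OF indicator_in_rkhs_kernel_f[of "ball 0 1" \<psi>]] assms(2) by blast

lemma szego_coordinate_holomorphic: "\<forall>i. (\<lambda>z. ((\<chi> i. z)::complex^1) $ i) holomorphic_on ball 0 1"
  by (auto intro: holomorphic_intros)

lemma rkhs_szego_holomorphic: "u \<in> rkhs (ball 0 1) szego \<Longrightarrow> u holomorphic_on ball 0 1"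
  unfolding szego_eq_kernel_f
  by (rule rkhs_kernel_f_holomorphic[OF szego_coordinate_holomorphic]) (auto simp: norm_vec1)

lemma multipliers_szego_holomorphic: "\<phi> \<in> multipliers (ball 0 1) szego \<Longrightarrow> \<phi> holomorphic_on ball 0 1"
  unfolding szego_eq_kernel_f
  by (rule multipliers_kernel_f_holomorphic[OF szego_coordinate_holomorphic]) (auto simp: norm_vec1)

lemma bounded_holomorphic_multiplier:
  assumes hol: "\<phi> holomorphic_on ball 0 1" and B: "0 < B" "\<And>z. z \<in> ball 0 1 \<Longrightarrow> cmod (\<phi> z) \<le> B"
  shows "(\<lambda>z. disc_ind z * \<phi> z) \<in> multipliers (ball 0 1) szego"
proof (rule multipliersI[where C="B\<^sup>2"])
  have "pos_kernel (ball 0 1) (\<lambda>z w. (1 - \<phi> z / of_real B * cnj (\<phi> w / of_real B)) * szego z w)"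
    by (rule Pick_ball) (use B in \<open>auto intro!: holomorphic_intros hol simp: norm_divide\<close>)
  then have "pos_kernel (ball 0 1) (\<lambda>z w. of_real (B\<^sup>2) * ((1 - \<phi> z / of_real B * cnj (\<phi> w / of_real B)) * szego z w))"
    by (rule pos_kernel_scale) (simp add: complex_nonneg_iff del: of_real_power)
  also have "?this \<longleftrightarrow> pos_kernel (ball 0 1) (\<lambda>z w. (complex_of_real (B\<^sup>2) -
      disc_ind z * \<phi> z * cnj (disc_ind w * \<phi> w)) * szego z w)"
  proof (rule pos_kernel_cong, goal_cases)
    case (1 z w)
    have "of_real (B\<^sup>2) * ((1 - \<phi> z / of_real B * (cnj (\<phi> w) / of_real B)) * k) = (complex_of_real (B\<^sup>2) -
        \<phi> z * cnj (\<phi> w)) * k" for k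
      using B(1) by (simp add: field_simps power2_eq_square)
    then show ?case using 1 by simp
  qed
  finally show "pos_kernel (ball 0 1) (\<lambda>z w. (complex_of_real (B\<^sup>2) -
      disc_ind z * \<phi> z * cnj (disc_ind w * \<phi> w)) * szego z w)" .
qed auto

text \<open>The multipliers vanishing at \<open>l\<close> form the principal ideal of
  \<open>z - l\<close>. This is tested on each \<open>u\<close>: the product of
  \<open>\<phi> - \<phi> l\<close> with \<open>u\<close> vanishes at \<open>l\<close>, and its
  quotient stays in the space by \<open>rkhs_szego_divide\<close>.\<close>

lemma multipliers_szego_divide:
  assumes phi: "\<phi> \<in> multipliers (ball 0 1) szego" and l: "l \<in> ball 0 1"
  obtains \<psi> where "\<psi> \<in> multipliers (ball 0 1) szego" "\<And>z. z \<in> ball 0 1 \<Longrightarrow> \<phi> z = \<phi> l + (z - l) * \<psi> z"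
proof -
  note hol = multipliers_szego_holomorphic[OF phi]
  define d where "d z = (if z = l then deriv \<phi> l else (\<phi> z - \<phi> l) / (z - l))" for z
  have dhol: "d holomorphic_on ball 0 1" unfolding d_def by (rule pole_lemma_open[OF hol open_ball])
  define \<psi> where "\<psi> z = disc_ind z * d z" for z
  have eq: "\<phi> z = \<phi> l + (z - l) * \<psi> z" if "z \<in> ball 0 1" for z using that by (simp add: \<psi>_def d_def)
  have "(\<lambda>z. \<psi> z * u z) \<in> rkhs (ball 0 1) szego" if u: "u \<in> rkhs (ball 0 1) szego" for u
  proof (rule rkhs_szego_divide[OF _ l])
    show "(\<lambda>z. \<phi> z * u z - \<phi> l * u z) \<in> rkhs (ball 0 1) szego"
      using phi u by (intro rkhs_diff rkhs_scale) (auto simp: multipliers_def)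
    show "\<phi> z * u z - \<phi> l * u z = (z - l) * (\<psi> z * u z)" if "z \<in> ball 0 1" for z
      using arg_cong[OF eq[OF that], of "\<lambda>t. t * u z"] by (simp add: algebra_simps)
    have "(\<lambda>z. d z * u z) holomorphic_on ball 0 1"
      by (intro holomorphic_intros dhol rkhs_szego_holomorphic u)
    then have "(\<lambda>z. \<psi> z * u z) holomorphic_on ball 0 1" by (rule holomorphic_transform) (simp add: \<psi>_def)
    then show "isCont (\<lambda>z. \<psi> z * u z) l"
      using l holomorphic_on_imp_continuous_on continuous_on_eq_continuous_at[OF open_ball] by blast
    show "\<psi> z * u z = 0" if "z \<notin> ball 0 1" for z using that by (simp add: \<psi>_def)
  qed
  then have "\<psi> \<in> multipliers (ball 0 1) szego" unfolding multipliers_def by (simp add: \<psi>_def)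
  then show ?thesis using that eq by blast
qed

text \<open>The pullback of a function in the Drury-Arveson space lies in the space of
  \<open>kernel_f \<psi>\<close>, whose members are holomorphic in one variable. This lets the
  equations of a variety be continued along discs.\<close>

lemma Mult_d_compose_holomorphic:
  fixes \<psi> :: "complex \<Rightarrow> complex^'n"
  assumes hol: "\<forall>i. (\<lambda>z. \<psi> z $ i) holomorphic_on ball 0 1" and lt: "\<And>z. z \<in> ball 0 1 \<Longrightarrow> norm (\<psi> z) < 1"
    and phi: "\<phi> \<in> Mult_d"
  shows "(\<lambda>z. \<phi> (\<psi> z)) holomorphic_on ball 0 1"
proof -
  have "\<phi> \<in> rkhs (ball 0 1) DA_kernel"
    using phi multipliers_subset_rkhs[OF indicator_in_rkhs_DA_kernel] unfolding Mult_d_def by blast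
  then have mem: "(\<lambda>z. disc_ind z * \<phi> (\<psi> z)) \<in> rkhs (ball 0 1) (kernel_f \<psi>)"
    by (rule rkhs_DA_kernel_compose[OF _ lt])
  have "(\<lambda>z. disc_ind z * \<phi> (\<psi> z)) holomorphic_on ball 0 1" by (rule rkhs_kernel_f_holomorphic[OF hol lt mem])
  then show ?thesis by (rule holomorphic_transform) simp
qed

text \<open>\<open>g\<close> sends the circle to the sphere, so the part of the closed disc mapped
  into a smaller ball is compact and lies in the open disc; there the inverse is continuous.
  Holomorphy follows from a local inverse of a component with nonzero derivative.\<close>

lemma embedding_inverse_holomorphic:
  fixes g \<psi> :: "complex \<Rightarrow> complex^'n"
  assumes emb: "embedding_map g W"
    and hol: "\<forall>i. (\<lambda>z. \<psi> z $ i) holomorphic_on ball 0 1" and lt: "\<And>z. z \<in> ball 0 1 \<Longrightarrow> norm (\<psi> z) < 1"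
    and W: "\<And>z. z \<in> ball 0 1 \<Longrightarrow> \<psi> z \<in> g ` ball 0 1"
  shows "(\<lambda>z. the_inv_into (ball 0 1) g (\<psi> z)) holomorphic_on ball 0 1"
proof -
  note E = embedding_mapD[OF emb]
  define G where "G = the_inv_into (ball 0 1) g"
  define k where "k z = G (\<psi> z)" for z
  have Gg: "G (g x) = x" if "x \<in> ball 0 1" for x unfolding G_def by (rule the_inv_into_f_f[OF E(3) that])
  have gk: "g (k z) = \<psi> z" "k z \<in> ball 0 1" if "z \<in> ball 0 1" for z
    using W[OF that] Gg unfolding k_def by auto
  have psic: "continuous_on (ball 0 1) \<psi>"
  proof -
    have "continuous_on (ball 0 1) (\<lambda>z. \<chi> i. \<psi> z $ i)"
      using hol by (intro continuous_on_vec_lambda holomorphic_on_imp_continuous_on) auto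
    then show ?thesis by simp
  qed
  have kc: "isCont k z0" if z0: "z0 \<in> ball 0 1" for z0
  proof -
    define r where "r = (1 + norm (\<psi> z0)) / 2"
    have r: "norm (\<psi> z0) < r" "r < 1" using lt[OF z0] by (auto simp: r_def)
    define T where "T = {x \<in> cball 0 1. norm (g x) \<le> r}"
    have Tb: "x \<in> ball 0 1" if "x \<in> T" for x
    proof -
      have "norm (g x) \<noteq> 1" using that r by (auto simp: T_def)
      then show ?thesis using that E(8)[of x] by (auto simp: T_def)
    qed
    have "closed T" unfolding T_def
      by (intro continuous_closed_preimage_constant continuous_on_closed_Collect_le continuous_intros E(9)) auto
    then have "compact (cball 0 1 \<inter> T)" by (rule compact_Int_closed[OF compact_cball])
    moreover have "cball 0 1 \<inter> T = T" by (auto simp: T_def)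
    ultimately have "compact T" by simp
    moreover have "continuous_on T g" using E(9) by (rule continuous_on_subset) (auto simp: T_def)
    ultimately have Gc: "continuous_on (g ` T) G" using Gg Tb by (intro continuous_on_inv) auto
    define U where "U = {z \<in> ball 0 1. norm (\<psi> z) < r}"
    have Uo: "open U"
    proof -
      have "open (ball 0 1 \<inter> (\<lambda>z. norm (\<psi> z)) -` {..<r})"
        by (intro continuous_open_preimage continuous_intros psic) auto
      then show ?thesis by (simp add: U_def vimage_def Int_def)
    qed
    have "continuous_on U k"
      unfolding k_def
    proof (rule continuous_on_compose2[OF Gc])
      show "continuous_on U \<psi>" using psic by (rule continuous_on_subset) (auto simp: U_def)
      show "\<psi> ` U \<subseteq> g ` T"
      proof safe
        fix z assume "z \<in> U"
        then have z: "z \<in> ball 0 1" "norm (\<psi> z) < r" by (auto simp: U_def)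
        then have "k z \<in> T" using gk[OF z(1)] by (auto simp: T_def)
        then show "\<psi> z \<in> g ` T" using gk(1)[OF z(1)] by (metis imageI)
      qed
    qed
    then show ?thesis using Uo z0 r by (auto simp: continuous_on_eq_continuous_at U_def)
  qed
  have "k field_differentiable (at z0)" if z0: "z0 \<in> ball 0 1" for z0
  proof -
    obtain i where i: "deriv (\<lambda>w. g w $ i) (k z0) \<noteq> 0" using E(4)[OF gk(2)[OF z0]] by blast
    have gi: "(\<lambda>w. g w $ i) holomorphic_on ball 0 1" using E(2) by blast
    obtain r where r: "0 < r" "ball (k z0) r \<subseteq> ball 0 1" "open ((\<lambda>w. g w $ i) ` ball (k z0) r)" "inj_on (\<lambda>w. g
        w $ i) (ball (k z0) r)"
      using has_complex_derivative_locally_invertible[OF gi _ open_ball i] gk(2)[OF z0] by metis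
    obtain h where h: "h holomorphic_on ((\<lambda>w. g w $ i) ` ball (k z0) r)" "\<And>x. x \<in> ball (k z0) r \<Longrightarrow> h (g x $ i) = x"
      using holomorphic_has_inverse[OF holomorphic_on_subset[OF gi r(2)] open_ball r(4)] by metis
    have "\<forall>\<^sub>F z in nhds z0. k z \<in> ball (k z0) r"
      using kc[OF z0] r(1) unfolding isCont_def tendsto_at_iff_tendsto_nhds by (intro topological_tendstoD) auto
    then obtain U where U: "open U" "z0 \<in> U" "\<And>z. z \<in> U \<Longrightarrow> k z \<in> ball (k z0) r" unfolding eventually_nhds by blast
    define U' where "U' = U \<inter> ball 0 1"
    have U': "open U'" "z0 \<in> U'" using U z0 by (auto simp: U'_def)
    have "(\<lambda>z. h (\<psi> z $ i)) holomorphic_on U'"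
    proof (rule holomorphic_on_compose_gen[of "\<lambda>z. \<psi> z $ i" U' h, unfolded o_def])
      show "(\<lambda>z. \<psi> z $ i) holomorphic_on U'" using hol by (auto simp: U'_def elim: holomorphic_on_subset)
      show "(\<lambda>z. \<psi> z $ i) ` U' \<subseteq> (\<lambda>w. g w $ i) ` ball (k z0) r"
      proof safe
        fix z assume "z \<in> U'"
        then show "\<psi> z $ i \<in> (\<lambda>w. g w $ i) ` ball (k z0) r"
          using U(3)[of z] gk(1)[of z] by (intro image_eqI[of _ _ "k z"]) (auto simp: U'_def)
      qed
    qed (rule h(1))
    moreover have "h (\<psi> z $ i) = k z" if "z \<in> U'" for z
      using h(2)[OF U(3)[of z]] gk(1)[of z] that by (simp add: U'_def)
    ultimately have "k holomorphic_on U'" by (rule holomorphic_transform)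
    then show ?thesis using U' holomorphic_on_imp_differentiable_at by blast
  qed
  then show ?thesis unfolding holomorphic_on_def k_def G_def by (auto intro: field_differentiable_at_within)
qed

text \<open>An isomorphism from the multiplier algebra of the Hardy space is composition with the image
  \<open>h\<close> of the coordinate function, since \<open>\<phi> - \<phi> (h w)\<close> is divisible by the coordinate minus \<open>h w\<close>.\<close>
lemma szego_multiplier_isomorphism:
  assumes bij: "bij_betw \<Phi> (multipliers (ball 0 1) szego) B"
    and add: "\<And>a b. a \<in> multipliers (ball 0 1) szego \<Longrightarrow> b \<in> multipliers (ball 0 1) szego \<Longrightarrow> \<Phi> (\<lambda>z. a z + b z) =
        (\<lambda>z. \<Phi> a z + \<Phi> b z)"
    and mult: "\<And>a b. a \<in> multipliers (ball 0 1) szego \<Longrightarrow> b \<in> multipliers (ball 0 1) szego \<Longrightarrow> \<Phi> (\<lambda>z. a z * b z) =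
        (\<lambda>z. \<Phi> a z * \<Phi> b z)"
    and scale: "\<And>c a. a \<in> multipliers (ball 0 1) szego \<Longrightarrow> \<Phi> (\<lambda>z. c * a z) = (\<lambda>z. c * \<Phi> a z)"
    and one: "disc_ind \<in> B" and off: "\<And>b z. b \<in> B \<Longrightarrow> z \<notin> ball 0 1 \<Longrightarrow> b z = 0"
    and hol: "\<And>b. b \<in> B \<Longrightarrow> b holomorphic_on ball 0 1"
  shows "\<exists>h. h holomorphic_on ball 0 1 \<and> h ` ball 0 1 \<subseteq> ball 0 1 \<and> \<not> h constant_on ball 0 1 \<and>
    (\<forall>\<phi>\<in>multipliers (ball 0 1) szego. \<forall>z\<in>ball 0 1. \<Phi> \<phi> z = \<phi> (h z))"
proof -
  define A where "A = multipliers (ball 0 1) szego"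
  note add = add[folded A_def] and mult = mult[folded A_def] and scale = scale[folded A_def] and bij = bij[folded A_def]
  have PB: "\<Phi> a \<in> B" if "a \<in> A" for a using bij that by (auto simp: bij_betw_def)
  have oneA: "disc_ind \<in> A" unfolding A_def by (rule indicator_in_multipliers)
  have off_A: "a z = 0" if "a \<in> A" "z \<notin> ball 0 1" for a z using that unfolding A_def multipliers_def by blast
  \<comment> \<open>\<open>\<Phi>\<close> is not assumed to preserve the unit; this is recovered
    from a preimage of the unit of \<open>B\<close>.\<close>
  have P1: "\<Phi> disc_ind = disc_ind"
  proof -
    obtain e where e: "e \<in> A" "\<Phi> e = disc_ind" using bij one unfolding bij_betw_def by (metis imageE)
    have "(\<lambda>z. disc_ind z * e z) = e" using off_A[OF e(1)] by (intro ext) (auto simp: indicator_def)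
    then have "disc_ind = (\<lambda>z. \<Phi> disc_ind z * disc_ind z)" using mult[OF oneA e(1)] e(2) by simp
    also have "\<dots> = \<Phi> disc_ind" using off[OF PB[OF oneA]] by (intro ext) (auto simp: indicator_def)
    finally show ?thesis ..
  qed
  define x where "x z = disc_ind z * z" for z
  have xA: "x \<in> A" unfolding A_def x_def
    by (rule bounded_holomorphic_multiplier[where B=1]) (auto intro: holomorphic_intros)
  define h where "h = \<Phi> x"
  have hhol: "h holomorphic_on ball 0 1" unfolding h_def by (rule hol[OF PB[OF xA]])
  have cA: "(\<lambda>z. c * disc_ind z) \<in> A" for c using oneA unfolding A_def by (rule multipliers_scale)
  have Pc: "\<Phi> (\<lambda>z. c * disc_ind z) = (\<lambda>z. c * disc_ind z)" for c using scale[OF oneA] P1 by simp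
  have xcA: "(\<lambda>z. x z + (- c) * disc_ind z) \<in> A" for c
  proof -
    have "(\<lambda>z. disc_ind z * (z - c)) \<in> A" unfolding A_def
    proof (rule bounded_holomorphic_multiplier[where B="1 + cmod c"])
      show "cmod (z - c) \<le> 1 + cmod c" if "z \<in> ball 0 1" for z using norm_triangle_ineq4[of z c] that by simp
    qed (auto intro: holomorphic_intros simp: add_pos_nonneg)
    also have "(\<lambda>z. disc_ind z * (z - c)) = (\<lambda>z. x z + (- c) * disc_ind z)" by (intro ext) (simp add: x_def algebra_simps)
    finally show ?thesis .
  qed
  have Pxc: "\<Phi> (\<lambda>z. x z + (- c) * disc_ind z) = (\<lambda>z. h z + (- c) * disc_ind z)" for c
    using add[OF xA cA[of "- c"]] Pc[of "- c"] by (simp only: h_def)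
  have le1: "cmod (h z) \<le> 1" if z: "z \<in> ball 0 1" for z
  proof (rule ccontr)
    define c where "c = h z"
    assume "\<not> cmod (h z) \<le> 1"
    then have c: "1 < cmod c" by (simp add: c_def)
    have low: "cmod c - 1 \<le> cmod (w - c)" if "w \<in> ball 0 1" for w
      using norm_triangle_ineq2[of c w] that by (simp add: norm_minus_commute)
    \<comment> \<open>For \<open>1 < cmod c\<close> the element \<open>x - c\<close> is invertible
      in \<open>A\<close>, while its image vanishes at \<open>z\<close>.\<close>
    have rA: "(\<lambda>w. disc_ind w * (1 / (w - c))) \<in> A" unfolding A_def
    proof (rule bounded_holomorphic_multiplier[where B="1 / (cmod c - 1)"])
      show "(\<lambda>w. 1 / (w - c)) holomorphic_on ball 0 1" using c by (intro holomorphic_intros) auto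
      show "cmod (1 / (w - c)) \<le> 1 / (cmod c - 1)" if "w \<in> ball 0 1" for w
        unfolding norm_divide norm_one using low[OF that] c by (intro frac_le) auto
    qed (use c in simp)
    have "(\<lambda>w. (x w + (- c) * disc_ind w) * (disc_ind w * (1 / (w - c)))) = disc_ind"
      using low c by (intro ext) (auto simp: x_def indicator_def)
    then have "disc_ind = (\<lambda>w. (h w + (- c) * disc_ind w) * \<Phi> (\<lambda>w. disc_ind w * (1 / (w - c))) w)"
      using mult[OF xcA[of c] rA] P1 Pxc[of c] by simp
    then have "disc_ind z = (h z + (- c) * disc_ind z) * \<Phi> (\<lambda>w. disc_ind w * (1 / (w - c))) z" by (rule fun_cong)
    then show False using z by (simp add: c_def)
  qed
  have nc: "\<not> h constant_on ball 0 1"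
  proof
    assume "h constant_on ball 0 1"
    then obtain c where c: "\<And>z. z \<in> ball 0 1 \<Longrightarrow> h z = c" unfolding constant_on_def by blast
    have "h = (\<lambda>z. c * disc_ind z)"
    proof
      fix z show "h z = c * disc_ind z" using c[of z] off[OF PB[OF xA], of z] by (cases "z \<in> ball 0 1") (auto simp: h_def)
    qed
    then have "\<Phi> x = \<Phi> (\<lambda>z. c * disc_ind z)" unfolding h_def Pc .
    then have xc: "x = (\<lambda>z. c * disc_ind z)" using bij xA cA unfolding bij_betw_def inj_on_def by blast
    have "x 0 = c" "x (1/2) = c" using xc by (auto simp: indicator_def)
    then show False by (simp add: x_def)
  qed
  have lt1: "h z \<in> ball 0 1" if z: "z \<in> ball 0 1" for z
  proof (rule ccontr)
    assume "h z \<notin> ball 0 1"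
    then have "cmod (h z) = 1" using le1[OF z] by simp
    then have "h constant_on ball 0 1"
      using maximum_modulus_principle[OF hhol open_ball _ open_ball subset_refl z] le1 connected_ball by simp
    then show False using nc by simp
  qed
  have comp: "\<Phi> \<phi> z = \<phi> (h z)" if phi: "\<phi> \<in> multipliers (ball 0 1) szego" and z: "z \<in> ball 0 1" for \<phi> z
  proof -
    define \<mu> where "\<mu> = h z"
    obtain \<psi> where psi: "\<psi> \<in> A" "\<And>w. w \<in> ball 0 1 \<Longrightarrow> \<phi> w = \<phi> \<mu> + (w - \<mu>) * \<psi> w"
      using multipliers_szego_divide[OF phi lt1[OF z]] unfolding \<mu>_def A_def by metis
    have pA: "(\<lambda>w. (x w + (- \<mu>) * disc_ind w) * \<psi> w) \<in> A"
      using xcA psi(1) unfolding A_def by (rule multipliers_mult)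
    have "\<phi> = (\<lambda>w. \<phi> \<mu> * disc_ind w + (x w + (- \<mu>) * disc_ind w) * \<psi> w)"
    proof
      fix w show "\<phi> w = \<phi> \<mu> * disc_ind w + (x w + (- \<mu>) * disc_ind w) * \<psi> w"
        using psi(2)[of w] off_A[of \<phi> w] phi by (cases "w \<in> ball 0 1") (auto simp: A_def x_def)
    qed
    then have "\<Phi> \<phi> = \<Phi> (\<lambda>w. \<phi> \<mu> * disc_ind w + (x w + (- \<mu>) * disc_ind w) * \<psi> w)" by (rule arg_cong)
    also have "\<dots> = (\<lambda>w. \<phi> \<mu> * disc_ind w + (h w + (- \<mu>) * disc_ind w) * \<Phi> \<psi> w)"
      using add[OF cA pA] Pc mult[OF xcA psi(1)] Pxc by simp
    finally show ?thesis using z by (simp add: \<mu>_def)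
  qed
  show ?thesis using hhol lt1 nc comp by (intro exI[of _ h]) auto
qed

lemma inj_on_of_isomorphic:
  fixes f g :: "complex \<Rightarrow> complex^'n"
  assumes f: "embedding_map f V" "inj_on f (cball 0 1)" and emb: "embedding_map g W"
    and iso: "alg_isomorphic (Mult_f f) (Mult_f g)"
  shows "inj_on g (cball 0 1)"
proof -
  note E = embedding_mapD[OF emb]
  define B where "B = Mult_f g"
  have A: "Mult_f f = multipliers (ball 0 1) szego"
    unfolding Mult_f_def by (rule multipliers_rkhs_cong[OF rkhs_embedding_eq_szego[OF f]])
  obtain \<Phi> where P: "bij_betw \<Phi> (multipliers (ball 0 1) szego) B"
    "\<And>a b. a \<in> multipliers (ball 0 1) szego \<Longrightarrow> b \<in> multipliers (ball 0 1) szego \<Longrightarrow> \<Phi> (\<lambda>z. a z + b z) = (\<lambda>z. \<Phi> a z + \<Phi> b z)"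
    "\<And>a b. a \<in> multipliers (ball 0 1) szego \<Longrightarrow> b \<in> multipliers (ball 0 1) szego \<Longrightarrow> \<Phi> (\<lambda>z. a z * b z) = (\<lambda>z. \<Phi> a z * \<Phi> b z)"
    "\<And>c a. a \<in> multipliers (ball 0 1) szego \<Longrightarrow> \<Phi> (\<lambda>z. c * a z) = (\<lambda>z. c * \<Phi> a z)"
    using iso unfolding alg_isomorphic_def A B_def by auto
  have off: "b z = 0" if "b \<in> B" "z \<notin> ball 0 1" for b z using that unfolding B_def Mult_f_def multipliers_def by blast
  have holB: "b holomorphic_on ball 0 1" if "b \<in> B" for b
    using multipliers_kernel_f_holomorphic[OF E(2) E(1)] that unfolding B_def Mult_f_def by blast
  have oneB: "disc_ind \<in> B" unfolding B_def Mult_f_def by (rule indicator_in_multipliers)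
  have "\<exists>h. h holomorphic_on ball 0 1 \<and> h ` ball 0 1 \<subseteq> ball 0 1 \<and> \<not> h constant_on ball 0 1 \<and>
      (\<forall>\<phi>\<in>multipliers (ball 0 1) szego. \<forall>z\<in>ball 0 1. \<Phi> \<phi> z = \<phi> (h z))"
  proof (rule szego_multiplier_isomorphism[where \<Phi>=\<Phi> and B=B, OF P(1)])
    show "\<Phi> (\<lambda>z. a z + b z) = (\<lambda>z. \<Phi> a z + \<Phi> b z)"
      if "a \<in> multipliers (ball 0 1) szego" "b \<in> multipliers (ball 0 1) szego" for a b using that by (rule P(2))
    show "\<Phi> (\<lambda>z. a z * b z) = (\<lambda>z. \<Phi> a z * \<Phi> b z)"
      if "a \<in> multipliers (ball 0 1) szego" "b \<in> multipliers (ball 0 1) szego" for a b using that by (rule P(3))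
    show "\<Phi> (\<lambda>z. c * a z) = (\<lambda>z. c * \<Phi> a z)" if "a \<in> multipliers (ball 0 1) szego" for c a using that by (rule P(4))
    show "disc_ind \<in> B" by (rule oneB)
    show "b z = 0" if "b \<in> B" "z \<notin> ball 0 1" for b z using that by (rule off)
    show "b holomorphic_on ball 0 1" if "b \<in> B" for b using that by (rule holB)
  qed
  then obtain h where h: "h holomorphic_on ball 0 1" "h ` ball 0 1 \<subseteq> ball 0 1" "\<not> h constant_on ball 0 1"
    and comp: "\<And>\<phi> z. \<phi> \<in> multipliers (ball 0 1) szego \<Longrightarrow> z \<in> ball 0 1 \<Longrightarrow> \<Phi> \<phi> z = \<phi> (h z)"
    by blast
  have hD: "h z \<in> ball 0 1" if "z \<in> ball 0 1" for z using h(2) that by blast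
  \<comment> \<open>Since the image of \<open>h\<close> is open, identities between holomorphic
    functions need to be checked only there, where \<open>\<psi>\<close> is known.\<close>
  have ho: "open (h ` ball 0 1)" by (rule open_mapping_thm[OF h(1) open_ball _ open_ball subset_refl h(3)]) auto
  have agree: "p z = q z" if "p holomorphic_on ball 0 1" "q holomorphic_on ball 0 1" "\<And>w. w \<in> ball 0 1 \<Longrightarrow>
      p (h w) = q (h w)" "z \<in> ball 0 1" for p q z
    by (rule analytic_continuation_open[OF ho open_ball _ _ h(2) that(1,2) _ that(4)]) (use that(3) in auto)
  have surj: "\<exists>a\<in>multipliers (ball 0 1) szego. \<Phi> a = b" if "b \<in> B" for b
    using P(1) that unfolding bij_betw_def by (metis imageE)
  have "\<forall>i. \<exists>a\<in>multipliers (ball 0 1) szego. \<Phi> a = (\<lambda>z. disc_ind z * g z $ i)"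
    using surj component_in_multipliers[of "ball 0 1" g] E(1) unfolding B_def Mult_f_def by blast
  then obtain c where c: "\<And>i. c i \<in> multipliers (ball 0 1) szego" "\<And>i. \<Phi> (c i) = (\<lambda>z. disc_ind z * g z $ i)" by metis
  define \<psi> where "\<psi> z = (\<chi> i. c i z)" for z
  have psih: "\<psi> (h z) = g z" if z: "z \<in> ball 0 1" for z
    using comp[OF c(1) z] c(2) z by (simp add: \<psi>_def vec_eq_iff)
  have psihol: "\<forall>i. (\<lambda>z. \<psi> z $ i) holomorphic_on ball 0 1"
    using multipliers_szego_holomorphic[OF c(1)] by (simp add: \<psi>_def)
  have le1: "norm (\<psi> z) \<le> 1" if z: "z \<in> ball 0 1" for z
  proof (rule ccontr)
    assume "\<not> norm (\<psi> z) \<le> 1"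
    then have n: "1 < norm (\<psi> z)" by simp
    \<comment> \<open>The point of the ball dual to \<open>\<psi> z\<close>, with
      \<open>cinner (\<psi> z) p = 1\<close> and \<open>norm p < 1\<close>. The resolvent at
      \<open>p\<close> is a multiplier for \<open>g\<close>, and its preimage would invert
      \<open>1 - cinner (\<psi> z) p = 0\<close>.\<close>
    define p where "p = of_real (1 / (norm (\<psi> z))\<^sup>2) *s \<psi> z"
    have "norm p = norm (\<psi> z) / (norm (\<psi> z))\<^sup>2" by (simp add: p_def norm_vec_smult norm_divide norm_power)
    then have p: "norm p < 1" using n by (simp add: power2_eq_square)
    have "(\<lambda>w. disc_ind w / (1 - cinner (g w) p)) \<in> B"
      unfolding B_def Mult_f_def by (rule resolvent_in_multipliers[OF E(1) p])
    then obtain a where a: "a \<in> multipliers (ball 0 1) szego" "\<Phi> a = (\<lambda>w. disc_ind w / (1 - cinner (g w) p))"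
        using surj by blast
    have "(1 - cinner (\<psi> z) p) * a z = 1"
    proof (rule agree[OF _ _ _ z])
      show "(\<lambda>z. (1 - cinner (\<psi> z) p) * a z) holomorphic_on ball 0 1"
        by (intro holomorphic_intros holomorphic_on_cinner psihol multipliers_szego_holomorphic a)
      fix w :: complex assume w: "w \<in> ball 0 1"
      have "1 - cinner (g w) p \<noteq> 0" using norm_cinner_less_1[OF E(1)[OF w], of p] p by fastforce
      then show "(1 - cinner (\<psi> (h w)) p) * a (h w) = 1"
        using comp[OF a(1) w, symmetric] a(2) psih[OF w] w by simp
    qed (intro holomorphic_intros)
    moreover have "cinner (\<psi> z) p = 1"
      using n unfolding p_def cinner_smult_right cinner_self by (auto simp flip: of_real_mult)
    ultimately show False by simp
  qed
  have lt1: "norm (\<psi> z) < 1" if z: "z \<in> ball 0 1" for z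
  proof (rule ccontr)
    assume "\<not> norm (\<psi> z) < 1"
    then have n: "norm (\<psi> z) = 1" using le1[OF z] by simp
    \<comment> \<open>With \<open>\<psi> z\<close> on the sphere, \<open>q\<close> would attain its
      maximal modulus at \<open>z\<close> and be constant. This contradicts its value at
      \<open>h 0\<close>, where \<open>\<psi>\<close> takes the value \<open>g 0\<close> in the open
      ball.\<close>
    define q where "q w = cinner (\<psi> w) (\<psi> z)" for w
    have qh: "q holomorphic_on ball 0 1" unfolding q_def by (intro holomorphic_on_cinner psihol)
    have qz: "q z = 1" unfolding q_def cinner_self n by simp
    have "cmod (q w) \<le> cmod (q z)" if "w \<in> ball 0 1" for w
      using norm_cinner_le[of "\<psi> w" "\<psi> z"] le1[OF that] n qz by (simp add: q_def)
    then have "q constant_on ball 0 1"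
      using maximum_modulus_principle[OF qh open_ball _ open_ball subset_refl z] connected_ball by simp
    then have "q (h 0) = q z" using hD[of 0] z unfolding constant_on_def by auto
    moreover have "cmod (q (h 0)) < 1"
      unfolding q_def psih[of 0, simplified] using norm_cinner_less_1[of "g 0" "\<psi> z"] E(1)[of 0] n by simp
    ultimately show False using qz by simp
  qed
  obtain S where S: "S \<subseteq> Mult_d" "W = {z \<in> ball 0 1. \<forall>\<phi>\<in>S. \<phi> z = 0}" using E(6) unfolding variety_def by blast
  have W: "\<psi> z \<in> g ` ball 0 1" if z: "z \<in> ball 0 1" for z
  proof -
    \<comment> \<open>The equations of \<open>W\<close> hold at \<open>\<psi> (h w) = g w\<close>
      and extend by the identity theorem. Here it matters that \<open>W\<close> is a common zero set
      and not merely the image of \<open>g\<close>.\<close>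
    have "\<phi> (\<psi> z) = 0" if phi: "\<phi> \<in> S" for \<phi>
    proof (rule agree[where p="\<lambda>z. \<phi> (\<psi> z)" and q="\<lambda>z. 0", OF _ _ _ z])
      show "(\<lambda>z. \<phi> (\<psi> z)) holomorphic_on ball 0 1"
        by (rule Mult_d_compose_holomorphic[OF psihol lt1]) (use phi S in auto)
      fix w :: complex assume w: "w \<in> ball 0 1"
      then have "g w \<in> W" using E(5) by blast
      then show "\<phi> (\<psi> (h w)) = 0" using S(2) phi psih[OF w] by auto
    qed (intro holomorphic_intros)
    then have "\<psi> z \<in> W" using S(2) lt1[OF z] by auto
    then show ?thesis using E(5) by simp
  qed
  define k where "k z = the_inv_into (ball 0 1) g (\<psi> z)" for z
  have khol: "k holomorphic_on ball 0 1" unfolding k_def by (rule embedding_inverse_holomorphic[OF emb psihol lt1 W])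
  have kb: "k z \<in> ball 0 1" if "z \<in> ball 0 1" for z
    unfolding k_def using the_inv_into_into[OF E(3) W[OF that] subset_refl] .
  have kA: "(\<lambda>z. disc_ind z * k z) \<in> multipliers (ball 0 1) szego"
    by (rule bounded_holomorphic_multiplier[where B=1, OF khol]) (use kb in \<open>auto simp: less_imp_le\<close>)
  have "\<Phi> (\<lambda>z. disc_ind z * k z) = (\<lambda>z. disc_ind z * z)"
  proof
    fix z
    show "\<Phi> (\<lambda>z. disc_ind z * k z) z = disc_ind z * z"
    proof (cases "z \<in> ball 0 1")
      case True
      have "k (h z) = z" unfolding k_def psih[OF True] by (rule the_inv_into_f_f[OF E(3) True])
      then show ?thesis using comp[OF kA True] hD[OF True] True by simp
    next
      case False
      have "\<Phi> (\<lambda>z. disc_ind z * k z) \<in> B" using P(1) kA unfolding bij_betw_def by blast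
      then show ?thesis using off False by simp
    qed
  qed
  then have "(\<lambda>z. disc_ind z * z) \<in> B" using P(1) kA unfolding bij_betw_def by (metis imageI)
  then show ?thesis unfolding B_def by (rule inj_on_of_identity_multiplier[OF emb])
qed

theorem theorem1p4:
  fixes f g :: "complex \<Rightarrow> complex^'n::finite"
    and V W :: "(complex^'n) set"
  assumes "analytic_disc_attached V" and "analytic_disc_attached W"
    and "embedding_map f V" and "embedding_map g W"
    and "inj_on f (cball 0 1)"
  shows "alg_isomorphic (Mult_f f) (Mult_f g) \<longleftrightarrow> inj_on g (cball 0 1)"
proof
  assume "alg_isomorphic (Mult_f f) (Mult_f g)"
  then show "inj_on g (cball 0 1)" by (rule inj_on_of_isomorphic[OF assms(3,5,4)])
next
  assume g: "inj_on g (cball 0 1)"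
  have "rkhs (ball 0 1) (kernel_f f) = rkhs (ball 0 1) (kernel_f g)"
    using rkhs_embedding_eq_szego[OF assms(3,5)] rkhs_embedding_eq_szego[OF assms(4) g] by simp
  then have "Mult_f f = Mult_f g" unfolding Mult_f_def by (rule multipliers_rkhs_cong)
  then show "alg_isomorphic (Mult_f f) (Mult_f g)"
    unfolding alg_isomorphic_def by (intro exI[of _ id]) auto
qed

end
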